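(* Let $\mu$ be a Bernoulli measure on a self-affine set $E\subset\mathbb R^2$ associated to strictly positive matrices $A_1,\dots,A_k$ and satisfying the separation condition (as in the context). Then there exists an ergodic fractal distribution $P$ on the space of Borel probability measures on $[-1,1]$ such that for $\mu_F$-almost every $\theta\in\mathbb P\mathbb R^1$ and for $\mu$-almost every $\underline a\in\Sigma$, \[ \frac1T\int_0^T\delta_{\mu_{\theta,\underline a,t}}\,dt\;\longrightarrow\;P\qquad(\text{weak}^* )\ \text{ as }T\to\infty . \]
   Context: **Self-affine setting.** Let $k\in\mathbb N$; for $i\in\{1,\dots,k\}$ let $A_i$ be a real $2\times2$ matrix with strictly positive entries and norm less than one, let $d_i\in\mathbb R^2$ and $T_i(x)=A_ix+d_i$. Let $X$ be the unit disk. Separation condition: the $T_i$ map $X$ into disjoint ellipses contained in $X$. $E$ is the attractor of $(T_i)$; $\Sigma=\{1,\dots,k\}^{\mathbb N}$; $\pi(\underline a)=\lim_n T_{a_1}\circ\cdots\circ T_{a_n}(0)\in E$ is the coding bijection $\Sigma\to E$. $\mu$ is the Bernoulli measure on $\Sigma$ with probabilities $p_1,\dots,p_k$; $\mu$ also denotes its image $\mu\circ\pi^{-1}$ on $E$. **Furstenberg measure.** $\mathbb P\mathbb R^1$ is the space of lines through the origin, identified with the angle $\theta$ made with the positive real axis; $\mathcal Q_2$ is the set of directions in the second/fourth (negative) quadrant. $\phi_i:\mathbb P\mathbb R^1\to\mathbb P\mathbb R^1$ is the action of $A_i^{-1}$ on directions; it strictly contracts $\mathcal Q_2$. $\mu_F$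 is the unique Borel probability measure supported on $\mathcal Q_2$ with $\mu_F(A)=\sum_ip_i\mu_F(\phi_i^{-1}(A))$. **Slices.** $\pi_\theta:E\to[-1,1]$ is orthogonal projection along direction $\theta$ onto the diameter of $X$ perpendicular to $\theta$, this diameter being identified linearly with $[-1,1]$; $\mu_\theta=\mu\circ\pi_\theta^{-1}$. $(\mu_{\theta,x})_{x\in[-1,1]}$ is the disintegration of $\mu$ over $\pi_\theta$ into probability measures on the slices $E\cap\pi_\theta^{-1}(x)$: $\mu(A)=\int\mu_{\theta,x}(A)\,d\mu_\theta(x)$. $L(\underline a,\theta,t)$ is the line segment in direction $\theta$, centred at $\pi(\underline a)$, of length $e^{-t}$; $\mu_{\theta,\underline a,t}$ is the slice measure $\mu_{\theta,\pi_\theta(\pi(\underline a))}$ restricted to $L(\underline a,\theta,t)$, linearly rescaled onto $[-1,1]$ and normalised to mass $1$. **Fractal distributions on $[-1,1]$.** On Borel probability measures $m$ on $[-1,1]$ with $0\in\operatorname{supp}(m)$, $S_t(m)$ is $m|_{[-e^{-t},e^{-t}]}$ normalised to mass $1$ and pushed forward by $x\mapsto e^tx$; the space of measures carries the weak$^*$ topology. A distribution is an $S_t$-invariant probability measure on this space of measures. It is quasi-Palm if for each set $A$ of measures: it gives $A$ measure $0$ iff, choosing $m$ according to it and then $x$ according to $m$, the measure $S_{0,x}(m)$ ($m$ translated by $y\mapsto y-x$, restricted to $[-1,1]$, normalised) is almost surely not in $A$. An ergodic fractal distribution is an $S_t$-invariant, ergodic, quasi-Palm probability measure.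
   Formalization: Quasi-Palm is corrected for truncation at the ends of [-1,1]: for all t>0, P(A)=0 iff for P-a.e. m and m-a.e. x with [x-e^{-t},x+e^{-t}] in [-1,1], S_t(S_{0,x}(m)) is not in A. Verbatim, the condition fails, e.g. when E is a Cantor set on a line. *)

theory Defs
  imports "HOL-Probability.Probability"
begin

section \<open>Self-affine sets and Bernoulli measures\<close>

text \<open>The alphabet \<open>{1,\<dots>,k}\<close> is an arbitrary finite type \<open>'k\<close>; a word in the shift space is a
  function \<open>nat \<Rightarrow> 'k\<close>, indexed from \<open>0\<close>.\<close>

definition affine_map :: "real^2^2 \<Rightarrow> real^2 \<Rightarrow> real^2 \<Rightarrow> real^2" where
  "affine_map A d x = A *v x + d"

definition attractor :: "('k \<Rightarrow> 'b::topological_space \<Rightarrow> 'b) \<Rightarrow> 'b set" where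
  "attractor T = (THE K. compact K \<and> K \<noteq> {} \<and> K = (\<Union>i. T i ` K))"

primrec prefix_map :: "('k \<Rightarrow> 'b \<Rightarrow> 'b) \<Rightarrow> (nat \<Rightarrow> 'k) \<Rightarrow> nat \<Rightarrow> 'b \<Rightarrow> 'b" where
  "prefix_map T a 0 = id"
| "prefix_map T a (Suc n) = prefix_map T a n \<circ> T (a n)"

definition coding :: "('k \<Rightarrow> 'b \<Rightarrow> 'b) \<Rightarrow> (nat \<Rightarrow> 'k) \<Rightarrow> 'b::real_normed_vector" where
  "coding T a = lim (\<lambda>n. prefix_map T a n 0)"

definition bernoulli_measure :: "'k pmf \<Rightarrow> (nat \<Rightarrow> 'k) measure" where
  "bernoulli_measure p = PiM UNIV (\<lambda>_. measure_pmf p)"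

definition self_affine_measure :: "('k \<Rightarrow> real^2 \<Rightarrow> real^2) \<Rightarrow> 'k pmf \<Rightarrow> (real^2) measure" where
  "self_affine_measure T p = distr (bernoulli_measure p) borel (coding T)"


section \<open>Directions and the Furstenberg measure\<close>

text \<open>A line through the origin is identified with its angle in \<open>[0, \<pi>)\<close>. Only the Borel structure
  of the projective line is used, and that is the one of the interval.\<close>

definition dir :: "real \<Rightarrow> real^2" where
  "dir \<theta> = vector [cos \<theta>, sin \<theta>]"

definition line_angle :: "(real^2) set \<Rightarrow> real" where
  "line_angle L = (THE \<theta>. \<theta> \<in> {0..<pi} \<and> L = span {dir \<theta>})"

definition direction_action :: "real^2^2 \<Rightarrow> real \<Rightarrow> real" where
  "direction_action A \<theta> = line_angle ((*v) (matrix_inv A) ` span {dir \<theta>})"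

text \<open>The closed second/fourth quadrant. The angle \<open>0\<close> (the horizontal axis) belongs to it.\<close>

definition Q2 :: "real set" where
  "Q2 = {\<theta> \<in> {0..<pi}. cos \<theta> * sin \<theta> \<le> 0}"

definition furstenberg_measure :: "('k::finite \<Rightarrow> real^2^2) \<Rightarrow> 'k pmf \<Rightarrow> real measure \<Rightarrow> bool" where
  "furstenberg_measure A p M \<longleftrightarrow>
     prob_space M \<and> sets M = sets (restrict_space borel {0..<pi}) \<and> measure M Q2 = 1 \<and>
     (\<forall>B\<in>sets M. measure M B =
        (\<Sum>i\<in>UNIV. pmf p i * measure M (direction_action (A i) -` B \<inter> {0..<pi})))"


section \<open>Slices\<close>

text \<open>The diameter perpendicular to \<open>\<theta>\<close> is identified with \<open>[-1,1]\<close> through the unit normal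
  \<open>(-sin \<theta>, cos \<theta>)\<close>.\<close>

definition slice_proj :: "real \<Rightarrow> real^2 \<Rightarrow> real" where
  "slice_proj \<theta> z = z \<bullet> vector [- sin \<theta>, cos \<theta>]"

text \<open>Disintegration of \<open>\<mu>\<close>, carried by \<open>E\<close>, over the projection. The slice measures have
  to live on their slices only almost everywhere, since slices may be empty.\<close>

definition slice_disintegration ::
    "(real^2) set \<Rightarrow> (real^2) measure \<Rightarrow> real \<Rightarrow> (real \<Rightarrow> (real^2) measure) \<Rightarrow> bool" where
  "slice_disintegration E \<mu> \<theta> D \<longleftrightarrow>
     D \<in> borel \<rightarrow>\<^sub>M prob_algebra borel \<and>
     (AE x in distr \<mu> borel (slice_proj \<theta>). emeasure (D x) (E \<inter> slice_proj \<theta> -` {x}) = 1) \<and>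
     (\<forall>B\<in>sets borel. emeasure \<mu> B = (\<integral>\<^sup>+ x. emeasure (D x) B \<partial>distr \<mu> borel (slice_proj \<theta>)))"

definition window :: "real^2 \<Rightarrow> real \<Rightarrow> real \<Rightarrow> (real^2) set" where
  "window y \<theta> t = closed_segment (y - (exp (- t) / 2) *\<^sub>R dir \<theta>) (y + (exp (- t) / 2) *\<^sub>R dir \<theta>)"

text \<open>The slice measure through \<open>y\<close> seen in the window of length \<open>exp (-t)\<close> around \<open>y\<close>. The
  conditional measure \<open>uniform_measure \<nu> L\<close> is \<open>\<nu>\<close> restricted to \<open>L\<close> and normalised; the factor
  \<open>2\<close> occurs because the window has half-length \<open>exp (-t) / 2\<close>.\<close>

definition slice_scenery ::
    "(real \<Rightarrow> (real^2) measure) \<Rightarrow> real \<Rightarrow> real^2 \<Rightarrow> real \<Rightarrow> real measure" where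
  "slice_scenery D \<theta> y t =
     distr (uniform_measure (D (slice_proj \<theta> y)) (window y \<theta> t)) borel
       (\<lambda>z. 2 * exp t * ((z - y) \<bullet> dir \<theta>))"


section \<open>Fractal distributions on \<open>[-1,1]\<close>\<close>

text \<open>A Borel probability measure on \<open>[-1,1]\<close> is represented as a Borel probability measure on the
  real line that gives \<open>[-1,1]\<close> full mass.\<close>

definition interval_measures :: "real measure set" where
  "interval_measures = {m. prob_space m \<and> sets m = sets borel \<and> measure m {-1..1} = 1}"

definition weak_star :: "real measure topology" where
  "weak_star = topology_generated_by
     {{m \<in> interval_measures. (LINT x:{-1..1}|m. f x) \<in> U} | f U.
        continuous_on {-1..1} (f :: real \<Rightarrow> real) \<and> open U}"

definition weak_star_borel :: "real measure measure" where
  "weak_star_borel = sigma interval_measures {U. openin weak_star U}"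

definition msupport :: "'b::topological_space measure \<Rightarrow> 'b set" where
  "msupport m = {x. \<forall>U. open U \<and> x \<in> U \<longrightarrow> emeasure m U > 0}"

definition pointed_measures :: "real measure set" where
  "pointed_measures = {m \<in> interval_measures. 0 \<in> msupport m}"

definition zoom :: "real \<Rightarrow> real measure \<Rightarrow> real measure" where
  "zoom t m = distr (uniform_measure m {- exp (- t)..exp (- t)}) borel (\<lambda>x. exp t * x)"

definition recentre :: "real \<Rightarrow> real measure \<Rightarrow> real measure" where
  "recentre x m = uniform_measure (distr m borel (\<lambda>y. y - x)) {-1..1}"

definition fd_distribution :: "real measure measure \<Rightarrow> bool" where
  "fd_distribution P \<longleftrightarrow>
     prob_space P \<and> sets P = sets weak_star_borel \<and> (AE m in P. m \<in> pointed_measures) \<and>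
     (\<forall>t\<ge>0. \<forall>A\<in>sets P. emeasure P {m \<in> pointed_measures. zoom t m \<in> A} = emeasure P A)"

text \<open>The quasi-Palm property compares \<open>P\<close> with the law of \<open>recentre x m\<close>, where \<open>m\<close> is chosen
  by \<open>P\<close> and \<open>x\<close> by \<open>m\<close>. A measure on \<open>[-1,1]\<close> carries no information outside \<open>[-1,1]\<close>, so for
  \<open>x \<noteq> 0\<close> a part of \<open>recentre x m\<close> vanishes merely by truncation; taken verbatim, the condition
  fails even for the point mass at normalised Lebesgue measure, and for the scenery of a Cantor
  measure. The recentred measure is therefore inspected on the windows
  \<open>[x - exp (-t), x + exp (-t)]\<close> that lie in \<open>[-1,1]\<close>. By invariance under \<open>zoom t\<close>, this is
  the same as recentring at points of \<open>[1 - exp t, exp t - 1]\<close> the extension of \<open>m\<close> to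
  \<open>[- exp t, exp t]\<close> and restricting to \<open>[-1,1]\<close>.\<close>

definition quasi_palm :: "real measure measure \<Rightarrow> bool" where
  "quasi_palm P \<longleftrightarrow>
     (\<forall>t>0. \<forall>A\<in>sets P. emeasure P A = 0 \<longleftrightarrow>
        (AE m in P. AE x in m. {x - exp (- t)..x + exp (- t)} \<subseteq> {-1..1} \<longrightarrow>
            zoom t (recentre x m) \<notin> A))"

definition ergodic_distribution :: "real measure measure \<Rightarrow> bool" where
  "ergodic_distribution P \<longleftrightarrow>
     (\<forall>A\<in>sets P. (\<forall>t\<ge>0. {m \<in> pointed_measures. zoom t m \<in> A} = A \<inter> pointed_measures) \<longrightarrow>
        emeasure P A = 0 \<or> emeasure P A = 1)"

definition ergodic_fractal_distribution :: "real measure measure \<Rightarrow> bool" where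
  "ergodic_fractal_distribution P \<longleftrightarrow>
     fd_distribution P \<and> ergodic_distribution P \<and> quasi_palm P"

end

theory Submission
  imports Defs
begin

text \<open>
  Zooming into a slice of \<open>\<mu>\<close> soon shows only points of one first level piece of the self-affine set. This
  piece is an affine image of the whole set under some \<open>T i\<close>, and \<open>T i\<close> maps lines in direction \<open>\<phi> i \<theta>\<close> to lines in
  direction \<open>\<theta>\<close>. So the scenery of the slice in direction \<open>\<theta>\<close> at the point coded by a word \<open>a\<close> with first
  letter \<open>i\<close> is, after a time that depends on the scaling factor of \<open>A i\<close> in this direction, the scenery of
  the slice in direction \<open>\<phi> i \<theta>\<close> at the point coded by the shifted word, reversed if \<open>det (A i)\<close> is
  negative (\<open>step_identity\<close>). In other words, sceneries of slices are trajectories of a special flow over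
  the skew product \<open>(a, e, \<theta>) \<mapsto> (shift a, e * sgn (det (A i)), \<phi> i \<theta>)\<close>, where \<open>e\<close> is an orientation and the
  roof is the time just mentioned (\<open>scenery_flow\<close>).

  The skew product preserves the product of the Bernoulli measure, a law of orientations and the
  Furstenberg measure, and it is ergodic. An invariant set does not depend on the word, because a
  set that is nearly determined by finitely many letters becomes independent of them after as many
  steps (\<open>ergodic_skew\<close>); and an invariant set of directions has measure zero or one because the
  projective maps contract the quadrant, so that all directions are eventually driven to the same side
  (\<open>zero_one_law\<close>). The orientation is a two-valued extension, which is handled by letting the maps in the
  zero-one law exchange a set with its complement (\<open>signed_zero_one_law\<close>).

  The distribution \<open>P\<close> is the law of the scenery at a random point of the flow. It is invariant and ergodic
  because the flow is, and the ergodic theorem gives the limit of time averages for a given observable.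
  The weak star topology on measures on \<open>[-1,1]\<close> is that of the moment sequences, which form a compact set, so
  that by the Stone-Weierstrass theorem countably many observables suffice for all continuous functions
  (\<open>weak_star_approx\<close>).

  The quasi-Palm property rests on the fact that a random point of a slice, chosen by the slice measure,
  is again distributed according to \<open>\<mu>\<close> (\<open>AE_resample\<close>): recentring a typical scenery at one of its typical points
  leads to a typical scenery at another point of the same slice.

  For all of this the slice measures must depend measurably on the direction. They are therefore obtained
  from one disintegration of the product of the Furstenberg measure and \<open>\<mu>\<close>
  (\<open>disintegration_exists\<close>). In almost every direction, every disintegration of \<open>\<mu>\<close> into slices
  agrees with this one at almost every point (\<open>AE_slice_scenery_eq_zoom\<close>).\<close>

section \<open>Birkhoff's pointwise ergodic theorem\<close>

locale ergodic_map = prob_space M for M :: "'a measure" +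
  fixes F :: "'a => 'a"
  assumes F_measurable [measurable]: "F \<in> M \<rightarrow>\<^sub>M M"
    and F_preserving: "distr M M F = M"
    and F_ergodic: "\<And>B. B \<in> sets M ==> AE x in M. (x \<in> B \<longleftrightarrow> F x \<in> B) ==> prob B = 0 \<or> prob B = 1"
begin

lemma AE_comp:
  assumes "AE x in M. Q x" shows "AE x in M. Q (F x)"
proof (rule AE_distrD[OF F_measurable])
  show "AE x in distr M M F. Q x" using assms by (simp only: F_preserving)
qed

lemma AE_orbit:
  assumes "AE x in M. Q x" shows "AE x in M. \<forall>k. Q ((F ^^ k) x)"
  unfolding AE_all_countable
proof
  fix k show "AE x in M. Q ((F ^^ k) x)"
  proof (induction k)
    case (Suc k)
    from AE_comp[OF Suc] show ?case by (simp add: funpow_swap1)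
  qed (use assms in simp)
qed

lemma integrable_comp:
  fixes f :: "'a => real"
  assumes "integrable M f" shows "integrable M (\<lambda>x. f (F x))"
  using assms integrable_distr[OF F_measurable, of f] F_preserving by simp

lemma integral_comp:
  fixes f :: "'a => real"
  assumes "f \<in> borel_measurable M" shows "(LINT x|M. f (F x)) = (LINT x|M. f x)"
  using integral_distr[OF F_measurable, of f] F_preserving assms by simp

lemma nn_integral_comp:
  assumes "f \<in> borel_measurable M" shows "(\<integral>\<^sup>+x. f (F x) \<partial>M) = (\<integral>\<^sup>+x. f x \<partial>M)"
  using nn_integral_distr[OF F_measurable, of f] F_preserving assms by simp

primrec birkhoff_sum :: "('a => real) => nat => 'a => real" where
  "birkhoff_sum g 0 x = 0"
| "birkhoff_sum g (Suc n) x = g x + birkhoff_sum g n (F x)"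

text \<open>The largest of the numbers \<open>birkhoff_sum g k x\<close> with \<open>0 \<le> k \<le> n\<close>.\<close>

primrec max_sum :: "('a => real) => nat => 'a => real" where
  "max_sum g 0 x = 0"
| "max_sum g (Suc n) x = max 0 (g x + max_sum g n (F x))"

lemma birkhoff_sum_measurable [measurable]:
  assumes [measurable]: "g \<in> borel_measurable M"
  shows "birkhoff_sum g n \<in> borel_measurable M"
proof (induction n)
  case (Suc n)
  note Suc[measurable]
  show ?case by simp
qed simp

lemma max_sum_integrable:
  assumes g: "integrable M g" shows "integrable M (max_sum g n)"
proof (induction n)
  case (Suc n)
  have "integrable M (\<lambda>x. g x + max_sum g n (F x))"
    using g integrable_comp[OF Suc] by simp
  then show ?case by simp
qed simp

lemma max_sum_nonneg: "0 \<le> max_sum g n x"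
  by (cases n) auto

lemma max_sum_mono: "max_sum g n x \<le> max_sum g (Suc n) x"
proof (induction n arbitrary: x)
  case 0 then show ?case by simp
next
  case (Suc n)
  have "max 0 (g x + max_sum g n (F x)) \<le> max 0 (g x + max_sum g (Suc n) (F x))"
    by (intro max.mono order_refl add_left_mono Suc)
  then show ?case
    unfolding max_sum.simps(2)[of g n x] max_sum.simps(2)[of g "Suc n" x] .
qed

lemma birkhoff_sum_le_max_sum: "birkhoff_sum g n x \<le> max_sum g n x"
proof (induction n arbitrary: x)
  case (Suc n) show ?case using Suc[of "F x"] by simp
qed simp

text \<open>Hopf's maximal ergodic theorem. Where \<open>max_sum g (Suc k)\<close> is positive, it is the sum of \<open>g\<close> and
  \<open>max_sum g k \<circ> F\<close>. So \<open>g\<close> dominates there the coboundary \<open>max_sum g n - max_sum g n \<circ> F\<close>, whose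
  integral vanishes.\<close>

lemma maximal_inequality:
  assumes g: "integrable M g"
  shows "0 \<le> (LINT x|M. indicator {x. 0 < max_sum g n x} x * g x)"
proof (cases n)
  case (Suc k)
  have [measurable]: "g \<in> borel_measurable M" "max_sum g n \<in> borel_measurable M"
    using g max_sum_integrable[OF g] by auto
  let ?m = "max_sum g n"
  have "0 = (LINT x|M. ?m x) - (LINT x|M. ?m (F x))"
    using integral_comp[of ?m] by simp
  also have "\<dots> = (LINT x|M. ?m x - ?m (F x))"
    by (intro Bochner_Integration.integral_diff[symmetric] max_sum_integrable integrable_comp g)
  also have "\<dots> \<le> (LINT x|M. indicator {x. 0 < ?m x} x * g x)"
  proof (rule integral_mono)
    show "integrable M (\<lambda>x. ?m x - ?m (F x))"
      by (intro Bochner_Integration.integrable_diff max_sum_integrable integrable_comp g)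
    show "integrable M (\<lambda>x. indicator {x. 0 < ?m x} x * g x)"
      by (rule Bochner_Integration.integrable_bound[OF g]) (auto simp: indicator_def)
    fix x
    show "?m x - ?m (F x) \<le> indicator {x. 0 < ?m x} x * g x"
    proof (cases "0 < ?m x")
      case True
      then have "?m x = g x + max_sum g k (F x)" by (simp add: Suc max_def split: if_splits)
      with True max_sum_mono[of g k "F x"] show ?thesis by (simp add: Suc del: max_sum.simps)
    next
      case False
      with max_sum_nonneg[of g n "F x"] show ?thesis by simp
    qed
  qed
  finally show ?thesis .
qed simp

text \<open>The set on which the sums are unbounded above is invariant. If it had full measure, the sets
  where \<open>max_sum g n\<close> is positive would exhaust the space, and the maximal inequality would give
  \<open>g\<close> a nonnegative integral.\<close>

lemma birkhoff_sum_bounded_above: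
  assumes g: "integrable M g" and neg: "(LINT x|M. g x) < 0"
  shows "AE x in M. \<exists>K. \<forall>n. birkhoff_sum g n x \<le> K"
proof -
  have gm [measurable]: "g \<in> borel_measurable M" using g by auto
  have mm [measurable]: "max_sum g n \<in> borel_measurable M" for n
    using max_sum_integrable[OF g] by auto
  define B where "B = {x \<in> space M. \<forall>K::nat. \<exists>n. birkhoff_sum g n x > K}"
  have B [measurable]: "B \<in> sets M" unfolding B_def by measurable
  have shift: "x \<in> B \<longleftrightarrow> F x \<in> B" if x: "x \<in> space M" for x
  proof -
    have Fx: "F x \<in> space M" using measurable_space[OF F_measurable x] .
    have "(\<forall>K::nat. \<exists>n. birkhoff_sum g n x > K) \<longleftrightarrow> (\<forall>K::nat. \<exists>n. birkhoff_sum g n (F x) > K)"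
    proof safe
      fix K :: nat assume *: "\<forall>K::nat. \<exists>n. birkhoff_sum g n x > K"
      obtain K' :: nat where K': "real K' \<ge> K + \<bar>g x\<bar>" using real_arch_simple by blast
      obtain n where n: "birkhoff_sum g n x > K'" using * by blast
      then obtain m where "n = Suc m" using K' by (cases n) auto
      then show "\<exists>n. birkhoff_sum g n (F x) > K" using n K' by (intro exI[of _ m]) auto
    next
      fix K :: nat assume *: "\<forall>K::nat. \<exists>n. birkhoff_sum g n (F x) > K"
      obtain K' :: nat where K': "real K' \<ge> K + \<bar>g x\<bar>" using real_arch_simple by blast
      obtain n where n: "birkhoff_sum g n (F x) > K'" using * by blast
      then show "\<exists>n. birkhoff_sum g n x > K" using n K' by (intro exI[of _ "Suc n"]) auto
    qed
    then show ?thesis using x Fx by (auto simp: B_def)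
  qed
  have "prob B \<noteq> 1"
  proof
    assume "prob B = 1"
    then have ae: "AE x in M. x \<in> B" using AE_prob_1 by blast
    let ?i = "\<lambda>n x. indicator {x. 0 < max_sum g n x} x * g x"
    have lim: "(\<lambda>n. LINT x|M. ?i n x) \<longlonglongrightarrow> (LINT x|M. g x)"
    proof (rule integral_dominated_convergence[where w="\<lambda>x. \<bar>g x\<bar>"])
      show "AE x in M. (\<lambda>n. ?i n x) \<longlonglongrightarrow> g x"
        using ae
      proof eventually_elim
        case (elim x)
        then have "\<exists>n. birkhoff_sum g n x > real 0" unfolding B_def by blast
        then obtain n where "birkhoff_sum g n x > 0" by auto
        then have n: "max_sum g n x > 0" using birkhoff_sum_le_max_sum[of g n x] by linarith
        have "max_sum g m x > 0" if "m \<ge> n" for m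
          using that by (induction m rule: dec_induct) (use n max_sum_mono order_less_le_trans in blast)+
        then have "\<forall>\<^sub>F m in sequentially. ?i m x = g x"
          by (auto simp: eventually_sequentially indicator_def intro!: exI[of _ n])
        then show ?case by (simp add: tendsto_eventually)
      qed
      show "?i n \<in> borel_measurable M" for n by measurable
      show "integrable M (\<lambda>x. \<bar>g x\<bar>)" using g by simp
      show "AE x in M. norm (?i n x) \<le> \<bar>g x\<bar>" for n
        by (rule AE_I2) (simp add: indicator_def)
    qed measurable
    have "0 \<le> (LINT x|M. g x)"
      by (rule LIMSEQ_le_const[OF lim]) (use maximal_inequality[OF g] in auto)
    then show False using neg by simp
  qed
  then have "prob B = 0" using F_ergodic[OF B] shift by auto
  then have "AE x in M. x \<notin> B" using B by (simp add: prob_eq_0)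
  then show ?thesis
    using AE_space
  proof eventually_elim
    case (elim x)
    then obtain K :: nat where "\<forall>n. birkhoff_sum g n x \<le> K" by (auto simp: B_def not_less)
    then show ?case by blast
  qed
qed

lemma birkhoff_sum_diff_const: "birkhoff_sum (\<lambda>x. g x - c) n x = birkhoff_sum g n x - n * c"
  by (induction n arbitrary: x) (auto simp: algebra_simps)

lemma birkhoff_sum_const_diff: "birkhoff_sum (\<lambda>x. c - g x) n x = n * c - birkhoff_sum g n x"
  by (induction n arbitrary: x) (auto simp: algebra_simps)

text \<open>The sums of \<open>f - (c + e)\<close> and of \<open>(c - e) - f\<close>, where \<open>c\<close> is the mean of \<open>f\<close>, are bounded above,
  which confines the averages of \<open>f\<close> asymptotically to \<open>[c - e, c + e]\<close>.\<close>

theorem birkhoff: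
  assumes f: "integrable M f"
  shows "AE x in M. (\<lambda>n. birkhoff_sum f n x / n) \<longlonglongrightarrow> (LINT x|M. f x)"
proof -
  let ?c = "LINT x|M. f x"
  let ?e = "\<lambda>j::nat. 1 / real (Suc j)"
  have up: "AE x in M. \<exists>K. \<forall>n. birkhoff_sum f n x - n * (?c + ?e j) \<le> K" for j
    using birkhoff_sum_bounded_above[of "\<lambda>x. f x - (?c + ?e j)"] f
    by (simp add: birkhoff_sum_diff_const prob_space)
  have lo: "AE x in M. \<exists>K. \<forall>n. n * (?c - ?e j) - birkhoff_sum f n x \<le> K" for j
    using birkhoff_sum_bounded_above[of "\<lambda>x. (?c - ?e j) - f x"] f
    by (simp add: birkhoff_sum_const_diff prob_space)
  have "AE x in M. \<forall>j. (\<exists>K. \<forall>n. birkhoff_sum f n x - n * (?c + ?e j) \<le> K) \<and>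
                       (\<exists>K. \<forall>n. n * (?c - ?e j) - birkhoff_sum f n x \<le> K)"
    using up lo by (simp add: AE_all_countable)
  then show ?thesis
  proof eventually_elim
    case (elim x)
    show ?case
    proof (rule LIMSEQ_I)
      fix r :: real assume r: "r > 0"
      obtain j where j: "?e j < r / 2" using r reals_Archimedean[of "r/2"] by (auto simp: inverse_eq_divide)
      obtain K1 K2 where K1: "\<And>n. birkhoff_sum f n x - n * (?c + ?e j) \<le> K1"
        and K2: "\<And>n. n * (?c - ?e j) - birkhoff_sum f n x \<le> K2" using elim[rule_format, of j] by blast
      define K where "K = max 0 (max K1 K2)"
      obtain N :: nat where N: "real N > 2 * K / r" using reals_Archimedean2 by blast
      show "\<exists>no. \<forall>n\<ge>no. norm (birkhoff_sum f n x / n - ?c) < r"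
      proof (intro exI allI impI)
        fix n assume n: "n \<ge> Suc N"
        then have np: "real n > 0" by simp
        have "K < N * (r/2)" using N r by (simp add: field_simps)
        also have "\<dots> \<le> n * (r/2)" using n r by (intro mult_right_mono) auto
        finally have "K < n * (r/2)" .
        moreover have "\<bar>birkhoff_sum f n x - n * ?c\<bar> \<le> K + n * ?e j"
          using K1[of n] K2[of n] unfolding K_def distrib_left right_diff_distrib by linarith
        moreover have "n * ?e j \<le> n * (r/2)" using j by (intro mult_left_mono) auto
        moreover have "real n * r = n * (r/2) + n * (r/2)" by simp
        ultimately have "\<bar>birkhoff_sum f n x - n * ?c\<bar> < n * r" by linarith
        then have "\<bar>birkhoff_sum f n x - n * ?c\<bar> / n < r" using np by (simp add: field_simps)
        moreover have "birkhoff_sum f n x / n - ?c = (birkhoff_sum f n x - n * ?c) / n" using np by (simp add: field_simps)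
        ultimately show "norm (birkhoff_sum f n x / n - ?c) < r" using np by simp
      qed
    qed
  qed
qed

end

section \<open>The weak star topology on measures on an interval\<close>

lemma interval_measuresD:
  assumes "m \<in> interval_measures"
  shows "prob_space m" "sets m = sets borel" "space m = UNIV" "AE x in m. x \<in> {-1..1}"
proof -
  show m: "prob_space m" "sets m = sets borel" using assms by (auto simp: interval_measures_def)
  show "space m = UNIV" using sets_eq_imp_space_eq[OF m(2)] by simp
  show "AE x in m. x \<in> {-1..1}"
    using prob_space.AE_prob_1[OF m(1), of "{-1..1}"] assms by (auto simp: interval_measures_def)
qed

lemma integrable_interval:
  fixes f :: "real => real"
  assumes m: "m \<in> interval_measures" and f: "continuous_on {-1..1} f"
  shows "set_integrable m {-1..1} f"
proof -
  interpret prob_space m using interval_measuresD[OF m] by simp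
  note [measurable_cong] = interval_measuresD(2)[OF m]
  have [measurable]: "(\<lambda>x. indicator {-1..1} x *\<^sub>R f x) \<in> borel_measurable borel"
    using f borel_measurable_continuous_on_indicator[of "{-1..1}" f] by simp
  obtain B where B: "\<And>x. x \<in> {-1..1} ==> \<bar>f x\<bar> \<le> B"
    using compact_imp_bounded[OF compact_continuous_image[OF f compact_Icc]]
    by (auto simp: bounded_iff) (metis atLeastAtMost_iff)
  have B0: "0 \<le> B" using B[of 0] by simp
  show ?thesis
    unfolding set_integrable_def
  proof (rule integrable_const_bound[of _ B])
    show "AE x in m. norm (indicator {-1..1} x *\<^sub>R f x) \<le> B"
      using B B0 by (intro AE_I2) (simp add: indicator_def)
  qed measurable
qed

lemma integral_interval_diff_le:
  fixes f g :: "real => real"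
  assumes m: "m \<in> interval_measures" and f: "continuous_on {-1..1} f" and g: "continuous_on {-1..1} g"
    and e: "\<And>x. x \<in> {-1..1} ==> \<bar>f x - g x\<bar> \<le> e" and "0 \<le> e"
  shows "\<bar>(LINT x:{-1..1}|m. f x) - (LINT x:{-1..1}|m. g x)\<bar> \<le> e"
proof -
  interpret prob_space m using interval_measuresD[OF m] by simp
  have i: "set_integrable m {-1..1} f" "set_integrable m {-1..1} g"
    using integrable_interval[OF m f] integrable_interval[OF m g] .
  have "(LINT x:{-1..1}|m. f x) - (LINT x:{-1..1}|m. g x) = (LINT x:{-1..1}|m. f x - g x)"
    using set_integral_diff(2)[OF i] by simp
  also have "\<bar>\<dots>\<bar> \<le> (LINT x|m. \<bar>indicator {-1..1} x *\<^sub>R (f x - g x)\<bar>)"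
    unfolding set_lebesgue_integral_def by (rule integral_abs_bound)
  also have "\<dots> \<le> (LINT x|m. e)"
  proof (rule integral_mono)
    show "integrable m (\<lambda>x. \<bar>indicator {-1..1} x *\<^sub>R (f x - g x)\<bar>)"
      using set_integral_diff(1)[OF i] unfolding set_integrable_def by (rule integrable_abs)
    show "\<bar>indicator {-1..1} x *\<^sub>R (f x - g x)\<bar> \<le> e" for x
      using e[of x] \<open>0 \<le> e\<close> by (auto simp: indicator_def)
  qed simp
  finally show ?thesis by (simp add: prob_space)
qed

definition moments :: "real measure => nat => real" where
  "moments m n = (LINT x:{-1..1}|m. x ^ n)"

lemma moments_bound:
  assumes m: "m \<in> interval_measures" shows "\<bar>moments m n\<bar> \<le> 1"
proof -
  have "\<bar>(LINT x:{-1..1}|m. x ^ n) - (LINT x:{-1..1}|m. 0)\<bar> \<le> 1"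
    by (rule integral_interval_diff_le[OF m]) (auto simp: power_abs intro!: continuous_intros power_le_one)
  then show ?thesis by (simp add: moments_def set_lebesgue_integral_def)
qed

lemma integral_polynomial_eq_moments:
  assumes m: "m \<in> interval_measures"
  shows "(LINT x:{-1..1}|m. (\<Sum>i\<le>n. a i * x ^ i)) = (\<Sum>i\<le>n. a i * moments m i)"
proof -
  have i: "integrable m (\<lambda>x. indicator {-1..1} x *\<^sub>R x ^ i)" for i :: nat
    using integrable_interval[OF m, of "\<lambda>x. x ^ i"] unfolding set_integrable_def
    by (simp add: continuous_intros)
  have "(LINT x:{-1..1}|m. (\<Sum>i\<le>n. a i * x ^ i)) = (LINT x|m. (\<Sum>i\<le>n. a i * (indicator {-1..1} x *\<^sub>R x ^ i)))"
    unfolding set_lebesgue_integral_def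
    by (intro Bochner_Integration.integral_cong refl) (simp add: sum_distrib_left mult_ac)
  also have "\<dots> = (\<Sum>i\<le>n. (LINT x|m. a i * (indicator {-1..1} x *\<^sub>R x ^ i)))"
    by (intro Bochner_Integration.integral_sum integrable_mult_right i)
  also have "\<dots> = (\<Sum>i\<le>n. a i * moments m i)"
    by (intro sum.cong refl) (simp only: integral_mult_right_zero moments_def set_lebesgue_integral_def)
  finally show ?thesis .
qed

lemma topspace_weak_star: "topspace weak_star = interval_measures"
proof -
  have "continuous_on {-1..1} (\<lambda>x. 0::real) \<and> open (UNIV :: real set)" by simp
  then have "interval_measures \<in> {{m \<in> interval_measures. (LINT x:{-1..1}|m. f x) \<in> U} | f U.
        continuous_on {-1..1} (f :: real => real) \<and> open U}"
    by (intro CollectI exI[of _ "\<lambda>x. 0::real"] exI[of _ UNIV]) simp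
  then show ?thesis
    unfolding weak_star_def topology_generated_by_topspace by blast
qed

lemma continuous_map_integral_weak_star:
  assumes "continuous_on {-1..1} (f :: real => real)"
  shows "continuous_map weak_star euclideanreal (\<lambda>m. LINT x:{-1..1}|m. f x)"
  unfolding continuous_map_def topspace_weak_star
proof (intro conjI allI impI)
  fix U :: "real set" assume "openin euclideanreal U"
  then have "open U" by simp
  then show "openin weak_star {m \<in> interval_measures. (LINT x:{-1..1}|m. f x) \<in> U}"
    unfolding weak_star_def using assms \<open>open U\<close>
    by (intro topology_generated_by_Basis CollectI exI[of _ f] exI[of _ U] conjI refl)
qed simp

lemma continuous_map_moments: "continuous_map weak_star euclidean moments"
proof -
  have "continuous_map weak_star (product_topology (\<lambda>i. euclideanreal) UNIV) moments"
    using continuous_map_integral_weak_star[of "\<lambda>x. x ^ n" for n]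
    by (intro continuous_map_coordinatewise_then_product) (auto simp: moments_def continuous_intros)
  then show ?thesis by (simp add: euclidean_product_topology)
qed

text \<open>Polynomials are uniformly dense in the continuous functions on \<open>[-1,1]\<close>. Hence the weak star
  topology is induced by the moment sequence, and questions about it reduce to the countable product
  of lines.\<close>

lemma openin_weak_star_iff:
  "openin weak_star U \<longleftrightarrow> (\<exists>V. open V \<and> U = moments -` V \<inter> interval_measures)"
proof
  assume "\<exists>V. open V \<and> U = moments -` V \<inter> interval_measures"
  then obtain V where V: "open V" "U = {m \<in> topspace weak_star. moments m \<in> V}"
    by (auto simp: topspace_weak_star)
  then show "openin weak_star U"
    using openin_continuous_map_preimage[OF continuous_map_moments, of V] by simp
next
  assume "openin weak_star U"
  then have gen: "generate_topology_on {{m \<in> interval_measures. (LINT x:{-1..1}|m. f x) \<in> U} | f U.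
        continuous_on {-1..1} (f :: real => real) \<and> open U} U"
    unfolding weak_star_def by (simp add: openin_topology_generated_by_iff)
  have basic: "openin (pullback_topology interval_measures moments euclidean) {m \<in> interval_measures. (LINT x:{-1..1}|m. f x) \<in> W}"
    if f: "continuous_on {-1..1} f" and W: "open W" for f :: "real => real" and W
  proof (subst openin_subopen, intro ballI)
    fix m0 assume "m0 \<in> {m \<in> interval_measures. (LINT x:{-1..1}|m. f x) \<in> W}"
    then have m0: "m0 \<in> interval_measures" "(LINT x:{-1..1}|m0. f x) \<in> W" by auto
    obtain e where e: "e > 0" "ball (LINT x:{-1..1}|m0. f x) e \<subseteq> W"
      using W m0(2) by (meson open_contains_ball)
    obtain g where g: "real_polynomial_function g" "\<And>x. x \<in> {-1..1} ==> \<bar>f x - g x\<bar> < e/3"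
      using Stone_Weierstrass_real_polynomial_function[OF compact_Icc f, of "e/3"] e(1) by auto
    obtain a n where an: "g = (\<lambda>x. \<Sum>i\<le>n. a i * x ^ i)"
      using g(1) unfolding real_polynomial_function_iff_sum by blast
    have gc: "continuous_on {-1..1} g" unfolding an by (intro continuous_intros)
    define L where "L c = (\<Sum>i\<le>n. a i * c i)" for c :: "nat => real"
    have L: "(LINT x:{-1..1}|m. g x) = L (moments m)" if "m \<in> interval_measures" for m
      unfolding an L_def by (rule integral_polynomial_eq_moments[OF that])
    have near: "\<bar>(LINT x:{-1..1}|m. f x) - L (moments m)\<bar> \<le> e/3" if "m \<in> interval_measures" for m
      using integral_interval_diff_le[OF that f gc, of "e/3"] g(2) e(1) L[OF that] by (simp add: less_imp_le)
    have Lc: "continuous_on UNIV L" unfolding L_def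
      by (intro continuous_intros continuous_on_product_coordinates) 
    define V where "V = L -` ball (L (moments m0)) (e/3)"
    have V: "open V" unfolding V_def using Lc by (simp add: continuous_on_open_vimage)
    show "\<exists>T. openin (pullback_topology interval_measures moments euclidean) T \<and> m0 \<in> T \<and>
        T \<subseteq> {m \<in> interval_measures. (LINT x:{-1..1}|m. f x) \<in> W}"
    proof (intro exI[of _ "moments -` V \<inter> interval_measures"] conjI subsetI)
      show "openin (pullback_topology interval_measures moments euclidean) (moments -` V \<inter> interval_measures)"
        unfolding openin_pullback_topology using V by auto
      show "m0 \<in> moments -` V \<inter> interval_measures" using m0 e by (simp add: V_def)
      fix m assume "m \<in> moments -` V \<inter> interval_measures"
      then have m: "m \<in> interval_measures" "\<bar>L (moments m0) - L (moments m)\<bar> < e/3"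
        by (auto simp: V_def dist_real_def)
      have "(LINT x:{-1..1}|m. f x) \<in> ball (LINT x:{-1..1}|m0. f x) e"
        using near[OF m(1)] near[OF m0(1)] m(2) unfolding mem_ball dist_real_def by linarith
      then show "m \<in> {m \<in> interval_measures. (LINT x:{-1..1}|m. f x) \<in> W}"
        using e(2) m(1) by blast
    qed
  qed
  have "openin (pullback_topology interval_measures moments euclidean) U"
  proof (rule generate_topology_on_coarsest[OF istopology_openin _ gen])
    fix s assume "s \<in> {{m \<in> interval_measures. (LINT x:{-1..1}|m. f x) \<in> U} | f U.
        continuous_on {-1..1} (f :: real => real) \<and> open U}"
    then obtain f W where "continuous_on {-1..1} (f :: real => real)" "open W"
      "s = {m \<in> interval_measures. (LINT x:{-1..1}|m. f x) \<in> W}" by blast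
    then show "openin (pullback_topology interval_measures moments euclidean) s" using basic by simp
  qed
  then show "\<exists>V. open V \<and> U = moments -` V \<inter> interval_measures"
    by (simp add: openin_pullback_topology)
qed

lemma space_weak_star_borel [simp]: "space weak_star_borel = interval_measures"
  unfolding weak_star_borel_def by (rule space_measure_of) (use openin_subset topspace_weak_star in blast)

lemma sets_weak_star_borel: "sets weak_star_borel = sigma_sets interval_measures {U. openin weak_star U}"
  unfolding weak_star_borel_def by (rule sets_measure_of) (use openin_subset topspace_weak_star in blast)

lemma measurable_weak_star_borel_moments:
  assumes "\<And>x. x \<in> space M ==> f x \<in> interval_measures"
    and "\<And>n. (\<lambda>x. moments (f x) n) \<in> borel_measurable M"
  shows "f \<in> M \<rightarrow>\<^sub>M weak_star_borel"
  unfolding weak_star_borel_def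
proof (rule measurable_measure_of)
  show "{U. openin weak_star U} \<subseteq> Pow interval_measures"
    using openin_subset topspace_weak_star by blast
  show "f \<in> space M \<rightarrow> interval_measures" using assms(1) by auto
  have m: "(\<lambda>x. moments (f x)) \<in> borel_measurable M"
    using assms(2) by (rule measurable_coordinatewise_then_product)
  fix U assume "U \<in> {U. openin weak_star U}"
  then obtain V where V: "open V" "U = moments -` V \<inter> interval_measures"
    unfolding openin_weak_star_iff by blast
  have "f -` U \<inter> space M = (\<lambda>x. moments (f x)) -` V \<inter> space M" using V assms(1) by auto
  also have "\<dots> \<in> sets M" using m V(1) by (simp add: measurable_sets)
  finally show "f -` U \<inter> space M \<in> sets M" .
qed

lemma measurable_weak_star_borelI:
  assumes f: "\<And>x. x \<in> space M ==> f x \<in> interval_measures"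
    and e: "\<And>B. B \<in> sets borel ==> (\<lambda>x. emeasure (f x) B) \<in> borel_measurable M"
  shows "f \<in> M \<rightarrow>\<^sub>M weak_star_borel"
proof (rule measurable_weak_star_borel_moments[OF f])
  fix n
  have [measurable]: "f \<in> M \<rightarrow>\<^sub>M subprob_algebra borel"
    using f e by (intro measurable_subprob_algebra) (auto simp: interval_measures_def prob_space_imp_subprob_space)
  show "(\<lambda>x. moments (f x) n) \<in> borel_measurable M"
    unfolding moments_def set_lebesgue_integral_def by measurable
qed

lemma borel_measurable_continuous_map_weak_star:
  assumes "continuous_map weak_star euclideanreal F"
  shows "F \<in> borel_measurable weak_star_borel"
proof (rule borel_measurableI)
  fix U :: "real set" assume "open U"
  then have "openin weak_star {m \<in> interval_measures. F m \<in> U}"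
    using openin_continuous_map_preimage[OF assms, of U] by (simp add: topspace_weak_star)
  moreover have "F -` U \<inter> space weak_star_borel = {m \<in> interval_measures. F m \<in> U}" by auto
  ultimately show "F -` U \<inter> space weak_star_borel \<in> sets weak_star_borel"
    unfolding sets_weak_star_borel by auto
qed

text \<open>The weak star Borel sets are fine enough to make \<open>m \<mapsto> m A\<close> measurable: for a half-line \<open>A\<close>, this is a
  limit of integrals of continuous functions.\<close>

lemma measurable_weak_star_borel_prob_algebra [measurable]:
  "(\<lambda>m. m) \<in> weak_star_borel \<rightarrow>\<^sub>M prob_algebra borel"
proof (rule measurable_prob_algebra_generated[where \<Omega>=UNIV and G="range atMost"])
  show "sets borel = sigma_sets UNIV (range (atMost :: real => _))"
    unfolding borel_eq_atMost by simp
  show "Int_stable (range (atMost :: real => _))"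
    by (auto simp: Int_stable_def)
  show "a \<in> space weak_star_borel ==> prob_space a" "a \<in> space weak_star_borel ==> sets a = sets borel" for a :: "real measure"
    using interval_measuresD by auto
  fix A :: "real set" assume "A \<in> range atMost"
  then obtain a where A: "A = {..a}" by auto
  define h where "h n x = max 0 (min 1 (1 - real n * (x - a)))" for n :: nat and x
  have hc: "continuous_on S (h n)" for n S unfolding h_def by (intro continuous_intros)
  have lim: "(\<lambda>n. LINT x:{-1..1}|m. h n x) \<longlonglongrightarrow> measure m A" if m: "m \<in> interval_measures" for m
  proof -
    interpret prob_space m using interval_measuresD[OF m] by simp
    note [measurable_cong] = interval_measuresD(2)[OF m]
    have [measurable]: "h n \<in> borel_measurable borel" for n
      using hc by (rule borel_measurable_continuous_onI)
    have "(\<lambda>n. LINT x|m. indicator {-1..1} x *\<^sub>R h n x) \<longlonglongrightarrow> (LINT x|m. indicator A x)"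
    proof (rule integral_dominated_convergence[where w="\<lambda>_. 1"])
      show "AE x in m. (\<lambda>n. indicator {-1..1} x *\<^sub>R h n x) \<longlonglongrightarrow> indicator A x"
        using interval_measuresD(4)[OF m]
      proof eventually_elim
        case (elim x)
        have "(\<lambda>n. h n x) \<longlonglongrightarrow> indicator A x"
        proof (cases "x \<le> a")
          case True
          then have "h n x = 1" for n by (simp add: h_def mult_nonneg_nonpos)
          then show ?thesis using True by (simp add: A)
        next
          case False
          obtain N :: nat where N: "real N > 1 / (x - a)" using reals_Archimedean2 by blast
          have "h n x = 0" if "n \<ge> N" for n
          proof -
            have "1 < real N * (x - a)" using N False by (simp add: field_simps)
            also have "\<dots> \<le> real n * (x - a)" using that False by (intro mult_right_mono) auto
            finally show ?thesis by (simp add: h_def)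
          qed
          then have "\<forall>\<^sub>F n in sequentially. h n x = indicator A x"
            using False by (auto simp: eventually_sequentially A)
          then show ?thesis by (rule tendsto_eventually)
        qed
        then show ?case using elim by simp
      qed
      show "AE x in m. norm (indicator {-1..1} x *\<^sub>R h n x) \<le> 1" for n
        by (rule AE_I2) (auto simp: h_def indicator_def)
      show "indicator A \<in> borel_measurable m" unfolding A by measurable
    qed (auto simp: h_def indicator_def)
    then show ?thesis by (simp add: set_lebesgue_integral_def A)
  qed
  have "(\<lambda>m. LINT x:{-1..1}|m. h n x) \<in> borel_measurable weak_star_borel" for n
    by (intro borel_measurable_continuous_map_weak_star continuous_map_integral_weak_star hc)
  then have "(\<lambda>m. measure m A) \<in> borel_measurable weak_star_borel"
    by (rule borel_measurable_LIMSEQ_real[rotated]) (use lim in auto)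
  then have "(\<lambda>m. ennreal (measure m A)) \<in> borel_measurable weak_star_borel" by measurable
  then show "(\<lambda>m. emeasure m A) \<in> borel_measurable weak_star_borel"
    by (rule measurable_cong[THEN iffD1, rotated])
       (use interval_measuresD in \<open>auto intro!: finite_measure.emeasure_eq_measure[symmetric] prob_space.finite_measure\<close>)
qed auto

text \<open>By Helly's selection theorem: measures carried by a bounded interval are tight, and moments pass to
  weak limits.\<close>

lemma compact_moments: "compact (moments ` interval_measures)"
  unfolding compact_eq_seq_compact_metric seq_compact_def
proof (intro allI impI)
  fix c :: "nat => nat => real" assume "\<forall>n. c n \<in> moments ` interval_measures"
  then have "\<forall>n. \<exists>m. m \<in> interval_measures \<and> c n = moments m" by auto
  then obtain m where m: "\<And>k. m k \<in> interval_measures" and c: "\<And>k. c k = moments (m k)"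
    by metis
  have rd: "real_distribution (m k)" for k
    using interval_measuresD[OF m[of k]] by (simp add: real_distribution_def real_distribution_axioms_def)
  have "tight m"
    unfolding tight_def
  proof (intro conjI allI impI)
    fix e :: real assume e: "e > 0"
    have "measure (m n) {-2<..1} > 1 - e" for n
    proof -
      interpret prob_space "m n" using interval_measuresD[OF m[of n]] by simp
      have "measure (m n) {-1..1} \<le> measure (m n) {-2<..1}"
        by (intro finite_measure_mono) (auto simp: interval_measuresD(2)[OF m])
      then show ?thesis using m[of n] e by (auto simp: interval_measures_def)
    qed
    then show "\<exists>a b. a < b \<and> (\<forall>n. measure (m n) {a<..b} > 1 - e)"
      by (intro exI[of _ "-2"] exI[of _ 1]) auto
  qed (rule rd)
  then obtain r M where r: "strict_mono (r :: nat => nat)" and M: "real_distribution M"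
    and w: "weak_conv_m (m \<circ> id \<circ> r) M"
    using tight_imp_convergent_subsubsequence[of m id] by (auto simp: strict_mono_id)
  have conv: "(\<lambda>k. integral\<^sup>L (m (r k)) f) \<longlonglongrightarrow> integral\<^sup>L M f"
    if "\<And>x. isCont f x" "\<And>x. norm (f x) \<le> B" for f :: "real => real" and B
    using weak_conv_imp_integral_bdd_continuous_conv[of "m \<circ> id \<circ> r" M f B] rd M w that by (simp add: o_def)
  interpret M: real_distribution M by (rule M)
  define f where "f x = max 0 (min 1 (\<bar>x\<bar> - 1))" for x :: real
  have f0: "integral\<^sup>L (m k) f = 0" for k
  proof (rule integral_eq_zero_AE)
    show "AE x in m k. f x = 0"
      using interval_measuresD(4)[OF m[of k]] by eventually_elim (auto simp: f_def)
  qed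
  have fc: "isCont f x" for x unfolding f_def by (intro continuous_intros)
  have "(\<lambda>k. integral\<^sup>L (m (r k)) f) \<longlonglongrightarrow> integral\<^sup>L M f"
    by (rule conv[OF fc, of 1]) (simp add: f_def)
  then have fM: "integral\<^sup>L M f = 0" using LIMSEQ_unique[OF _ tendsto_const] by (simp add: f0)
  have [measurable]: "f \<in> borel_measurable borel" unfolding f_def by measurable
  have "integrable M f" by (rule M.integrable_const_bound[of _ 1]) (auto simp: f_def)
  then have "AE x in M. f x = 0"
    using fM integral_nonneg_eq_0_iff_AE[of M f] by (simp add: f_def)
  then have ae: "AE x in M. x \<in> {-1..1}" by eventually_elim (auto simp: f_def split: if_splits)
  then have "measure M {-1..1} = 1" by (intro M.prob_eq_1[THEN iffD2]) auto
  then have Mi: "M \<in> interval_measures"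
    by (simp add: interval_measures_def M.prob_space_axioms)
  define q where "q n x = (max (-1) (min 1 x)) ^ n" for n :: nat and x :: real
  have qm: "integral\<^sup>L N (q n) = moments N n" if "N \<in> interval_measures" for N n
  proof -
    note [measurable_cong] = interval_measuresD(2)[OF that]
    have [measurable]: "q n \<in> borel_measurable borel" unfolding q_def by measurable
    show ?thesis unfolding moments_def set_lebesgue_integral_def
    proof (rule integral_cong_AE)
      show "AE x in N. q n x = indicator {-1..1} x *\<^sub>R x ^ n"
        using interval_measuresD(4)[OF that] by eventually_elim (auto simp: q_def)
    qed measurable
  qed
  have "(\<lambda>k. c (r k) n) \<longlonglongrightarrow> moments M n" for n
  proof -
    have "(\<lambda>k. integral\<^sup>L (m (r k)) (q n)) \<longlonglongrightarrow> integral\<^sup>L M (q n)"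
    proof (rule conv)
      show "isCont (q n) x" for x unfolding q_def by (intro continuous_intros)
      show "norm (q n x) \<le> 1" for x unfolding q_def by (simp add: power_abs power_le_one)
    qed
    then show ?thesis by (simp add: qm m Mi c)
  qed
  then have "limitin (product_topology (\<lambda>i. euclideanreal) UNIV) (c \<circ> r) (moments M) sequentially"
    by (subst limitin_componentwise) (simp add: o_def)
  then have "(c \<circ> r) \<longlonglongrightarrow> moments M" by (simp add: euclidean_product_topology)
  then show "\<exists>l\<in>moments ` interval_measures. \<exists>r. strict_mono r \<and> (c \<circ> r) \<longlonglongrightarrow> l"
    using Mi r by blast
qed

definition moment_monomial :: "nat list => real measure => real" where
  "moment_monomial l m = (\<Prod>n\<leftarrow>l. moments m n)"

lemma moment_monomial_bound: "m \<in> interval_measures ==> \<bar>moment_monomial l m\<bar> \<le> 1"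
  unfolding moment_monomial_def
  by (induction l) (auto simp: abs_mult intro!: mult_le_one moments_bound)

lemma continuous_map_moment_monomial: "continuous_map weak_star euclideanreal (moment_monomial l)"
  unfolding moment_monomial_def
proof (induction l)
  case (Cons n l)
  have "continuous_map weak_star euclideanreal (\<lambda>m. moments m n)"
    unfolding moments_def by (intro continuous_map_integral_weak_star continuous_intros)
  then show ?case using Cons by (simp add: continuous_map_real_mult)
qed simp

text \<open>A weak star continuous function is a continuous function on the compact set of moment sequences, and
  the polynomials in the moments form an algebra that separates these sequences. By the
  Stone-Weierstrass theorem the countably many functions \<open>moment_monomial l\<close> therefore decide about the
  convergence of averages of all continuous functions.\<close>

lemma weak_star_approx:
  assumes F: "continuous_map weak_star euclideanreal F" and e: "e > 0"
  shows "\<exists>xs. \<forall>m\<in>interval_measures. \<bar>F m - (\<Sum>(a, l)\<leftarrow>xs. a * moment_monomial l m)\<bar> < e"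
proof -
  let ?K = "moments ` interval_measures"
  have pre: "\<exists>V. open V \<and> {m \<in> interval_measures. F m \<in> U} = moments -` V \<inter> interval_measures" if "open U" for U
    using openin_continuous_map_preimage[OF F, of U] that
    unfolding topspace_weak_star openin_weak_star_iff by simp
  have inj: "F m = F m'" if m: "m \<in> interval_measures" "m' \<in> interval_measures" "moments m = moments m'" for m m'
  proof (rule ccontr)
    assume *: "F m \<noteq> F m'"
    obtain V where V: "{m \<in> interval_measures. F m \<in> - {F m'}} = moments -` V \<inter> interval_measures"
      using pre[of "- {F m'}"] by (auto simp: open_Compl)
    have "m \<in> moments -` V \<inter> interval_measures" unfolding V[symmetric] using * m by simp
    then have "m' \<in> moments -` V \<inter> interval_measures" using m by simp
    then show False unfolding V[symmetric] by simp
  qed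
  define G where "G c = F (inv_into interval_measures moments c)" for c
  have G: "G (moments m) = F m" if "m \<in> interval_measures" for m
    unfolding G_def by (rule inj) (use that in \<open>auto intro: inv_into_into f_inv_into_f\<close>)
  have Gc: "continuous_on ?K G"
    unfolding continuous_on_open_invariant
  proof (intro allI impI)
    fix U :: "real set" assume "open U"
    then obtain V where V: "open V" "{m \<in> interval_measures. F m \<in> U} = moments -` V \<inter> interval_measures"
      using pre by blast
    have "V \<inter> ?K = G -` U \<inter> ?K"
      using V(2) G by (auto simp: set_eq_iff)
    then show "\<exists>A. open A \<and> A \<inter> ?K = G -` U \<inter> ?K" using V(1) by blast
  qed
  define poly where "poly g \<longleftrightarrow> (\<exists>xs. g = (\<lambda>c. \<Sum>(a, l)\<leftarrow>xs. a * (\<Prod>n\<leftarrow>l. c n)))" for g :: "(nat => real) => real"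
  have "\<exists>g. poly g \<and> (\<forall>c\<in>?K. \<bar>G c - g c\<bar> < e)"
  proof (rule Stone_Weierstrass_HOL[OF compact_moments])
    show "poly (\<lambda>x. a)" for a
      unfolding poly_def by (rule exI[of _ "[(a, [])]"]) simp
    show "continuous_on ?K g" if g: "poly g" for g
    proof -
      obtain xs where xs: "g = (\<lambda>c. \<Sum>(a, l)\<leftarrow>xs. a * (\<Prod>n\<leftarrow>l. c n))" using g poly_def by blast
      have mon: "continuous_on ?K (\<lambda>c. \<Prod>n\<leftarrow>l. c n)" for l
      proof (induction l)
        case (Cons n l)
        have "continuous_on ?K (\<lambda>c. c n)" 
          by (rule continuous_on_subset[OF continuous_on_product_coordinates]) simp
        then show ?case using Cons by (simp add: continuous_on_mult)
      qed simp
      show ?thesis unfolding xs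
        by (induction xs) (auto intro!: continuous_intros mon)
    qed
    show "poly (\<lambda>x. f x + g x)" if fg: "poly f \<and> poly g" for f g
    proof -
      obtain xs ys where "f = (\<lambda>c. \<Sum>(a, l)\<leftarrow>xs. a * (\<Prod>n\<leftarrow>l. c n))" "g = (\<lambda>c. \<Sum>(a, l)\<leftarrow>ys. a * (\<Prod>n\<leftarrow>l. c n))"
        using fg poly_def by blast
      then show ?thesis unfolding poly_def by (intro exI[of _ "xs @ ys"]) simp
    qed
    show "poly (\<lambda>x. f x * g x)" if fg: "poly f \<and> poly g" for f g
    proof -
      obtain xs ys where xs: "f = (\<lambda>c. \<Sum>(a, l)\<leftarrow>xs. a * (\<Prod>n\<leftarrow>l. c n))" and ys: "g = (\<lambda>c. \<Sum>(a, l)\<leftarrow>ys. a * (\<Prod>n\<leftarrow>l. c n))"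
        using fg poly_def by blast
      have one: "(\<Sum>(a', l')\<leftarrow>map (\<lambda>(b, k). (a * b, l @ k)) ys. a' * (\<Prod>n\<leftarrow>l'. c n)) =
         a * (\<Prod>n\<leftarrow>l. c n) * (\<Sum>(a, l)\<leftarrow>ys. a * (\<Prod>n\<leftarrow>l. c n))" for a l and c :: "nat => real"
        by (induction ys) (auto simp: algebra_simps)
      have "(\<Sum>(a', l')\<leftarrow>concat (map (\<lambda>(a, l). map (\<lambda>(b, k). (a * b, l @ k)) ys) xs). a' * (\<Prod>n\<leftarrow>l'. c n)) =
         (\<Sum>(a, l)\<leftarrow>xs. a * (\<Prod>n\<leftarrow>l. c n)) * (\<Sum>(a, l)\<leftarrow>ys. a * (\<Prod>n\<leftarrow>l. c n))" for c :: "nat => real"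
      proof (induction xs)
        case (Cons p xs)
        obtain a l where p: "p = (a, l)" by (cases p)
        show ?case
          unfolding p list.map concat.simps map_append sum_list_append prod.case one Cons sum_list.Cons distrib_right ..
      qed simp
      then show ?thesis unfolding poly_def xs ys by (intro exI ext) (rule sym)
    qed
    show "\<exists>f. poly f \<and> f x \<noteq> f y" if "x \<in> ?K \<and> y \<in> ?K \<and> x \<noteq> y" for x y
    proof -
      from that have "x \<noteq> y" by simp
      then obtain n where "x n \<noteq> y n" unfolding fun_eq_iff by blast
      moreover have "poly (\<lambda>c. c n)" unfolding poly_def by (rule exI[of _ "[(1, [n])]"]) simp
      ultimately show ?thesis by blast
    qed
  qed (use Gc e in auto)
  then obtain xs where "\<forall>c\<in>?K. \<bar>G c - (\<Sum>(a, l)\<leftarrow>xs. a * (\<Prod>n\<leftarrow>l. c n))\<bar> < e"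
    unfolding poly_def by blast
  then show ?thesis by (intro exI[of _ xs]) (auto simp: G moment_monomial_def)
qed

lemma continuous_map_weak_star_bounded:
  assumes F: "continuous_map weak_star euclideanreal F"
  obtains B where "\<And>m. m \<in> interval_measures ==> \<bar>F m\<bar> \<le> B"
proof -
  obtain xs where xs: "\<forall>m\<in>interval_measures. \<bar>F m - (\<Sum>(a, l)\<leftarrow>xs. a * moment_monomial l m)\<bar> < 1"
    using weak_star_approx[OF F, of 1] by auto
  have b: "\<bar>\<Sum>(a, l)\<leftarrow>xs. a * moment_monomial l m\<bar> \<le> (\<Sum>(a, l)\<leftarrow>xs. \<bar>a\<bar>)" if m: "m \<in> interval_measures" for m
  proof (induction xs)
    case (Cons p xs)
    obtain a l where p: "p = (a, l)" by (cases p)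
    have "\<bar>a * moment_monomial l m\<bar> \<le> \<bar>a\<bar> * 1"
      unfolding abs_mult by (intro mult_left_mono moment_monomial_bound m) simp
    then show ?case using Cons unfolding p by simp
  qed simp
  show thesis
  proof (rule that[of "1 + (\<Sum>(a, l)\<leftarrow>xs. \<bar>a\<bar>)"])
    fix m assume m: "m \<in> interval_measures"
    show "\<bar>F m\<bar> \<le> 1 + (\<Sum>(a, l)\<leftarrow>xs. \<bar>a\<bar>)"
      using xs[rule_format, OF m] b[OF m] by linarith
  qed
qed

section \<open>Zooming into a measure on the line\<close>

abbreviation zoom_window :: "real => real set" where
  "zoom_window s \<equiv> {- exp (- s)..exp (- s)}"

lemma ennreal_divide_divide_cancel:
  fixes a b c :: ennreal
  assumes "c \<noteq> 0" "c \<noteq> \<infinity>" shows "(a / c) / (b / c) = a / b"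
  using divide_mult_eq[of "inverse c" a b] assms
  by (simp add: divide_ennreal_def ennreal_inverse_eq_top_iff)

lemma emeasure_zoom:
  assumes m [measurable_cong]: "sets m = sets borel" and [measurable]: "B \<in> sets borel"
  shows "emeasure (zoom s m) B = emeasure m {v. v \<in> zoom_window s \<and> exp s * v \<in> B} / emeasure m (zoom_window s)"
proof -
  have sp: "space m = UNIV" using sets_eq_imp_space_eq[OF m] by simp
  have "emeasure (zoom s m) B = emeasure (uniform_measure m (zoom_window s)) ((\<lambda>v. exp s * v) -` B \<inter> space m)"
    unfolding zoom_def by (subst emeasure_distr) (auto simp: m cong: measurable_cong_sets)
  also have "\<dots> = emeasure m (zoom_window s \<inter> ((\<lambda>v. exp s * v) -` B \<inter> space m)) / emeasure m (zoom_window s)"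
  proof (rule emeasure_uniform_measure)
    have "(\<lambda>v. exp s * v) -` B \<inter> space borel \<in> sets borel"
      by (rule measurable_sets[where A=borel]) auto
    then show "(\<lambda>v. exp s * v) -` B \<inter> space m \<in> sets m" by (simp add: sp m)
  qed (simp add: m)
  also have "zoom_window s \<inter> ((\<lambda>v. exp s * v) -` B \<inter> space m) = {v. v \<in> zoom_window s \<and> exp s * v \<in> B}"
    by (auto simp: sp)
  finally show ?thesis .
qed

lemma sets_zoom [simp]: "sets (zoom s m) = sets borel"
  by (simp add: zoom_def)

lemma exp_scale_in_unit: "exp s * v \<in> {-1..1} \<longleftrightarrow> v \<in> zoom_window s" for s v :: real
proof -
  have "exp s * v \<le> 1 \<longleftrightarrow> v \<le> exp (- s)" "- 1 \<le> exp s * v \<longleftrightarrow> - exp (- s) \<le> v"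
    by (auto simp: exp_minus field_simps)
  then show ?thesis by auto
qed

lemma zoom_in_interval_measures:
  assumes m: "sets m = sets borel" and pos: "emeasure m (zoom_window s) \<noteq> 0" "emeasure m (zoom_window s) \<noteq> \<infinity>"
  shows "zoom s m \<in> interval_measures"
proof -
  have 1: "emeasure (zoom s m) B = 1" if "B \<in> sets borel" "{-1..1} \<subseteq> B" for B
  proof -
    have "{v. v \<in> zoom_window s \<and> exp s * v \<in> B} = zoom_window s"
      using that(2) exp_scale_in_unit by blast
    then show ?thesis using pos by (simp add: emeasure_zoom[OF m that(1)] less_top)
  qed
  have "prob_space (zoom s m)"
    by (rule prob_spaceI) (use 1[of UNIV] sets_eq_imp_space_eq[OF sets_zoom[of s m]] in simp)
  then show ?thesis
    using 1[of "{-1..1}"] by (simp add: interval_measures_def measure_def)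
qed

text \<open>Conditioning on a null set yields the null measure. So \<open>zoom s m \<in> A\<close>, for a set \<open>A\<close> of measures on
  the interval, includes the statement that the window has positive mass.\<close>

lemma zoom_null:
  assumes m: "sets m = sets borel" and "emeasure m (zoom_window s) = 0"
  shows "zoom s m \<notin> interval_measures"
proof
  assume "zoom s m \<in> interval_measures"
  then have "prob_space (zoom s m)" "space (zoom s m) = UNIV" using interval_measuresD by auto
  then have "emeasure (zoom s m) UNIV = 1" using prob_space.emeasure_space_1 by metis
  moreover have "emeasure (zoom s m) UNIV = 0"
    using assms(2) by (subst emeasure_zoom[OF m]) (simp_all add: Collect_conj_eq[symmetric] atLeastAtMost_def atLeast_def atMost_def)
  ultimately show False by simp
qed

text \<open>The truncation in \<open>recentre\<close> removes only points outside the window of the zoom that follows.\<close>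

lemma zoom_recentre_eq:
  assumes m [measurable_cong]: "sets m = sets borel" and fin: "finite_measure m" and t: "t \<ge> 0"
  shows "zoom t (recentre x m) = zoom t (distr m borel (\<lambda>y. y - x))"
proof (rule measure_eqI)
  interpret finite_measure m by fact
  fix B assume "B \<in> sets (zoom t (recentre x m))"
  then have B [measurable]: "B \<in> sets borel" by simp
  let ?n = "distr m borel (\<lambda>y. y - x)"
  let ?a = "emeasure ?n {v. v \<in> zoom_window t \<and> exp t * v \<in> B}" and ?b = "emeasure ?n (zoom_window t)"
  let ?d = "emeasure ?n {-1..1}"
  have w: "zoom_window t \<subseteq> {-1..1}" using t by auto
  have [measurable]: "{v. v \<in> zoom_window t \<and> exp t * v \<in> B} \<in> sets borel" by measurable
  have r: "emeasure (recentre x m) C = emeasure ?n C / ?d" if C: "C \<in> sets borel" "C \<subseteq> zoom_window t" for C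
  proof -
    have "{-1..1} \<inter> C = C" using C(2) w by blast
    then show ?thesis unfolding recentre_def using C(1) by (subst emeasure_uniform_measure) simp_all
  qed
  have "emeasure (zoom t (recentre x m)) B = (?a / ?d) / (?b / ?d)"
    by (subst emeasure_zoom, simp add: recentre_def, simp, subst r, simp, blast, subst r) simp_all
  also have "\<dots> = ?a / ?b"
  proof (cases "?d = 0")
    case True
    have "?a \<le> ?d" by (rule emeasure_mono) (use w in blast, simp)
    then have a: "?a = 0" unfolding True by simp
    show ?thesis unfolding a by simp
  next
    case False
    have "?d \<noteq> \<infinity>" by (subst emeasure_distr) (auto simp: emeasure_eq_measure)
    then show ?thesis using False by (rule ennreal_divide_divide_cancel[rotated])
  qed
  also have "\<dots> = emeasure (zoom t ?n) B" by (subst emeasure_zoom) auto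
  finally show "emeasure (zoom t (recentre x m)) B = emeasure (zoom t ?n) B" .
qed simp

text \<open>Zooming, moving to another centre and zooming again amounts to moving in the original scale and
  zooming once. The hypothesis on \<open>x\<close> says that the second window lies inside the part of \<open>N\<close> which the
  first zoom retains.\<close>

lemma zoom_shift_zoom:
  assumes N [measurable_cong]: "sets N = sets borel"
    and pos: "emeasure N (zoom_window s) \<noteq> 0" "emeasure N (zoom_window s) \<noteq> \<infinity>"
    and x: "{x - exp (- t)..x + exp (- t)} \<subseteq> {-1..1}"
  shows "zoom t (distr (zoom s N) borel (\<lambda>y. y - x)) = zoom (s + t) (distr N borel (\<lambda>v. v - exp (- s) * x))"
proof (rule measure_eqI)
  fix B assume "B \<in> sets (zoom t (distr (zoom s N) borel (\<lambda>y. y - x)))"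
  then have B [measurable]: "B \<in> sets borel" by simp
  have sp: "space N = UNIV" using sets_eq_imp_space_eq[OF N] by simp
  have x': "x - exp (- t) \<ge> -1" "x + exp (- t) \<le> 1"
    using x by (auto simp: atLeastatMost_subset_iff)
  have win: "exp s * v - x \<in> zoom_window t \<longleftrightarrow> v - exp (- s) * x \<in> zoom_window (s + t)" for v
  proof -
    have "exp s * v - x = exp s * (v - exp (- s) * x)" by (simp add: algebra_simps exp_minus)
    moreover have "exp s * w \<le> exp (- t) \<longleftrightarrow> w \<le> exp (- (s + t))"
       "- exp (- t) \<le> exp s * w \<longleftrightarrow> - exp (- (s + t)) \<le> w" for w :: real
      unfolding minus_add_distrib exp_add by (simp_all add: exp_minus field_simps)
    ultimately show ?thesis by (simp only: atLeastAtMost_iff)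
  qed
  have wi: "v \<in> zoom_window s" if "exp s * v - x \<in> zoom_window t" for v
    using that x' by (subst exp_scale_in_unit[symmetric]) auto
  have sc: "exp t * (exp s * v - x) = exp (s + t) * (v - exp (- s) * x)" for v
    by (simp add: algebra_simps exp_minus exp_add)
  have z: "emeasure (distr (zoom s N) borel (\<lambda>y. y - x)) C =
     emeasure N {v. exp s * v - x \<in> C} / emeasure N (zoom_window s)"
    if C [measurable]: "C \<in> sets borel" and sub: "C \<subseteq> zoom_window t" for C
  proof -
    have C': "{y. y - x \<in> C} \<in> sets borel" by measurable
    have 1: "emeasure (distr (zoom s N) borel (\<lambda>y. y - x)) C = emeasure (zoom s N) {y. y - x \<in> C}"
      using sets_eq_imp_space_eq[OF sets_zoom[of s N]] by (subst emeasure_distr) (auto simp: vimage_def cong: measurable_cong_sets)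
    also have "\<dots> = emeasure N {v. v \<in> zoom_window s \<and> exp s * v - x \<in> C} / emeasure N (zoom_window s)"
      by (subst emeasure_zoom[OF N C']) simp
    also have "{v. v \<in> zoom_window s \<and> exp s * v - x \<in> C} = {v. exp s * v - x \<in> C}"
      using wi sub by blast
    finally show ?thesis .
  qed
  let ?n = "distr N borel (\<lambda>v. v - exp (- s) * x)"
  have n: "emeasure ?n C = emeasure N {v. v - exp (- s) * x \<in> C}" if [measurable]: "C \<in> sets borel" for C
    by (subst emeasure_distr) (auto simp: sp vimage_def)
  have m: "{v. v \<in> zoom_window u \<and> exp u * v \<in> B} \<in> sets borel" for u by measurable
  have "emeasure (zoom t (distr (zoom s N) borel (\<lambda>y. y - x))) B =
    (emeasure N {v. exp s * v - x \<in> {v. v \<in> zoom_window t \<and> exp t * v \<in> B}} / emeasure N (zoom_window s)) /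
    (emeasure N {v. exp s * v - x \<in> zoom_window t} / emeasure N (zoom_window s))"
    by (subst emeasure_zoom) (simp, simp, subst z[OF m], blast, subst z, auto)
  also have "\<dots> = emeasure N {v. exp s * v - x \<in> {v. v \<in> zoom_window t \<and> exp t * v \<in> B}} /
     emeasure N {v. exp s * v - x \<in> zoom_window t}"
    by (rule ennreal_divide_divide_cancel[OF pos])
  also have "{v. exp s * v - x \<in> {v. v \<in> zoom_window t \<and> exp t * v \<in> B}} =
     {v. v - exp (- s) * x \<in> {v. v \<in> zoom_window (s + t) \<and> exp (s + t) * v \<in> B}}"
    by (simp only: mem_Collect_eq win sc)
  also have "{v. exp s * v - x \<in> zoom_window t} = {v. v - exp (- s) * x \<in> zoom_window (s + t)}"
    by (simp only: win)
  also have "emeasure N {v. v - exp (- s) * x \<in> {v. v \<in> zoom_window (s + t) \<and> exp (s + t) * v \<in> B}} /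
     emeasure N {v. v - exp (- s) * x \<in> zoom_window (s + t)} = emeasure (zoom (s + t) ?n) B"
    by (subst emeasure_zoom) (simp, simp, subst n[OF m], subst n, auto)
  finally show "emeasure (zoom t (distr (zoom s N) borel (\<lambda>y. y - x))) B = emeasure (zoom (s + t) ?n) B" .
qed simp

lemma zoom_zoom:
  assumes N: "sets N = sets borel"
    and pos: "emeasure N (zoom_window s) \<noteq> 0" "emeasure N (zoom_window s) \<noteq> \<infinity>" and t: "t \<ge> 0"
  shows "zoom t (zoom s N) = zoom (s + t) N"
  using zoom_shift_zoom[OF N pos, of 0 t] t N by (simp add: distr_id2)

lemma msupport_iff_windows:
  assumes m: "sets m = sets borel"
  shows "(x::real) \<in> msupport m \<longleftrightarrow> (\<forall>n. emeasure m {x - 1 / Suc n..x + 1 / Suc n} > 0)"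
proof
  assume x: "x \<in> msupport m"
  show "\<forall>n. emeasure m {x - 1 / Suc n..x + 1 / Suc n} > 0"
  proof
    fix n
    have "0 < emeasure m {x - 1 / Suc n<..<x + 1 / Suc n}"
      using x unfolding msupport_def by (auto simp: field_simps)
    also have "\<dots> \<le> emeasure m {x - 1 / Suc n..x + 1 / Suc n}"
      by (intro emeasure_mono) (auto simp: m)
    finally show "emeasure m {x - 1 / Suc n..x + 1 / Suc n} > 0" .
  qed
next
  assume *: "\<forall>n. emeasure m {x - 1 / Suc n..x + 1 / Suc n} > 0"
  show "x \<in> msupport m" unfolding msupport_def
  proof safe
    fix U :: "real set" assume U: "open U" "x \<in> U"
    then obtain e where e: "e > 0" "cball x e \<subseteq> U" by (meson open_contains_cball)
    obtain n where n: "1 / real (Suc n) < e" using reals_Archimedean[OF e(1)] by (auto simp: inverse_eq_divide)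
    have "{x - 1 / Suc n..x + 1 / Suc n} \<subseteq> U"
      using n e(2) by (auto simp: subset_eq dist_real_def)
    then have "emeasure m {x - 1 / Suc n..x + 1 / Suc n} \<le> emeasure m U"
      using U by (intro emeasure_mono) (auto simp: m)
    with * show "0 < emeasure m U" by (meson order_less_le_trans)
  qed
qed

lemma pointed_measures_sets [measurable]: "pointed_measures \<in> sets weak_star_borel"
proof -
  have [measurable]: "(\<lambda>m. emeasure m B) \<in> borel_measurable weak_star_borel" if "B \<in> sets borel" for B
    using measurable_emeasure_kernel[OF measurable_prob_algebraD[OF measurable_weak_star_borel_prob_algebra] that] .
  have "pointed_measures = {m \<in> space weak_star_borel. \<forall>n. emeasure m {0 - 1 / Suc n..0 + 1 / Suc n} > 0}"
    unfolding pointed_measures_def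
    using msupport_iff_windows interval_measuresD(2) by auto
  also have "\<dots> \<in> sets weak_star_borel" by measurable
  finally show ?thesis .
qed

lemma msupport_window_pos:
  assumes "sets m = sets borel" "(0::real) \<in> msupport m" shows "emeasure m (zoom_window s) \<noteq> 0"
proof -
  have "0 < emeasure m {- exp (- s)<..<exp (- s)}" using assms(2) unfolding msupport_def by auto
  also have "\<dots> \<le> emeasure m (zoom_window s)" by (intro emeasure_mono) (auto simp: assms(1))
  finally show ?thesis by simp
qed

lemma zoom_pointed:
  assumes m: "sets m = sets borel" and fin: "finite_measure m" and 0: "0 \<in> msupport m"
  shows "zoom s m \<in> pointed_measures"
proof -
  interpret finite_measure m by fact
  have "zoom s m \<in> interval_measures"
    by (intro zoom_in_interval_measures m msupport_window_pos 0) (simp add: emeasure_eq_measure)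
  moreover have "0 \<in> msupport (zoom s m)"
    unfolding msupport_def
  proof safe
    fix U :: "real set" assume U: "open U" "0 \<in> U"
    let ?V = "{- exp (- s)<..<exp (- s)} \<inter> (\<lambda>v. exp s * v) -` U"
    have V: "open ?V" using U by (intro open_Int open_vimage) (auto intro!: continuous_intros)
    have "0 < emeasure m ?V" using 0 U V unfolding msupport_def by auto
    also have "\<dots> \<le> emeasure m {v. v \<in> zoom_window s \<and> exp s * v \<in> U}"
    proof (rule emeasure_mono)
      have [measurable]: "U \<in> sets borel" using U by simp
      have "{v. v \<in> zoom_window s \<and> exp s * v \<in> U} \<in> sets borel" by measurable
      then show "{v. v \<in> zoom_window s \<and> exp s * v \<in> U} \<in> sets m" by (simp add: m)
    qed auto
    finally show "0 < emeasure (zoom s m) U"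
      using U by (subst emeasure_zoom[OF m]) (auto simp: ennreal_zero_less_divide emeasure_eq_measure)
  qed
  ultimately show ?thesis by (simp add: pointed_measures_def)
qed

text \<open>The value on null windows is an arbitrary measure on the interval: sceneries that take values in
  \<open>interval_measures\<close> without exception are measurable functions into the space of measures.\<close>

definition total_zoom :: "real => real measure => real measure" where
  "total_zoom s m = (if emeasure m (zoom_window s) = 0 then return borel 0 else zoom s m)"

lemma return_interval_measures: "return borel 0 \<in> interval_measures"
  by (auto simp: interval_measures_def measure_return intro!: prob_space_return)

lemma measurable_total_zoom:
  assumes K: "K \<in> M \<rightarrow>\<^sub>M subprob_algebra borel" and [measurable]: "s \<in> borel_measurable M"
  shows "(\<lambda>x. total_zoom (s x) (K x)) \<in> M \<rightarrow>\<^sub>M weak_star_borel"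
proof (rule measurable_weak_star_borelI)
  note K [measurable]
  have Kb: "sets (K x) = sets borel" "subprob_space (K x)" if "x \<in> space M" for x
    using measurable_space[OF K that] by (auto simp: space_subprob_algebra)
  show "total_zoom (s x) (K x) \<in> interval_measures" if "x \<in> space M" for x
    using Kb[OF that] subprob_space.emeasure_subprob_space_less_top[of "K x"]
    by (auto simp: total_zoom_def return_interval_measures intro!: zoom_in_interval_measures)
  fix B :: "real set" assume B [measurable]: "B \<in> sets borel"
  have w [measurable]: "(\<lambda>x. emeasure (K x) (zoom_window (s x))) \<in> borel_measurable M"
  proof (rule emeasure_measurable_subprob_algebra2[OF _ K])
    have "(SIGMA x:space M. zoom_window (s x)) =
      {p \<in> space (M \<Otimes>\<^sub>M borel). snd p \<in> zoom_window (s (fst p))}"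
      by (auto simp: space_pair_measure)
    also have "\<dots> \<in> sets (M \<Otimes>\<^sub>M borel)" unfolding atLeastAtMost_iff by measurable
    finally show "(SIGMA x:space M. zoom_window (s x)) \<in> sets (M \<Otimes>\<^sub>M borel)" .
  qed
  have n [measurable]: "(\<lambda>x. emeasure (K x) {v. v \<in> zoom_window (s x) \<and> exp (s x) * v \<in> B}) \<in> borel_measurable M"
  proof (rule emeasure_measurable_subprob_algebra2[OF _ K])
    have "(SIGMA x:space M. {v. v \<in> zoom_window (s x) \<and> exp (s x) * v \<in> B}) =
      {p \<in> space (M \<Otimes>\<^sub>M borel). snd p \<in> zoom_window (s (fst p)) \<and> exp (s (fst p)) * snd p \<in> B}"
      by (auto simp: space_pair_measure)
    also have "\<dots> \<in> sets (M \<Otimes>\<^sub>M borel)" unfolding atLeastAtMost_iff by measurable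
    finally show "(SIGMA x:space M. {v. v \<in> zoom_window (s x) \<and> exp (s x) * v \<in> B}) \<in> sets (M \<Otimes>\<^sub>M borel)" .
  qed
  have "(\<lambda>x. if emeasure (K x) (zoom_window (s x)) = 0 then emeasure (return borel 0) B
    else emeasure (K x) {v. v \<in> zoom_window (s x) \<and> exp (s x) * v \<in> B} / emeasure (K x) (zoom_window (s x)))
     \<in> borel_measurable M" by measurable
  then show "(\<lambda>x. emeasure (total_zoom (s x) (K x)) B) \<in> borel_measurable M"
    by (rule measurable_cong[THEN iffD1, rotated]) (auto simp: total_zoom_def emeasure_zoom Kb)
qed

lemma measurable_zoom_pointed:
  assumes A: "A \<in> sets weak_star_borel"
  shows "{m \<in> pointed_measures. zoom t m \<in> A} \<in> sets weak_star_borel"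
proof -
  have [measurable]: "total_zoom t \<in> weak_star_borel \<rightarrow>\<^sub>M weak_star_borel"
    by (rule measurable_total_zoom[OF measurable_prob_algebraD[OF measurable_weak_star_borel_prob_algebra]]) simp
  have "{m \<in> pointed_measures. zoom t m \<in> A} = pointed_measures \<inter> (total_zoom t -` A \<inter> space weak_star_borel)"
    using msupport_window_pos interval_measuresD(2)
    by (auto simp: total_zoom_def pointed_measures_def)
  also have "\<dots> \<in> sets weak_star_borel" using A by measurable
  finally show ?thesis .
qed

section \<open>Scenery along a special flow\<close>

lemma set_integral_Ico_eq_Icc:
  fixes g :: "real => real"
  assumes "g \<in> borel_measurable borel"
  shows "(LBINT s:{a..<b}. g s) = (LBINT s:{a..b}. g s)"
  unfolding set_lebesgue_integral_def
proof (rule integral_cong_AE)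
  show "AE x in lborel. indicator {a..<b} x *\<^sub>R g x = indicator {a..b} x *\<^sub>R g x"
    using AE_lborel_singleton[of b] by eventually_elim (auto simp: indicator_def)
qed (use assms in measurable)

lemma bounded_set_integrable:
  fixes g :: "real => real"
  assumes [measurable]: "g \<in> borel_measurable borel" and B: "\<And>s. \<bar>g s\<bar> \<le> B"
  shows "set_integrable lborel {a..<b} g"
  unfolding set_integrable_def
proof (rule Bochner_Integration.integrable_bound[of _ "\<lambda>x. indicator {a..<b} x *\<^sub>R B"])
  show "integrable lborel (\<lambda>x. indicator {a..<b} x *\<^sub>R B)"
    using emeasure_bounded_finite[of "{a..<b}"] by (intro integrable_scaleR_left integrable_real_indicator) auto
  show "AE x in lborel. norm (indicator {a..<b} x *\<^sub>R g x) \<le> norm (indicator {a..<b} x *\<^sub>R B)"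
    using B[THEN order_trans, OF abs_ge_self] by (intro AE_I2) (simp add: indicator_def)
qed measurable

lemma bounded_set_integral_split:
  fixes g :: "real => real"
  assumes "g \<in> borel_measurable borel" "\<And>s. \<bar>g s\<bar> \<le> B" "a \<le> b" "b \<le> c"
  shows "(LBINT s:{a..<c}. g s) = (LBINT s:{a..<b}. g s) + (LBINT s:{b..<c}. g s)"
proof -
  have "{a..<c} = {a..<b} \<union> {b..<c}" using assms by auto
  then show ?thesis
    using set_integral_Un[OF _ bounded_set_integrable[OF assms(1,2)] bounded_set_integrable[OF assms(1,2)], of a b b c]
    by (simp add: ivl_disj_int)
qed

lemma bounded_set_integral_le:
  fixes g :: "real => real"
  assumes [measurable]: "g \<in> borel_measurable borel" and B: "\<And>s. \<bar>g s\<bar> \<le> B" and ab: "a \<le> b"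
  shows "\<bar>LBINT s:{a..<b}. g s\<bar> \<le> B * (b - a)"
proof -
  have "\<bar>LBINT s:{a..<b}. g s\<bar> \<le> (LBINT s. \<bar>indicator {a..<b} s *\<^sub>R g s\<bar>)"
    unfolding set_lebesgue_integral_def by (rule integral_abs_bound)
  also have "\<dots> \<le> (LBINT s. indicator {a..<b} s *\<^sub>R B)"
  proof (rule integral_mono)
    show "integrable lborel (\<lambda>s. \<bar>indicator {a..<b} s *\<^sub>R g s\<bar>)"
      using bounded_set_integrable[OF assms(1) B, of a b] unfolding set_integrable_def by (rule integrable_abs)
    show "integrable lborel (\<lambda>s. indicator {a..<b} s *\<^sub>R B)"
      using emeasure_bounded_finite[of "{a..<b}"] by (intro integrable_scaleR_left integrable_real_indicator) auto
    show "\<bar>indicator {a..<b} s *\<^sub>R g s\<bar> \<le> indicator {a..<b} s *\<^sub>R B" for s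
      using B[of s] by (simp add: indicator_def)
  qed
  also have "\<dots> = B * (b - a)" using ab by simp
  finally show ?thesis .
qed

lemma set_integral_translate:
  fixes g :: "real => real"
  shows "(LBINT s:{c..<c + b}. g s) = (LBINT s:{0..<b}. g (s + c))"
  unfolding set_lebesgue_integral_def
  by (subst lborel_integral_real_affine[where c=1 and t=c])
     (auto intro!: Bochner_Integration.integral_cong simp: indicator_def add.commute)

text \<open>Consecutive return times \<open>R n\<close> differ by a bounded amount, so a bounded function has the same averages
  along the return times as along all times.\<close>

lemma time_average_of_return_average:
  fixes g :: "real => real" and R :: "nat => real"
  assumes g [measurable]: "g \<in> borel_measurable borel" and B: "\<And>s. \<bar>g s\<bar> \<le> B"
    and R0: "R 0 = 0" and R1: "\<And>n. R n \<le> R (Suc n)" and R2: "\<And>n. R (Suc n) \<le> R n + C"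
    and R: "(\<lambda>n. R n / n) \<longlonglongrightarrow> \<rho>" and rho: "\<rho> > 0"
    and H: "(\<lambda>n. (LBINT s:{0..<R n}. g s) / n) \<longlonglongrightarrow> H"
  shows "((\<lambda>t. 1 / t * (LBINT s:{0..<t}. g s)) \<longlongrightarrow> H / \<rho>) at_top"
proof -
  have B0: "B \<ge> 0" using B[of 0] by linarith
  have mono: "R i \<le> R j" if "i \<le> j" for i j using R1 that by (rule lift_Suc_mono_le)
  have unb: "\<exists>n. R (Suc n) > t" for t
  proof -
    have "\<forall>\<^sub>F n in sequentially. R n / n > \<rho> / 2" using R rho by (intro order_tendstoD) auto
    moreover have "\<forall>\<^sub>F n in sequentially. real n > 2 * \<bar>t\<bar> / \<rho>"
      using filterlim_real_sequentially eventually_gt_at_top by (rule filterlim_compose[THEN filterlim_at_top_dense[THEN iffD1, rule_format], OF filterlim_ident, rotated] | simp add: filterlim_at_top_dense)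
    ultimately have "\<forall>\<^sub>F n in sequentially. R n > t"
    proof eventually_elim
      case (elim n)
      then have "n > 0" using rho by (cases n) (auto simp: field_simps)
      then have "R n > n * (\<rho> / 2)" using elim(1) by (simp add: field_simps)
      moreover have "n * (\<rho> / 2) > \<bar>t\<bar>" using elim(2) rho by (simp add: field_simps)
      ultimately show ?case by linarith
    qed
    then obtain n where n: "R n > t" by (auto simp: eventually_sequentially)
    then show ?thesis using R1[of n] by (intro exI[of _ n]) linarith
  qed
  define n where "n t = (LEAST n. R (Suc n) > t)" for t
  have n1: "R (Suc (n t)) > t" for t unfolding n_def using unb by (rule LeastI_ex)
  have n2: "R (n t) \<le> t" if "t \<ge> 0" for t
  proof (cases "n t")
    case (Suc k)
    then have "\<not> R (Suc k) > t" using not_less_Least[of k "\<lambda>n. R (Suc n) > t"] by (simp add: n_def)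
    then show ?thesis using Suc by simp
  qed (use that R0 in simp)
  have nlim: "filterlim n at_top at_top"
    unfolding filterlim_at_top
  proof
    fix N
    show "\<forall>\<^sub>F t in at_top. N \<le> n t"
      using eventually_ge_at_top[of "R N"]
    proof eventually_elim
      case (elim t)
      then have "R N < R (Suc (n t))" using n1[of t] by linarith
      then show ?case using mono[of "Suc (n t)" N] by (cases "N \<le> n t") auto
    qed
  qed
  let ?G = "\<lambda>t. LBINT s:{0..<t}. g s"
  have r1: "((\<lambda>t. R (n t) / n t) \<longlongrightarrow> \<rho>) at_top" using R nlim by (rule filterlim_compose)
  have h1: "((\<lambda>t. ?G (R (n t)) / n t) \<longlongrightarrow> H) at_top" using H nlim by (rule filterlim_compose)
  have "(\<lambda>n. K / real n) \<longlonglongrightarrow> 0" for K using lim_const_over_n[of K] by simp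
  then have k: "((\<lambda>t. K / real (n t)) \<longlongrightarrow> 0) at_top" for K
    using nlim filterlim_compose by blast
  have e1: "((\<lambda>t. t / n t - R (n t) / n t) \<longlongrightarrow> 0) at_top"
  proof (rule Lim_null_comparison[OF _ k[of C]])
    show "\<forall>\<^sub>F t in at_top. norm (t / n t - R (n t) / n t) \<le> C / n t"
      using eventually_ge_at_top[of 0]
    proof eventually_elim
      case (elim t)
      have "\<bar>t - R (n t)\<bar> \<le> C" using n1[of t] n2[OF elim] R2[of "n t"] by linarith
      then have "\<bar>t - R (n t)\<bar> / n t \<le> C / n t" by (rule divide_right_mono) simp
      then show ?case by (simp add: diff_divide_distrib[symmetric])
    qed
  qed
  have e2: "((\<lambda>t. ?G t / n t - ?G (R (n t)) / n t) \<longlongrightarrow> 0) at_top"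
  proof (rule Lim_null_comparison[OF _ k[of "B * C"]])
    show "\<forall>\<^sub>F t in at_top. norm (?G t / n t - ?G (R (n t)) / n t) \<le> B * C / n t"
      using eventually_ge_at_top[of 0]
    proof eventually_elim
      case (elim t)
      have R0': "0 \<le> R (n t)" using mono[of 0 "n t"] R0 by simp
      have "?G t - ?G (R (n t)) = (LBINT s:{R (n t)..<t}. g s)"
        using bounded_set_integral_split[OF g B R0' n2[OF elim]] by simp
      then have "\<bar>?G t - ?G (R (n t))\<bar> \<le> B * (t - R (n t))"
        using bounded_set_integral_le[OF g B n2[OF elim]] by simp
      also have "\<dots> \<le> B * C" using n1[of t] R2[of "n t"] B0 by (intro mult_left_mono) auto
      finally have "\<bar>?G t - ?G (R (n t))\<bar> / n t \<le> B * C / n t" by (rule divide_right_mono) simp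
      then show ?case by (simp add: diff_divide_distrib[symmetric])
    qed
  qed
  have t1: "((\<lambda>t. t / n t) \<longlongrightarrow> \<rho>) at_top" using tendsto_add[OF e1 r1] by simp
  have g1: "((\<lambda>t. ?G t / n t) \<longlongrightarrow> H) at_top" using tendsto_add[OF e2 h1] by simp
  have "((\<lambda>t. (?G t / n t) / (t / n t)) \<longlongrightarrow> H / \<rho>) at_top"
    using g1 t1 by (rule tendsto_divide) (use rho in simp)
  moreover have "\<forall>\<^sub>F t in at_top. (?G t / n t) / (t / n t) = 1 / t * ?G t"
  proof -
    have "\<forall>\<^sub>F t in at_top. n t \<ge> 1" using nlim unfolding filterlim_at_top by blast
    then show ?thesis by eventually_elim simp
  qed
  ultimately show ?thesis by (rule Lim_transform_eventually)
qed

text \<open>Sceneries organised as a special flow: above \<open>x\<close> the scenery is seen up to the time \<open>r x\<close>, and then it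
  continues as the scenery of \<open>F x\<close>.\<close>

locale scenery_flow = ergodic_map M F for M :: "'a measure" and F +
  fixes r :: "'a => real" and scen :: "'a => real => real measure" and rmin rmax :: real
  assumes r_measurable [measurable]: "r \<in> borel_measurable M"
    and rmin_pos: "0 < rmin" and r_bounds: "\<And>x. x \<in> space M ==> rmin \<le> r x \<and> r x \<le> rmax"
    and scen_measurable: "(\<lambda>(x, s). scen x s) \<in> M \<Otimes>\<^sub>M borel \<rightarrow>\<^sub>M weak_star_borel"
    and scen_step: "AE x in M. \<forall>s\<ge>0. scen x (s + r x) = scen (F x) s"
    and scen_pointed: "AE x in M. \<forall>s\<ge>0. scen x s \<in> pointed_measures"
    and scen_zoom: "AE x in M. \<forall>s\<ge>0. \<forall>t\<ge>0. zoom t (scen x s) = scen x (s + t)"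
begin

lemma scen_measurable' [measurable (raw)]:
  assumes "f \<in> N \<rightarrow>\<^sub>M M" "g \<in> borel_measurable N"
  shows "(\<lambda>x. scen (f x) (g x)) \<in> N \<rightarrow>\<^sub>M weak_star_borel"
  using measurable_compose[OF measurable_Pair[OF assms] scen_measurable] by simp

lemma scen_interval: "x \<in> space M ==> scen x s \<in> interval_measures"
  using measurable_space[OF scen_measurable, of "(x, s)"] by (simp add: space_pair_measure)

definition mean_roof :: real where "mean_roof = (LINT x|M. r x)"

lemma r_integrable: "integrable M r"
  by (rule integrable_const_bound[of _ rmax]) (use r_bounds rmin_pos in \<open>force intro!: AE_I2\<close>)+

lemma mean_roof_pos: "0 < mean_roof"
proof -
  have "(LINT x|M. rmin) \<le> (LINT x|M. r x)"
    by (intro integral_mono r_integrable) (use r_bounds in auto)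
  then show ?thesis using rmin_pos by (simp add: mean_roof_def prob_space)
qed

lemma nn_integral_r: "(\<integral>\<^sup>+x. ennreal (r x) \<partial>M) = ennreal mean_roof"
  unfolding mean_roof_def
  by (rule nn_integral_eq_integral[OF r_integrable]) (use r_bounds rmin_pos in \<open>force intro!: AE_I2\<close>)

definition flow_density :: "'a \<times> real => ennreal" where
  "flow_density = (\<lambda>(x, s). indicator {0..<r x} s / ennreal mean_roof)"

text \<open>The law of the scenery at a random point \<open>(x, s)\<close> of the special flow, uniform in the region
  \<open>0 \<le> s < r x\<close> below the roof. This is the scenery distribution.\<close>

definition law :: "real measure measure" where
  "law = distr (density (M \<Otimes>\<^sub>M lborel) flow_density) weak_star_borel (\<lambda>(x, s). scen x s)"

lemma indicator_Ico_measurable [measurable (raw)]: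
  fixes f g h :: "'b => real"
  assumes [measurable]: "f \<in> borel_measurable N" "g \<in> borel_measurable N" "h \<in> borel_measurable N"
  shows "(\<lambda>x. indicator {f x..<g x} (h x) :: ennreal) \<in> borel_measurable N"
proof -
  have "(\<lambda>x. if f x \<le> h x \<and> h x < g x then 1 else 0 :: ennreal) \<in> borel_measurable N" by measurable
  then show ?thesis by (rule measurable_cong[THEN iffD1, rotated]) (auto simp: indicator_def)
qed

lemma flow_density_measurable [measurable]: "flow_density \<in> borel_measurable (M \<Otimes>\<^sub>M lborel)"
  unfolding flow_density_def by measurable

lemma sets_law: "sets law = sets weak_star_borel" "space law = interval_measures"
  by (simp_all add: law_def)

lemma nn_integral_law:
  assumes f [measurable]: "f \<in> borel_measurable weak_star_borel"
  shows "(\<integral>\<^sup>+m. f m \<partial>law) = (\<integral>\<^sup>+x. \<integral>\<^sup>+s. indicator {0..<r x} s * f (scen x s) \<partial>lborel \<partial>M) / ennreal mean_roof"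
proof -
  have m: "(\<lambda>(x, s). scen x s) \<in> M \<Otimes>\<^sub>M lborel \<rightarrow>\<^sub>M weak_star_borel" by measurable
  have "(\<integral>\<^sup>+m. f m \<partial>law) = (\<integral>\<^sup>+p. flow_density p * f (case p of (x, s) => scen x s) \<partial>(M \<Otimes>\<^sub>M lborel))"
    unfolding law_def by (subst nn_integral_distr) (simp_all add: nn_integral_density)
  also have "\<dots> = (\<integral>\<^sup>+p. (indicator {0..<r (fst p)} (snd p) * f (scen (fst p) (snd p))) / ennreal mean_roof \<partial>(M \<Otimes>\<^sub>M lborel))"
    by (intro nn_integral_cong) (auto simp: flow_density_def divide_ennreal_def mult_ac)
  also have "\<dots> = (\<integral>\<^sup>+p. (indicator {0..<r (fst p)} (snd p) * f (scen (fst p) (snd p))) \<partial>(M \<Otimes>\<^sub>M lborel)) / ennreal mean_roof"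
    by (rule nn_integral_divide) measurable
  also have "(\<integral>\<^sup>+p. (indicator {0..<r (fst p)} (snd p) * f (scen (fst p) (snd p))) \<partial>(M \<Otimes>\<^sub>M lborel)) =
    (\<integral>\<^sup>+x. \<integral>\<^sup>+s. indicator {0..<r x} s * f (scen x s) \<partial>lborel \<partial>M)"
    by (subst lborel.nn_integral_fst[symmetric]) simp_all
  finally show ?thesis .
qed

lemma prob_space_law: "prob_space law"
proof (rule prob_spaceI)
  have "emeasure law (space law) = (\<integral>\<^sup>+m. 1 \<partial>law)" by simp
  also have "\<dots> = (\<integral>\<^sup>+x. \<integral>\<^sup>+s. indicator {0..<r x} s \<partial>lborel \<partial>M) / ennreal mean_roof"
    by (subst nn_integral_law) simp_all
  also have "(\<integral>\<^sup>+x. \<integral>\<^sup>+s. indicator {0..<r x} s \<partial>lborel \<partial>M) = (\<integral>\<^sup>+x. ennreal (r x) \<partial>M)"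
    by (intro nn_integral_cong) (use r_bounds rmin_pos in \<open>force simp: emeasure_lborel_Ico\<close>)
  also have "\<dots> / ennreal mean_roof = 1"
    using mean_roof_pos by (simp add: nn_integral_r)
  finally show "emeasure law (space law) = 1" .
qed

lemma nn_integral_translate:
  fixes g :: "real => ennreal"
  assumes [measurable]: "g \<in> borel_measurable borel"
  shows "(\<integral>\<^sup>+s. indicator {a + c..<b + c} s * g s \<partial>lborel) = (\<integral>\<^sup>+s. indicator {a..<b} s * g (s + c) \<partial>lborel)"
  by (subst nn_integral_real_affine[where c=1 and t=c])
     (auto intro!: nn_integral_cong simp: indicator_def add.commute)

text \<open>Invariance of the flow. The integrals over \<open>[T, T + r x)\<close> and over \<open>[0, r x)\<close> differ by those over
  \<open>[0, T)\<close> and over \<open>[r x, T + r x)\<close>. The latter is the integral over \<open>[0, T)\<close> at \<open>F x\<close>, so both have the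
  same mean.\<close>

lemma nn_integral_shift_roof:
  assumes f [measurable]: "f \<in> borel_measurable weak_star_borel" and b: "\<And>m. f m \<le> 1" and T: "T \<ge> 0"
  shows "(\<integral>\<^sup>+x. \<integral>\<^sup>+s. indicator {T..<T + r x} s * f (scen x s) \<partial>lborel \<partial>M) =
    (\<integral>\<^sup>+x. \<integral>\<^sup>+s. indicator {0..<r x} s * f (scen x s) \<partial>lborel \<partial>M)"
proof -
  define I where "I x a b = (\<integral>\<^sup>+s. indicator {a..<b} s * f (scen x s) \<partial>lborel)" for x and a b :: real
  have [measurable]: "(\<lambda>x. I x (a x) (b x)) \<in> borel_measurable M"
    if [measurable]: "a \<in> borel_measurable M" "b \<in> borel_measurable M" for a b
    unfolding I_def by measurable
  have split: "I x a c = I x a b + I x b c" if x: "x \<in> space M" and "a \<le> b" "b \<le> c" for x a b c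
  proof -
    have [measurable]: "(\<lambda>s. f (scen x s)) \<in> borel_measurable lborel" using x by measurable
    have "I x a c = (\<integral>\<^sup>+s. indicator {a..<b} s * f (scen x s) + indicator {b..<c} s * f (scen x s) \<partial>lborel)"
      unfolding I_def using that by (intro nn_integral_cong) (auto simp: indicator_def)
    also have "\<dots> = I x a b + I x b c" unfolding I_def by (rule nn_integral_add) measurable
    finally show ?thesis .
  qed
  have fin: "(\<integral>\<^sup>+x. I x 0 T \<partial>M) \<noteq> \<infinity>"
  proof -
    have "I x 0 T \<le> (\<integral>\<^sup>+s. indicator {0..<T} s \<partial>lborel)" for x
      unfolding I_def by (intro nn_integral_mono) (use b in \<open>auto simp: indicator_def\<close>)
    then have "I x 0 T \<le> ennreal T" for x using T by simp
    then have "(\<integral>\<^sup>+x. I x 0 T \<partial>M) \<le> (\<integral>\<^sup>+x. ennreal T \<partial>M)" by (intro nn_integral_mono) auto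
    also have "\<dots> < \<infinity>" by (simp add: emeasure_space_1)
    finally show ?thesis by simp
  qed
  have rp: "0 \<le> r x" if "x \<in> space M" for x using r_bounds[OF that] rmin_pos by linarith
  have "AE x in M. I x (r x) (T + r x) = I (F x) 0 T"
    using scen_step AE_space
  proof eventually_elim
    case (elim x)
    have [measurable]: "(\<lambda>s. f (scen x s)) \<in> borel_measurable lborel" using elim by measurable
    have "I x (0 + r x) (T + r x) = (\<integral>\<^sup>+s. indicator {0..<T} s * f (scen x (s + r x)) \<partial>lborel)"
      unfolding I_def by (rule nn_integral_translate) simp
    also have "\<dots> = I (F x) 0 T"
      unfolding I_def using elim by (intro nn_integral_cong) (auto simp: indicator_def)
    finally show ?case by simp
  qed
  then have "(\<integral>\<^sup>+x. I x (r x) (T + r x) \<partial>M) = (\<integral>\<^sup>+x. I (F x) 0 T \<partial>M)"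
    by (rule nn_integral_cong_AE)
  also have "\<dots> = (\<integral>\<^sup>+x. I x 0 T \<partial>M)" by (rule nn_integral_comp) measurable
  finally have shift: "(\<integral>\<^sup>+x. I x (r x) (T + r x) \<partial>M) = (\<integral>\<^sup>+x. I x 0 T \<partial>M)" .
  have "(\<integral>\<^sup>+x. I x 0 T \<partial>M) + (\<integral>\<^sup>+x. I x T (T + r x) \<partial>M) = (\<integral>\<^sup>+x. I x 0 (T + r x) \<partial>M)"
    by (subst nn_integral_add[symmetric]) (auto intro!: nn_integral_cong split[symmetric] simp: T rp)
  also have "\<dots> = (\<integral>\<^sup>+x. I x 0 (r x) \<partial>M) + (\<integral>\<^sup>+x. I x (r x) (T + r x) \<partial>M)"
    by (subst nn_integral_add[symmetric]) (auto intro!: nn_integral_cong split simp: T rp)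
  also have "\<dots> = (\<integral>\<^sup>+x. I x 0 T \<partial>M) + (\<integral>\<^sup>+x. I x 0 (r x) \<partial>M)" by (simp add: shift add.commute)
  finally show ?thesis
    using fin unfolding ennreal_add_left_cancel by (auto simp: I_def)
qed

lemma emeasure_law_zoom:
  assumes A [measurable]: "A \<in> sets weak_star_borel" and t: "t \<ge> 0"
  shows "emeasure law {m \<in> pointed_measures. zoom t m \<in> A} = emeasure law A"
proof -
  let ?Z = "{m \<in> pointed_measures. zoom t m \<in> A}"
  have Z [measurable]: "?Z \<in> sets weak_star_borel" using A by (rule measurable_zoom_pointed)
  have "emeasure law ?Z = (\<integral>\<^sup>+m. indicator ?Z m \<partial>law)" by (simp add: sets_law)
  also have "\<dots> = (\<integral>\<^sup>+x. \<integral>\<^sup>+s. indicator {0..<r x} s * indicator ?Z (scen x s) \<partial>lborel \<partial>M) / ennreal mean_roof"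
    by (rule nn_integral_law) measurable
  also have "(\<integral>\<^sup>+x. \<integral>\<^sup>+s. indicator {0..<r x} s * indicator ?Z (scen x s) \<partial>lborel \<partial>M) =
     (\<integral>\<^sup>+x. \<integral>\<^sup>+s. indicator {t..<t + r x} s * indicator A (scen x s) \<partial>lborel \<partial>M)"
  proof (rule nn_integral_cong_AE)
    show "AE x in M. (\<integral>\<^sup>+s. indicator {0..<r x} s * indicator ?Z (scen x s) \<partial>lborel) =
       (\<integral>\<^sup>+s. indicator {t..<t + r x} s * indicator A (scen x s) \<partial>lborel)"
      using scen_pointed scen_zoom AE_space
    proof eventually_elim
      case (elim x)
      have [measurable]: "(\<lambda>s. indicator A (scen x s) :: ennreal) \<in> borel_measurable borel" using elim by measurable
      have "(\<integral>\<^sup>+s. indicator {0 + t..<r x + t} s * indicator A (scen x s) \<partial>lborel) =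
        (\<integral>\<^sup>+s. indicator {0..<r x} s * indicator A (scen x (s + t)) \<partial>lborel)"
        by (rule nn_integral_translate) simp
      also have "\<dots> = (\<integral>\<^sup>+s. indicator {0..<r x} s * indicator ?Z (scen x s) \<partial>lborel)"
        by (intro nn_integral_cong) (use elim t in \<open>auto simp: indicator_def\<close>)
      finally show ?case by (simp add: add.commute)
    qed
  qed
  also have "\<dots> = (\<integral>\<^sup>+x. \<integral>\<^sup>+s. indicator {0..<r x} s * indicator A (scen x s) \<partial>lborel \<partial>M)"
    by (rule nn_integral_shift_roof) (use t in \<open>auto simp: indicator_def\<close>)
  also have "\<dots> / ennreal mean_roof = (\<integral>\<^sup>+m. indicator A m \<partial>law)"
    by (rule nn_integral_law[symmetric]) measurable
  finally show ?thesis by (simp add: sets_law)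
qed

text \<open>By invariance a null set is also avoided at almost all times in \<open>[j * rmin, j * rmin + r x)\<close>, for each
  \<open>j\<close>, and these intervals cover the half-line.\<close>

lemma emeasure_law_eq_0_iff:
  assumes A [measurable]: "A \<in> sets weak_star_borel"
  shows "emeasure law A = 0 \<longleftrightarrow> (AE x in M. AE s in lborel. 0 \<le> s --> scen x s \<notin> A)"
proof -
  have law: "emeasure law A = (\<integral>\<^sup>+x. \<integral>\<^sup>+s. indicator {0..<r x} s * indicator A (scen x s) \<partial>lborel \<partial>M) / ennreal mean_roof"
    using nn_integral_law[of "indicator A"] by (simp add: sets_law)
  have top: "ennreal mean_roof \<noteq> top" by simp
  show ?thesis
  proof
    assume "emeasure law A = 0"
    then have "(\<integral>\<^sup>+x. \<integral>\<^sup>+s. indicator {0..<r x} s * indicator A (scen x s) \<partial>lborel \<partial>M) = 0"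
      using law by simp
    then have "(\<integral>\<^sup>+x. \<integral>\<^sup>+s. indicator {T..<T + r x} s * indicator A (scen x s) \<partial>lborel \<partial>M) = 0" if "T \<ge> 0" for T
      using nn_integral_shift_roof[of "indicator A" T] that by (simp add: indicator_def)
    then have "AE x in M. (\<integral>\<^sup>+s. indicator {T..<T + r x} s * indicator A (scen x s) \<partial>lborel) = 0" if "T \<ge> 0" for T
      using that by (subst (asm) nn_integral_0_iff_AE) (auto simp: zero_le)
    then have "AE x in M. \<forall>j::nat. (\<integral>\<^sup>+s. indicator {j * rmin..<j * rmin + r x} s * indicator A (scen x s) \<partial>lborel) = 0"
      using rmin_pos by (simp add: AE_all_countable)
    then show "AE x in M. AE s in lborel. 0 \<le> s --> scen x s \<notin> A"
      using AE_space
    proof eventually_elim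
      case (elim x)
      have [measurable]: "(\<lambda>s. scen x s) \<in> borel \<rightarrow>\<^sub>M weak_star_borel" using elim by measurable
      have "AE s in lborel. indicator {j * rmin..<j * rmin + r x} s * indicator A (scen x s) = (0::ennreal)" for j :: nat
        using elim(1)[rule_format, of j] by (subst (asm) nn_integral_0_iff_AE) auto
      then have "AE s in lborel. \<forall>j::nat. indicator {j * rmin..<j * rmin + r x} s * indicator A (scen x s) = (0::ennreal)"
        by (intro AE_all_countable[THEN iffD2] allI)
      then show ?case
      proof eventually_elim
        case (elim s)
        show ?case
        proof
          assume s: "0 \<le> s"
          define j where "j = nat \<lfloor>s / rmin\<rfloor>"
          have j: "real j \<le> s / rmin" "s / rmin < real j + 1"
            using s rmin_pos by (auto simp: j_def)
          have "real j * rmin \<le> s" "s < real j * rmin + rmin"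
            using j rmin_pos by (simp_all add: field_simps)
          then have "s \<in> {j * rmin..<j * rmin + r x}" using r_bounds[OF \<open>x \<in> space M\<close>] by auto
          then show "scen x s \<notin> A" using elim[rule_format, of j] by (auto simp: indicator_def split: if_splits)
        qed
      qed
    qed
  next
    assume "AE x in M. AE s in lborel. 0 \<le> s --> scen x s \<notin> A"
    then have "AE x in M. (\<integral>\<^sup>+s. indicator {0..<r x} s * indicator A (scen x s) \<partial>lborel) = 0"
      using AE_space
    proof eventually_elim
      case (elim x)
      have [measurable]: "(\<lambda>s. scen x s) \<in> borel \<rightarrow>\<^sub>M weak_star_borel" using elim by measurable
      show ?case
        using elim(1) by (subst nn_integral_0_iff_AE) (auto elim!: eventually_mono simp: indicator_def)
    qed
    then have "(\<integral>\<^sup>+x. \<integral>\<^sup>+s. indicator {0..<r x} s * indicator A (scen x s) \<partial>lborel \<partial>M) = 0"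
      by (subst nn_integral_0_iff_AE) auto
    then show "emeasure law A = 0" by (simp add: law)
  qed
qed

lemma AE_law_iff:
  assumes Q: "{m \<in> interval_measures. Q m} \<in> sets weak_star_borel"
  shows "(AE m in law. Q m) \<longleftrightarrow> (AE x in M. AE s in lborel. 0 \<le> s --> Q (scen x s))"
proof -
  have e: "interval_measures - {m \<in> interval_measures. Q m} = {m \<in> interval_measures. \<not> Q m}" by auto
  have N: "{m \<in> interval_measures. \<not> Q m} \<in> sets weak_star_borel"
    using sets.compl_sets[OF Q] by (simp add: e)
  have "(AE m in law. Q m) \<longleftrightarrow> emeasure law {m \<in> interval_measures. \<not> Q m} = 0"
    using N by (subst AE_iff_measurable[OF _ refl]) (simp_all add: sets_law)
  also have "\<dots> \<longleftrightarrow> (AE x in M. AE s in lborel. 0 \<le> s --> scen x s \<notin> {m \<in> interval_measures. \<not> Q m})"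
    by (rule emeasure_law_eq_0_iff[OF N])
  also have "\<dots> \<longleftrightarrow> (AE x in M. AE s in lborel. 0 \<le> s --> Q (scen x s))"
    by (intro AE_cong) (simp add: scen_interval)
  finally show ?thesis .
qed

lemma fd_distribution_law: "fd_distribution law"
proof -
  have "{m \<in> interval_measures. m \<in> pointed_measures} = pointed_measures" by (auto simp: pointed_measures_def)
  then have "AE m in law. m \<in> pointed_measures"
    using scen_pointed pointed_measures_sets by (subst AE_law_iff) (auto elim!: eventually_mono)
  then show ?thesis
    unfolding fd_distribution_def using prob_space_law emeasure_law_zoom by (simp add: sets_law)
qed

text \<open>An invariant set contains the whole scenery of \<open>x\<close> or avoids it. So it comes from an invariant subset
  of the base.\<close>

lemma ergodic_distribution_law: "ergodic_distribution law"
  unfolding ergodic_distribution_def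
proof (intro ballI impI)
  fix A assume "A \<in> sets law" and inv: "\<forall>t\<ge>0. {m \<in> pointed_measures. zoom t m \<in> A} = A \<inter> pointed_measures"
  then have A [measurable]: "A \<in> sets weak_star_borel" by (simp add: sets_law)
  define A' where "A' = {x \<in> space M. scen x 0 \<in> A}"
  have A' [measurable]: "A' \<in> sets M" unfolding A'_def by measurable
  have const: "AE x in M. \<forall>s\<ge>0. scen x s \<in> A \<longleftrightarrow> scen x 0 \<in> A"
    using scen_pointed scen_zoom
  proof eventually_elim
    case (elim x)
    show ?case
    proof (intro allI impI)
      fix s :: real assume s: "s \<ge> 0"
      have p: "scen x 0 \<in> pointed_measures" using elim(1) by simp
      have z: "zoom s (scen x 0) = scen x s" using elim(2) s by force
      have "scen x 0 \<in> {m \<in> pointed_measures. zoom s m \<in> A} \<longleftrightarrow> scen x 0 \<in> A \<inter> pointed_measures"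
        using inv s by simp
      then show "scen x s \<in> A \<longleftrightarrow> scen x 0 \<in> A" using p z by simp
    qed
  qed
  have "AE x in M. x \<in> A' \<longleftrightarrow> F x \<in> A'"
    using const scen_step AE_space
  proof eventually_elim
    case (elim x)
    have "scen (F x) 0 = scen x (r x)" using elim(2)[rule_format, of 0] by simp
    moreover have "0 \<le> r x" using r_bounds[OF elim(3)] rmin_pos by linarith
    ultimately have "scen (F x) 0 \<in> A \<longleftrightarrow> scen x 0 \<in> A" using elim(1)[rule_format, of "r x"] by simp
    then show ?case using elim(3) measurable_space[OF F_measurable elim(3)] unfolding A'_def by blast
  qed
  then consider "prob A' = 0" | "prob A' = 1" using F_ergodic[OF A'] by blast
  then show "emeasure law A = 0 \<or> emeasure law A = 1"
  proof cases
    case 1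
    then have "AE x in M. x \<notin> A'" using A' by (simp add: prob_eq_0)
    then have "AE x in M. AE s in lborel. 0 \<le> s --> scen x s \<notin> A"
      using const AE_space
    proof eventually_elim
      case (elim x)
      then have "scen x 0 \<notin> A" unfolding A'_def by blast
      with elim(2) show ?case by (intro AE_I2) blast
    qed
    then show ?thesis using emeasure_law_eq_0_iff[OF A] by blast
  next
    case 2
    then have "AE x in M. x \<in> A'" using A' by (simp add: prob_eq_1)
    then have "AE x in M. AE s in lborel. 0 \<le> s --> scen x s \<in> A"
      using const
    proof eventually_elim
      case (elim x)
      then have "scen x 0 \<in> A" unfolding A'_def by blast
      with elim(2) show ?case by (intro AE_I2) blast
    qed
    moreover have "{m \<in> interval_measures. m \<in> A} = A"
      using sets.sets_into_space[OF A] by auto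
    ultimately have "AE m in law. m \<in> A" using AE_law_iff[of "\<lambda>m. m \<in> A"] A by simp
    then show ?thesis
      using prob_space.emeasure_eq_1_AE[OF prob_space_law, of A] A by (simp add: sets_law)
  qed
qed

lemma integral_law:
  fixes f :: "real measure => real"
  assumes f [measurable]: "f \<in> borel_measurable weak_star_borel" and b: "\<And>m. m \<in> interval_measures ==> \<bar>f m\<bar> \<le> B"
  shows "(LINT m|law. f m) = (LINT x|M. (LBINT s:{0..<r x}. f (scen x s))) / mean_roof"
proof -
  interpret law: prob_space law by (rule prob_space_law)
  interpret pair_sigma_finite M lborel ..
  have fl: "integrable law f"
    by (rule law.integrable_const_bound[of _ B])
       (use f b in \<open>auto intro!: AE_I2 simp: sets_law cong: measurable_cong_sets\<close>)
  have dens: "flow_density = (\<lambda>p. ennreal (indicator {0..<r (fst p)} (snd p) / mean_roof))"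
    using mean_roof_pos by (auto simp: flow_density_def fun_eq_iff indicator_def divide_ennreal ennreal_1[symmetric] simp del: ennreal_1)
  have m: "(\<lambda>(x, s). scen x s) \<in> M \<Otimes>\<^sub>M lborel \<rightarrow>\<^sub>M weak_star_borel" by measurable
  have dm: "(\<lambda>p. indicator {0..<r (fst p)} (snd p) / mean_roof) \<in> borel_measurable (M \<Otimes>\<^sub>M lborel)"
  proof -
    have "(\<lambda>p. (if 0 \<le> snd p \<and> snd p < r (fst p) then 1 else 0) / mean_roof) \<in> borel_measurable (M \<Otimes>\<^sub>M lborel)"
      by measurable
    then show ?thesis by (rule measurable_cong[THEN iffD1, rotated]) (auto simp: indicator_def)
  qed
  have fm: "(\<lambda>p. f (case p of (x, s) => scen x s)) \<in> borel_measurable (M \<Otimes>\<^sub>M lborel)" using f m by (rule measurable_compose[rotated])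
  have "integrable (density (M \<Otimes>\<^sub>M lborel) flow_density) (\<lambda>p. f (case p of (x, s) => scen x s))"
    using fl m unfolding law_def by (subst (asm) integrable_distr_eq) auto
  then have i: "integrable (M \<Otimes>\<^sub>M lborel) (\<lambda>p. indicator {0..<r (fst p)} (snd p) / mean_roof * f (scen (fst p) (snd p)))"
    unfolding dens using mean_roof_pos dm fm
    by (subst (asm) integrable_density) (auto simp: case_prod_unfold)
  have inner: "(LBINT s. indicator {0..<r x} s / mean_roof * f (scen x s)) = (LBINT s:{0..<r x}. f (scen x s)) / mean_roof" for x
    unfolding set_lebesgue_integral_def integral_divide_zero[symmetric]
    by (intro Bochner_Integration.integral_cong refl) simp
  have "(LINT m|law. f m) = (LINT p|(M \<Otimes>\<^sub>M lborel). indicator {0..<r (fst p)} (snd p) / mean_roof * f (scen (fst p) (snd p)))"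
    unfolding law_def using m dm fm mean_roof_pos
    by (subst integral_distr) (auto simp: dens integral_density case_prod_unfold)
  also have "\<dots> = (LINT x|M. (LBINT s. indicator {0..<r x} s / mean_roof * f (scen x s)))"
    using integral_fst'[OF i] unfolding fst_conv snd_conv by (rule sym)
  also have "\<dots> = (LINT x|M. (LBINT s:{0..<r x}. f (scen x s)) / mean_roof)"
    by (simp only: inner)
  finally show ?thesis by simp
qed

text \<open>Up to the \<open>n\<close>-th return, the time integral is the Birkhoff sum of the integral over one roof interval,
  and the elapsed time is the Birkhoff sum of the roof.\<close>

lemma time_averages:
  fixes f :: "real measure => real"
  assumes f [measurable]: "f \<in> borel_measurable weak_star_borel" and b: "\<And>m. m \<in> interval_measures ==> \<bar>f m\<bar> \<le> B"
  shows "AE x in M. ((\<lambda>t. 1 / t * (LBINT s:{0..<t}. f (scen x s))) \<longlongrightarrow> (LINT m|law. f m)) at_top"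
proof -
  define h where "h x = (LBINT s:{0..<r x}. f (scen x s))" for x
  have rp: "0 \<le> r x" if "x \<in> space M" for x using r_bounds[OF that] rmin_pos by linarith
  have fs [measurable]: "(\<lambda>s. f (scen x s)) \<in> borel_measurable borel" if "x \<in> space M" for x using that by measurable
  have fb: "\<bar>f (scen x s)\<bar> \<le> B" if "x \<in> space M" for x s using b scen_interval[OF that] by blast
  have B0: "0 \<le> B" using not_empty fb abs_ge_zero order_trans by (metis ex_in_conv)
  have hm [measurable]: "h \<in> borel_measurable M"
  proof -
    have "(\<lambda>p. (if 0 \<le> snd p \<and> snd p < r (fst p) then 1 else 0) *\<^sub>R f (scen (fst p) (snd p))) \<in> borel_measurable (M \<Otimes>\<^sub>M lborel)"
      by measurable
    then have "(\<lambda>(x, s). indicator {0..<r x} s *\<^sub>R f (scen x s)) \<in> borel_measurable (M \<Otimes>\<^sub>M lborel)"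
      by (rule measurable_cong[THEN iffD1, rotated]) (auto simp: indicator_def)
    then show ?thesis unfolding h_def set_lebesgue_integral_def by (rule lborel.borel_measurable_lebesgue_integral)
  qed
  have hi: "integrable M h"
  proof (rule integrable_const_bound[of _ "B * rmax"])
    show "AE x in M. norm (h x) \<le> B * rmax"
    proof (rule AE_I2)
      fix x assume x: "x \<in> space M"
      have "\<bar>h x\<bar> \<le> B * (r x - 0)" unfolding h_def by (rule bounded_set_integral_le[OF fs[OF x] fb[OF x] rp[OF x]])
      also have "\<dots> \<le> B * rmax" using r_bounds[OF x] B0 by (intro mult_left_mono) auto
      finally show "norm (h x) \<le> B * rmax" by simp
    qed
  qed measurable
  have orbit: "x \<in> space M ==> (F ^^ k) x \<in> space M" for x k
    by (induction k) (auto intro: measurable_space[OF F_measurable])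
  have bsr: "birkhoff_sum r (Suc n) x = birkhoff_sum r n x + r ((F ^^ n) x)" for n x
    by (induction n arbitrary: x) (auto simp: funpow_swap1)
  have "AE x in M. \<forall>k. \<forall>s\<ge>0. scen ((F ^^ k) x) (s + r ((F ^^ k) x)) = scen (F ((F ^^ k) x)) s"
    by (rule AE_orbit[OF scen_step])
  then show ?thesis
    using birkhoff[OF r_integrable] birkhoff[OF hi] AE_space
  proof eventually_elim
    case (elim x)
    have rnn: "0 \<le> birkhoff_sum r n y" if "y \<in> space M" for n y
      using that by (induction n arbitrary: y) (auto intro!: add_nonneg_nonneg rp measurable_space[OF F_measurable])
    have "(LBINT s:{0..<birkhoff_sum r n ((F ^^ k) x)}. f (scen ((F ^^ k) x) s)) = birkhoff_sum h n ((F ^^ k) x)" for n k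
    proof (induction n arbitrary: k)
      case (Suc n)
      let ?y = "(F ^^ k) x"
      have y: "?y \<in> space M" "F ?y \<in> space M" using orbit[OF elim(4), of k] orbit[OF elim(4), of "Suc k"] by auto
      let ?b = "birkhoff_sum r n (F ?y)"
      have "(LBINT s:{0..<r ?y + ?b}. f (scen ?y s)) = h ?y + (LBINT s:{r ?y..<r ?y + ?b}. f (scen ?y s))"
        unfolding h_def by (rule bounded_set_integral_split[OF fs[OF y(1)] fb[OF y(1)] rp[OF y(1)]]) (simp add: rnn y)
      also have "(LBINT s:{r ?y..<r ?y + ?b}. f (scen ?y s)) = (LBINT s:{0..<?b}. f (scen ?y (s + r ?y)))"
        by (rule set_integral_translate)
      also have "\<dots> = (LBINT s:{0..<?b}. f (scen (F ?y) s))"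
        using elim(1)[rule_format, of _ k] by (intro set_lebesgue_integral_cong) auto
      also have "\<dots> = birkhoff_sum h n (F ?y)" using Suc[of "Suc k"] by simp
      finally show ?case by simp
    qed (simp add: set_lebesgue_integral_def)
    from this[of _ 0] have sums: "(LBINT s:{0..<birkhoff_sum r n x}. f (scen x s)) = birkhoff_sum h n x" for n by simp
    have "((\<lambda>t. 1 / t * (LBINT s:{0..<t}. f (scen x s))) \<longlongrightarrow> (LINT x|M. h x) / mean_roof) at_top"
    proof (rule time_average_of_return_average[where R="\<lambda>n. birkhoff_sum r n x" and C=rmax, OF fs[OF elim(4)] fb[OF elim(4)]])
      show "birkhoff_sum r n x \<le> birkhoff_sum r (Suc n) x" "birkhoff_sum r (Suc n) x \<le> birkhoff_sum r n x + rmax" for n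
        unfolding bsr using r_bounds[OF orbit[OF elim(4), of n]] rmin_pos by linarith+
      show "(\<lambda>n. birkhoff_sum r n x / n) \<longlonglongrightarrow> mean_roof" using elim(2) by (simp add: mean_roof_def)
      show "(\<lambda>n. (LBINT s:{0..<birkhoff_sum r n x}. f (scen x s)) / n) \<longlonglongrightarrow> (LINT x|M. h x)"
        using elim(3) by (simp add: sums)
    qed (simp_all add: mean_roof_pos)
    then show ?case using integral_law[OF f b] by (simp add: h_def)
  qed
qed

end

section \<open>Ergodicity of skew products over Bernoulli shifts\<close>

text \<open>The sets that can be approximated form a \<open>\<sigma>\<close>-algebra.\<close>

lemma approximation_by_algebra:
  assumes M: "finite_measure M" and A: "algebra \<Omega> \<A>" and sets: "sets M = sigma_sets \<Omega> \<A>"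
    and B: "B \<in> sets M" and e: "e > 0"
  shows "\<exists>A\<in>\<A>. measure M (sym_diff A B) < e"
proof -
  interpret finite_measure M by fact
  interpret A: algebra \<Omega> \<A> by fact
  have As [measurable]: "A \<in> sets M" if "A \<in> \<A>" for A using that sets by auto
  have sp: "space M = \<Omega>"
    using sets_eq_imp_space_eq[of M "sigma \<Omega> \<A>"] sets A.space_closed by simp
  have "\<forall>e>0. \<exists>A\<in>\<A>. measure M (sym_diff A B) < e"
    using B unfolding sets
  proof (induction rule: sigma_sets.induct)
    case (Basic a)
    then show ?case by (intro allI impI bexI[of _ a]) auto
  next
    case Empty
    then show ?case by (intro allI impI bexI[of _ "{}"]) auto
  next
    case (Compl a)
    show ?case
    proof (intro allI impI)
      fix e :: real assume "e > 0"
      then obtain A where A: "A \<in> \<A>" "measure M (sym_diff A a) < e" using Compl by blast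
      have a: "a \<subseteq> \<Omega>" using Compl(1) sets sp sets.sets_into_space by blast
      have "sym_diff (\<Omega> - A) (\<Omega> - a) = sym_diff A a" using A.sets_into_space[OF A(1)] a by blast
      then show "\<exists>A\<in>\<A>. measure M (sym_diff A (\<Omega> - a)) < e" using A by (intro bexI[of _ "\<Omega> - A"]) auto
    qed
  next
    case (Union a)
    show ?case
    proof (intro allI impI)
      fix e :: real assume e: "e > 0"
      have [measurable]: "a i \<in> sets M" for i using Union(1) sets by simp
      have "(\<lambda>n. measure M (\<Union>i<n. a i)) \<longlonglongrightarrow> measure M (\<Union>n. \<Union>i<n. a i)"
      proof (rule finite_Lim_measure_incseq)
        show "range (\<lambda>n. \<Union>i<n. a i) \<subseteq> sets M" by auto
        show "incseq (\<lambda>n. \<Union>i<n. a i)" unfolding incseq_def by (intro allI impI UN_mono) auto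
      qed
      moreover have "(\<Union>n. \<Union>i<n. a i) = (\<Union>i. a i)" by auto
      ultimately have "\<forall>\<^sub>F n in sequentially. measure M (\<Union>i<n. a i) > measure M (\<Union>i. a i) - e/2"
        using e by (intro order_tendstoD) auto
      then obtain n where n: "measure M (\<Union>i<n. a i) > measure M (\<Union>i. a i) - e/2"
        by (auto simp: eventually_sequentially)
      have "\<forall>i. \<exists>A\<in>\<A>. measure M (sym_diff A (a i)) < e / (2 * Suc n)"
        using Union(2) e by auto
      then obtain A where A: "\<And>i. A i \<in> \<A>" "\<And>i. measure M (sym_diff (A i) (a i)) < e / (2 * Suc n)" by metis
      have "measure M (sym_diff (\<Union>i<n. A i) (\<Union>i. a i)) \<le>
        measure M ((\<Union>i<n. sym_diff (A i) (a i)) \<union> ((\<Union>i. a i) - (\<Union>i<n. a i)))"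
        using A(1) by (intro finite_measure_mono) (auto intro!: sets.Un sets.finite_UN sets.Diff)
      also have "\<dots> \<le> measure M (\<Union>i<n. sym_diff (A i) (a i)) + measure M ((\<Union>i. a i) - (\<Union>i<n. a i))"
        using A(1) by (intro measure_Un_le) (auto intro!: sets.Un sets.finite_UN sets.Diff)
      also have "\<dots> \<le> (\<Sum>i<n. measure M (sym_diff (A i) (a i))) + (measure M (\<Union>i. a i) - measure M (\<Union>i<n. a i))"
      proof (rule add_mono)
        show "measure M (\<Union>i<n. sym_diff (A i) (a i)) \<le> (\<Sum>i<n. measure M (sym_diff (A i) (a i)))"
          using A(1) by (intro finite_measure_subadditive_finite) auto
        show "measure M ((\<Union>i. a i) - (\<Union>i<n. a i)) \<le> measure M (\<Union>i. a i) - measure M (\<Union>i<n. a i)"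
          by (subst finite_measure_Diff) auto
      qed
      also have "\<dots> < (\<Sum>i<n. e / (2 * Suc n)) + e/2 + 0"
      proof -
        have "(\<Sum>i<n. measure M (sym_diff (A i) (a i))) \<le> (\<Sum>i<n. e / (2 * Suc n))"
          using A(2) by (intro sum_mono less_imp_le)
        then show ?thesis using n by linarith
      qed
      also have "\<dots> \<le> e" using e by (simp add: field_simps)
      finally have "measure M (sym_diff (\<Union>i<n. A i) (\<Union>i. a i)) < e" .
      moreover have "(\<Union>i<n. A i) \<in> \<A>" using A(1) by (intro A.finite_UN) auto
      ultimately show "\<exists>A\<in>\<A>. measure M (sym_diff A (\<Union>i. a i)) < e" by blast
    qed
  qed
  then show ?thesis using e by blast
qed

lemma space_bernoulli_measure [simp]: "space (bernoulli_measure p) = UNIV"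
  by (simp add: bernoulli_measure_def space_PiM)

lemma prob_space_bernoulli_measure: "prob_space (bernoulli_measure p)"
  unfolding bernoulli_measure_def by (intro prob_space_PiM measure_pmf.prob_space_axioms)

lemma sequence_space_pmf: "sequence_space (measure_pmf p)"
  unfolding sequence_space_def product_prob_space_def product_prob_space_axioms_def product_sigma_finite_def
  by (auto intro: measure_pmf.prob_space_axioms measure_pmf.sigma_finite_measure_axioms)

lemma bernoulli_coordinate_measurable: "(\<lambda>a. a n) \<in> bernoulli_measure p \<rightarrow>\<^sub>M count_space UNIV"
proof -
  have "(\<lambda>a. a n) \<in> bernoulli_measure p \<rightarrow>\<^sub>M measure_pmf p"
    unfolding bernoulli_measure_def by (rule measurable_component_singleton) simp
  then show ?thesis by simp
qed

lemma bernoulli_measurableI: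
  assumes "\<And>n. (\<lambda>x. f x n) \<in> M \<rightarrow>\<^sub>M count_space UNIV"
  shows "f \<in> M \<rightarrow>\<^sub>M bernoulli_measure p"
  unfolding bernoulli_measure_def
  by (rule measurable_PiM_single') (use assms in auto)

lemma bernoulli_Suc_measurable [measurable]: "(\<lambda>a n. a (Suc n)) \<in> bernoulli_measure p \<rightarrow>\<^sub>M bernoulli_measure p"
  by (rule bernoulli_measurableI) (rule bernoulli_coordinate_measurable)

lemma bernoulli_case_nat_measurable [measurable]:
  "(\<lambda>(i, a). case_nat i a) \<in> measure_pmf p \<Otimes>\<^sub>M bernoulli_measure p \<rightarrow>\<^sub>M bernoulli_measure p"
  unfolding bernoulli_measure_def by measurable

lemma bernoulli_comb_seq_measurable [measurable]:
  "(\<lambda>(a, a'). comb_seq m a a') \<in> bernoulli_measure p \<Otimes>\<^sub>M bernoulli_measure p \<rightarrow>\<^sub>M bernoulli_measure p"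
  unfolding bernoulli_measure_def by (rule measurable_comb_seq)

lemma nn_integral_of_pair_image:
  assumes M: "M = distr (M1 \<Otimes>\<^sub>M M2) M h" and h [measurable]: "h \<in> M1 \<Otimes>\<^sub>M M2 \<rightarrow>\<^sub>M M"
    and "sigma_finite_measure M2" and f [measurable]: "f \<in> borel_measurable M"
  shows "(\<integral>\<^sup>+a. f a \<partial>M) = (\<integral>\<^sup>+x. \<integral>\<^sup>+y. f (h (x, y)) \<partial>M2 \<partial>M1)"
proof -
  interpret sigma_finite_measure M2 by fact
  have "(\<integral>\<^sup>+a. f a \<partial>M) = (\<integral>\<^sup>+a. f a \<partial>distr (M1 \<Otimes>\<^sub>M M2) M h)" using M by (rule arg_cong)
  also have "\<dots> = (\<integral>\<^sup>+x. f (h x) \<partial>(M1 \<Otimes>\<^sub>M M2))" by (rule nn_integral_distr[OF h]) (use f in simp)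
  also have "\<dots> = (\<integral>\<^sup>+x. \<integral>\<^sup>+y. f (h (x, y)) \<partial>M2 \<partial>M1)" by (rule nn_integral_fst[symmetric]) measurable
  finally show ?thesis .
qed

text \<open>The first letter is independent of the remaining ones, which again form a Bernoulli word.\<close>

lemma nn_integral_bernoulli_first:
  assumes f: "f \<in> borel_measurable (bernoulli_measure p)"
  shows "(\<integral>\<^sup>+a. f a \<partial>bernoulli_measure p) = (\<integral>\<^sup>+i. \<integral>\<^sup>+a. f (case_nat i a) \<partial>bernoulli_measure p \<partial>measure_pmf p)"
proof -
  interpret sequence_space "measure_pmf p" by (rule sequence_space_pmf)
  have "bernoulli_measure p = distr (measure_pmf p \<Otimes>\<^sub>M bernoulli_measure p) (bernoulli_measure p) (\<lambda>(i, a). case_nat i a)"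
    using PiM_iter by (simp add: bernoulli_measure_def)
  from nn_integral_of_pair_image[OF this bernoulli_case_nat_measurable prob_space_imp_sigma_finite[OF prob_space_bernoulli_measure] f]
  show ?thesis by simp
qed

lemma nn_integral_bernoulli_comb_seq:
  assumes f: "f \<in> borel_measurable (bernoulli_measure p)"
  shows "(\<integral>\<^sup>+a. f a \<partial>bernoulli_measure p) = (\<integral>\<^sup>+a. \<integral>\<^sup>+a'. f (comb_seq m a a') \<partial>bernoulli_measure p \<partial>bernoulli_measure p)"
proof -
  interpret sequence_space "measure_pmf p" by (rule sequence_space_pmf)
  have "bernoulli_measure p = distr (bernoulli_measure p \<Otimes>\<^sub>M bernoulli_measure p) (bernoulli_measure p) (\<lambda>(a, a'). comb_seq m a a')"
    using PiM_comb_seq[of m] by (simp add: bernoulli_measure_def)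
  from nn_integral_of_pair_image[OF this bernoulli_comb_seq_measurable prob_space_imp_sigma_finite[OF prob_space_bernoulli_measure] f]
  show ?thesis by simp
qed

lemma AE_bernoulli_first:
  assumes "Measurable.pred (bernoulli_measure p) Q"
  shows "(AE a in bernoulli_measure p. Q a) \<longleftrightarrow> (\<forall>i\<in>set_pmf p. AE a in bernoulli_measure p. Q (case_nat i a))"
proof -
  have m: "(\<lambda>a. indicator {a. \<not> R a} a :: ennreal) \<in> borel_measurable (bernoulli_measure p)"
    if R: "Measurable.pred (bernoulli_measure p) R" for R
  proof -
    have "{a. \<not> R a} = space (bernoulli_measure p) - {a \<in> space (bernoulli_measure p). R a}" by auto
    also have "\<dots> \<in> sets (bernoulli_measure p)" using R unfolding pred_def by (rule sets.compl_sets)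
    finally show ?thesis by (rule borel_measurable_indicator)
  qed
  have "(AE a in bernoulli_measure p. Q a) \<longleftrightarrow> (\<integral>\<^sup>+a. indicator {a. \<not> Q a} a \<partial>bernoulli_measure p) = 0"
    using nn_integral_0_iff_AE[OF m[OF assms]] by (simp add: indicator_eq_0_iff)
  also have "\<dots> \<longleftrightarrow> (\<integral>\<^sup>+i. \<integral>\<^sup>+a. indicator {a. \<not> Q a} (case_nat i a) \<partial>bernoulli_measure p \<partial>measure_pmf p) = 0"
    by (subst nn_integral_bernoulli_first[OF m[OF assms]]) (rule refl)
  also have "\<dots> \<longleftrightarrow> (\<forall>i\<in>set_pmf p. (\<integral>\<^sup>+a. indicator {a. \<not> Q a} (case_nat i a) \<partial>bernoulli_measure p) = 0)"
    by (subst nn_integral_0_iff_AE) (simp_all add: AE_measure_pmf_iff)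
  also have "\<dots> \<longleftrightarrow> (\<forall>i\<in>set_pmf p. AE a in bernoulli_measure p. Q (case_nat i a))"
  proof (intro ball_cong refl)
    fix i
    have "(\<lambda>a. case_nat i a) \<in> bernoulli_measure p \<rightarrow>\<^sub>M bernoulli_measure p"
    proof (rule bernoulli_measurableI)
      fix n show "(\<lambda>a. case_nat i a n) \<in> bernoulli_measure p \<rightarrow>\<^sub>M count_space UNIV"
        by (cases n) (simp_all add: bernoulli_coordinate_measurable)
    qed
    then have m': "Measurable.pred (bernoulli_measure p) (\<lambda>a. Q (case_nat i a))"
      using assms by (rule measurable_compose)
    have e: "indicator {a. \<not> Q a} (case_nat i a) = (indicator {a. \<not> Q (case_nat i a)} a :: ennreal)" for a
      by (simp add: indicator_def)
    show "(\<integral>\<^sup>+a. indicator {a. \<not> Q a} (case_nat i a) \<partial>bernoulli_measure p) = 0 \<longleftrightarrow>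
      (AE a in bernoulli_measure p. Q (case_nat i a))"
      unfolding e using nn_integral_0_iff_AE[OF m[OF m']] by (simp add: indicator_eq_0_iff)
  qed
  finally show ?thesis .
qed

lemma AE_bernoulli_letters: "AE a in bernoulli_measure p. \<forall>n. a n \<in> set_pmf p"
proof -
  have "AE a in bernoulli_measure p. a n \<in> set_pmf p" for n
    unfolding bernoulli_measure_def
    by (rule AE_PiM_component) (auto intro: measure_pmf.prob_space_axioms simp: AE_measure_pmf_iff)
  then show ?thesis by (simp add: AE_all_countable)
qed

locale random_maps = Th: prob_space Th for Th :: "'t measure" +
  fixes p :: "'k::finite pmf" and \<Phi> :: "'k => 't => 't"
  assumes \<Phi>_measurable [measurable]: "\<And>i. \<Phi> i \<in> Th \<rightarrow>\<^sub>M Th"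
    and stationary: "\<And>B. B \<in> sets Th ==> emeasure Th B = (\<integral>\<^sup>+i. emeasure Th (\<Phi> i -` B \<inter> space Th) \<partial>measure_pmf p)"
begin

abbreviation "\<B> \<equiv> bernoulli_measure p"

abbreviation "BTh \<equiv> \<B> \<Otimes>\<^sub>M Th"

sublocale \<B>: prob_space \<B> by (rule prob_space_bernoulli_measure)

sublocale BT: pair_prob_space \<B> Th ..

definition skew :: "(nat => 'k) \<times> 't => (nat => 'k) \<times> 't" where
  "skew = (\<lambda>(a, \<tau>). (\<lambda>n. a (Suc n), \<Phi> (a 0) \<tau>))"

primrec random_orbit :: "nat => (nat => 'k) => 't => 't" where
  "random_orbit 0 a \<tau> = \<tau>"
| "random_orbit (Suc n) a \<tau> = \<Phi> (a n) (random_orbit n a \<tau>)"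

lemma \<Phi>_case_measurable:
  assumes "f \<in> N \<rightarrow>\<^sub>M count_space UNIV" "g \<in> N \<rightarrow>\<^sub>M Th"
  shows "(\<lambda>x. \<Phi> (f x) (g x)) \<in> N \<rightarrow>\<^sub>M Th"
  using measurable_compose_countable[where f="\<lambda>i x. \<Phi> i (g x)" and g=f,
    OF measurable_compose[OF assms(2) \<Phi>_measurable] assms(1)] .

lemma skew_measurable [measurable]: "skew \<in> BTh \<rightarrow>\<^sub>M BTh"
  unfolding skew_def case_prod_unfold
proof (intro measurable_Pair \<Phi>_case_measurable)
  show "(\<lambda>x n. fst x (Suc n)) \<in> BTh \<rightarrow>\<^sub>M \<B>"
    using measurable_compose[OF measurable_fst bernoulli_Suc_measurable] .
  show "(\<lambda>x. fst x 0) \<in> BTh \<rightarrow>\<^sub>M count_space UNIV"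
    using measurable_compose[OF measurable_fst bernoulli_coordinate_measurable] .
qed (rule measurable_snd)

lemma random_orbit_measurable [measurable]:
  "(\<lambda>x. random_orbit n (fst x) (snd x)) \<in> BTh \<rightarrow>\<^sub>M Th"
proof (induction n)
  case (Suc n)
  have "(\<lambda>x. fst x n) \<in> BTh \<rightarrow>\<^sub>M count_space UNIV"
    using measurable_compose[OF measurable_fst bernoulli_coordinate_measurable] .
  then show ?case using Suc unfolding random_orbit.simps by (rule \<Phi>_case_measurable)
qed simp

lemma skew_funpow: "(skew ^^ n) (a, \<tau>) = (\<lambda>j. a (j + n), random_orbit n a \<tau>)"
  by (induction n) (auto simp: skew_def)

lemma random_orbit_cong: "(\<And>i. i < n ==> a i = a' i) ==> random_orbit n a \<tau> = random_orbit n a' \<tau>"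
  by (induction n) auto

lemma AE_\<Phi>:
  assumes "AE \<tau> in Th. Q \<tau>" "i \<in> set_pmf p" shows "AE \<tau> in Th. Q (\<Phi> i \<tau>)"
proof -
  obtain N where N: "N \<in> null_sets Th" "{\<tau> \<in> space Th. \<not> Q \<tau>} \<subseteq> N" using assms(1) by (auto simp: eventually_ae_filter)
  have Ns [measurable]: "N \<in> sets Th" using N by auto
  have "(\<integral>\<^sup>+i. emeasure Th (\<Phi> i -` N \<inter> space Th) \<partial>measure_pmf p) = 0"
    using stationary[OF Ns] N(1) by (simp add: null_setsD1)
  then have "emeasure Th (\<Phi> i -` N \<inter> space Th) = 0"
    using assms(2) nn_integral_0_iff_AE[of "\<lambda>i. emeasure Th (\<Phi> i -` N \<inter> space Th)" "measure_pmf p"]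
    by (simp add: AE_measure_pmf_iff)
  moreover have "\<Phi> i -` N \<inter> space Th \<in> sets Th" using \<Phi>_measurable Ns by (rule measurable_sets)
  ultimately have "\<Phi> i -` N \<inter> space Th \<in> null_sets Th" by (simp add: null_sets_def)
  then show ?thesis
  proof (rule AE_I')
    show "{\<tau> \<in> space Th. \<not> Q (\<Phi> i \<tau>)} \<subseteq> \<Phi> i -` N \<inter> space Th"
      using N(2) measurable_space[OF \<Phi>_measurable] by blast
  qed
qed

lemma skew_preserving: "distr BTh BTh skew = BTh"
proof (rule pair_measure_eqI[symmetric])
  fix A B assume A [measurable]: "A \<in> sets \<B>" and B [measurable]: "B \<in> sets Th"
  have "emeasure (distr BTh BTh skew) (A \<times> B) =
    (\<integral>\<^sup>+x. indicator (A \<times> B) (skew x) \<partial>BTh)"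
    by (simp add: nn_integral_distr flip: nn_integral_indicator)
  also have "\<dots> = (\<integral>\<^sup>+a. \<integral>\<^sup>+\<tau>. indicator (A \<times> B) (skew (a, \<tau>)) \<partial>Th \<partial>\<B>)"
    by (rule Th.nn_integral_fst[symmetric]) measurable
  also have "\<dots> = (\<integral>\<^sup>+i. \<integral>\<^sup>+a. \<integral>\<^sup>+\<tau>. indicator (A \<times> B) (skew (case_nat i a, \<tau>)) \<partial>Th \<partial>\<B> \<partial>measure_pmf p)"
    by (rule nn_integral_bernoulli_first) measurable
  also have "\<dots> = (\<integral>\<^sup>+i. \<integral>\<^sup>+a. indicator A a * emeasure Th (\<Phi> i -` B \<inter> space Th) \<partial>\<B> \<partial>measure_pmf p)"
  proof (intro nn_integral_cong)
    fix i a
    have "(\<integral>\<^sup>+\<tau>. indicator (A \<times> B) (skew (case_nat i a, \<tau>)) \<partial>Th) =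
      (\<integral>\<^sup>+\<tau>. indicator A a * indicator (\<Phi> i -` B \<inter> space Th) \<tau> \<partial>Th)"
      by (intro nn_integral_cong) (auto simp: skew_def indicator_def)
    also have "\<dots> = indicator A a * emeasure Th (\<Phi> i -` B \<inter> space Th)"
      by (subst nn_integral_cmult) auto
    finally show "(\<integral>\<^sup>+\<tau>. indicator (A \<times> B) (skew (case_nat i a, \<tau>)) \<partial>Th) = indicator A a * emeasure Th (\<Phi> i -` B \<inter> space Th)" .
  qed
  also have "\<dots> = (\<integral>\<^sup>+i. emeasure \<B> A * emeasure Th (\<Phi> i -` B \<inter> space Th) \<partial>measure_pmf p)"
    by (intro nn_integral_cong) (simp add: nn_integral_multc)
  also have "\<dots> = emeasure \<B> A * emeasure Th B"
    by (simp add: nn_integral_cmult stationary[OF B])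
  finally show "emeasure \<B> A * emeasure Th B = emeasure (distr BTh BTh skew) (A \<times> B)" by simp
qed (auto intro: Th.sigma_finite_measure_axioms \<B>.sigma_finite_measure_axioms)

lemma skew_funpow_preserving: "distr BTh BTh (skew ^^ n) = BTh"
proof (induction n)
  case 0 show ?case by (simp add: distr_id id_def)
next
  case (Suc n)
  have [measurable]: "skew ^^ n \<in> BTh \<rightarrow>\<^sub>M BTh"
    by (induction n) (auto simp: o_def intro: measurable_compose[OF _ skew_measurable])
  have "distr BTh BTh (skew ^^ Suc n) = distr (distr BTh BTh (skew ^^ n)) BTh skew"
    by (subst distr_distr) (simp_all add: o_def)
  then show ?case by (simp only: Suc skew_preserving)
qed

lemma nn_integral_random_orbit:
  assumes g [measurable]: "g \<in> borel_measurable Th"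
  shows "(\<integral>\<^sup>+x. g (random_orbit n (fst x) (snd x)) \<partial>BTh) = (\<integral>\<^sup>+\<tau>. g \<tau> \<partial>Th)"
proof -
  have m [measurable]: "skew ^^ n \<in> BTh \<rightarrow>\<^sub>M BTh"
    by (induction n) (auto simp: o_def intro: measurable_compose[OF _ skew_measurable])
  have "(\<integral>\<^sup>+x. g (random_orbit n (fst x) (snd x)) \<partial>BTh) = (\<integral>\<^sup>+x. g (snd ((skew ^^ n) x)) \<partial>BTh)"
    by (intro nn_integral_cong) (auto simp: skew_funpow case_prod_unfold)
  also have "\<dots> = (\<integral>\<^sup>+x. g (snd x) \<partial>distr BTh BTh (skew ^^ n))"
    by (rule nn_integral_distr[symmetric]) measurable
  also have "\<dots> = (\<integral>\<^sup>+x. g (snd x) \<partial>BTh)" by (simp only: skew_funpow_preserving)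
  also have "\<dots> = (\<integral>\<^sup>+a. \<integral>\<^sup>+\<tau>. g \<tau> \<partial>Th \<partial>\<B>)" by (subst Th.nn_integral_fst[symmetric]) simp_all
  also have "\<dots> = (\<integral>\<^sup>+\<tau>. g \<tau> \<partial>Th)" using \<B>.emeasure_space_1 by simp
  finally show ?thesis .
qed

definition cylinder_sets :: "((nat => 'k) \<times> 't) set set" where
  "cylinder_sets = {A \<in> sets BTh. \<exists>m. \<forall>a a' \<tau>. (\<forall>i<m. a i = a' i) --> (a, \<tau>) \<in> A \<longleftrightarrow> (a', \<tau>) \<in> A}"

lemma algebra_cylinder_sets: "algebra (space BTh) cylinder_sets"
  unfolding algebra_iff_Un
proof (intro conjI ballI)
  show "cylinder_sets \<subseteq> Pow (space BTh)"
    unfolding cylinder_sets_def using sets.sets_into_space by blast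
  show "{} \<in> cylinder_sets" by (simp add: cylinder_sets_def)
  fix A assume A: "A \<in> cylinder_sets"
  show "space BTh - A \<in> cylinder_sets"
  proof -
    obtain m where "\<And>a a' \<tau>. (\<forall>i<m. a i = a' i) ==> (a, \<tau>) \<in> A \<longleftrightarrow> (a', \<tau>) \<in> A"
      using A unfolding cylinder_sets_def by blast
    then have "\<forall>a a' \<tau>. (\<forall>i<m. a i = a' i) -->
      (a, \<tau>) \<in> space BTh - A \<longleftrightarrow> (a', \<tau>) \<in> space BTh - A"
      unfolding Diff_iff space_pair_measure mem_Sigma_iff space_bernoulli_measure by blast
    moreover have "space BTh - A \<in> sets BTh"
      using A unfolding cylinder_sets_def by blast
    ultimately show ?thesis unfolding cylinder_sets_def by blast
  qed
  fix B assume B: "B \<in> cylinder_sets"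
  obtain m n where "\<And>a a' \<tau>. (\<forall>i<m. a i = a' i) ==> (a, \<tau>) \<in> A \<longleftrightarrow> (a', \<tau>) \<in> A"
    "\<And>a a' \<tau>. (\<forall>i<n. a i = a' i) ==> (a, \<tau>) \<in> B \<longleftrightarrow> (a', \<tau>) \<in> B"
    using A B unfolding cylinder_sets_def by blast
  then have "\<forall>a a' \<tau>. (\<forall>i<max m n. a i = a' i) --> (a, \<tau>) \<in> A \<union> B \<longleftrightarrow> (a', \<tau>) \<in> A \<union> B"
    unfolding Un_iff less_max_iff_disj by blast
  then show "A \<union> B \<in> cylinder_sets"
    using A B unfolding cylinder_sets_def by blast
qed

lemma sets_cylinder_sets: "sets BTh = sigma_sets (space BTh) cylinder_sets"
proof
  show "sigma_sets (space BTh) cylinder_sets \<subseteq> sets BTh"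
    by (rule sets.sigma_sets_subset) (auto simp: cylinder_sets_def)
  interpret A: algebra "space BTh" cylinder_sets by (rule algebra_cylinder_sets)
  let ?N = "sigma (space BTh) cylinder_sets"
  have sN: "sets ?N = sigma_sets (space BTh) cylinder_sets" "space ?N = space BTh"
    using A.space_closed by simp_all
  have "(\<lambda>x. x) \<in> ?N \<rightarrow>\<^sub>M BTh"
  proof (rule measurable_pair)
    have "(\<lambda>x. fst x n) \<in> ?N \<rightarrow>\<^sub>M count_space UNIV" for n
    proof (rule measurableI)
      fix K :: "'k set"
      have "(\<lambda>x. fst x n) -` K \<inter> space BTh \<in> sets BTh"
        by (rule measurable_sets[OF measurable_compose[OF measurable_fst bernoulli_coordinate_measurable]]) simp
      then have "(\<lambda>x. fst x n) -` K \<inter> space BTh \<in> cylinder_sets"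
        unfolding cylinder_sets_def by (auto simp: space_pair_measure intro!: exI[of _ "Suc n"])
      then show "(\<lambda>x. fst x n) -` K \<inter> space ?N \<in> sets ?N" unfolding sN by auto
    qed simp
    then have "(\<lambda>x n. fst x n) \<in> ?N \<rightarrow>\<^sub>M \<B>" by (rule bernoulli_measurableI)
    then show "fst \<circ> (\<lambda>x. x) \<in> ?N \<rightarrow>\<^sub>M \<B>" by (simp add: o_def)
    show "snd \<circ> (\<lambda>x. x) \<in> ?N \<rightarrow>\<^sub>M Th"
    proof (rule measurableI)
      fix C assume C: "C \<in> sets Th"
      have "snd -` C \<inter> space BTh \<in> sets BTh"
        using C by (rule measurable_sets[OF measurable_snd])
      then have "snd -` C \<inter> space BTh \<in> cylinder_sets"
        unfolding cylinder_sets_def by (auto simp: space_pair_measure)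
      then show "(snd \<circ> (\<lambda>x. x)) -` C \<inter> space ?N \<in> sets ?N" unfolding sN by (auto simp: o_def)
    next
      fix x assume "x \<in> space ?N"
      then have "x \<in> space BTh" by (simp only: sN(2))
      then show "(snd \<circ> (\<lambda>x. x)) x \<in> space Th" by (auto simp: space_pair_measure)
    qed
  qed
  then show "sets BTh \<subseteq> sigma_sets (space BTh) cylinder_sets"
  proof (intro subsetI)
    fix X assume m: "(\<lambda>x. x) \<in> ?N \<rightarrow>\<^sub>M BTh" and X: "X \<in> sets BTh"
    have "(\<lambda>x. x) -` X \<inter> space ?N \<in> sets ?N" using m X by (rule measurable_sets)
    moreover have "(\<lambda>x. x) -` X \<inter> space ?N = X" using sets.sets_into_space[OF X] sN by auto
    ultimately show "X \<in> sigma_sets (space BTh) cylinder_sets" using sN by simp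
  qed
qed

text \<open>Approximate an invariant set \<open>B\<close> by a set \<open>A\<close> that depends only on the first \<open>m\<close> letters. After \<open>m\<close>
  steps of the skew product these letters have been used up and the remaining word is independent of
  them, while membership in \<open>B\<close> has not changed. Hence membership in \<open>B\<close> hardly depends on the word.\<close>

lemma invariant_sections_trivial:
  assumes B [measurable]: "B \<in> sets BTh" and inv: "AE x in BTh. x \<in> B \<longleftrightarrow> skew x \<in> B"
  shows "AE \<tau> in Th. (AE a in \<B>. (a, \<tau>) \<in> B) \<or> (AE a in \<B>. (a, \<tau>) \<notin> B)"
proof -
  have invn: "AE x in BTh. x \<in> B \<longleftrightarrow> (skew ^^ m) x \<in> B" for m
  proof (induction m)
    case (Suc m)
    have [measurable]: "skew ^^ m \<in> BTh \<rightarrow>\<^sub>M BTh"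
      by (induction m) (auto simp: o_def intro: measurable_compose[OF _ skew_measurable])
    have "AE x in BTh. (skew ^^ m) x \<in> B \<longleftrightarrow> skew ((skew ^^ m) x) \<in> B"
    proof (rule AE_distrD[where M'="BTh"])
      show "AE x in distr BTh BTh (skew ^^ m). x \<in> B \<longleftrightarrow> skew x \<in> B"
        using inv by (simp only: skew_funpow_preserving)
    qed measurable
    with Suc show ?case by eventually_elim simp
  qed simp
  \<comment> \<open>The probability that two independent words disagree about the section of \<open>B\<close> at \<open>\<tau>\<close>.\<close>
  define g :: "'t => ennreal" where "g \<tau> = (\<integral>\<^sup>+a'. \<integral>\<^sup>+a''. (if ((a', \<tau>) \<in> B) \<noteq> ((a'', \<tau>) \<in> B) then 1 else 0) \<partial>\<B> \<partial>\<B>)" for \<tau>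
  have [measurable]: "g \<in> borel_measurable Th" unfolding g_def by measurable
  have small: "(\<integral>\<^sup>+\<tau>. g \<tau> \<partial>Th) \<le> ennreal (2 * e)" if e: "e > 0" for e
  proof -
    obtain A where A: "A \<in> cylinder_sets" "measure BTh (sym_diff A B) < e"
      using approximation_by_algebra[OF BT.finite_measure_axioms algebra_cylinder_sets sets_cylinder_sets B e] by blast
    have Am [measurable]: "A \<in> sets BTh" using A(1) by (simp add: cylinder_sets_def)
    obtain m where m: "\<And>a a' \<tau>. (\<And>i. i < m ==> a i = a' i) ==> (a, \<tau>) \<in> A \<longleftrightarrow> (a', \<tau>) \<in> A"
      using A(1) unfolding cylinder_sets_def by blast
    have [measurable]: "skew ^^ m \<in> BTh \<rightarrow>\<^sub>M BTh"
      by (induction m) (auto simp: o_def intro: measurable_compose[OF _ skew_measurable])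
    \<comment> \<open>Disagreement between \<open>A\<close> and the preimage of \<open>B\<close> under \<open>m\<close> steps, for a word that is split
      after \<open>m\<close> letters into its beginning, which \<open>x\<close> contains, and the rest \<open>a'\<close>.\<close>
    define D :: "(nat => 'k) \<times> 't => (nat => 'k) => ennreal"
      where "D x a' = (if (x \<in> A) \<noteq> ((a', random_orbit m (fst x) (snd x)) \<in> B) then 1 else 0)" for x a'
    have D [measurable]: "(\<lambda>(x, a'). D x a') \<in> borel_measurable (BTh \<Otimes>\<^sub>M \<B>)"
      unfolding D_def by measurable
    have Dx [measurable]: "D x \<in> borel_measurable \<B>" if "x \<in> space BTh" for x
      using measurable_compose[OF measurable_Pair1'[OF that] D] by simp
    define f :: "(nat => 'k) \<times> 't => ennreal"
      where "f y = (if (y \<in> A) \<noteq> ((skew ^^ m) y \<in> B) then 1 else 0)" for y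
    have [measurable]: "f \<in> borel_measurable BTh" unfolding f_def by measurable
    have fD: "f (comb_seq m a a', \<tau>) = D (a, \<tau>) a'" for a a' \<tau>
    proof -
      have "(\<lambda>j. comb_seq m a a' (j + m)) = a'" by (simp add: comb_seq_add)
      moreover have "random_orbit m (comb_seq m a a') \<tau> = random_orbit m a \<tau>"
        by (rule random_orbit_cong) (simp add: comb_seq_less)
      moreover have "(comb_seq m a a', \<tau>) \<in> A \<longleftrightarrow> (a, \<tau>) \<in> A" by (rule m) (simp add: comb_seq_less)
      ultimately show ?thesis by (simp add: f_def D_def skew_funpow)
    qed
    have "(\<integral>\<^sup>+x. \<integral>\<^sup>+a'. D x a' \<partial>\<B> \<partial>BTh) = (\<integral>\<^sup>+\<tau>. \<integral>\<^sup>+a. \<integral>\<^sup>+a'. D (a, \<tau>) a' \<partial>\<B> \<partial>\<B> \<partial>Th)"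
      by (rule BT.nn_integral_snd[symmetric]) measurable
    also have "\<dots> = (\<integral>\<^sup>+\<tau>. \<integral>\<^sup>+a. f (a, \<tau>) \<partial>\<B> \<partial>Th)"
    proof (rule nn_integral_cong)
      fix \<tau> assume "\<tau> \<in> space Th"
      then have "(\<lambda>a. f (a, \<tau>)) \<in> borel_measurable \<B>" by measurable
      from nn_integral_bernoulli_comb_seq[OF this, of m]
      show "(\<integral>\<^sup>+a. \<integral>\<^sup>+a'. D (a, \<tau>) a' \<partial>\<B> \<partial>\<B>) = (\<integral>\<^sup>+a. f (a, \<tau>) \<partial>\<B>)" by (simp only: fD)
    qed
    also have "\<dots> = (\<integral>\<^sup>+y. f y \<partial>BTh)" by (rule BT.nn_integral_snd) measurable
    also have "\<dots> = (\<integral>\<^sup>+y. indicator (sym_diff A B) y \<partial>BTh)"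
    proof (rule nn_integral_cong_AE)
      show "AE y in BTh. f y = indicator (sym_diff A B) y"
        using invn[of m] by eventually_elim (auto simp: f_def indicator_def)
    qed
    also have "\<dots> = emeasure BTh (sym_diff A B)" by (rule nn_integral_indicator) measurable
    also have "\<dots> \<le> ennreal e" using A(2) by (simp add: BT.P.emeasure_eq_measure ennreal_leI)
    finally have De: "(\<integral>\<^sup>+x. \<integral>\<^sup>+a'. D x a' \<partial>\<B> \<partial>BTh) \<le> ennreal e" .
    have "(\<integral>\<^sup>+\<tau>. g \<tau> \<partial>Th) = (\<integral>\<^sup>+x. g (random_orbit m (fst x) (snd x)) \<partial>BTh)"
      by (rule nn_integral_random_orbit[symmetric]) measurable
    also have "\<dots> \<le> (\<integral>\<^sup>+x. 2 * (\<integral>\<^sup>+a'. D x a' \<partial>\<B>) \<partial>BTh)"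
    proof (rule nn_integral_mono)
      fix x assume x: "x \<in> space BTh"
      note Dx[OF x, measurable]
      have "g (random_orbit m (fst x) (snd x)) \<le> (\<integral>\<^sup>+a'. \<integral>\<^sup>+a''. D x a' + D x a'' \<partial>\<B> \<partial>\<B>)"
        unfolding g_def by (intro nn_integral_mono) (auto simp: D_def)
      also have "\<dots> = 2 * (\<integral>\<^sup>+a'. D x a' \<partial>\<B>)"
        using \<B>.emeasure_space_1 by (simp add: nn_integral_add mult_2)
      finally show "g (random_orbit m (fst x) (snd x)) \<le> 2 * (\<integral>\<^sup>+a'. D x a' \<partial>\<B>)" .
    qed
    also have "\<dots> = 2 * (\<integral>\<^sup>+x. \<integral>\<^sup>+a'. D x a' \<partial>\<B> \<partial>BTh)" by (rule nn_integral_cmult) measurable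
    also have "\<dots> \<le> 2 * ennreal e" using De by (rule mult_left_mono) simp
    also have "\<dots> = ennreal (2 * e)" using e by (simp add: ennreal_mult)
    finally show ?thesis .
  qed
  have "(\<integral>\<^sup>+\<tau>. g \<tau> \<partial>Th) = 0"
  proof (rule ccontr)
    assume n: "(\<integral>\<^sup>+\<tau>. g \<tau> \<partial>Th) \<noteq> 0"
    have "(\<integral>\<^sup>+\<tau>. g \<tau> \<partial>Th) \<le> ennreal 2" using small[of 1] by simp
    then obtain c where c: "(\<integral>\<^sup>+\<tau>. g \<tau> \<partial>Th) = ennreal c" "c \<ge> 0"
      by (metis ennreal_cases ennreal_less_top linorder_not_le order_le_less_trans top.extremum_strict)
    then have "c > 0" using n by (cases "c = 0") auto
    then show False using small[of "c / 4"] c by (simp add: ennreal_le_iff)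
  qed
  then have "AE \<tau> in Th. g \<tau> = 0" by (subst (asm) nn_integral_0_iff_AE) auto
  then show ?thesis
    using AE_space
  proof eventually_elim
    case (elim \<tau>)
    have [measurable]: "(\<lambda>a. (a, \<tau>)) \<in> \<B> \<rightarrow>\<^sub>M BTh" using elim(2) by simp
    have "AE a' in \<B>. (\<integral>\<^sup>+a''. (if ((a', \<tau>) \<in> B) \<noteq> ((a'', \<tau>) \<in> B) then 1 else (0::ennreal)) \<partial>\<B>) = 0"
      using elim(1) unfolding g_def by (subst (asm) nn_integral_0_iff_AE) measurable
    then have ae: "AE a' in \<B>. AE a'' in \<B>. ((a', \<tau>) \<in> B) = ((a'', \<tau>) \<in> B)"
    proof eventually_elim
      case (elim a')
      have "AE a'' in \<B>. (if ((a', \<tau>) \<in> B) \<noteq> ((a'', \<tau>) \<in> B) then 1 else (0::ennreal)) = 0"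
        using elim by (subst (asm) nn_integral_0_iff_AE) measurable
      then show ?case by eventually_elim (auto split: if_splits)
    qed
    show ?case
    proof (rule disjCI)
      assume nt: "\<not> (AE a in \<B>. (a, \<tau>) \<notin> B)"
      have "\<exists>a'. (a', \<tau>) \<in> B \<and> (AE a'' in \<B>. ((a', \<tau>) \<in> B) = ((a'', \<tau>) \<in> B))"
      proof (rule ccontr)
        assume "\<nexists>a'. (a', \<tau>) \<in> B \<and> (AE a'' in \<B>. ((a', \<tau>) \<in> B) = ((a'', \<tau>) \<in> B))"
        then have "AE a in \<B>. (a, \<tau>) \<notin> B" using ae by (auto elim!: eventually_mono)
        then show False using nt by contradiction
      qed
      then obtain a' where "(a', \<tau>) \<in> B" "AE a'' in \<B>. ((a', \<tau>) \<in> B) = ((a'', \<tau>) \<in> B)" by blast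
      then show "AE a in \<B>. (a, \<tau>) \<in> B" by simp
    qed
  qed
qed

text \<open>By \<open>invariant_sections_trivial\<close> an invariant set is, up to a null set, of the form \<open>UNIV \<times> C\<close>. Inserting a
  first letter \<open>i\<close> shows that \<open>C\<close> is invariant under \<open>\<Phi> i\<close> for every letter separately.\<close>

theorem ergodic_skew:
  assumes erg: "\<And>C. C \<in> sets Th ==> (\<And>i. i \<in> set_pmf p ==> AE \<tau> in Th. \<tau> \<in> C \<longleftrightarrow> \<Phi> i \<tau> \<in> C) ==> Th.prob C = 0 \<or> Th.prob C = 1"
  shows "ergodic_map BTh skew"
proof
  show "skew \<in> BTh \<rightarrow>\<^sub>M BTh" "distr BTh BTh skew = BTh"
    by (measurable, rule skew_preserving)
  fix B assume B [measurable]: "B \<in> sets BTh" and inv: "AE x in BTh. x \<in> B \<longleftrightarrow> skew x \<in> B"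
  define C where "C = {\<tau> \<in> space Th. emeasure \<B> {a. (a, \<tau>) \<in> B} = 1}"
  have sec: "{a. (a, \<tau>) \<in> B} \<in> sets \<B>" if "\<tau> \<in> space Th" for \<tau>
  proof -
    have "(\<lambda>a. (a, \<tau>)) -` B \<inter> space \<B> \<in> sets \<B>" using that by (intro measurable_sets[OF measurable_Pair2' B])
    then show ?thesis by (simp add: vimage_def)
  qed
  have [measurable]: "(\<lambda>\<tau>. emeasure \<B> {a. (a, \<tau>) \<in> B}) \<in> borel_measurable Th"
    using BT.measurable_emeasure_Pair2[OF B] by (simp add: vimage_def)
  have C [measurable]: "C \<in> sets Th" unfolding C_def by measurable
  have Ciff: "\<tau> \<in> C \<longleftrightarrow> (AE a in \<B>. (a, \<tau>) \<in> B)" if t: "\<tau> \<in> space Th" for \<tau>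
    using \<B>.emeasure_eq_1_AE[OF sec[OF t]] t \<B>.AE_in_set_eq_1[OF sec[OF t]]
    by (simp add: C_def \<B>.emeasure_eq_measure)
  have triv: "AE \<tau> in Th. (AE a in \<B>. (a, \<tau>) \<in> B) \<or> (AE a in \<B>. (a, \<tau>) \<notin> B)"
    by (rule invariant_sections_trivial[OF B inv])
  have "AE \<tau> in Th. AE a in \<B>. (a, \<tau>) \<in> B \<longleftrightarrow> skew (a, \<tau>) \<in> B"
  proof -
    have "AE a in \<B>. AE \<tau> in Th. (a, \<tau>) \<in> B \<longleftrightarrow> skew (a, \<tau>) \<in> B"
      using BT.AE_pair[OF inv] .
    moreover have "{x \<in> space BTh. (fst x, snd x) \<in> B \<longleftrightarrow> skew (fst x, snd x) \<in> B} \<in> sets BTh"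
      by measurable
    ultimately show ?thesis using BT.AE_commute[of "\<lambda>a \<tau>. (a, \<tau>) \<in> B \<longleftrightarrow> skew (a, \<tau>) \<in> B"] by simp
  qed
  then have inv': "AE \<tau> in Th. \<forall>i\<in>set_pmf p. AE a in \<B>. (case_nat i a, \<tau>) \<in> B \<longleftrightarrow> (a, \<Phi> i \<tau>) \<in> B"
    using AE_space
  proof eventually_elim
    case (elim \<tau>)
    have [measurable]: "(\<lambda>a. (a, \<tau>)) \<in> \<B> \<rightarrow>\<^sub>M BTh" using elim(2) by simp
    have pm: "Measurable.pred \<B> (\<lambda>a. (a, \<tau>) \<in> B \<longleftrightarrow> skew (a, \<tau>) \<in> B)" by measurable
    from elim(1)[unfolded AE_bernoulli_first[OF pm]] show ?case
      unfolding skew_def prod.case nat.case .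
  qed
  have Cinv: "AE \<tau> in Th. \<tau> \<in> C \<longleftrightarrow> \<Phi> i \<tau> \<in> C" if i: "i \<in> set_pmf p" for i
    using inv' triv AE_\<Phi>[OF triv i] AE_space
  proof eventually_elim
    case (elim \<tau>)
    have \<Phi>: "\<Phi> i \<tau> \<in> space Th" using measurable_space[OF \<Phi>_measurable elim(4)] .
    have [measurable]: "(\<lambda>a. (a, \<tau>)) \<in> \<B> \<rightarrow>\<^sub>M BTh" using elim(4) by simp
    have p: "Measurable.pred \<B> (\<lambda>a. (a, \<tau>) \<in> B)" "Measurable.pred \<B> (\<lambda>a. (a, \<tau>) \<notin> B)" by measurable
    have e: "AE a in \<B>. (case_nat i a, \<tau>) \<in> B \<longleftrightarrow> (a, \<Phi> i \<tau>) \<in> B" using elim(1) i by blast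
    have no: "\<not> ((AE a in \<B>. Q a) \<and> (AE a in \<B>. \<not> Q a))" for Q
    proof
      assume "(AE a in \<B>. Q a) \<and> (AE a in \<B>. \<not> Q a)"
      then have "AE a in \<B>. Q a" "AE a in \<B>. \<not> Q a" by blast+
      then have "AE a in \<B>. False" by eventually_elim simp
      then show False by simp
    qed
    from elim(2) show ?case
    proof
      assume 1: "AE a in \<B>. (a, \<tau>) \<in> B"
      then have "AE a in \<B>. (case_nat i a, \<tau>) \<in> B" using i AE_bernoulli_first[OF p(1)] by blast
      with e have "AE a in \<B>. (a, \<Phi> i \<tau>) \<in> B" by eventually_elim simp
      with 1 show ?thesis using Ciff elim(4) \<Phi> by simp
    next
      assume 1: "AE a in \<B>. (a, \<tau>) \<notin> B"
      then have "AE a in \<B>. (case_nat i a, \<tau>) \<notin> B" using i AE_bernoulli_first[OF p(2)] by blast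
      with e have "AE a in \<B>. (a, \<Phi> i \<tau>) \<notin> B" by eventually_elim simp
      with 1 show ?thesis using Ciff elim(4) \<Phi> no by blast
    qed
  qed
  have fub: "emeasure BTh B = (\<integral>\<^sup>+\<tau>. emeasure \<B> {a. (a, \<tau>) \<in> B} \<partial>Th)"
    using BT.emeasure_pair_measure_alt2[OF B] by (simp add: vimage_def)
  have "(\<integral>\<^sup>+\<tau>. emeasure \<B> {a. (a, \<tau>) \<in> B} \<partial>Th) = (\<integral>\<^sup>+\<tau>. indicator C \<tau> \<partial>Th)"
  proof (rule nn_integral_cong_AE)
    show "AE \<tau> in Th. emeasure \<B> {a. (a, \<tau>) \<in> B} = indicator C \<tau>"
      using triv AE_space
    proof eventually_elim
      case (elim \<tau>)
      show ?case
      proof (cases "\<tau> \<in> C")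
        case True then show ?thesis by (simp add: C_def)
      next
        case False
        then have "AE a in \<B>. (a, \<tau>) \<notin> B" using elim Ciff by blast
        then have "emeasure \<B> {a. (a, \<tau>) \<in> B} = 0"
          using sec[OF elim(2)] by (subst (asm) AE_iff_measurable) auto
        then show ?thesis using False by simp
      qed
    qed
  qed
  then have "emeasure BTh B = emeasure Th C" by (simp add: fub)
  then have "measure BTh B = Th.prob C" by (simp add: measure_def)
  then show "measure BTh B = 0 \<or> measure BTh B = 1"
    using erg[OF C Cinv] by simp
qed

end

section \<open>Random contractions with signs\<close>

locale contracting_maps = random_maps Th p \<phi> for Th :: "real measure" and p :: "'k::finite pmf" and \<phi> +
  fixes Q :: "real set"
  assumes sets_Th [measurable_cong]: "sets Th = sets borel"
    and AE_Q: "AE \<theta> in Th. \<theta> \<in> Q"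
    and contract: "\<And>e. e > 0 ==> \<exists>n. \<forall>a. \<forall>\<theta>\<in>Q. \<forall>\<theta>'\<in>Q. \<bar>random_orbit n a \<theta> - random_orbit n a \<theta>'\<bar> < e"
begin

lemma space_Th: "space Th = UNIV"
  using sets_eq_imp_space_eq[OF sets_Th] by simp

lemma AE_random_orbit:
  assumes "AE \<theta> in Th. R \<theta>" "\<And>n. a n \<in> set_pmf p"
  shows "AE \<theta> in Th. R (random_orbit n a \<theta>)"
  using assms(1)
proof (induction n arbitrary: R)
  case (Suc n)
  show ?case using Suc.IH[OF AE_\<Phi>[OF Suc.prems assms(2)]] by simp
qed simp

lemma random_orbit_alternative:
  assumes inv: "\<And>i. i \<in> set_pmf p ==> (AE \<theta> in Th. \<theta> \<in> C \<longleftrightarrow> \<phi> i \<theta> \<in> C) \<or> (AE \<theta> in Th. \<theta> \<in> C \<longleftrightarrow> \<phi> i \<theta> \<notin> C)"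
    and a: "\<And>n. a n \<in> set_pmf p"
  shows "(AE \<theta> in Th. \<theta> \<in> C \<longleftrightarrow> random_orbit n a \<theta> \<in> C) \<or> (AE \<theta> in Th. \<theta> \<in> C \<longleftrightarrow> random_orbit n a \<theta> \<notin> C)"
proof (induction n)
  case (Suc n)
  have step: "(AE \<theta> in Th. random_orbit n a \<theta> \<in> C \<longleftrightarrow> random_orbit (Suc n) a \<theta> \<in> C) \<or>
    (AE \<theta> in Th. random_orbit n a \<theta> \<in> C \<longleftrightarrow> random_orbit (Suc n) a \<theta> \<notin> C)"
    using inv[OF a[of n]]
  proof
    assume "AE \<theta> in Th. \<theta> \<in> C \<longleftrightarrow> \<phi> (a n) \<theta> \<in> C"
    from AE_random_orbit[OF this a, of n] show ?thesis by simp
  next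
    assume "AE \<theta> in Th. \<theta> \<in> C \<longleftrightarrow> \<phi> (a n) \<theta> \<notin> C"
    from AE_random_orbit[OF this a, of n] show ?thesis by simp
  qed
  from Suc step show ?case
    by (elim disjE) (rule disjI1 disjI2, elim AE_mp eventually_elim2, simp; fail)+
qed simp

text \<open>Up to small measure, \<open>C\<close> and its complement are compact, and then they lie at a positive distance. After
  sufficiently many steps with the same letters the images of any two points of \<open>Q\<close> are closer
  than this distance, so that apart from few exceptions they all lie on the same side. On the way,
  membership in \<open>C\<close> was kept for almost all points or flipped for almost all points, so that \<open>C\<close> or its complement has nearly full measure. The maps that flip \<open>C\<close> occur
  for the two halves of a signed invariant set.\<close>

lemma zero_one_law:
  assumes C: "C \<in> sets borel"
    and inv: "\<And>i. i \<in> set_pmf p ==> (AE \<theta> in Th. \<theta> \<in> C \<longleftrightarrow> \<phi> i \<theta> \<in> C) \<or> (AE \<theta> in Th. \<theta> \<in> C \<longleftrightarrow> \<phi> i \<theta> \<notin> C)"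
  shows "Th.prob C = 0 \<or> Th.prob C = 1"
proof -
  have near: "Th.prob C < e \<or> Th.prob C > 1 - e" if e: "e > 0" for e
  proof -
    have inner: "\<exists>K. compact K \<and> K \<subseteq> B \<and> Th.prob K > Th.prob B - e / 2" if B: "B \<in> sets borel" for B
    proof -
      have sup: "emeasure Th B = (SUP K\<in>{K. K \<subseteq> B \<and> compact K}. emeasure Th K)"
        by (rule inner_regular[OF sets_Th _ B]) (simp add: Th.emeasure_space_1)
      have ex: "\<exists>K. K \<subseteq> B \<and> compact K \<and> ennreal (Th.prob B - e / 2) < emeasure Th K" if pos: "Th.prob B > 0"
      proof -
        have "ennreal (Th.prob B - e / 2) < emeasure Th B"
          unfolding Th.emeasure_eq_measure using e pos by (intro ennreal_lessI) auto
        then show ?thesis unfolding sup less_SUP_iff by blast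
      qed
      show ?thesis
      proof (cases "Th.prob B - e / 2 < 0")
        case True then show ?thesis by (intro exI[of _ "{}"]) simp
      next
        case False
        then have "Th.prob B > 0" using e by linarith
        then obtain K where "K \<subseteq> B" "compact K" "ennreal (Th.prob B - e / 2) < emeasure Th K" using ex by blast
        then show ?thesis using False by (intro exI[of _ K]) (auto simp: Th.emeasure_eq_measure ennreal_less_iff)
      qed
    qed
    obtain K where K: "compact K" "K \<subseteq> C" "Th.prob K > Th.prob C - e / 2" using inner[OF C] by blast
    obtain K' where K': "compact K'" "K' \<subseteq> - C" "Th.prob K' > Th.prob (- C) - e / 2"
      using inner[OF borel_comp[OF C]] by blast
    have Km [measurable]: "K \<in> sets borel" "K' \<in> sets borel" using K K' by (auto intro: borel_compact)
    have comp: "Th.prob (- B) = 1 - Th.prob B" if "B \<in> sets borel" for B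
      using Th.prob_compl[of B] that by (simp add: sets_Th space_Th Compl_eq_Diff_UNIV)
    \<comment> \<open>The exceptional set outside both compact sets.\<close>
    define J where "J = - (K \<union> K')"
    have J [measurable]: "J \<in> sets borel" unfolding J_def by measurable
    have "Th.prob (K \<union> K') = Th.prob K + Th.prob K'"
      using K K' by (intro Th.finite_measure_Union) (auto simp: sets_Th)
    then have Jm: "Th.prob J < e" unfolding J_def using K K' comp[OF C] comp[of "K \<union> K'"] by simp
    have "K \<inter> K' = {}" using K K' by blast
    then obtain r where r: "r > 0" "\<And>x y. x \<in> K ==> y \<in> K' ==> r \<le> dist x y"
      using separate_compact_closed[OF K(1) compact_imp_closed[OF K'(1)]] by blast
    obtain n where n: "\<And>a \<theta> \<theta>'. \<theta> \<in> Q ==> \<theta>' \<in> Q ==> \<bar>random_orbit n a \<theta> - random_orbit n a \<theta>'\<bar> < r"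
      using contract[OF r(1)] by blast
    have om: "(\<lambda>\<theta>. random_orbit n a \<theta>) \<in> borel \<rightarrow>\<^sub>M borel" for a
    proof -
      have "(\<lambda>\<theta>. (a, \<theta>)) \<in> Th \<rightarrow>\<^sub>M BTh" by simp
      from measurable_compose[OF this random_orbit_measurable[of n]]
      show ?thesis by (simp add: measurable_cong_sets[OF sets_Th sets_Th])
    qed
    have Je: "(\<integral>\<^sup>+a. emeasure Th {\<theta>. random_orbit n a \<theta> \<in> J} \<partial>\<B>) < ennreal e"
    proof -
      have s: "(\<integral>\<^sup>+\<theta>. indicator J (random_orbit n a \<theta>) \<partial>Th) = emeasure Th {\<theta>. random_orbit n a \<theta> \<in> J}" for a
      proof -
        have "(\<lambda>\<theta>. random_orbit n a \<theta>) -` J \<inter> space borel \<in> sets borel" using om J by (rule measurable_sets)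
        then have m: "{\<theta>. random_orbit n a \<theta> \<in> J} \<in> sets Th" by (simp add: vimage_def sets_Th)
        have "(\<integral>\<^sup>+\<theta>. indicator J (random_orbit n a \<theta>) \<partial>Th) = (\<integral>\<^sup>+\<theta>. indicator {\<theta>. random_orbit n a \<theta> \<in> J} \<theta> \<partial>Th)"
          by (intro nn_integral_cong) (simp add: indicator_def)
        then show ?thesis using m by simp
      qed
      have "(\<integral>\<^sup>+a. emeasure Th {\<theta>. random_orbit n a \<theta> \<in> J} \<partial>\<B>) =
        (\<integral>\<^sup>+x. indicator J (random_orbit n (fst x) (snd x)) \<partial>BTh)"
      proof -
        have "J \<in> sets Th" using J by (simp add: sets_Th)
        then have m: "(\<lambda>x. indicator J (random_orbit n (fst x) (snd x)) :: ennreal) \<in> borel_measurable BTh"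
          by (intro measurable_compose[OF random_orbit_measurable[of n]] borel_measurable_indicator)
        show ?thesis unfolding s[symmetric] using Th.nn_integral_fst[OF m] by simp
      qed
      also have "\<dots> = (\<integral>\<^sup>+\<theta>. indicator J \<theta> \<partial>Th)"
        by (rule nn_integral_random_orbit) measurable
      also have "\<dots> = emeasure Th J" by (simp add: sets_Th)
      also have "\<dots> < ennreal e" using Jm by (simp add: Th.emeasure_eq_measure ennreal_lessI e)
      finally show ?thesis .
    qed
    \<comment> \<open>For a random word the images have law \<open>Th\<close>, so some word sends few points into \<open>J\<close>.\<close>
    have "\<exists>a. (\<forall>n. a n \<in> set_pmf p) \<and> emeasure Th {\<theta>. random_orbit n a \<theta> \<in> J} < ennreal e"
    proof (rule ccontr)
      assume no: "\<nexists>a. (\<forall>n. a n \<in> set_pmf p) \<and> emeasure Th {\<theta>. random_orbit n a \<theta> \<in> J} < ennreal e"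
      have "AE a in \<B>. ennreal e \<le> emeasure Th {\<theta>. random_orbit n a \<theta> \<in> J}"
        using AE_bernoulli_letters[of p]
      proof eventually_elim
        case (elim a)
        show ?case
        proof (rule ccontr)
          assume "\<not> ennreal e \<le> emeasure Th {\<theta>. random_orbit n a \<theta> \<in> J}"
          then show False using no elim not_le by blast
        qed
      qed
      then have "(\<integral>\<^sup>+a. ennreal e \<partial>\<B>) \<le> (\<integral>\<^sup>+a. emeasure Th {\<theta>. random_orbit n a \<theta> \<in> J} \<partial>\<B>)"
        by (rule nn_integral_mono_AE)
      moreover have "(\<integral>\<^sup>+a. ennreal e \<partial>\<B>) = ennreal e" using \<B>.emeasure_space_1 by simp
      ultimately show False using Je by simp
    qed
    then obtain a where a: "\<And>n. a n \<in> set_pmf p" "emeasure Th {\<theta>. random_orbit n a \<theta> \<in> J} < ennreal e" by blast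
    let ?o = "random_orbit n a"
    have vm: "{\<theta>. ?o \<theta> \<in> B} \<in> sets Th" if "B \<in> sets borel" for B
      using measurable_sets[OF om that, of a] by (simp add: vimage_def sets_Th)
    have big: "Th.prob {\<theta>. ?o \<theta> \<notin> J} > 1 - e"
    proof -
      have "Th.prob {\<theta>. ?o \<theta> \<in> J} < e" using a(2) e by (simp add: Th.emeasure_eq_measure ennreal_less_iff)
      moreover have "{\<theta>. ?o \<theta> \<notin> J} = - {\<theta>. ?o \<theta> \<in> J}" by auto
      ultimately show ?thesis using comp[of "{\<theta>. ?o \<theta> \<in> J}"] vm[OF J] by (simp add: sets_Th)
    qed
    have notJ: "{\<theta>. ?o \<theta> \<notin> J} \<in> sets Th" using vm[of "- J"] J by (simp add: borel_comp)
    have dich: "(AE \<theta> in Th. ?o \<theta> \<notin> J --> ?o \<theta> \<in> C) \<or> (AE \<theta> in Th. ?o \<theta> \<notin> J --> ?o \<theta> \<notin> C)"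
    proof (cases "\<exists>\<theta>\<in>Q. ?o \<theta> \<in> K'")
      case True
      then obtain \<theta>' where t: "\<theta>' \<in> Q" "?o \<theta>' \<in> K'" by blast
      have "AE \<theta> in Th. ?o \<theta> \<notin> J --> ?o \<theta> \<notin> C"
        using AE_Q
      proof eventually_elim
        case (elim \<theta>)
        have "?o \<theta> \<notin> K" using r(2)[of "?o \<theta>" "?o \<theta>'"] t n[OF elim t(1), of a] by (auto simp: dist_real_def)
        then show ?case using K' by (auto simp: J_def)
      qed
      then show ?thesis ..
    next
      case False
      have "AE \<theta> in Th. ?o \<theta> \<notin> J --> ?o \<theta> \<in> C"
        using AE_Q by eventually_elim (use False K in \<open>auto simp: J_def\<close>)
      then show ?thesis ..
    qed
    have alt: "(AE \<theta> in Th. \<theta> \<in> C \<longleftrightarrow> ?o \<theta> \<in> C) \<or> (AE \<theta> in Th. \<theta> \<in> C \<longleftrightarrow> ?o \<theta> \<notin> C)"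
      by (rule random_orbit_alternative) (rule inv a(1); assumption?)+
    have "(AE \<theta> in Th. ?o \<theta> \<notin> J --> \<theta> \<in> C) \<or> (AE \<theta> in Th. ?o \<theta> \<notin> J --> \<theta> \<notin> C)"
      using dich alt
      by (elim disjE) (rule disjI1 disjI2, erule (1) eventually_elim2, blast)+
    then show ?thesis
    proof
      assume "AE \<theta> in Th. ?o \<theta> \<notin> J --> \<theta> \<in> C"
      then have "Th.prob {\<theta>. ?o \<theta> \<notin> J} \<le> Th.prob C"
        by (intro Th.finite_measure_mono_AE) (auto simp: sets_Th C)
      then show ?thesis using big by linarith
    next
      assume "AE \<theta> in Th. ?o \<theta> \<notin> J --> \<theta> \<notin> C"
      then have "Th.prob {\<theta>. ?o \<theta> \<notin> J} \<le> Th.prob (- C)"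
        by (intro Th.finite_measure_mono_AE) (auto simp: sets_Th C borel_comp)
      then show ?thesis using big comp[OF C] by linarith
    qed
  qed
  show ?thesis
  proof (rule ccontr)
    assume "\<not> (Th.prob C = 0 \<or> Th.prob C = 1)"
    then have "0 < min (Th.prob C) (1 - Th.prob C)"
      using Th.prob_le_1[of C] measure_nonneg[of Th C] by (auto simp: less_le)
    then show False using near[of "min (Th.prob C) (1 - Th.prob C)"] by auto
  qed
qed

end

locale signed_contracting_maps = contracting_maps Th p \<phi> Q
  for Th and p :: "'k::finite pmf" and \<phi> and Q +
  fixes sg :: "'k => real"
  assumes sg: "\<And>i. sg i = 1 \<or> sg i = - 1"
begin

text \<open>The stationary law of the orientation. If no letter reverses it, the orientation never changes, and
  a law that charges both signs would make the signed skew product decomposable.\<close>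

definition sign_pmf :: "real pmf" where
  "sign_pmf = (if \<forall>i\<in>set_pmf p. sg i = 1 then return_pmf 1 else pmf_of_set {1, - 1})"

lemma map_sign_pmf:
  assumes "i \<in> set_pmf p" shows "map_pmf (\<lambda>e. e * sg i) sign_pmf = sign_pmf"
proof (cases "\<forall>i\<in>set_pmf p. sg i = 1")
  case True then show ?thesis using assms by (simp add: sign_pmf_def)
next
  case False
  have "map_pmf (\<lambda>e. e * sg i) (pmf_of_set {1, - 1}) = pmf_of_set ((\<lambda>e. e * sg i) ` {1, - 1})"
    using sg[of i] by (intro map_pmf_of_set_inj) (auto simp: inj_on_def)
  also have "(\<lambda>e. e * sg i) ` {1, - 1} = {1, - 1}" using sg[of i] by auto
  finally show ?thesis unfolding sign_pmf_def if_not_P[OF False] .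
qed

abbreviation "STh \<equiv> measure_pmf sign_pmf \<Otimes>\<^sub>M Th"

abbreviation "BSTh \<equiv> bernoulli_measure p \<Otimes>\<^sub>M STh"

definition signed_map :: "'k => real \<times> real => real \<times> real" where
  "signed_map i = (\<lambda>(e, \<theta>). (e * sg i, \<phi> i \<theta>))"

lemma pair_prob_space_signed: "pair_prob_space (measure_pmf sign_pmf) Th"
  by (intro pair_prob_space.intro pair_sigma_finite.intro measure_pmf.prob_space_axioms Th.prob_space_axioms
    measure_pmf.sigma_finite_measure_axioms Th.sigma_finite_measure_axioms)

lemma signed_map_measurable: "signed_map i \<in> STh \<rightarrow>\<^sub>M STh"
  unfolding signed_map_def case_prod_unfold
proof (rule measurable_Pair)
  show "(\<lambda>x. fst x * sg i) \<in> STh \<rightarrow>\<^sub>M measure_pmf sign_pmf"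
    by (rule measurable_compose[OF measurable_fst]) simp
  show "(\<lambda>x. \<phi> i (snd x)) \<in> STh \<rightarrow>\<^sub>M Th"
    by (rule measurable_compose[OF measurable_snd \<Phi>_measurable])
qed

lemma emeasure_STh: "B \<in> sets STh ==> emeasure STh B = (\<integral>\<^sup>+e. emeasure Th (Pair e -` B) \<partial>measure_pmf sign_pmf)"
  by (rule Th.emeasure_pair_measure_alt)

lemma random_maps_signed: "random_maps STh p signed_map"
proof (intro random_maps.intro random_maps_axioms.intro signed_map_measurable)
  interpret ST: pair_prob_space "measure_pmf sign_pmf" Th by (rule pair_prob_space_signed)
  show "prob_space STh" by unfold_locales
  fix B assume B: "B \<in> sets STh"
  have sec: "Pair e -` B \<in> sets Th" for e using B by (rule sets_Pair1)
  have fin: "(\<integral>\<^sup>+i. g i \<partial>measure_pmf p) = (\<Sum>i\<in>set_pmf p. g i * ennreal (pmf p i))" for g :: "'k => ennreal"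
    by (rule nn_integral_measure_pmf_finite) auto
  have pre: "Pair e -` (signed_map i -` B \<inter> space STh) = \<phi> i -` (Pair (e * sg i) -` B) \<inter> space Th" for e i
    by (auto simp: signed_map_def space_pair_measure)
  have "emeasure STh B = (\<integral>\<^sup>+e. (\<Sum>i\<in>set_pmf p. emeasure Th (\<phi> i -` (Pair e -` B) \<inter> space Th) * ennreal (pmf p i)) \<partial>measure_pmf sign_pmf)"
    unfolding emeasure_STh[OF B] by (intro nn_integral_cong) (simp only: stationary[OF sec] fin)
  also have "\<dots> = (\<Sum>i\<in>set_pmf p. (\<integral>\<^sup>+e. emeasure Th (\<phi> i -` (Pair e -` B) \<inter> space Th) * ennreal (pmf p i) \<partial>measure_pmf sign_pmf))"
    by (rule nn_integral_sum) simp
  also have "\<dots> = (\<Sum>i\<in>set_pmf p. (\<integral>\<^sup>+e. emeasure Th (\<phi> i -` (Pair (e * sg i) -` B) \<inter> space Th) * ennreal (pmf p i) \<partial>measure_pmf sign_pmf))"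
  proof (rule sum.cong[OF refl])
    fix i assume i: "i \<in> set_pmf p"
    let ?g = "\<lambda>e. emeasure Th (\<phi> i -` (Pair e -` B) \<inter> space Th) * ennreal (pmf p i)"
    have "(\<integral>\<^sup>+e. ?g e \<partial>measure_pmf (map_pmf (\<lambda>e. e * sg i) sign_pmf)) = (\<integral>\<^sup>+e. ?g (e * sg i) \<partial>measure_pmf sign_pmf)"
      by (rule nn_integral_map_pmf)
    then show "(\<integral>\<^sup>+e. ?g e \<partial>measure_pmf sign_pmf) = (\<integral>\<^sup>+e. ?g (e * sg i) \<partial>measure_pmf sign_pmf)"
      by (simp only: map_sign_pmf[OF i])
  qed
  also have "\<dots> = (\<Sum>i\<in>set_pmf p. emeasure STh (signed_map i -` B \<inter> space STh) * ennreal (pmf p i))"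
  proof (rule sum.cong[OF refl])
    fix i
    have m: "signed_map i -` B \<inter> space STh \<in> sets STh" using signed_map_measurable B by (rule measurable_sets)
    show "(\<integral>\<^sup>+e. emeasure Th (\<phi> i -` (Pair (e * sg i) -` B) \<inter> space Th) * ennreal (pmf p i) \<partial>measure_pmf sign_pmf) =
      emeasure STh (signed_map i -` B \<inter> space STh) * ennreal (pmf p i)"
      unfolding emeasure_STh[OF m] pre by (rule nn_integral_multc) simp
  qed
  also have "\<dots> = (\<integral>\<^sup>+i. emeasure STh (signed_map i -` B \<inter> space STh) \<partial>measure_pmf p)"
    by (simp only: fin)
  finally show "emeasure STh B = (\<integral>\<^sup>+i. emeasure STh (signed_map i -` B \<inter> space STh) \<partial>measure_pmf p)" .
qed

text \<open>Let \<open>S 1\<close> and \<open>S (-1)\<close> be the sections of an invariant set. If some sign is negative, their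
  intersection and their union are invariant under all maps, so each of them is trivial. The
  remaining case is that the sections are complementary: then every map keeps or flips \<open>S 1\<close>, which is
  therefore trivial itself, and a map with negative sign carries it to its complement.\<close>

lemma signed_zero_one_law:
  assumes C: "C \<in> sets STh"
    and inv: "\<And>i. i \<in> set_pmf p ==> AE \<tau> in STh. \<tau> \<in> C \<longleftrightarrow> signed_map i \<tau> \<in> C"
  shows "measure STh C = 0 \<or> measure STh C = 1"
proof -
  interpret ST: pair_prob_space "measure_pmf sign_pmf" Th by (rule pair_prob_space_signed)
  define S where "S e = Pair e -` C" for e
  have S: "S e \<in> sets borel" for e using sets_Pair1[OF C, of e] by (simp add: S_def sets_Th)
  have Sinv: "AE \<theta> in Th. \<theta> \<in> S e \<longleftrightarrow> \<phi> i \<theta> \<in> S (e * sg i)" if "i \<in> set_pmf p" "e \<in> set_pmf sign_pmf" for i e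
  proof -
    have "AE e in measure_pmf sign_pmf. AE \<theta> in Th. (e, \<theta>) \<in> C \<longleftrightarrow> signed_map i (e, \<theta>) \<in> C"
      using ST.AE_pair[OF inv[OF that(1)]] .
    then show ?thesis using that(2) by (simp add: AE_measure_pmf_iff signed_map_def S_def)
  qed
  show ?thesis
  proof (cases "\<forall>i\<in>set_pmf p. sg i = 1")
    case True
    then have s: "sign_pmf = return_pmf 1" by (simp add: sign_pmf_def)
    have "Th.prob (S 1) = 0 \<or> Th.prob (S 1) = 1"
    proof (rule zero_one_law[OF S])
      fix i assume i: "i \<in> set_pmf p"
      show "(AE \<theta> in Th. \<theta> \<in> S 1 \<longleftrightarrow> \<phi> i \<theta> \<in> S 1) \<or> (AE \<theta> in Th. \<theta> \<in> S 1 \<longleftrightarrow> \<phi> i \<theta> \<notin> S 1)"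
        using Sinv[OF i, of 1] True i by (simp add: s)
    qed
    moreover have "emeasure STh C = emeasure Th (S 1)"
      unfolding emeasure_STh[OF C] by (simp add: s S_def)
    ultimately show ?thesis by (simp add: measure_def)
  next
    case False
    then have s: "sign_pmf = pmf_of_set {1, - 1}" unfolding sign_pmf_def by (rule if_not_P)
    then have ss: "1 \<in> set_pmf sign_pmf" "- 1 \<in> set_pmf sign_pmf" by simp_all
    obtain j where j: "j \<in> set_pmf p" "sg j = - 1" using False sg by blast
    have p: "AE \<theta> in Th. \<theta> \<in> S 1 \<longleftrightarrow> \<phi> i \<theta> \<in> S (sg i)" if "i \<in> set_pmf p" for i using Sinv[OF that ss(1)] by simp
    have m: "AE \<theta> in Th. \<theta> \<in> S (- 1) \<longleftrightarrow> \<phi> i \<theta> \<in> S (- sg i)" if "i \<in> set_pmf p" for i using Sinv[OF that ss(2)] by simp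
    have triv: "Th.prob X = 0 \<or> Th.prob X = 1"
      if "X \<in> sets borel" "\<And>i. i \<in> set_pmf p ==> AE \<theta> in Th. \<theta> \<in> X \<longleftrightarrow> \<phi> i \<theta> \<in> X" for X
      using that(2) by (intro zero_one_law[OF that(1)] disjI1)
    have IU: "AE \<theta> in Th. \<theta> \<in> S 1 \<inter> S (- 1) \<longleftrightarrow> \<phi> i \<theta> \<in> S 1 \<inter> S (- 1)"
      "AE \<theta> in Th. \<theta> \<in> S 1 \<union> S (- 1) \<longleftrightarrow> \<phi> i \<theta> \<in> S 1 \<union> S (- 1)" if i: "i \<in> set_pmf p" for i
      using p[OF i] m[OF i] by (eventually_elim, use sg[of i] in auto)+
    have I: "Th.prob (S 1 \<inter> S (- 1)) = 0 \<or> Th.prob (S 1 \<inter> S (- 1)) = 1"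
      by (rule triv[OF sets.Int[OF S S] IU(1)])
    have U: "Th.prob (S 1 \<union> S (- 1)) = 0 \<or> Th.prob (S 1 \<union> S (- 1)) = 1"
      by (rule triv[OF sets.Un[OF S S] IU(2)])
    have avg: "measure STh C = (Th.prob (S 1) + Th.prob (S (- 1))) / 2"
    proof -
      have "emeasure STh C = (emeasure Th (S 1) + emeasure Th (S (- 1))) / 2"
        by (subst emeasure_STh[OF C], subst s, subst nn_integral_pmf_of_set) (simp_all add: S_def)
      also have "\<dots> = ennreal ((Th.prob (S 1) + Th.prob (S (- 1))) / 2)"
        by (simp add: Th.emeasure_eq_measure ennreal_plus[symmetric] ennreal_divide_numeral del: ennreal_plus)
      finally show ?thesis by (simp add: measure_def)
    qed
    have sum: "Th.prob (S 1 \<union> S (- 1)) + Th.prob (S 1 \<inter> S (- 1)) = Th.prob (S 1) + Th.prob (S (- 1))"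
      using Th.finite_measure_Union'[of "S 1" "S (- 1)"] Th.finite_measure_Diff'[of "S (- 1)" "S 1"] S
      by (simp add: sets_Th Int_commute)
    have le: "Th.prob (S 1 \<inter> S (- 1)) \<le> Th.prob (S 1 \<union> S (- 1))"
      using S by (intro Th.finite_measure_mono) (auto simp: sets_Th)
    show ?thesis
    proof (cases "Th.prob (S 1 \<inter> S (- 1)) = 0 \<and> Th.prob (S 1 \<union> S (- 1)) = 1")
      case False
      then show ?thesis using I U avg sum le by auto
    next
      case True
      have "AE \<theta> in Th. \<theta> \<notin> S 1 \<inter> S (- 1)"
        using True S by (subst Th.prob_eq_0[symmetric]) (auto simp: sets_Th)
      moreover have "AE \<theta> in Th. \<theta> \<in> S 1 \<union> S (- 1)"
        using True S by (subst Th.prob_eq_1[symmetric]) (auto simp: sets_Th)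
      ultimately have part: "AE \<theta> in Th. \<theta> \<in> S (- 1) \<longleftrightarrow> \<theta> \<notin> S 1" by eventually_elim auto
      have "Th.prob (S 1) = 0 \<or> Th.prob (S 1) = 1"
      proof (rule zero_one_law[OF S])
        fix i assume i: "i \<in> set_pmf p"
        show "(AE \<theta> in Th. \<theta> \<in> S 1 \<longleftrightarrow> \<phi> i \<theta> \<in> S 1) \<or> (AE \<theta> in Th. \<theta> \<in> S 1 \<longleftrightarrow> \<phi> i \<theta> \<notin> S 1)"
        proof (cases "sg i = 1")
          case True then show ?thesis using p[OF i] by simp
        next
          case False
          then have "sg i = - 1" using sg by blast
          then have "AE \<theta> in Th. \<theta> \<in> S 1 \<longleftrightarrow> \<phi> i \<theta> \<notin> S 1"
            using p[OF i] AE_\<Phi>[OF part i] by (auto elim: eventually_elim2)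
          then show ?thesis ..
        qed
      qed
      moreover have "Th.prob (S 1) = Th.prob (S (- 1))"
      proof -
        have pr: "Th.prob (S 1) = 0 \<longleftrightarrow> (AE \<theta> in Th. \<theta> \<notin> S 1)" "Th.prob (S (- 1)) = 0 \<longleftrightarrow> (AE \<theta> in Th. \<theta> \<notin> S (- 1))"
          "Th.prob (S 1) = 1 \<longleftrightarrow> (AE \<theta> in Th. \<theta> \<in> S 1)" "Th.prob (S (- 1)) = 1 \<longleftrightarrow> (AE \<theta> in Th. \<theta> \<in> S (- 1))"
          using S by (simp_all add: Th.prob_eq_0 Th.prob_eq_1 sets_Th)
        have mj: "AE \<theta> in Th. \<theta> \<in> S (- 1) \<longleftrightarrow> \<phi> j \<theta> \<in> S 1" using m[OF j(1)] j(2) by simp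
        from calculation show ?thesis
        proof
          assume 0: "Th.prob (S 1) = 0"
          have "AE \<theta> in Th. \<theta> \<notin> S (- 1)"
            using mj AE_\<Phi>[OF 0[unfolded pr] j(1)] by eventually_elim simp
          then show ?thesis using pr 0 by simp
        next
          assume 1: "Th.prob (S 1) = 1"
          have "AE \<theta> in Th. \<theta> \<in> S (- 1)"
            using mj AE_\<Phi>[OF 1[unfolded pr] j(1)] by eventually_elim simp
          then show ?thesis using pr 1 by simp
        qed
      qed
      ultimately show ?thesis using avg by auto
    qed
  qed
qed

theorem ergodic_signed_skew: "ergodic_map BSTh (random_maps.skew signed_map)"
proof -
  interpret S: random_maps STh p signed_map by (rule random_maps_signed)
  show ?thesis using signed_zero_one_law by (rule S.ergodic_skew)
qed

end

section \<open>The projective action of positive matrices\<close>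

lemma matrix_inv_mult:
  fixes A :: "real^2^2"
  assumes "invertible A"
  shows "A ** matrix_inv A = mat 1" "matrix_inv A ** A = mat 1"
proof -
  have "\<exists>A'. A ** A' = mat 1 \<and> A' ** A = mat 1" using assms unfolding invertible_def .
  then have "A ** matrix_inv A = mat 1 \<and> matrix_inv A ** A = mat 1"
    unfolding matrix_inv_def by (rule someI_ex)
  then show "A ** matrix_inv A = mat 1" "matrix_inv A ** A = mat 1" by auto
qed

lemma matrix_inv_2:
  fixes A :: "real^2^2"
  assumes "invertible A"
  shows "matrix_inv A *v v = (1 / det A) *\<^sub>R vector [A$2$2 * v$1 - A$1$2 * v$2, A$1$1 * v$2 - A$2$1 * v$1]"
proof -
  have d: "det A \<noteq> 0" using assms invertible_det_nz by blast
  let ?w = "(1 / det A) *\<^sub>R vector [A$2$2 * v$1 - A$1$2 * v$2, A$1$1 * v$2 - A$2$1 * v$1] :: real^2"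
  have "A *v ?w = v"
  proof -
    have c: "(A *v ?w) $ i = (1 / det A) * (A$i$1 * (A$2$2 * v$1 - A$1$2 * v$2) + A$i$2 * (A$1$1 * v$2 - A$2$1 * v$1))" for i
      by (simp add: matrix_vector_mult_def sum_2 algebra_simps diff_divide_distrib add_divide_distrib)
    have "(A *v ?w) $ i = v $ i" for i
    proof (cases "i = 1")
      case True
      have "A$1$1 * (A$2$2 * v$1 - A$1$2 * v$2) + A$1$2 * (A$1$1 * v$2 - A$2$1 * v$1) = det A * v$1"
        by (simp add: det_2 algebra_simps)
      then show ?thesis using d unfolding c True by simp
    next
      case False
      then have i: "i = 2" using exhaust_2 by blast
      have "A$2$1 * (A$2$2 * v$1 - A$1$2 * v$2) + A$2$2 * (A$1$1 * v$2 - A$2$1 * v$1) = det A * v$2"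
        by (simp add: det_2 algebra_simps)
      then show ?thesis using d unfolding c i by simp
    qed
    then show ?thesis by (simp add: vec_eq_iff)
  qed
  then have "matrix_inv A *v v = matrix_inv A *v (A *v ?w)" by simp
  also have "\<dots> = ?w"
    using matrix_inv_mult(2)[OF assms] by (simp only: matrix_vector_mul_assoc matrix_vector_mul_lid)
  finally show ?thesis .
qed

lemma matrix_inv_cancel:
  fixes A :: "real^2^2"
  assumes "invertible A"
  shows "A *v (matrix_inv A *v v) = v" "matrix_inv A *v (A *v v) = v"
  using matrix_inv_mult[OF assms]
  by (simp_all only: matrix_vector_mul_assoc matrix_vector_mul_lid)

lemma dir_nth [simp]: "dir \<theta> $ 1 = cos \<theta>" "dir \<theta> $ 2 = sin \<theta>"
  by (simp_all add: dir_def)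

lemma norm_dir [simp]: "norm (dir \<theta>) = 1"
  by (simp add: norm_vec_def L2_set_def sum_2)

lemma dir_nonzero [simp]: "dir \<theta> \<noteq> 0"
  using norm_dir[of \<theta>] by (metis norm_zero zero_neq_one)

text \<open>For \<open>v \<noteq> 0\<close>, the number \<open>line_angle (span {v})\<close> in closed form.\<close>

definition vec_angle :: "real^2 => real" where
  "vec_angle v = (if v$1 = 0 then pi / 2 else if v$2 / v$1 \<ge> 0 then arctan (v$2 / v$1) else pi + arctan (v$2 / v$1))"

lemma vec_angle_range: "vec_angle v \<in> {0..<pi}"
  using arctan_lbound[of "v$2 / v$1"] arctan_ubound[of "v$2 / v$1"] pi_gt_zero
  by (auto simp: vec_angle_def zero_le_arctan_iff)

lemma vec_angle_dir:
  assumes "v \<noteq> 0" shows "\<exists>k. k \<noteq> 0 \<and> v = k *\<^sub>R dir (vec_angle v)"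
proof (cases "v$1 = 0")
  case True
  then have "v$2 \<noteq> 0" using assms by (metis (mono_tags) exhaust_2 vec_eq_iff zero_index)
  then show ?thesis using True by (intro exI[of _ "v$2"]) (simp add: vec_eq_iff forall_2 vec_angle_def)
next
  case False
  define x where "x = v$2 / v$1"
  have x: "v$2 = v$1 * x" using False by (simp add: x_def)
  have s: "sqrt (1 + x\<^sup>2) > 0" by (simp add: add_pos_nonneg)
  show ?thesis
  proof (cases "x \<ge> 0")
    case True
    then show ?thesis using False s x
      by (intro exI[of _ "v$1 * sqrt (1 + x\<^sup>2)"])
         (simp add: vec_eq_iff forall_2 vec_angle_def x_def[symmetric] cos_arctan sin_arctan)
  next
    case neg: False
    then show ?thesis using False s x
      by (intro exI[of _ "- (v$1 * sqrt (1 + x\<^sup>2))"])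
         (simp add: vec_eq_iff forall_2 vec_angle_def x_def[symmetric] cos_arctan sin_arctan cos_add sin_add)
  qed
qed

lemma span_dir_inj:
  assumes t: "\<theta> \<in> {0..<pi}" "\<theta>' \<in> {0..<pi}" and s: "span {dir \<theta>} = span {dir \<theta>'}"
  shows "\<theta> = \<theta>'"
proof -
  have "dir \<theta> \<in> span {dir \<theta>'}" using s span_base[of "dir \<theta>" "{dir \<theta>}"] by simp
  then obtain k where k: "dir \<theta> = k *\<^sub>R dir \<theta>'" unfolding span_singleton by blast
  then have "norm (dir \<theta>) = \<bar>k\<bar> * norm (dir \<theta>')" by simp
  then have k1: "k = 1 \<or> k = - 1" by auto
  have c: "cos \<theta> = k * cos \<theta>'" "sin \<theta> = k * sin \<theta>'"
    using arg_cong[OF k, of "\<lambda>v. v$1"] arg_cong[OF k, of "\<lambda>v. v$2"] by simp_all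
  from k1 show ?thesis
  proof
    assume "k = 1"
    then show ?thesis using cos_inj_pi[of \<theta> \<theta>'] t c by auto
  next
    assume "k = - 1"
    moreover have "0 \<le> sin \<theta>" "0 \<le> sin \<theta>'" using t by (auto intro: sin_ge_zero)
    ultimately have "sin \<theta> = 0" "sin \<theta>' = 0" using c by auto
    moreover have "0 < sin x" if "x \<in> {0..<pi}" "x \<noteq> 0" for x using that by (intro sin_gt_zero) auto
    ultimately show ?thesis using t by (metis less_irrefl)
  qed
qed

lemma line_angle_span:
  assumes v: "v \<noteq> 0" shows "line_angle (span {v}) = vec_angle v"
proof -
  obtain k where k: "k \<noteq> 0" "v = k *\<^sub>R dir (vec_angle v)" using vec_angle_dir[OF v] by blast
  have "span {k *\<^sub>R w} = span {w}" for w :: "real^2"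
  proof -
    have "range (\<lambda>c. c *\<^sub>R (k *\<^sub>R w)) = range (\<lambda>c. c *\<^sub>R w)"
    proof safe
      fix c
      show "c *\<^sub>R (k *\<^sub>R w) \<in> range (\<lambda>c. c *\<^sub>R w)" by (rule range_eqI[of _ _ "c * k"]) simp
      show "c *\<^sub>R w \<in> range (\<lambda>c. c *\<^sub>R (k *\<^sub>R w))" by (rule range_eqI[of _ _ "c / k"]) (use k in simp)
    qed
    then show ?thesis unfolding span_singleton .
  qed
  then have s: "span {v} = span {dir (vec_angle v)}" using k(2) by metis
  show ?thesis unfolding line_angle_def
    by (rule the_equality) (use s vec_angle_range[of v] span_dir_inj in auto)
qed

lemma direction_action_eq:
  assumes "invertible A" shows "direction_action A \<theta> = vec_angle (matrix_inv A *v dir \<theta>)"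
proof -
  have nz: "matrix_inv A *v dir \<theta> \<noteq> 0"
    using matrix_inv_cancel(1)[OF assms, of "dir \<theta>"] dir_nonzero[of \<theta>] by (metis matrix_vector_mult_0_right)
  have "(*v) (matrix_inv A) ` span {dir \<theta>} = span ((*v) (matrix_inv A) ` {dir \<theta>})"
    by (rule linear_span_image[symmetric]) (rule matrix_vector_mul_linear)
  then show ?thesis unfolding direction_action_def using line_angle_span[OF nz] by simp
qed

lemma vec_angle_measurable: "vec_angle \<in> borel_measurable borel"
  unfolding vec_angle_def by measurable

lemma dir_measurable [measurable]: "dir \<in> borel_measurable borel"
proof -
  have eq: "dir = (\<lambda>\<theta>. cos \<theta> *\<^sub>R axis 1 1 + sin \<theta> *\<^sub>R axis 2 1)"
    by (simp add: fun_eq_iff vec_eq_iff forall_2 axis_def)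
  show ?thesis unfolding eq by (intro borel_measurable_continuous_onI continuous_intros)
qed

text \<open>The inverse of a positive matrix is, up to the factor \<open>1 / det A\<close>, a matrix with positive diagonal and
  negative off-diagonal entries, which maps the closed second quadrant, except the origin, into the open one. Thus the sign
  of the determinant tells whether the orientation of lines is reversed.\<close>

lemma positive_inverse_dir:
  fixes A :: "real^2^2"
  assumes pos: "\<And>r c. 0 < A$r$c" and inv: "invertible A" and t: "\<theta> \<in> Q2"
  shows "direction_action A \<theta> \<in> {pi/2<..<pi}"
    and "\<theta> \<in> {pi/2<..<pi} ==>
      matrix_inv A *v dir \<theta> = (sgn (det A) * norm (matrix_inv A *v dir \<theta>)) *\<^sub>R dir (direction_action A \<theta>)"
    and "\<theta> \<in> {pi/2<..<pi} ==> direction_action A \<theta> = pi - arctan ((A$1$1 * (- tan \<theta>) + A$2$1) / (A$1$2 * (- tan \<theta>) + A$2$2))"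
proof -
  have d: "det A \<noteq> 0" using inv invertible_det_nz by blast
  let ?w = "matrix_inv A *v dir \<theta>"
  define s where "s = (if \<theta> = 0 then - 1 else 1 :: real)"
  define x where "x = - s * cos \<theta>" define y where "y = s * sin \<theta>"
  have ss: "s * s = 1" by (simp add: s_def)
  have xy: "0 \<le> x \<and> 0 \<le> y \<and> (0 < x \<or> 0 < y)"
  proof (cases "\<theta> = 0")
    case True then show ?thesis by (simp add: x_def y_def s_def)
  next
    case False
    then have "0 < sin \<theta>" using t by (intro sin_gt_zero) (auto simp: Q2_def)
    moreover from this have "cos \<theta> \<le> 0" using t by (auto simp: Q2_def mult_le_0_iff)
    ultimately show ?thesis using False by (simp add: x_def y_def s_def)
  qed
  define P where "P = A$2$2 * x + A$1$2 * y" define R where "R = A$1$1 * y + A$2$1 * x"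
  have "0 \<le> A$2$2 * x" "0 \<le> A$1$2 * y" "0 \<le> A$1$1 * y" "0 \<le> A$2$1 * x"
    using xy by (auto intro!: mult_nonneg_nonneg[OF less_imp_le[OF pos]])
  moreover have "0 < A$2$2 * x \<or> 0 < A$1$2 * y"
    using xy mult_pos_pos[OF pos[of 2 2], of x] mult_pos_pos[OF pos[of 1 2], of y] by blast
  moreover have "0 < A$1$1 * y \<or> 0 < A$2$1 * x"
    using xy mult_pos_pos[OF pos[of 1 1], of y] mult_pos_pos[OF pos[of 2 1], of x] by blast
  ultimately have PR: "0 < P" "0 < R" unfolding P_def R_def by linarith+
  have sx: "cos \<theta> = - s * x" "sin \<theta> = s * y" using ss by (simp_all add: x_def y_def mult.assoc[symmetric])
  have w: "?w $ 1 = - (s / det A) * P" "?w $ 2 = (s / det A) * R"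
    unfolding matrix_inv_2[OF inv] by (simp_all add: sx P_def R_def algebra_simps diff_divide_distrib add_divide_distrib)
  have snz: "s / det A \<noteq> 0" using d by (simp add: s_def)
  have q: "?w $ 2 / ?w $ 1 = - (R / P)" "?w $ 1 \<noteq> 0" using snz PR unfolding w by (auto simp: field_simps)
  have a: "direction_action A \<theta> = pi - arctan (R / P)"
    unfolding direction_action_eq[OF inv] vec_angle_def q using q(2) divide_pos_pos[OF PR(2,1)] by (simp add: arctan_minus not_le del: zero_less_divide_iff)
  have RP: "0 < R / P" using PR by simp
  then show in_range: "direction_action A \<theta> \<in> {pi/2<..<pi}"
    unfolding a using arctan_ubound[of "R / P"] zero_less_arctan_iff[of "R / P"] by auto
  {
    assume t': "\<theta> \<in> {pi/2<..<pi}"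
    then have "\<theta> \<noteq> 0" using pi_gt_zero by auto
    then have s1: "s = 1" by (simp add: s_def)
    have cneg: "cos \<theta> < 0" using t' cos_monotone_0_pi[of "pi/2" \<theta>] by simp
    then have "R / P = (A$1$1 * (- tan \<theta>) + A$2$1) / (A$1$2 * (- tan \<theta>) + A$2$2)"
      unfolding R_def P_def x_def y_def s1 tan_def by (simp add: divide_simps) (simp add: algebra_simps)
    then show "direction_action A \<theta> = pi - arctan ((A$1$1 * (- tan \<theta>) + A$2$1) / (A$1$2 * (- tan \<theta>) + A$2$2))"
      using a by simp
    have nz: "?w \<noteq> 0" using q(2) by auto
    obtain k where k: "k \<noteq> 0" "?w = k *\<^sub>R dir (direction_action A \<theta>)"
      using vec_angle_dir[OF nz] unfolding direction_action_eq[OF inv] by blast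
    have "norm ?w = \<bar>k\<bar>" using arg_cong[OF k(2), of norm] by simp
    moreover have "sgn k = sgn (det A)"
    proof -
      have "0 < sin (direction_action A \<theta>)" using in_range pi_gt_zero by (intro sin_gt_zero) auto
      moreover have "k * sin (direction_action A \<theta>) = (1 / det A) * R"
        using arg_cong[OF k(2), of "\<lambda>v. v$2"] w(2) s1 by simp
      ultimately have "sgn k = sgn ((1 / det A) * R)" by (metis mult.right_neutral sgn_mult sgn_pos)
      then show ?thesis using PR d by (simp add: sgn_mult sgn_divide)
    qed
    ultimately show "?w = (sgn (det A) * norm ?w) *\<^sub>R dir (direction_action A \<theta>)"
      using k by (metis mult_sgn_abs mult.commute)
  }
qed

text \<open>Birkhoff's contraction of the Hilbert metric: in the logarithmic coordinate the derivative of a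
  positive Moebius map is at most \<open>\<bar>a * d - b * c\<bar> / (a * d + b * c)\<close>.\<close>

lemma mobius_log_contraction:
  fixes a b c d L L' :: real
  assumes pos: "0 < a" "0 < b" "0 < c" "0 < d"
  shows "\<bar>ln ((a * exp L + c) / (b * exp L + d)) - ln ((a * exp L' + c) / (b * exp L' + d))\<bar>
    \<le> \<bar>a * d - b * c\<bar> / (a * d + b * c) * \<bar>L - L'\<bar>"
proof -
  define h where "h L = ln (a * exp L + c) - ln (b * exp L + d)" for L
  have p: "0 < a * exp L + c" "0 < b * exp L + d" for L using pos by (simp_all add: add_pos_pos)
  have hd: "(h has_field_derivative (a * exp L / (a * exp L + c) - b * exp L / (b * exp L + d))) (at L)" for L
    unfolding h_def using p[of L] by (auto intro!: derivative_eq_intros simp: mult.commute)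
  have bd: "\<bar>a * exp L / (a * exp L + c) - b * exp L / (b * exp L + d)\<bar> \<le> \<bar>a * d - b * c\<bar> / (a * d + b * c)" for L
  proof -
    let ?e = "exp L"
    have e: "a * ?e / (a * ?e + c) - b * ?e / (b * ?e + d) = ?e * (a * d - b * c) / ((a * ?e + c) * (b * ?e + d))"
      using p[of L] by (simp add: divide_simps less_imp_neq[THEN not_sym]) (simp add: algebra_simps)
    have "(a * d + b * c) * ?e \<le> (a * ?e + c) * (b * ?e + d)"
      using pos by (simp add: algebra_simps)
    moreover have pp: "0 < a * d + b * c" using pos by (simp add: add_pos_pos)
    ultimately have "?e * \<bar>a * d - b * c\<bar> / ((a * ?e + c) * (b * ?e + d)) \<le> ?e * \<bar>a * d - b * c\<bar> / ((a * d + b * c) * ?e)"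
      by (intro divide_left_mono mult_pos_pos p) auto
    also have "\<dots> = \<bar>a * d - b * c\<bar> / (a * d + b * c)" by simp
    finally show ?thesis unfolding e using p[of L] by (simp add: abs_mult)
  qed
  have "\<bar>h L - h L'\<bar> \<le> \<bar>a * d - b * c\<bar> / (a * d + b * c) * \<bar>L - L'\<bar>"
    using field_differentiable_bound[of UNIV h "\<lambda>L. a * exp L / (a * exp L + c) - b * exp L / (b * exp L + d)"
       "\<bar>a * d - b * c\<bar> / (a * d + b * c)" L L'] hd bd by (simp add: has_field_derivative_at_within)
  moreover have "ln ((a * exp L + c) / (b * exp L + d)) = h L" for L
    unfolding h_def using p[of L] by (intro ln_divide_pos)
  ultimately show ?thesis by simp
qed

lemma mobius_log_bounded:
  fixes a b c d L :: real
  assumes pos: "0 < a" "0 < b" "0 < c" "0 < d"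
  shows "\<bar>ln ((a * exp L + c) / (b * exp L + d))\<bar> \<le> \<bar>ln (a / b)\<bar> + \<bar>ln (c / d)\<bar>"
proof -
  have p: "0 < a * exp L + c" "0 < b * exp L + d" using pos by (simp_all add: add_pos_pos)
  let ?r = "(a * exp L + c) / (b * exp L + d)"
  have up: "?r \<le> max (a / b) (c / d)"
  proof -
    have "a \<le> max (a / b) (c / d) * b" "c \<le> max (a / b) (c / d) * d"
      using pos by (simp_all add: pos_divide_le_eq[symmetric])
    then have "a * exp L + c \<le> max (a / b) (c / d) * b * exp L + max (a / b) (c / d) * d"
      by (intro add_mono mult_right_mono) auto
    then show ?thesis using p by (simp add: divide_le_eq algebra_simps)
  qed
  have lo: "min (a / b) (c / d) \<le> ?r"
  proof -
    have "min (a / b) (c / d) * b \<le> a" "min (a / b) (c / d) * d \<le> c"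
      using pos by (simp_all add: pos_le_divide_eq[symmetric])
    then have "min (a / b) (c / d) * b * exp L + min (a / b) (c / d) * d \<le> a * exp L + c"
      by (intro add_mono mult_right_mono) auto
    then show ?thesis using p by (simp add: le_divide_eq algebra_simps)
  qed
  have rp: "0 < ?r" using p by simp
  have mp: "0 < min (a / b) (c / d)" "0 < max (a / b) (c / d)" using pos by (auto simp: less_max_iff_disj)
  have "ln ?r \<le> ln (max (a / b) (c / d))" "ln (min (a / b) (c / d)) \<le> ln ?r"
    using up lo rp mp by (simp_all only: ln_le_cancel_iff)
  then show ?thesis by (auto simp: max_def min_def split: if_splits)
qed

locale positive_matrices =
  fixes A :: "'k::finite => real^2^2"
  assumes positive: "\<And>i r c. 0 < A i $ r $ c" and invertible: "\<And>i. invertible (A i)"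
begin

definition \<phi> :: "'k => real => real" where "\<phi> i \<theta> = direction_action (A i) \<theta>"

abbreviation "Q \<equiv> {pi/2<..<pi}"

lemma Q_subset_Q2: "Q \<subseteq> Q2"
proof
  fix \<theta> assume t: "\<theta> \<in> Q"
  then have "cos \<theta> < 0" using cos_monotone_0_pi[of "pi/2" \<theta>] by simp
  moreover have "0 < sin \<theta>" using t pi_gt_zero by (intro sin_gt_zero) auto
  moreover have "0 \<le> \<theta>" using t pi_gt_zero by auto
  ultimately show "\<theta> \<in> Q2" using t by (auto simp: Q2_def mult_le_0_iff)
qed

lemma \<phi>_Q: "\<theta> \<in> Q2 ==> \<phi> i \<theta> \<in> Q"
  unfolding \<phi>_def by (rule positive_inverse_dir(1)[OF positive invertible])

lemma \<phi>_measurable [measurable]: "\<phi> i \<in> borel_measurable borel"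
proof -
  have "(\<lambda>\<theta>. matrix_inv (A i) *v dir \<theta>) \<in> borel_measurable borel"
    by (rule measurable_compose[OF dir_measurable]) (intro borel_measurable_continuous_onI matrix_vector_mult_linear_continuous_on)
  from measurable_compose[OF this vec_angle_measurable]
  show ?thesis unfolding \<phi>_def direction_action_eq[OF invertible] .
qed

lemma \<phi>_range: "\<phi> i \<theta> \<in> {0..<pi}"
  unfolding \<phi>_def direction_action_eq[OF invertible] by (rule vec_angle_range)

text \<open>The coordinate on the open quadrant in which the projective maps are uniform contractions.\<close>

definition slope_log :: "real => real" where "slope_log \<theta> = ln (- tan \<theta>)"

lemma tan_neg: "\<theta> \<in> Q ==> 0 < - tan \<theta>"
proof -
  assume t: "\<theta> \<in> Q"
  then have "cos \<theta> < 0" using cos_monotone_0_pi[of "pi/2" \<theta>] by simp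
  moreover have "0 < sin \<theta>" using t pi_gt_zero by (intro sin_gt_zero) auto
  ultimately show ?thesis by (simp add: tan_def divide_less_0_iff)
qed

lemma exp_slope_log: "\<theta> \<in> Q ==> exp (slope_log \<theta>) = - tan \<theta>"
  using tan_neg by (simp add: slope_log_def)

lemma angle_slope_log:
  assumes t: "\<theta> \<in> Q" shows "\<theta> = pi - arctan (exp (slope_log \<theta>))"
proof -
  have "tan (pi - \<theta>) = - tan \<theta>" by (simp add: tan_def)
  moreover have "arctan (tan (pi - \<theta>)) = pi - \<theta>" using t by (intro arctan_tan) auto
  ultimately show ?thesis using exp_slope_log[OF t] by simp
qed

lemma slope_log_\<phi>:
  assumes t: "\<theta> \<in> Q"
  shows "slope_log (\<phi> i \<theta>) = ln ((A i$1$1 * exp (slope_log \<theta>) + A i$2$1) / (A i$1$2 * exp (slope_log \<theta>) + A i$2$2))"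
proof -
  let ?r = "(A i$1$1 * exp (slope_log \<theta>) + A i$2$1) / (A i$1$2 * exp (slope_log \<theta>) + A i$2$2)"
  have "\<phi> i \<theta> = pi - arctan ?r"
    unfolding \<phi>_def exp_slope_log[OF t]
    by (rule positive_inverse_dir(3)[OF positive invertible]) (use t Q_subset_Q2 in auto)
  then have "- tan (\<phi> i \<theta>) = tan (arctan ?r)" by (simp add: tan_def)
  then show ?thesis by (simp add: slope_log_def tan_arctan)
qed

definition slope_bound :: real where
  "slope_bound = (\<Sum>i\<in>UNIV. \<bar>ln (A i$1$1 / A i$1$2)\<bar> + \<bar>ln (A i$2$1 / A i$2$2)\<bar>)"

definition slope_rate :: real where
  "slope_rate = Max (range (\<lambda>i. \<bar>A i$1$1 * A i$2$2 - A i$1$2 * A i$2$1\<bar> / (A i$1$1 * A i$2$2 + A i$1$2 * A i$2$1)))"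

lemma slope_rate: "0 \<le> slope_rate" "slope_rate < 1"
proof -
  let ?f = "\<lambda>i. \<bar>A i$1$1 * A i$2$2 - A i$1$2 * A i$2$1\<bar> / (A i$1$1 * A i$2$2 + A i$1$2 * A i$2$1)"
  have p: "0 < A i$1$1 * A i$2$2" "0 < A i$1$2 * A i$2$1" for i using positive by simp_all
  have f: "0 \<le> ?f i \<and> ?f i < 1" for i using p[of i] by (auto simp: divide_less_eq)
  have "slope_rate \<in> range ?f" unfolding slope_rate_def by (rule Max_in) auto
  then show "0 \<le> slope_rate" "slope_rate < 1" using f by auto
qed

lemma slope_log_contract:
  assumes "\<theta> \<in> Q" "\<theta>' \<in> Q"
  shows "\<bar>slope_log (\<phi> i \<theta>) - slope_log (\<phi> i \<theta>')\<bar> \<le> slope_rate * \<bar>slope_log \<theta> - slope_log \<theta>'\<bar>"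
proof -
  let ?f = "\<lambda>i. \<bar>A i$1$1 * A i$2$2 - A i$1$2 * A i$2$1\<bar> / (A i$1$1 * A i$2$2 + A i$1$2 * A i$2$1)"
  have "\<bar>slope_log (\<phi> i \<theta>) - slope_log (\<phi> i \<theta>')\<bar> \<le> ?f i * \<bar>slope_log \<theta> - slope_log \<theta>'\<bar>"
    unfolding slope_log_\<phi>[OF assms(1)] slope_log_\<phi>[OF assms(2)]
    by (rule mobius_log_contraction) (rule positive)+
  also have "\<dots> \<le> slope_rate * \<bar>slope_log \<theta> - slope_log \<theta>'\<bar>"
    unfolding slope_rate_def by (intro mult_right_mono Max_ge) auto
  finally show ?thesis .
qed

lemma slope_log_bounded: "\<theta> \<in> Q ==> \<bar>slope_log (\<phi> i \<theta>)\<bar> \<le> slope_bound"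
proof -
  assume t: "\<theta> \<in> Q"
  have "\<bar>slope_log (\<phi> i \<theta>)\<bar> \<le> \<bar>ln (A i$1$1 / A i$1$2)\<bar> + \<bar>ln (A i$2$1 / A i$2$2)\<bar>"
    unfolding slope_log_\<phi>[OF t] by (rule mobius_log_bounded) (rule positive)+
  also have "\<dots> \<le> slope_bound" unfolding slope_bound_def
    by (rule member_le_sum) auto
  finally show ?thesis .
qed

lemma angle_lipschitz:
  assumes "\<theta> \<in> Q" "\<theta>' \<in> Q" shows "\<bar>\<theta> - \<theta>'\<bar> \<le> \<bar>slope_log \<theta> - slope_log \<theta>'\<bar>"
proof -
  define h where "h L = arctan (exp L)" for L :: real
  have hd: "(h has_field_derivative (exp L / (1 + (exp L)\<^sup>2))) (at L)" for L
    unfolding h_def by (auto intro!: derivative_eq_intros simp: field_simps)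
  have bd: "norm (exp L / (1 + (exp L)\<^sup>2)) \<le> 1" for L :: real
  proof -
    have "exp L \<le> 1 + (exp L)\<^sup>2" using exp_gt_zero[of L] sum_squares_bound[of "exp L" 1] exp_gt_zero[of L] unfolding one_power2 mult_1_right by linarith
    then show ?thesis by (simp add: divide_le_eq add_pos_nonneg)
  qed
  have "norm (h (slope_log \<theta>) - h (slope_log \<theta>')) \<le> 1 * norm (slope_log \<theta> - slope_log \<theta>')"
    by (rule field_differentiable_bound[of UNIV]) (use hd bd in \<open>auto simp: has_field_derivative_at_within\<close>)
  then show ?thesis
    using angle_slope_log[OF assms(1)] angle_slope_log[OF assms(2)] by (simp add: h_def)
qed

text \<open>The quadrant is unbounded in the coordinate \<open>slope_log\<close>, but one step brings it into a bounded
  interval, from where on the distances decay geometrically.\<close>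

lemma orbit_contraction:
  fixes orb :: "nat => (nat => 'k) => real => real"
  assumes orb0: "\<And>a \<theta>. orb 0 a \<theta> = \<theta>" and orbS: "\<And>n a \<theta>. orb (Suc n) a \<theta> = \<phi> (a n) (orb n a \<theta>)" and e: "e > 0"
  shows "\<exists>n. \<forall>a. \<forall>\<theta>\<in>Q. \<forall>\<theta>'\<in>Q. \<bar>orb n a \<theta> - orb n a \<theta>'\<bar> < e"
proof -
  have inQ: "orb n a \<theta> \<in> Q" if "\<theta> \<in> Q" for n a \<theta>
  proof (induction n)
    case (Suc n) then show ?case unfolding orbS using Q_subset_Q2 by (intro \<phi>_Q) blast
  qed (use that orb0 in simp)
  have "\<bar>slope_log (orb (Suc n) a \<theta>) - slope_log (orb (Suc n) a \<theta>')\<bar> \<le> slope_rate ^ n * (2 * slope_bound)"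
    if t: "\<theta> \<in> Q" "\<theta>' \<in> Q" for n a \<theta> \<theta>'
  proof (induction n)
    case 0
    show ?case using slope_log_bounded[OF t(1), of "a 0"] slope_log_bounded[OF t(2), of "a 0"] by (simp add: orbS orb0)
  next
    case (Suc n)
    have "\<bar>slope_log (orb (Suc (Suc n)) a \<theta>) - slope_log (orb (Suc (Suc n)) a \<theta>')\<bar> \<le>
      slope_rate * \<bar>slope_log (orb (Suc n) a \<theta>) - slope_log (orb (Suc n) a \<theta>')\<bar>"
      unfolding orbS[of "Suc n"] by (rule slope_log_contract[OF inQ[OF t(1)] inQ[OF t(2)]])
    also have "\<dots> \<le> slope_rate * (slope_rate ^ n * (2 * slope_bound))"
      using Suc slope_rate(1) by (rule mult_left_mono)
    finally show ?case by simp
  qed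
  then have b: "\<bar>orb (Suc n) a \<theta> - orb (Suc n) a \<theta>'\<bar> \<le> slope_rate ^ n * (2 * slope_bound)"
    if "\<theta> \<in> Q" "\<theta>' \<in> Q" for n a \<theta> \<theta>'
    using order_trans[OF angle_lipschitz[OF inQ[OF that(1), of "Suc n" a] inQ[OF that(2), of "Suc n" a]]] that by blast
  have "(\<lambda>n. slope_rate ^ n * (2 * slope_bound)) \<longlonglongrightarrow> 0 * (2 * slope_bound)"
    using slope_rate by (intro tendsto_mult_right LIMSEQ_realpow_zero) auto
  then have "\<forall>\<^sub>F n in sequentially. slope_rate ^ n * (2 * slope_bound) < e"
    using e by (intro order_tendstoD) auto
  then obtain n where "slope_rate ^ n * (2 * slope_bound) < e" by (auto simp: eventually_sequentially)
  then show ?thesis using order_le_less_trans[OF b] by (intro exI[of _ "Suc n"] allI ballI) blast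
qed

text \<open>The factor by which lengths on lines in direction \<open>\<theta>\<close> grow under the inverse of \<open>A i\<close>.\<close>

definition stretch :: "'k => real => real" where
  "stretch i \<theta> = norm (matrix_inv (A i) *v dir \<theta>)"

lemma stretch_measurable [measurable]: "stretch i \<in> borel_measurable borel"
proof -
  have "(\<lambda>\<theta>. matrix_inv (A i) *v dir \<theta>) \<in> borel_measurable borel"
    by (rule measurable_compose[OF dir_measurable]) (intro borel_measurable_continuous_onI matrix_vector_mult_linear_continuous_on)
  then show ?thesis unfolding stretch_def by measurable
qed

lemma stretch_pos: "0 < stretch i \<theta>"
proof -
  have "matrix_inv (A i) *v dir \<theta> \<noteq> 0"
    using matrix_inv_cancel(1)[OF invertible, of i "dir \<theta>"] dir_nonzero[of \<theta>] by (metis matrix_vector_mult_0_right)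
  then show ?thesis by (simp add: stretch_def)
qed

lemma stretch_dir:
  "\<theta> \<in> Q ==> matrix_inv (A i) *v dir \<theta> = (sgn (det (A i)) * stretch i \<theta>) *\<^sub>R dir (\<phi> i \<theta>)"
  unfolding stretch_def \<phi>_def
  by (rule positive_inverse_dir(2)[OF positive invertible]) (use Q_subset_Q2 in auto)

lemma stretch_bounded: "\<exists>C. \<forall>i \<theta>. stretch i \<theta> \<le> C"
proof -
  have "stretch i \<theta> \<le> onorm ((*v) (matrix_inv (A i)))" for i \<theta>
    using onorm[of "(*v) (matrix_inv (A i))" "dir \<theta>"] by (simp add: stretch_def matrix_vector_mul_bounded_linear)
  moreover have "onorm ((*v) (matrix_inv (A i))) \<le> Max (range (\<lambda>i. onorm ((*v) (matrix_inv (A i)))))" for i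
    by (intro Max_ge) auto
  ultimately show ?thesis by (meson order_trans)
qed

end

section \<open>Self-affine measures\<close>

locale self_affine = positive_matrices A for A :: "'k::finite => real^2^2" +
  fixes d :: "'k => real^2" and p :: "'k pmf"
  assumes norm_less_one: "\<And>i. onorm ((*v) (A i)) < 1"
    and into_disk: "\<And>i. affine_map (A i) (d i) ` cball 0 1 \<subseteq> cball 0 1"
    and separation: "\<And>i j. i \<noteq> j ==> affine_map (A i) (d i) ` cball 0 1 \<inter> affine_map (A j) (d j) ` cball 0 1 = {}"
begin

abbreviation "T \<equiv> \<lambda>i. affine_map (A i) (d i)"

abbreviation "disk \<equiv> cball (0::real^2) 1"

lemma T_diff: "T i x - T i y = A i *v (x - y)"
  by (simp add: affine_map_def matrix_vector_mult_diff_distrib)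

definition rate :: real where "rate = Max (range (\<lambda>i. onorm ((*v) (A i))))"

lemma rate: "0 \<le> rate" "rate < 1" "onorm ((*v) (A i)) \<le> rate"
proof -
  have "rate \<in> range (\<lambda>i. onorm ((*v) (A i)))" unfolding rate_def by (rule Max_in) auto
  then show "0 \<le> rate" "rate < 1"
    using norm_less_one onorm_pos_le[OF matrix_vector_mul_bounded_linear] by auto
  show "onorm ((*v) (A i)) \<le> rate" unfolding rate_def by (rule Max_ge) auto
qed

lemma T_lipschitz: "norm (T i x - T i y) \<le> rate * norm (x - y)"
proof -
  have "norm (A i *v (x - y)) \<le> onorm ((*v) (A i)) * norm (x - y)"
    by (rule onorm[OF matrix_vector_mul_bounded_linear])
  also have "\<dots> \<le> rate * norm (x - y)" by (intro mult_right_mono rate) simp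
  finally show ?thesis by (simp add: T_diff)
qed

lemma T_disk: "x \<in> disk ==> T i x \<in> disk"
  using into_disk by blast

lemma continuous_T: "continuous_on S (T i)"
  unfolding affine_map_def
  by (intro continuous_intros matrix_vector_mult_linear_continuous_on)

lemma T_measurable [measurable]: "T i \<in> borel_measurable borel"
  by (intro borel_measurable_continuous_onI continuous_T)

lemma prefix_map_disk: "x \<in> disk ==> prefix_map T a n x \<in> disk"
  by (induction n arbitrary: x) (use T_disk in auto)

lemma prefix_map_lipschitz: "norm (prefix_map T a n x - prefix_map T a n y) \<le> rate ^ n * norm (x - y)"
proof (induction n arbitrary: x y)
  case (Suc n)
  have "norm (prefix_map T a n (T (a n) x) - prefix_map T a n (T (a n) y)) \<le> rate ^ n * norm (T (a n) x - T (a n) y)"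
    by (rule Suc)
  also have "\<dots> \<le> rate ^ n * (rate * norm (x - y))"
    using rate(1) by (intro mult_left_mono T_lipschitz) simp
  finally show ?case by (simp add: mult_ac)
qed simp

lemma prefix_map_add: "\<exists>y\<in>disk. prefix_map T a (n + m) 0 = prefix_map T a n y"
proof -
  have "\<exists>y\<in>disk. prefix_map T a (n + m) x = prefix_map T a n y" if "x \<in> disk" for x
    using that
  proof (induction m arbitrary: x)
    case (Suc m)
    from Suc.IH[OF T_disk[OF Suc.prems]] show ?case by simp
  qed auto
  then show ?thesis by simp
qed

lemma prefix_map_Cauchy: "Cauchy (\<lambda>n. prefix_map T a n 0)"
proof (rule metric_CauchyI)
  fix e :: real assume e: "e > 0"
  have "(\<lambda>n. rate ^ n) \<longlonglongrightarrow> 0" using rate by (intro LIMSEQ_realpow_zero) auto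
  then have "\<forall>\<^sub>F n in sequentially. rate ^ n < e / 2" using e by (intro order_tendstoD) auto
  then obtain N where N: "rate ^ N < e / 2" by (auto simp: eventually_sequentially)
  have near: "norm (prefix_map T a n 0 - prefix_map T a N 0) < e / 2" if n: "n \<ge> N" for n
  proof -
    obtain y where y: "y \<in> disk" "prefix_map T a n 0 = prefix_map T a N y"
      using prefix_map_add[of a N "n - N"] n by auto
    have "norm (prefix_map T a N y - prefix_map T a N 0) \<le> rate ^ N * norm (y - 0)" by (rule prefix_map_lipschitz)
    also have "\<dots> \<le> rate ^ N * 1" using y rate(1) by (intro mult_left_mono) auto
    finally show ?thesis using N y by simp
  qed
  show "\<exists>M. \<forall>m\<ge>M. \<forall>n\<ge>M. dist (prefix_map T a m 0) (prefix_map T a n 0) < e"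
  proof (intro exI allI impI)
    fix m n assume "N \<le> m" "N \<le> n"
    from near[OF this(1)] near[OF this(2)]
    show "dist (prefix_map T a m 0) (prefix_map T a n 0) < e"
      using dist_triangle_half_l[of "prefix_map T a m 0" "prefix_map T a N 0" e "prefix_map T a n 0"]
      by (simp add: dist_norm)
  qed
qed

lemma coding_limit: "(\<lambda>n. prefix_map T a n 0) \<longlonglongrightarrow> coding T a"
  unfolding coding_def using Cauchy_convergent[OF prefix_map_Cauchy] convergent_LIMSEQ_iff by blast

lemma coding_disk: "coding T a \<in> disk"
  by (rule closed_sequentially[OF closed_cball _ coding_limit]) (intro prefix_map_disk, simp)

lemma prefix_map_Suc: "prefix_map T a (Suc n) x = T (a 0) (prefix_map T (\<lambda>n. a (Suc n)) n x)"
  by (induction n arbitrary: x) simp_all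

lemma coding_Suc: "coding T a = T (a 0) (coding T (\<lambda>n. a (Suc n)))"
proof -
  have "(\<lambda>n. T (a 0) (prefix_map T (\<lambda>n. a (Suc n)) n 0)) \<longlonglongrightarrow> T (a 0) (coding T (\<lambda>n. a (Suc n)))"
    by (rule continuous_on_tendsto_compose[OF continuous_T[of UNIV] coding_limit]) auto
  then have "(\<lambda>n. prefix_map T a (Suc n) 0) \<longlonglongrightarrow> T (a 0) (coding T (\<lambda>n. a (Suc n)))"
    by (simp only: prefix_map_Suc)
  then show ?thesis using LIMSEQ_unique[OF LIMSEQ_Suc[OF coding_limit]] by blast
qed

lemma coding_measurable [measurable]: "coding T \<in> bernoulli_measure p \<rightarrow>\<^sub>M borel"
proof (rule borel_measurable_LIMSEQ_metric)
  have "(\<lambda>a. prefix_map T a n (g a)) \<in> bernoulli_measure p \<rightarrow>\<^sub>M borel" if "g \<in> bernoulli_measure p \<rightarrow>\<^sub>M borel" for g n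
    using that
  proof (induction n arbitrary: g)
    case (Suc n)
    have "(\<lambda>a. T (a n) (g a)) \<in> bernoulli_measure p \<rightarrow>\<^sub>M borel"
      using measurable_compose_countable[where f="\<lambda>i a. T i (g a)" and g="\<lambda>a. a n",
        OF measurable_compose[OF Suc.prems T_measurable] bernoulli_coordinate_measurable] .
    from Suc.IH[OF this] show ?case by simp
  qed simp
  then show "(\<lambda>a. prefix_map T a n 0) \<in> bernoulli_measure p \<rightarrow>\<^sub>M borel" for n by simp
qed (rule coding_limit)

abbreviation "\<mu> \<equiv> self_affine_measure T p"

lemma sets_\<mu> [measurable_cong, simp]: "sets \<mu> = sets borel" and space_\<mu> [simp]: "space \<mu> = UNIV"
  by (simp_all add: self_affine_measure_def)

lemma prob_space_\<mu>: "prob_space \<mu>"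
  unfolding self_affine_measure_def
  by (rule prob_space.prob_space_distr[OF prob_space_bernoulli_measure]) simp

lemma nn_integral_\<mu>: "f \<in> borel_measurable borel ==> (\<integral>\<^sup>+z. f z \<partial>\<mu>) = (\<integral>\<^sup>+a. f (coding T a) \<partial>bernoulli_measure p)"
  unfolding self_affine_measure_def by (rule nn_integral_distr) simp_all

lemma nn_integral_\<mu>_self_similar:
  assumes f [measurable]: "f \<in> borel_measurable borel"
  shows "(\<integral>\<^sup>+z. f z \<partial>\<mu>) = (\<integral>\<^sup>+i. \<integral>\<^sup>+z. f (T i z) \<partial>\<mu> \<partial>measure_pmf p)"
proof -
  have "(\<integral>\<^sup>+z. f z \<partial>\<mu>) = (\<integral>\<^sup>+i. \<integral>\<^sup>+a. f (coding T (case_nat i a)) \<partial>bernoulli_measure p \<partial>measure_pmf p)"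
    unfolding nn_integral_\<mu>[OF f] by (rule nn_integral_bernoulli_first) measurable
  also have "\<dots> = (\<integral>\<^sup>+i. \<integral>\<^sup>+a. f (T i (coding T a)) \<partial>bernoulli_measure p \<partial>measure_pmf p)"
    by (subst coding_Suc) simp
  also have "\<dots> = (\<integral>\<^sup>+i. \<integral>\<^sup>+z. f (T i z) \<partial>\<mu> \<partial>measure_pmf p)"
    by (intro nn_integral_cong nn_integral_\<mu>[symmetric]) measurable
  finally show ?thesis .
qed

lemma AE_\<mu>_iff:
  assumes "{z. R z} \<in> sets borel"
  shows "(AE z in \<mu>. R z) \<longleftrightarrow> (AE a in bernoulli_measure p. R (coding T a))"
  unfolding self_affine_measure_def using assms by (intro AE_distr_iff) auto

lemma AE_\<mu>_coding: "AE z in \<mu>. R z ==> AE a in bernoulli_measure p. R (coding T a)"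
  unfolding self_affine_measure_def by (rule AE_distrD[OF coding_measurable])

lemma compact_T_disk: "compact (T i ` disk)"
  by (intro compact_continuous_image continuous_T compact_cball)

lemma T_disk_sets [measurable]: "T i ` disk \<in> sets borel"
  by (intro borel_compact compact_T_disk)

lemma AE_\<mu>_cylinders: "AE z in \<mu>. z \<in> (\<Union>j. T j ` disk)"
proof (subst AE_\<mu>_iff)
  show "AE a in bernoulli_measure p. coding T a \<in> (\<Union>j. T j ` disk)"
    by (rule AE_I2) (use coding_Suc coding_disk in blast)
  have "{z. z \<in> (\<Union>j. T j ` disk)} = (\<Union>j. T j ` disk)" by auto
  also have "\<dots> \<in> sets borel" by measurable
  finally show "{z. z \<in> (\<Union>j. T j ` disk)} \<in> sets borel" .
qed

lemma AE_\<mu>_disk: "AE z in \<mu>. z \<in> disk"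
  using AE_\<mu>_cylinders by eventually_elim (use T_disk in blast)

lemma cylinder_gap: "\<exists>\<delta>>0. \<forall>i. \<forall>z\<in>T i ` disk. \<forall>z'\<in>(\<Union>j. T j ` disk). dist z z' < \<delta> --> z' \<in> T i ` disk"
proof -
  have ex: "\<exists>\<delta>>0. \<forall>z\<in>T i ` disk. \<forall>z'\<in>(\<Union>j\<in>-{i}. T j ` disk). \<delta> \<le> dist z z'" for i
  proof (rule separate_compact_closed[OF compact_T_disk])
    show "closed (\<Union>j\<in>-{i}. T j ` disk)" by (intro closed_UN compact_imp_closed compact_T_disk ballI) simp
    show "T i ` disk \<inter> (\<Union>j\<in>-{i}. T j ` disk) = {}" using separation by blast
  qed
  define \<delta> where "\<delta> i = (SOME r. r > 0 \<and> (\<forall>z\<in>T i ` disk. \<forall>z'\<in>(\<Union>j\<in>-{i}. T j ` disk). r \<le> dist z z'))" for i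
  have d0: "\<delta> i > 0 \<and> (\<forall>z\<in>T i ` disk. \<forall>z'\<in>(\<Union>j\<in>-{i}. T j ` disk). \<delta> i \<le> dist z z')" for i
    unfolding \<delta>_def by (rule someI_ex) (use ex in blast)
  have \<delta>1: "\<delta> i > 0" for i using d0 by (rule conjunct1)
  have \<delta>2: "\<delta> i \<le> dist z z'" if "z \<in> T i ` disk" "z' \<in> (\<Union>j\<in>-{i}. T j ` disk)" for i z z'
    using bspec[OF bspec[OF conjunct2[OF d0] that(1)] that(2)] .
  have "Min (range \<delta>) \<in> range \<delta>" by (rule Min_in) auto
  then have "Min (range \<delta>) > 0" using \<delta>1 by auto
  moreover have "z' \<in> T i ` disk" if z: "z \<in> T i ` disk" "z' \<in> (\<Union>j. T j ` disk)" "dist z z' < Min (range \<delta>)" for i z z'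
  proof (rule ccontr)
    assume "z' \<notin> T i ` disk"
    obtain j where j: "z' \<in> T j ` disk" using z(2) by (rule UN_E)
    have "j \<noteq> i" using j \<open>z' \<notin> T i ` disk\<close> by metis
    then have "z' \<in> (\<Union>j\<in>-{i}. T j ` disk)" using j by (intro UN_I) simp_all
    then have "\<delta> i \<le> dist z z'" by (rule \<delta>2[OF z(1)])
    moreover have "Min (range \<delta>) \<le> \<delta> i" by (rule Min_le) auto
    ultimately show False using z(3) by linarith
  qed
  ultimately show ?thesis by (intro exI[of _ "Min (range \<delta>)"] conjI allI ballI impI)
qed

end

locale self_affine_furstenberg = self_affine A d p for A :: "'k::finite => real^2^2" and d and p +
  fixes \<mu>F :: "real measure"
  assumes furstenberg: "furstenberg_measure A p \<mu>F"
begin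

text \<open>The Furstenberg measure as a Borel measure on the whole line, on which the maps \<open>\<phi> i\<close> act.\<close>

definition Th :: "real measure" where "Th = distr \<mu>F borel (\<lambda>\<theta>. \<theta>)"

lemma sets_\<mu>F: "sets \<mu>F = sets (restrict_space borel {0..<pi})"
  using furstenberg by (simp add: furstenberg_measure_def)

lemma space_\<mu>F: "space \<mu>F = {0..<pi}"
  using sets_eq_imp_space_eq[OF sets_\<mu>F] by (simp add: space_restrict_space)

lemma id_\<mu>F_measurable: "(\<lambda>\<theta>. \<theta>) \<in> borel_measurable \<mu>F"
  by (subst measurable_cong_sets[OF sets_\<mu>F refl]) (rule measurable_restrict_space1, simp)

sublocale \<mu>F: prob_space \<mu>F
  using furstenberg by (simp add: furstenberg_measure_def)

sublocale Th: prob_space Th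
  unfolding Th_def by (rule \<mu>F.prob_space_distr[OF id_\<mu>F_measurable])

lemma sets_Th [measurable_cong, simp]: "sets Th = sets borel" and space_Th [simp]: "space Th = UNIV"
  by (simp_all add: Th_def)

lemma \<mu>F_sets_Int: "B \<in> sets borel ==> B \<inter> {0..<pi} \<in> sets \<mu>F"
  by (simp add: sets_\<mu>F sets_restrict_space_iff)

lemma measure_Th: "B \<in> sets borel ==> measure Th B = measure \<mu>F (B \<inter> {0..<pi})"
  unfolding Th_def by (subst measure_distr) (auto simp: id_\<mu>F_measurable space_\<mu>F vimage_def intro!: arg_cong[where f="measure \<mu>F"])

lemma AE_Th_\<mu>F: "AE \<theta> in Th. R \<theta> ==> AE \<theta> in \<mu>F. R \<theta>"
  unfolding Th_def by (rule AE_distrD[OF id_\<mu>F_measurable])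

lemma \<phi>_vimage: "B \<in> sets borel ==> \<phi> i -` B \<in> sets borel"
  using measurable_sets[OF \<phi>_measurable, of B i] by simp

lemma measure_Th_stationary:
  assumes B: "B \<in> sets borel"
  shows "measure Th B = (\<Sum>i\<in>UNIV. pmf p i * measure Th (\<phi> i -` B))"
proof -
  have e: "direction_action (A i) -` (B \<inter> {0..<pi}) \<inter> {0..<pi} = \<phi> i -` B \<inter> {0..<pi}" for i
    using \<phi>_range[of i] by (auto simp: \<phi>_def)
  have "measure \<mu>F (B \<inter> {0..<pi}) = (\<Sum>i\<in>UNIV. pmf p i * measure \<mu>F (direction_action (A i) -` (B \<inter> {0..<pi}) \<inter> {0..<pi}))"
    using furstenberg \<mu>F_sets_Int[OF B] unfolding furstenberg_measure_def by blast
  then show ?thesis unfolding e using B \<phi>_vimage[OF B] by (simp add: measure_Th)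
qed

text \<open>The closed quadrant has full measure, every map sends it into the open one, and \<open>Th\<close> is stationary.\<close>

lemma Th_Q: "AE \<theta> in Th. \<theta> \<in> Q"
proof -
  have Q2: "Q2 \<in> sets \<mu>F"
    using furstenberg measure_notin_sets[of Q2 \<mu>F] by (auto simp: furstenberg_measure_def)
  have "measure Th (\<phi> i -` Q) = 1" for i
  proof -
    have "1 = measure \<mu>F Q2" using furstenberg by (simp add: furstenberg_measure_def)
    also have "\<dots> \<le> measure \<mu>F (\<phi> i -` Q \<inter> {0..<pi})"
      using \<phi>_Q by (intro \<mu>F.finite_measure_mono \<mu>F_sets_Int \<phi>_vimage) (auto simp: Q2_def)
    also have "\<dots> = measure Th (\<phi> i -` Q)" by (simp add: measure_Th \<phi>_vimage)
    finally show ?thesis using Th.prob_le_1[of "\<phi> i -` Q"] by simp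
  qed
  then have "measure Th Q = (\<Sum>i\<in>UNIV. pmf p i)" by (subst measure_Th_stationary) simp_all
  also have "\<dots> = 1" by (rule sum_pmf_eq_1) auto
  finally show ?thesis by (intro Th.AE_prob_1) simp
qed

sublocale random_maps Th p \<phi>
proof
  show "\<phi> i \<in> Th \<rightarrow>\<^sub>M Th" for i
    by (simp cong: measurable_cong_sets)
  fix B assume "B \<in> sets Th"
  then have B: "B \<in> sets borel" by simp
  have "(\<integral>\<^sup>+i. emeasure Th (\<phi> i -` B \<inter> space Th) \<partial>measure_pmf p) = (\<Sum>i\<in>UNIV. emeasure Th (\<phi> i -` B) * ennreal (pmf p i))"
    by (subst nn_integral_measure_pmf_support[where A=UNIV]) auto
  also have "\<dots> = (\<Sum>i\<in>UNIV. ennreal (pmf p i * measure Th (\<phi> i -` B)))"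
    by (simp add: Th.emeasure_eq_measure ennreal_mult mult.commute)
  also have "\<dots> = ennreal (\<Sum>i\<in>UNIV. pmf p i * measure Th (\<phi> i -` B))"
    by (rule sum_ennreal) simp
  finally show "emeasure Th B = (\<integral>\<^sup>+i. emeasure Th (\<phi> i -` B \<inter> space Th) \<partial>measure_pmf p)"
    by (simp add: Th.emeasure_eq_measure measure_Th_stationary[OF B])
qed

sublocale signed_contracting_maps Th p \<phi> Q "\<lambda>i. sgn (det (A i))"
proof
  show "sets Th = sets borel" "AE \<theta> in Th. \<theta> \<in> Q" by (simp, rule Th_Q)
  show "\<exists>n. \<forall>a. \<forall>\<theta>\<in>Q. \<forall>\<theta>'\<in>Q. \<bar>random_orbit n a \<theta> - random_orbit n a \<theta>'\<bar> < e" if "e > 0" for e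
    by (rule orbit_contraction[OF _ _ that]) simp_all
  show "sgn (det (A i)) = 1 \<or> sgn (det (A i)) = - 1" for i
    using invertible[of i] invertible_det_nz by (auto simp: sgn_if)
qed

end

section \<open>Disintegration over a product\<close>

text \<open>Integrate over the set where the inequality fails.\<close>

lemma AE_le_of_integrals:
  fixes f g :: "'a => ennreal"
  assumes [measurable]: "f \<in> borel_measurable M" "g \<in> borel_measurable M"
    and fin: "(\<integral>\<^sup>+x. g x \<partial>M) < \<infinity>"
    and le: "\<And>B. B \<in> sets M ==> (\<integral>\<^sup>+x. indicator B x * f x \<partial>M) \<le> (\<integral>\<^sup>+x. indicator B x * g x \<partial>M)"
  shows "AE x in M. f x \<le> g x"
proof -
  define N where "N = {x \<in> space M. g x < f x}"
  have N [measurable]: "N \<in> sets M" unfolding N_def by measurable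
  have finN: "(\<integral>\<^sup>+x. indicator N x * g x \<partial>M) < \<infinity>"
    by (rule le_less_trans[OF nn_integral_mono fin]) (auto simp: indicator_def)
  have "(\<integral>\<^sup>+x. indicator N x * f x - indicator N x * g x \<partial>M) =
    (\<integral>\<^sup>+x. indicator N x * f x \<partial>M) - (\<integral>\<^sup>+x. indicator N x * g x \<partial>M)"
    using finN by (intro nn_integral_diff) (auto simp: N_def indicator_def less_imp_le)
  also have "\<dots> = 0" 
    using le[OF N] le_less_trans[OF le[OF N] finN] by (intro diff_eq_0_ennreal) auto
  finally have "AE x in M. indicator N x * f x - indicator N x * g x = 0"
    by (subst (asm) nn_integral_0_iff_AE) auto
  moreover have "AE x in M. g x \<noteq> \<infinity>" using fin by (intro nn_integral_PInf_AE) auto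
  ultimately show ?thesis
    using AE_space
  proof eventually_elim
    case (elim x)
    show ?case
    proof (rule ccontr)
      assume "\<not> f x \<le> g x"
      then have "x \<in> N" using elim by (simp add: N_def)
      then have "f x - g x = 0" using elim by simp
      then show False using \<open>\<not> f x \<le> g x\<close> elim(2) by (metis diff_gt_0_iff_gt_ennreal less_irrefl not_le)
    qed
  qed
qed

lemma AE_eq_of_integrals:
  fixes f g :: "'a => ennreal"
  assumes "f \<in> borel_measurable M" "g \<in> borel_measurable M" "(\<integral>\<^sup>+x. g x \<partial>M) < \<infinity>"
    and eq: "\<And>B. B \<in> sets M ==> (\<integral>\<^sup>+x. indicator B x * f x \<partial>M) = (\<integral>\<^sup>+x. indicator B x * g x \<partial>M)"
  shows "AE x in M. f x = g x"
proof -
  have "(\<integral>\<^sup>+x. indicator (space M) x * f x \<partial>M) = (\<integral>\<^sup>+x. f x \<partial>M)"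
    "(\<integral>\<^sup>+x. indicator (space M) x * g x \<partial>M) = (\<integral>\<^sup>+x. g x \<partial>M)"
    by (intro nn_integral_cong; simp)+
  then have "(\<integral>\<^sup>+x. f x \<partial>M) < \<infinity>" using eq[OF sets.top] assms(3) by simp
  then have "AE x in M. f x \<le> g x" "AE x in M. g x \<le> f x"
    using assms by (auto intro!: AE_le_of_integrals)
  then show ?thesis by eventually_elim auto
qed

lemma borel_eq_rat_atMost: "sets (borel :: real measure) = sigma_sets UNIV (range (\<lambda>q. {..real_of_rat q}))"
proof
  interpret sigma_algebra UNIV "sigma_sets UNIV (range (\<lambda>q. {..real_of_rat q}))"
    by (rule sigma_algebra_sigma_sets) auto
  have "{..a} \<in> sigma_sets UNIV (range (\<lambda>q. {..real_of_rat q}))" for a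
  proof -
    have "{..a} = (\<Inter>q\<in>{q. a < real_of_rat q}. {..real_of_rat q})"
    proof (intro set_eqI iffI)
      fix x assume x: "x \<in> (\<Inter>q\<in>{q. a < real_of_rat q}. {..real_of_rat q})"
      have "x \<le> a"
      proof (rule ccontr)
        assume "\<not> x \<le> a"
        then obtain q where "a < real_of_rat q" "real_of_rat q < x" using of_rat_dense[of a x] by auto
        then show False using x by force
      qed
      then show "x \<in> {..a}" by simp
    qed auto
    moreover have "\<exists>q. a < real_of_rat q" using of_rat_dense[of a "a + 1"] by auto
    ultimately show ?thesis using countable_INT'[of "{q. a < real_of_rat q}" "\<lambda>q. {..real_of_rat q}"] by auto
  qed
  then have "range (atMost :: real => _) \<subseteq> sigma_sets UNIV (range (\<lambda>q. {..real_of_rat q}))" by auto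
  from sigma_sets_subset[OF this] show "sets (borel :: real measure) \<subseteq> sigma_sets UNIV (range (\<lambda>q. {..real_of_rat q}))"
    unfolding borel_eq_atMost by simp
  have r: "range (\<lambda>q. {..real_of_rat q}) \<subseteq> sets (borel :: real measure)" by auto
  from sets.sigma_sets_subset[OF r]
  show "sigma_sets UNIV (range (\<lambda>q. {..real_of_rat q})) \<subseteq> sets (borel :: real measure)" by simp
qed

lemma Int_stable_rat_atMost: "Int_stable (range (\<lambda>q. {..real_of_rat q}))"
proof (rule Int_stableI)
  fix a b assume "a \<in> range (\<lambda>q. {..real_of_rat q})" "b \<in> range (\<lambda>q. {..real_of_rat q})"
  then obtain q r where "a = {..real_of_rat q}" "b = {..real_of_rat r}" by auto
  then have "a \<inter> b = {..real_of_rat (min q r)}" by (auto simp: min_def of_rat_less_eq intro: order_trans)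
  then show "a \<inter> b \<in> range (\<lambda>q. {..real_of_rat q})" by blast
qed

lemma finite_measure_eqI_rat:
  assumes M: "sets M = sets borel" and N: "sets N = sets borel" and fin: "finite_measure M"
    and eq: "\<And>q. emeasure M {..real_of_rat q} = emeasure N {..real_of_rat q}"
  shows "M = N"
proof (rule measure_eqI_generator_eq[OF Int_stable_rat_atMost, where \<Omega>=UNIV and A="\<lambda>n. {..real_of_rat (of_nat n)}"])
  show "sets M = sigma_sets UNIV (range (\<lambda>q. {..real_of_rat q}))" "sets N = sigma_sets UNIV (range (\<lambda>q. {..real_of_rat q}))"
    using M N borel_eq_rat_atMost by simp_all
  show "range (\<lambda>n. {..real_of_rat (of_nat n)}) \<subseteq> range (\<lambda>q. {..real_of_rat q})"
    by (intro image_subsetI rangeI)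
  show "(\<Union>n. {..real_of_rat (of_nat n)}) = UNIV"
    using real_arch_simple by (auto simp: of_rat_of_nat_eq)
  show "emeasure M {..real_of_rat (of_nat n)} \<noteq> \<infinity>" for n
    using finite_measure.emeasure_finite[OF fin] by simp
qed (use eq in auto)

text \<open>The distribution function is the infimum of \<open>f\<close> over the larger rational numbers. Right continuity of
  \<open>f\<close> along the rationals ensures that this extends \<open>f\<close>.\<close>

lemma distribution_from_rational_cdf:
  fixes f :: "rat => real"
  assumes mono: "\<And>q r. q \<le> r ==> f q \<le> f r" and b: "\<And>q. 0 \<le> f q" "\<And>q. f q \<le> 1"
    and rc: "\<And>q e. e > 0 ==> \<exists>r>q. f r < f q + e"
    and lo: "\<And>e. e > 0 ==> \<exists>q. f q < e" and hi: "\<And>e. e > 0 ==> \<exists>q. f q > 1 - e"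
  shows "\<exists>N. real_distribution N \<and> (\<forall>q. measure N {..real_of_rat q} = f q)"
proof -
  define G where "G x = (INF q\<in>{q. x < real_of_rat q}. f q)" for x
  have ne: "{q. x < real_of_rat q} \<noteq> {}" for x using of_rat_dense[of x "x + 1"] by auto
  have bdd: "bdd_below (f ` S)" for S using b by (intro bdd_belowI[of _ 0]) auto
  have up: "G x \<le> f q" if "x < real_of_rat q" for x q
    unfolding G_def using that by (intro cINF_lower bdd) auto
  have low: "c \<le> G x" if "\<And>q. x < real_of_rat q ==> c \<le> f q" for x c
    unfolding G_def using that by (intro cINF_greatest ne) auto
  have Gq: "G (real_of_rat q) = f q" for q
  proof (rule antisym)
    show "f q \<le> G (real_of_rat q)" by (rule low) (auto intro!: mono simp: of_rat_less)
    show "G (real_of_rat q) \<le> f q"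
    proof (rule field_le_epsilon)
      fix e :: real assume "e > 0"
      then obtain r where "r > q" "f r < f q + e" using rc by blast
      then show "G (real_of_rat q) \<le> f q + e" using up[of "real_of_rat q" r] by (simp add: of_rat_less)
    qed
  qed
  have Gm: "G x \<le> G y" if "x \<le> y" for x y
    by (rule low) (use that in \<open>auto intro!: up\<close>)
  have near: "\<exists>q. x < real_of_rat q \<and> f q < G x + e" if "e > 0" for x e
  proof (rule ccontr)
    assume "\<nexists>q. x < real_of_rat q \<and> f q < G x + e"
    then have "G x + e \<le> f q" if "x < real_of_rat q" for q using that by (meson not_le)
    then have "G x + e \<le> G x" by (rule low)
    then show False using that by simp
  qed
  have Grc: "continuous (at_right x) G" for x
    unfolding continuous_within
  proof (rule tendstoI)
    fix e :: real assume e: "e > 0"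
    obtain q where q: "x < real_of_rat q" "f q < G x + e" using near[OF e] by blast
    have "\<forall>\<^sub>F y in at_right x. x < y \<and> y < real_of_rat q"
      using q(1) by (auto simp: eventually_at_right_field)
    then show "\<forall>\<^sub>F y in at_right x. dist (G y) (G x) < e"
    proof eventually_elim
      case (elim y)
      have "G x \<le> G y" "G y \<le> f q" using elim by (auto intro: Gm up)
      then show ?case using q by (simp add: dist_real_def)
    qed
  qed
  have G0: "(G \<longlongrightarrow> 0) at_bot"
  proof (rule tendstoI)
    fix e :: real assume "e > 0"
    then obtain q where q: "f q < e" using lo by blast
    have "\<forall>\<^sub>F y in at_bot. y < real_of_rat q" by (rule eventually_gt_at_bot)
    then show "\<forall>\<^sub>F y in at_bot. dist (G y) 0 < e"
    proof eventually_elim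
      case (elim y)
      have "0 \<le> G y" "G y \<le> f q" using elim b by (auto intro: low up)
      then show ?case using q by (simp add: dist_real_def)
    qed
  qed
  have G1: "(G \<longlongrightarrow> 1) at_top"
  proof (rule tendstoI)
    fix e :: real assume "e > 0"
    then obtain q where q: "f q > 1 - e" using hi by blast
    have "\<forall>\<^sub>F y in at_top. real_of_rat q < y" by (rule eventually_gt_at_top)
    then show "\<forall>\<^sub>F y in at_top. dist (G y) 1 < e"
    proof eventually_elim
      case (elim y)
      obtain r where r: "y < real_of_rat r" using ne[of y] by auto
      have "G y \<le> 1" using up[OF r] b(2)[of r] by linarith
      moreover have "f q \<le> G y" using Gm[of "real_of_rat q" y] elim by (simp add: Gq)
      ultimately show ?case using q by (simp add: dist_real_def)
    qed
  qed
  have "real_distribution (interval_measure G)"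
    by (rule real_distribution_interval_measure[OF Gm Grc G0 G1])
  moreover have "measure (interval_measure G) {..real_of_rat q} = f q" for q
    using fun_cong[OF cdf_interval_measure[OF Gm Grc G0], of "real_of_rat q"] by (simp add: cdf_def Gq)
  ultimately show ?thesis by blast
qed

text \<open>For each rational \<open>q\<close> the conditional probability of \<open>u \<le> q\<close> given \<open>w\<close> is a Radon-Nikodym derivative
  \<open>f q\<close>. The countably many relations that make \<open>q \<mapsto> f q x\<close> a distribution function on the rationals
  hold outside one null set \<open>Z\<close>, where the kernel is set to a point mass.\<close>

theorem disintegration_exists:
  assumes "prob_space M" and w [measurable]: "w \<in> M \<rightarrow>\<^sub>M W" and u [measurable]: "u \<in> borel_measurable M"
  shows "\<exists>\<kappa>. \<kappa> \<in> W \<rightarrow>\<^sub>M prob_algebra (borel :: real measure) \<and>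
    (\<forall>B\<in>sets W. \<forall>q. emeasure M {x \<in> space M. w x \<in> B \<and> u x \<le> real_of_rat q} =
      (\<integral>\<^sup>+x. indicator B (w x) * emeasure (\<kappa> (w x)) {..real_of_rat q} \<partial>M))"
proof -
  interpret prob_space M by fact
  define \<eta> where "\<eta> = distr M W w"
  interpret \<eta>: prob_space \<eta> unfolding \<eta>_def by (rule prob_space_distr) simp
  have s\<eta> [measurable_cong, simp]: "sets \<eta> = sets W" and sp\<eta> [simp]: "space \<eta> = space W" by (simp_all add: \<eta>_def)
  define E where "E B c = {x \<in> space M. w x \<in> B \<and> u x \<le> c}" for B c
  have E [measurable]: "E B c \<in> sets M" if [measurable]: "B \<in> sets W" for B c unfolding E_def by measurable
  have E\<eta>: "emeasure \<eta> B = emeasure M {x \<in> space M. w x \<in> B}" if "B \<in> sets W" for B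
    unfolding \<eta>_def using that by (subst emeasure_distr) (auto intro!: arg_cong[where f="emeasure M"])
  have Edec: "emeasure M (\<Inter>n. E B (c n)) = (INF n. emeasure M (E B (c n)))" if "B \<in> sets W" "decseq c" for B c
    using that by (intro INF_emeasure_decseq[symmetric]) (auto simp: decseq_def E_def intro: order_trans)
  have Einc: "emeasure M (\<Union>n. E B (c n)) = (SUP n. emeasure M (E B (c n)))" if "B \<in> sets W" "incseq c" for B c
    using that by (intro SUP_emeasure_incseq[symmetric]) (auto simp: incseq_def E_def intro: order_trans)
  define \<nu> where "\<nu> q = distr (density M (\<lambda>x. indicator {..real_of_rat q} (u x))) W w" for q
  have \<nu>: "emeasure (\<nu> q) B = emeasure M (E B (real_of_rat q))" if B [measurable]: "B \<in> sets W" for q B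
  proof -
    have "emeasure (\<nu> q) B = emeasure (density M (\<lambda>x. indicator {..real_of_rat q} (u x))) (w -` B \<inter> space M)"
      unfolding \<nu>_def by (subst emeasure_distr) auto
    also have "\<dots> = (\<integral>\<^sup>+x. indicator {..real_of_rat q} (u x) * indicator (w -` B \<inter> space M) x \<partial>M)"
      by (rule emeasure_density) measurable
    also have "\<dots> = (\<integral>\<^sup>+x. indicator (E B (real_of_rat q)) x \<partial>M)"
      by (intro nn_integral_cong) (auto simp: E_def indicator_def)
    finally show ?thesis by simp
  qed
  define f where "f q = RN_deriv \<eta> (\<nu> q)" for q
  have f [measurable]: "f q \<in> borel_measurable W" for q
    using borel_measurable_RN_deriv[of \<eta> "\<nu> q"] by (simp add: f_def cong: measurable_cong_sets)
  have I: "(\<integral>\<^sup>+x. indicator B x * f q x \<partial>\<eta>) = emeasure M (E B (real_of_rat q))" if B: "B \<in> sets W" for q B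
  proof -
    have "absolutely_continuous \<eta> (\<nu> q)"
      unfolding absolutely_continuous_def
    proof
      fix N assume N: "N \<in> null_sets \<eta>"
      then have Nw: "N \<in> sets W" by auto
      have "emeasure M (E N (real_of_rat q)) \<le> emeasure M {x \<in> space M. w x \<in> N}"
        using Nw by (intro emeasure_mono) (auto simp: E_def)
      also have "\<dots> = 0" using E\<eta>[OF Nw] N by (simp add: null_setsD1)
      finally show "N \<in> null_sets (\<nu> q)" using \<nu>[OF Nw] Nw by (simp add: null_sets_def \<nu>_def)
    qed
    then have "density \<eta> (f q) = \<nu> q"
      unfolding f_def by (rule \<eta>.density_RN_deriv) (simp add: \<nu>_def)
    then have "emeasure (\<nu> q) B = (\<integral>\<^sup>+x. f q x * indicator B x \<partial>\<eta>)"
      using B emeasure_density[of "f q" \<eta> B] by (simp cong: measurable_cong_sets)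
    then show ?thesis using \<nu>[OF B] by (simp add: mult.commute)
  qed
  have c1: "AE x in \<eta>. f q x \<le> 1" for q
  proof (rule AE_le_of_integrals)
    fix B assume "B \<in> sets \<eta>"
    then have B: "B \<in> sets W" by simp
    have "emeasure M (E B (real_of_rat q)) \<le> emeasure M {x \<in> space M. w x \<in> B}"
      using B by (intro emeasure_mono) (auto simp: E_def)
    then show "(\<integral>\<^sup>+x. indicator B x * f q x \<partial>\<eta>) \<le> (\<integral>\<^sup>+x. indicator B x * 1 \<partial>\<eta>)"
      using B by (simp add: I E\<eta>)
  qed (simp_all add: \<eta>.emeasure_space_1[unfolded sp\<eta>])
  have fin: "(\<integral>\<^sup>+x. f q x \<partial>\<eta>) < \<infinity>" for q
  proof -
    have "(\<integral>\<^sup>+x. f q x \<partial>\<eta>) \<le> (\<integral>\<^sup>+x. 1 \<partial>\<eta>)" using c1 by (rule nn_integral_mono_AE)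
    then show ?thesis by (simp add: \<eta>.emeasure_space_1[unfolded sp\<eta>] le_less_trans)
  qed
  have c2: "AE x in \<eta>. f q x \<le> f r x" if "q \<le> r" for q r
  proof (rule AE_le_of_integrals[OF _ _ fin])
    fix B assume "B \<in> sets \<eta>"
    then have B: "B \<in> sets W" by simp
    have "emeasure M (E B (real_of_rat q)) \<le> emeasure M (E B (real_of_rat r))"
      using B that order_trans[OF _ iffD2[OF of_rat_less_eq that]] by (intro emeasure_mono) (auto simp: E_def)
    then show "(\<integral>\<^sup>+x. indicator B x * f q x \<partial>\<eta>) \<le> (\<integral>\<^sup>+x. indicator B x * f r x \<partial>\<eta>)"
      by (simp only: I[OF B])
  qed simp_all
  have inf_le: "(\<integral>\<^sup>+x. indicator B x * (INF n. f (g n) x) \<partial>\<eta>) \<le> emeasure M (\<Inter>n. E B (real_of_rat (g n)))"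
    if B: "B \<in> sets W" and g: "decseq g" for B and g :: "nat => rat"
  proof -
    have d: "decseq (\<lambda>n. real_of_rat (g n))" using g by (auto simp: decseq_def of_rat_less_eq)
    show ?thesis unfolding Edec[OF B d]
    proof (rule INF_greatest)
      fix n
      show "(\<integral>\<^sup>+x. indicator B x * (INF n. f (g n) x) \<partial>\<eta>) \<le> emeasure M (E B (real_of_rat (g n)))"
        unfolding I[OF B, symmetric] by (intro nn_integral_mono mult_left_mono INF_lower) auto
    qed
  qed
  have c3: "AE x in \<eta>. (INF n. f (q + 1 / of_nat (Suc n)) x) \<le> f q x" for q
  proof (rule AE_le_of_integrals[OF _ _ fin])
    fix B assume "B \<in> sets \<eta>"
    then have B: "B \<in> sets W" by simp
    have d: "decseq (\<lambda>n. q + 1 / of_nat (Suc n) :: rat)"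
      by (auto simp: decseq_def intro!: divide_left_mono)
    have lim: "u0 \<le> real_of_rat q" if *: "\<forall>n. u0 \<le> real_of_rat (q + 1 / of_nat (Suc n))" for u0
    proof (rule field_le_epsilon)
      fix e :: real assume "e > 0"
      then obtain n where "1 / real (Suc n) < e" using reals_Archimedean by (auto simp: inverse_eq_divide)
      moreover have "real_of_rat (q + 1 / of_nat (Suc n)) = real_of_rat q + 1 / real (Suc n)"
        by (simp only: of_rat_add of_rat_divide of_rat_1 of_rat_of_nat_eq)
      ultimately show "u0 \<le> real_of_rat q + e" using *[rule_format, of n] by linarith
    qed
    have "(\<Inter>n. E B (real_of_rat (q + 1 / of_nat (Suc n)))) \<subseteq> E B (real_of_rat q)"
      using lim by (auto simp only: E_def INT_iff mem_Collect_eq)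
    then have "emeasure M (\<Inter>n. E B (real_of_rat (q + 1 / of_nat (Suc n)))) \<le> emeasure M (E B (real_of_rat q))"
      using B by (intro emeasure_mono) auto
    then show "(\<integral>\<^sup>+x. indicator B x * (INF n. f (q + 1 / of_nat (Suc n)) x) \<partial>\<eta>) \<le> (\<integral>\<^sup>+x. indicator B x * f q x \<partial>\<eta>)"
      unfolding I[OF B] using inf_le[OF B d] by (rule order_trans[rotated])
  qed simp_all
  have c4: "AE x in \<eta>. (INF n. f (- of_nat n) x) \<le> 0"
  proof (rule AE_le_of_integrals)
    fix B assume "B \<in> sets \<eta>"
    then have B: "B \<in> sets W" by simp
    have d: "decseq (\<lambda>n. - of_nat n :: rat)" by (auto simp: decseq_def)
    have "x \<notin> (\<Inter>n. E B (real_of_rat (- of_nat n)))" for x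
    proof -
      obtain n :: nat where "- u x < real n" using reals_Archimedean2 by blast
      then have "x \<notin> E B (real_of_rat (- of_nat n))" by (simp add: E_def of_rat_minus)
      then show ?thesis by blast
    qed
    then have "(\<Inter>n. E B (real_of_rat (- of_nat n))) = {}" by blast
    then show "(\<integral>\<^sup>+x. indicator B x * (INF n. f (- of_nat n) x) \<partial>\<eta>) \<le> (\<integral>\<^sup>+x. indicator B x * 0 \<partial>\<eta>)"
      using inf_le[OF B d] by simp
  qed simp_all
  have c5: "AE x in \<eta>. 1 \<le> (SUP n. f (of_nat n) x)"
  proof (rule AE_le_of_integrals)
    have "AE x in \<eta>. \<forall>n. f (of_nat n) x \<le> 1" using c1 by (simp add: AE_all_countable)
    then have "AE x in \<eta>. (SUP n. f (of_nat n) x) \<le> 1" by eventually_elim (auto intro: SUP_least)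
    then have "(\<integral>\<^sup>+x. (SUP n. f (of_nat n) x) \<partial>\<eta>) \<le> (\<integral>\<^sup>+x. 1 \<partial>\<eta>)" by (rule nn_integral_mono_AE)
    then show "(\<integral>\<^sup>+x. (SUP n. f (of_nat n) x) \<partial>\<eta>) < \<infinity>"
      by (simp add: \<eta>.emeasure_space_1[unfolded sp\<eta>] le_less_trans)
    fix B assume "B \<in> sets \<eta>"
    then have B: "B \<in> sets W" by simp
    have i: "incseq (\<lambda>n. real n)" by (auto simp: incseq_def)
    have "(\<Union>n. E B (real n)) = {x \<in> space M. w x \<in> B}"
      using real_arch_simple by (auto simp: E_def)
    then have "emeasure \<eta> B = (SUP n. emeasure M (E B (real n)))"
      using Einc[OF B i] E\<eta>[OF B] by simp
    also have "\<dots> \<le> (\<integral>\<^sup>+x. indicator B x * (SUP n. f (of_nat n) x) \<partial>\<eta>)"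
    proof (rule SUP_least)
      fix n
      have "emeasure M (E B (real n)) = (\<integral>\<^sup>+x. indicator B x * f (of_nat n) x \<partial>\<eta>)"
        using I[OF B, of "of_nat n"] by simp
      also have "\<dots> \<le> (\<integral>\<^sup>+x. indicator B x * (SUP n. f (of_nat n) x) \<partial>\<eta>)"
        by (intro nn_integral_mono mult_left_mono SUP_upper) auto
      finally show "emeasure M (E B (real n)) \<le> (\<integral>\<^sup>+x. indicator B x * (SUP n. f (of_nat n) x) \<partial>\<eta>)" .
    qed
    finally show "(\<integral>\<^sup>+x. indicator B x * 1 \<partial>\<eta>) \<le> (\<integral>\<^sup>+x. indicator B x * (SUP n. f (of_nat n) x) \<partial>\<eta>)"
      using B by simp
  qed simp_all
  define good where "good x \<longleftrightarrow> (\<exists>N. real_distribution N \<and> (\<forall>q. emeasure N {..real_of_rat q} = f q x))" for x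
  have "AE x in \<eta>. (\<forall>q. f q x \<le> 1) \<and> (\<forall>q r. q \<le> r --> f q x \<le> f r x) \<and>
      (\<forall>q. (INF n. f (q + 1 / of_nat (Suc n)) x) \<le> f q x) \<and> (INF n. f (- of_nat n) x) \<le> 0 \<and> 1 \<le> (SUP n. f (of_nat n) x)"
    using c1 c2 c3 c4 c5 by (intro AE_conjI AE_all_countable[THEN iffD2] allI AE_impI) auto
  then have "AE x in \<eta>. good x"
  proof eventually_elim
    case (elim x)
    define h where "h q = enn2real (f q x)" for q
    have fh: "f q x = ennreal (h q)" for q
    proof -
      have "f q x \<le> 1" using elim by blast
      then have "f q x < top" by (rule le_less_trans) simp
      then show ?thesis by (simp add: h_def)
    qed
    have h0: "0 \<le> h q" for q by (simp add: h_def)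
    have "\<exists>N. real_distribution N \<and> (\<forall>q. measure N {..real_of_rat q} = h q)"
    proof (rule distribution_from_rational_cdf)
      show "h q \<le> h r" if "q \<le> r" for q r
        using elim that fh[of q] fh[of r] h0[of r] by (metis ennreal_le_iff)
      show "h q \<le> 1" for q
        using elim fh[of q] by (metis ennreal_1 ennreal_le_iff zero_le_one)
      show "\<exists>r>q. h r < h q + e" if e: "e > 0" for q e
      proof -
        have "(INF n. f (q + 1 / of_nat (Suc n)) x) < ennreal (h q + e)"
        proof (rule le_less_trans)
          show "(INF n. f (q + 1 / of_nat (Suc n)) x) \<le> f q x" using elim by blast
          show "f q x < ennreal (h q + e)" unfolding fh using h0[of q] e by (intro ennreal_lessI) auto
        qed
        then obtain n where "f (q + 1 / of_nat (Suc n)) x < ennreal (h q + e)" unfolding INF_less_iff by blast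
        then show ?thesis unfolding fh using h0
          by (intro exI[of _ "q + 1 / of_nat (Suc n)"]) (auto simp: ennreal_less_iff)
      qed
      show "\<exists>q. h q < e" if e: "e > 0" for e
      proof -
        have "(INF n. f (- of_nat n) x) < ennreal e"
          by (rule le_less_trans[of _ 0]) (use elim e in auto)
        then obtain n where "f (- of_nat n) x < ennreal e" unfolding INF_less_iff by blast
        then show ?thesis unfolding fh using h0 by (auto simp: ennreal_less_iff)
      qed
      show "\<exists>q. h q > 1 - e" if e: "e > 0" for e
      proof (cases "1 - e < 0")
        case True then show ?thesis using h0[of 0] by (intro exI[of _ 0]) linarith
      next
        case False
        have "ennreal (1 - e) < 1" using e by (simp add: ennreal_less_one_iff)
        then have "ennreal (1 - e) < (SUP n. f (of_nat n) x)" using elim by (meson less_le_trans)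
        then obtain n where "ennreal (1 - e) < f (of_nat n) x" unfolding less_SUP_iff by blast
        then show ?thesis unfolding fh using False by (auto simp: ennreal_less_iff)
      qed
    qed (rule h0)
    then obtain N where N: "real_distribution N" "\<And>q. measure N {..real_of_rat q} = h q" by blast
    interpret N: real_distribution N by (rule N(1))
    show "good x" unfolding good_def using N by (intro exI[of _ N]) (simp add: N.emeasure_eq_measure fh)
  qed
  then obtain Z where Z: "Z \<in> null_sets \<eta>" "{x \<in> space \<eta>. \<not> good x} \<subseteq> Z" by (auto simp: eventually_ae_filter)
  have Zs [measurable]: "Z \<in> sets W" using Z by auto
  define \<kappa> where "\<kappa> x = (if x \<in> Z then return borel 0 else (SOME N. real_distribution N \<and> (\<forall>q. emeasure N {..real_of_rat q} = f q x)))" for x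
  have \<kappa>: "real_distribution (\<kappa> x) \<and> (\<forall>q. emeasure (\<kappa> x) {..real_of_rat q} = f q x)" if "x \<in> space W" "x \<notin> Z" for x
  proof -
    have "good x" using Z(2) that by auto
    from someI_ex[OF this[unfolded good_def]] show ?thesis unfolding \<kappa>_def if_not_P[OF that(2)] .
  qed
  have \<kappa>p: "prob_space (\<kappa> x) \<and> sets (\<kappa> x) = sets borel" if "x \<in> space W" for x
  proof (cases "x \<in> Z")
    case True then show ?thesis by (simp add: \<kappa>_def prob_space_return)
  next
    case False
    then interpret N: real_distribution "\<kappa> x" using \<kappa> that by blast
    show ?thesis using N.prob_space_axioms by simp
  qed
  have \<kappa>m: "\<kappa> \<in> W \<rightarrow>\<^sub>M prob_algebra borel"
  proof (rule measurable_prob_algebra_generated[OF borel_eq_rat_atMost Int_stable_rat_atMost])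
    fix A assume "A \<in> range (\<lambda>q. {..real_of_rat q})"
    then obtain q where A: "A = {..real_of_rat q}" by auto
    have "(\<lambda>x. if x \<in> Z then emeasure (return borel 0) A else f q x) \<in> borel_measurable W" by measurable
    then show "(\<lambda>a. emeasure (\<kappa> a) A) \<in> borel_measurable W"
    proof (rule measurable_cong[THEN iffD1, rotated])
      fix x assume x: "x \<in> space W"
      show "(if x \<in> Z then emeasure (return borel 0) A else f q x) = emeasure (\<kappa> x) A"
      proof (cases "x \<in> Z")
        case True then show ?thesis by (simp add: \<kappa>_def)
      next
        case False then show ?thesis using \<kappa>[OF x] A by simp
      qed
    qed
  qed (use \<kappa>p in auto)
  have "emeasure M {x \<in> space M. w x \<in> B \<and> u x \<le> real_of_rat q} =
      (\<integral>\<^sup>+x. indicator B (w x) * emeasure (\<kappa> (w x)) {..real_of_rat q} \<partial>M)" if B [measurable]: "B \<in> sets W" for B q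
  proof -
    have em [measurable]: "(\<lambda>x. emeasure (\<kappa> x) {..real_of_rat q}) \<in> borel_measurable W"
      using measurable_emeasure_kernel[OF measurable_prob_algebraD[OF \<kappa>m]] by simp
    have nZ: "AE x in \<eta>. x \<notin> Z" using Z(1) by (rule AE_not_in)
    have "(\<integral>\<^sup>+x. indicator B x * f q x \<partial>\<eta>) = (\<integral>\<^sup>+x. indicator B x * emeasure (\<kappa> x) {..real_of_rat q} \<partial>\<eta>)"
    proof (rule nn_integral_cong_AE)
      show "AE x in \<eta>. indicator B x * f q x = indicator B x * emeasure (\<kappa> x) {..real_of_rat q}"
        using nZ AE_space
      proof eventually_elim
        case (elim x)
        then show ?case using \<kappa>[of x] by simp
      qed
    qed
    also have "\<dots> = (\<integral>\<^sup>+x. indicator B (w x) * emeasure (\<kappa> (w x)) {..real_of_rat q} \<partial>M)"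
      unfolding \<eta>_def by (rule nn_integral_distr) measurable
    finally show ?thesis using I[OF B, of q] by (simp add: E_def)
  qed
  then show ?thesis using \<kappa>m by blast
qed

section \<open>Slice measures\<close>

lemma pred_AE_kernel:
  assumes K: "K \<in> M \<rightarrow>\<^sub>M subprob_algebra N" and R: "{p \<in> space (M \<Otimes>\<^sub>M N). R (fst p) (snd p)} \<in> sets (M \<Otimes>\<^sub>M N)"
  shows "{x \<in> space M. AE y in K x. R x y} \<in> sets M"
proof -
  have Kx: "sets (K x) = sets N" "space (K x) = space N" if "x \<in> space M" for x
    using measurable_space[OF K that] sets_eq_imp_space_eq[of "K x" N] by (auto simp: space_subprob_algebra)
  define A where "A x = {y \<in> space N. \<not> R x y}" for x
  have S: "(SIGMA x:space M. A x) = space (M \<Otimes>\<^sub>M N) - {p \<in> space (M \<Otimes>\<^sub>M N). R (fst p) (snd p)}"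
    by (auto simp: A_def space_pair_measure)
  have As: "(SIGMA x:space M. A x) \<in> sets (M \<Otimes>\<^sub>M N)" unfolding S using R by (rule sets.compl_sets)
  have Ax: "A x \<in> sets N" if "x \<in> space M" for x
  proof -
    have "Pair x -` (SIGMA x:space M. A x) = A x" using that by auto
    then show ?thesis using sets_Pair1[OF As, of x] by simp
  qed
  have "{x \<in> space M. AE y in K x. R x y} = {x \<in> space M. emeasure (K x) (A x) = 0}"
    using Ax Kx by (auto simp: A_def AE_iff_measurable[OF _ refl])
  also have "\<dots> \<in> sets M"
    using emeasure_measurable_subprob_algebra2[OF As K] by measurable
  finally show ?thesis .
qed

lemma kernel_eq_of_rat:
  fixes K1 K2 :: "'a => real measure"
  assumes "finite_measure M"
    and s: "\<And>x. x \<in> space M ==> sets (K1 x) = sets borel" "\<And>x. x \<in> space M ==> sets (K2 x) = sets borel"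
    and f: "\<And>x. x \<in> space M ==> finite_measure (K1 x)"
    and m: "\<And>q. (\<lambda>x. emeasure (K1 x) {..real_of_rat q}) \<in> borel_measurable M" "\<And>q. (\<lambda>x. emeasure (K2 x) {..real_of_rat q}) \<in> borel_measurable M"
    and le: "\<And>x q. x \<in> space M ==> emeasure (K2 x) {..real_of_rat q} \<le> 1"
    and eq: "\<And>B q. B \<in> sets M ==> (\<integral>\<^sup>+x. indicator B x * emeasure (K1 x) {..real_of_rat q} \<partial>M) =
      (\<integral>\<^sup>+x. indicator B x * emeasure (K2 x) {..real_of_rat q} \<partial>M)"
  shows "AE x in M. K1 x = K2 x"
proof -
  interpret finite_measure M by fact
  have "AE x in M. emeasure (K1 x) {..real_of_rat q} = emeasure (K2 x) {..real_of_rat q}" for q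
  proof (rule AE_eq_of_integrals[OF m _ eq])
    have "(\<integral>\<^sup>+x. emeasure (K2 x) {..real_of_rat q} \<partial>M) \<le> (\<integral>\<^sup>+x. 1 \<partial>M)"
      by (intro nn_integral_mono le)
    also have "\<dots> < \<infinity>" by (simp add: emeasure_eq_measure)
    finally show "(\<integral>\<^sup>+x. emeasure (K2 x) {..real_of_rat q} \<partial>M) < \<infinity>" .
  qed
  then have "AE x in M. \<forall>q. emeasure (K1 x) {..real_of_rat q} = emeasure (K2 x) {..real_of_rat q}"
    by (simp add: AE_all_countable)
  then show ?thesis
    using AE_space by eventually_elim (intro finite_measure_eqI_rat s f, auto)
qed

lemma AE_msupport:
  fixes N :: "real measure"
  assumes N: "sets N = sets borel"
  shows "AE v in N. v \<in> msupport N"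
proof -
  obtain \<B> :: "real set set" where B: "countable \<B>" "topological_basis \<B>" using ex_countable_basis by blast
  define Z where "Z = (\<Union>b\<in>{b \<in> \<B>. emeasure N b = 0}. b)"
  have "Z \<in> null_sets N"
    unfolding Z_def
  proof (rule null_sets_UN')
    show "countable {b \<in> \<B>. emeasure N b = 0}" using B(1) by simp
    show "b \<in> null_sets N" if "b \<in> {b \<in> \<B>. emeasure N b = 0}" for b
      using that topological_basis_open[OF B(2)] by (auto simp: null_sets_def N)
  qed
  then have "AE v in N. v \<notin> Z" by (rule AE_not_in)
  then show ?thesis
  proof eventually_elim
    case (elim v)
    show ?case unfolding msupport_def
    proof safe
      fix U assume U: "open U" "v \<in> U"
      then obtain b where b: "b \<in> \<B>" "v \<in> b" "b \<subseteq> U" using topological_basisE[OF B(2)] by blast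
      then have "emeasure N b \<noteq> 0" using elim by (auto simp: Z_def)
      moreover have "emeasure N b \<le> emeasure N U" using b U by (intro emeasure_mono) (auto simp: N)
      ultimately show "0 < emeasure N U" by (metis le_zero_eq not_gr_zero)
    qed
  qed
qed

lemma emeasure_distr_density:
  fixes f :: "'a => real"
  assumes f [measurable]: "f \<in> borel_measurable M" and w [measurable]: "w \<in> borel_measurable M" and B [measurable]: "B \<in> sets borel"
  shows "emeasure (distr (density M w) borel f) B = (\<integral>\<^sup>+x. indicator B (f x) * w x \<partial>M)"
proof -
  have vs: "f -` B \<inter> space M \<in> sets M" using f B by (rule measurable_sets)
  have "emeasure (distr (density M w) borel f) B = emeasure (density M w) (f -` B \<inter> space M)"
    by (subst emeasure_distr) auto
  also have "\<dots> = (\<integral>\<^sup>+x. w x * indicator (f -` B \<inter> space M) x \<partial>M)" by (rule emeasure_density[OF w vs])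
  also have "\<dots> = (\<integral>\<^sup>+x. indicator B (f x) * w x \<partial>M)" by (intro nn_integral_cong) (auto simp: indicator_def)
  finally show ?thesis .
qed

text \<open>If an interval of length \<open>h\<close> has positive mass, it contains a point \<open>u\<close> as in the hypothesis, and the
  window around \<open>u\<close> covers the interval. Countably many such intervals cover the line.\<close>

lemma null_of_locally_null:
  fixes N :: "real measure"
  assumes N: "sets N = sets borel" and B: "B \<in> sets borel" and h: "h > 0"
    and loc: "AE u in N. emeasure N (B \<inter> {u - h..u + h}) = 0"
  shows "emeasure N B = 0"
proof -
  define I where "I k = {of_int k * h..<of_int (k + 1) * h}" for k :: int
  have "emeasure N (B \<inter> I k) = 0" for k
  proof (rule ccontr)
    assume pos: "emeasure N (B \<inter> I k) \<noteq> 0"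
    have "\<exists>u\<in>I k. emeasure N (B \<inter> {u - h..u + h}) = 0"
    proof (rule ccontr)
      assume "\<not> ?thesis"
      then have "AE u in N. u \<notin> I k" using loc by (auto elim!: eventually_mono)
      then have "emeasure N (I k) = 0"
        by (subst (asm) AE_iff_measurable[of "I k"]) (auto simp: N I_def sets_eq_imp_space_eq[OF N])
      moreover have "emeasure N (B \<inter> I k) \<le> emeasure N (I k)" by (intro emeasure_mono) (auto simp: N I_def)
      ultimately show False using pos by simp
    qed
    then obtain u where u: "u \<in> I k" "emeasure N (B \<inter> {u - h..u + h}) = 0" by blast
    have "I k \<subseteq> {u - h..u + h}" using u(1) by (auto simp: I_def algebra_simps)
    then have "emeasure N (B \<inter> I k) \<le> emeasure N (B \<inter> {u - h..u + h})" using B by (intro emeasure_mono) (auto simp: N)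
    then show False using pos u by simp
  qed
  moreover have "B = (\<Union>k. B \<inter> I k)"
  proof -
    have "v \<in> I \<lfloor>v / h\<rfloor>" for v
    proof -
      have "of_int \<lfloor>v / h\<rfloor> \<le> v / h" "v / h < of_int (\<lfloor>v / h\<rfloor> + 1)" by linarith+
      then have "of_int \<lfloor>v / h\<rfloor> * h \<le> v" "v < of_int (\<lfloor>v / h\<rfloor> + 1) * h"
        using h by (simp_all only: pos_le_divide_eq pos_divide_less_eq)
      then show ?thesis by (simp add: I_def)
    qed
    then show ?thesis by blast
  qed
  moreover have "emeasure N (\<Union>k. B \<inter> I k) = 0"
  proof -
    have "(\<Union>k\<in>UNIV. B \<inter> I k) \<in> null_sets N"
      by (rule null_sets_UN') (use calculation B in \<open>auto simp: null_sets_def N I_def\<close>)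
    then show ?thesis by auto
  qed
  ultimately show ?thesis by metis
qed

definition normal_dir :: "real => real^2" where "normal_dir \<theta> = vector [- sin \<theta>, cos \<theta>]"

definition along :: "real => real^2 => real" where "along \<theta> z = z \<bullet> dir \<theta>"

lemma slice_proj_normal: "slice_proj \<theta> z = z \<bullet> normal_dir \<theta>"
  by (simp add: slice_proj_def normal_dir_def)

lemma inner_2: "(x::real^2) \<bullet> y = x$1 * y$1 + x$2 * y$2"
  by (simp add: inner_vec_def sum_2)

lemma normal_dir_nth [simp]: "normal_dir \<theta> $ 1 = - sin \<theta>" "normal_dir \<theta> $ 2 = cos \<theta>"
  by (simp_all add: normal_dir_def)

lemma sin_cos_sq: "sin \<theta> * sin \<theta> + cos \<theta> * cos \<theta> = (1::real)"
  using sin_cos_squared_add[of \<theta>] by (simp add: power2_eq_square)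

lemma frame_inner [simp]:
  "dir \<theta> \<bullet> dir \<theta> = 1" "normal_dir \<theta> \<bullet> normal_dir \<theta> = 1" "dir \<theta> \<bullet> normal_dir \<theta> = 0" "normal_dir \<theta> \<bullet> dir \<theta> = 0"
  using sin_cos_sq[of \<theta>] by (simp_all add: inner_2)

definition line_point :: "real => real => real => real^2" where
  "line_point \<theta> x v = v *\<^sub>R dir \<theta> + x *\<^sub>R normal_dir \<theta>"

lemma sin_cos_scale: "cos \<theta> * (cos \<theta> * w) + sin \<theta> * (sin \<theta> * w) = (w::real)"
proof -
  have "(sin \<theta> * sin \<theta> + cos \<theta> * cos \<theta>) * w = w" by (simp only: sin_cos_sq mult_1_left)
  then show ?thesis by (simp only: distrib_right mult.assoc add.commute)
qed

lemma line_point_coords: "line_point \<theta> (slice_proj \<theta> z) (along \<theta> z) = z"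
  by (simp add: vec_eq_iff forall_2 line_point_def along_def slice_proj_normal inner_2 algebra_simps sin_cos_scale)

lemma coords_line_point [simp]: "slice_proj \<theta> (line_point \<theta> x v) = x" "along \<theta> (line_point \<theta> x v) = v"
  by (simp_all add: line_point_def along_def slice_proj_normal inner_add_left)

lemma normal_dir_measurable [measurable]: "normal_dir \<in> borel_measurable borel"
proof -
  have eq: "normal_dir = (\<lambda>\<theta>. (- sin \<theta>) *\<^sub>R axis 1 1 + cos \<theta> *\<^sub>R axis 2 1)"
    by (simp add: fun_eq_iff vec_eq_iff forall_2 axis_def)
  show ?thesis unfolding eq by (intro borel_measurable_continuous_onI continuous_intros)
qed

lemma along_measurable [measurable (raw)]:
  assumes [measurable]: "f \<in> borel_measurable M" "g \<in> borel_measurable M"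
  shows "(\<lambda>x. along (f x) (g x)) \<in> borel_measurable M"
  unfolding along_def by measurable

lemma slice_proj_measurable [measurable (raw)]:
  assumes [measurable]: "f \<in> borel_measurable M" "g \<in> borel_measurable M"
  shows "(\<lambda>x. slice_proj (f x) (g x)) \<in> borel_measurable M"
  unfolding slice_proj_normal by measurable

lemma line_point_measurable [measurable (raw)]:
  assumes [measurable]: "f \<in> borel_measurable M" "g \<in> borel_measurable M" "h \<in> borel_measurable M"
  shows "(\<lambda>x. line_point (f x) (g x) (h x)) \<in> borel_measurable M"
  unfolding line_point_def by measurable

context self_affine_furstenberg
begin

interpretation \<mu>: prob_space \<mu> by (rule prob_space_\<mu>)

interpretation T\<mu>: pair_prob_space Th \<mu> ..

text \<open>The slice measures in all directions at once, as measures in the coordinate along the slice. Fubini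
  arguments over the direction need joint measurability in direction and position, so the kernel
  comes from one disintegration of \<open>Th \<Otimes>\<^sub>M \<mu>\<close>.\<close>

definition slice_kernel :: "real \<times> real => real measure" where
  "slice_kernel = (SOME \<kappa>. \<kappa> \<in> borel \<Otimes>\<^sub>M borel \<rightarrow>\<^sub>M prob_algebra borel \<and>
    (\<forall>B\<in>sets (borel \<Otimes>\<^sub>M borel). \<forall>q. emeasure (Th \<Otimes>\<^sub>M \<mu>) {x \<in> space (Th \<Otimes>\<^sub>M \<mu>). (fst x, slice_proj (fst x) (snd x)) \<in> B \<and> along (fst x) (snd x) \<le> real_of_rat q} =
      (\<integral>\<^sup>+x. indicator B (fst x, slice_proj (fst x) (snd x)) * emeasure (\<kappa> (fst x, slice_proj (fst x) (snd x))) {..real_of_rat q} \<partial>(Th \<Otimes>\<^sub>M \<mu>))))"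

lemma slice_kernel:
  "slice_kernel \<in> borel \<Otimes>\<^sub>M borel \<rightarrow>\<^sub>M prob_algebra borel"
  "B \<in> sets (borel \<Otimes>\<^sub>M borel) ==> emeasure (Th \<Otimes>\<^sub>M \<mu>) {x \<in> space (Th \<Otimes>\<^sub>M \<mu>). (fst x, slice_proj (fst x) (snd x)) \<in> B \<and> along (fst x) (snd x) \<le> real_of_rat q} =
      (\<integral>\<^sup>+x. indicator B (fst x, slice_proj (fst x) (snd x)) * emeasure (slice_kernel (fst x, slice_proj (fst x) (snd x))) {..real_of_rat q} \<partial>(Th \<Otimes>\<^sub>M \<mu>))"
proof -
  have w: "(\<lambda>x. (fst x, slice_proj (fst x) (snd x))) \<in> Th \<Otimes>\<^sub>M \<mu> \<rightarrow>\<^sub>M borel \<Otimes>\<^sub>M borel" by measurable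
  have u: "(\<lambda>x. along (fst x) (snd x)) \<in> borel_measurable (Th \<Otimes>\<^sub>M \<mu>)" by measurable
  note ex = disintegration_exists[OF T\<mu>.prob_space_axioms w u]
  from someI_ex[OF ex, folded slice_kernel_def]
  show "slice_kernel \<in> borel \<Otimes>\<^sub>M borel \<rightarrow>\<^sub>M prob_algebra borel"
    "B \<in> sets (borel \<Otimes>\<^sub>M borel) ==> emeasure (Th \<Otimes>\<^sub>M \<mu>) {x \<in> space (Th \<Otimes>\<^sub>M \<mu>). (fst x, slice_proj (fst x) (snd x)) \<in> B \<and> along (fst x) (snd x) \<le> real_of_rat q} =
      (\<integral>\<^sup>+x. indicator B (fst x, slice_proj (fst x) (snd x)) * emeasure (slice_kernel (fst x, slice_proj (fst x) (snd x))) {..real_of_rat q} \<partial>(Th \<Otimes>\<^sub>M \<mu>))"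
    by blast+
qed

abbreviation slice_at :: "real => real => real measure" where "slice_at \<theta> x \<equiv> slice_kernel (\<theta>, x)"

lemma slice_at_props: "prob_space (slice_at \<theta> x)" "sets (slice_at \<theta> x) = sets borel" "space (slice_at \<theta> x) = UNIV"
proof -
  have "slice_at \<theta> x \<in> space (prob_algebra borel)"
    using measurable_space[OF slice_kernel(1), of "(\<theta>, x)"] by (simp add: space_pair_measure)
  then show "prob_space (slice_at \<theta> x)" and s: "sets (slice_at \<theta> x) = sets borel" by (auto simp: space_prob_algebra)
  show "space (slice_at \<theta> x) = UNIV" using sets_eq_imp_space_eq[OF s] by simp
qed

lemma slice_at_measurable:
  "f \<in> borel_measurable M ==> g \<in> borel_measurable M ==> (\<lambda>x. slice_at (f x) (g x)) \<in> M \<rightarrow>\<^sub>M subprob_algebra borel"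
  by (rule measurable_compose[OF measurable_Pair measurable_prob_algebraD[OF slice_kernel(1)]])

lemma slice_at_emeasure_measurable:
  assumes f: "f \<in> borel_measurable M" "g \<in> borel_measurable M"
    and R: "{p \<in> space (M \<Otimes>\<^sub>M borel). R (fst p) (snd p)} \<in> sets (M \<Otimes>\<^sub>M borel)"
  shows "(\<lambda>x. emeasure (slice_at (f x) (g x)) {v. R x v}) \<in> borel_measurable M"
proof (rule emeasure_measurable_subprob_algebra2[OF _ slice_at_measurable[OF f]])
  have "(SIGMA x:space M. {v. R x v}) = {p \<in> space (M \<Otimes>\<^sub>M borel). R (fst p) (snd p)}"
    by (auto simp: space_pair_measure)
  then show "(SIGMA x:space M. {v. R x v}) \<in> sets (M \<Otimes>\<^sub>M borel)" using R by simp
qed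

definition disintegrates :: "real => bool" where
  "disintegrates \<theta> \<longleftrightarrow> (\<forall>B\<in>sets borel. \<forall>C\<in>sets borel.
     emeasure \<mu> {z. slice_proj \<theta> z \<in> B \<and> along \<theta> z \<in> C} =
     (\<integral>\<^sup>+z. indicator B (slice_proj \<theta> z) * emeasure (slice_at \<theta> (slice_proj \<theta> z)) C \<partial>\<mu>))"

text \<open>Restricting the joint disintegration to sets of directions shows that it holds in almost every
  direction, first for the countably many rational half-lines and then for all Borel sets.\<close>

lemma AE_disintegrates: "AE \<theta> in Th. disintegrates \<theta>"
proof -
  have "AE \<theta> in Th. emeasure \<mu> {z. slice_proj \<theta> z \<le> real_of_rat r \<and> along \<theta> z \<le> real_of_rat q} =
    (\<integral>\<^sup>+z. indicator {..real_of_rat r} (slice_proj \<theta> z) * emeasure (slice_at \<theta> (slice_proj \<theta> z)) {..real_of_rat q} \<partial>\<mu>)" for r q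
  proof -
    let ?g = "\<lambda>\<theta> z. indicator {..real_of_rat r} (slice_proj \<theta> z) * emeasure (slice_at \<theta> (slice_proj \<theta> z)) {..real_of_rat q}"
    let ?f = "\<lambda>\<theta> z. indicator {..real_of_rat r} (slice_proj \<theta> z) * indicator {..real_of_rat q} (along \<theta> z) :: ennreal"
    have em: "(\<lambda>p. emeasure (slice_kernel (fst p, slice_proj (fst p) (snd p))) {..real_of_rat q}) \<in> borel_measurable (Th \<Otimes>\<^sub>M \<mu>)"
      by (rule measurable_compose[OF slice_at_measurable measurable_emeasure_subprob_algebra]) measurable
    have g: "(\<lambda>p. ?g (fst p) (snd p)) \<in> borel_measurable (Th \<Otimes>\<^sub>M \<mu>)" using em by measurable
    have f: "(\<lambda>p. ?f (fst p) (snd p)) \<in> borel_measurable (Th \<Otimes>\<^sub>M \<mu>)" by measurable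
    have fs: "emeasure \<mu> {z. slice_proj \<theta> z \<le> real_of_rat r \<and> along \<theta> z \<le> real_of_rat q} = (\<integral>\<^sup>+z. ?f \<theta> z \<partial>\<mu>)" for \<theta>
    proof -
      have "{z \<in> space borel. slice_proj \<theta> z \<le> real_of_rat r \<and> along \<theta> z \<le> real_of_rat q} \<in> sets borel" by measurable
      then have "{z. slice_proj \<theta> z \<le> real_of_rat r \<and> along \<theta> z \<le> real_of_rat q} \<in> sets \<mu>" by simp
      then have "emeasure \<mu> {z. slice_proj \<theta> z \<le> real_of_rat r \<and> along \<theta> z \<le> real_of_rat q} =
         (\<integral>\<^sup>+z. indicator {z. slice_proj \<theta> z \<le> real_of_rat r \<and> along \<theta> z \<le> real_of_rat q} z \<partial>\<mu>)" by simp
      also have "\<dots> = (\<integral>\<^sup>+z. ?f \<theta> z \<partial>\<mu>)" by (intro nn_integral_cong) (auto simp: indicator_def)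
      finally show ?thesis .
    qed
    have "AE \<theta> in Th. (\<integral>\<^sup>+z. ?f \<theta> z \<partial>\<mu>) = (\<integral>\<^sup>+z. ?g \<theta> z \<partial>\<mu>)"
    proof (rule AE_eq_of_integrals)
      show fm: "(\<lambda>\<theta>. \<integral>\<^sup>+z. ?f \<theta> z \<partial>\<mu>) \<in> borel_measurable Th"
        using \<mu>.borel_measurable_nn_integral_fst[OF f] by simp
      show gm: "(\<lambda>\<theta>. \<integral>\<^sup>+z. ?g \<theta> z \<partial>\<mu>) \<in> borel_measurable Th"
        using \<mu>.borel_measurable_nn_integral_fst[OF g] by simp
      have le: "(\<integral>\<^sup>+z. ?g \<theta> z \<partial>\<mu>) \<le> (\<integral>\<^sup>+z. 1 \<partial>\<mu>)" for \<theta>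
      proof (rule nn_integral_mono)
        fix z
        have "emeasure (slice_at \<theta> (slice_proj \<theta> z)) {..real_of_rat q} \<le> 1"
          using slice_at_props(1) by (rule prob_space.emeasure_le_1)
        then show "?g \<theta> z \<le> 1" by (auto simp: indicator_def)
      qed
      have "(\<integral>\<^sup>+\<theta>. \<integral>\<^sup>+z. ?g \<theta> z \<partial>\<mu> \<partial>Th) \<le> (\<integral>\<^sup>+\<theta>. \<integral>\<^sup>+z. 1 \<partial>\<mu> \<partial>Th)"
        by (rule nn_integral_mono) (rule le)
      also have "\<dots> < \<infinity>" using \<mu>.emeasure_space_1 Th.emeasure_space_1 by simp
      finally show "(\<integral>\<^sup>+\<theta>. \<integral>\<^sup>+z. ?g \<theta> z \<partial>\<mu> \<partial>Th) < \<infinity>" .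
      fix B assume "B \<in> sets Th"
      then have B [measurable]: "B \<in> sets borel" by simp
      let ?X = "{x \<in> space (Th \<Otimes>\<^sub>M \<mu>). (fst x, slice_proj (fst x) (snd x)) \<in> B \<times> {..real_of_rat r} \<and> along (fst x) (snd x) \<le> real_of_rat q}"
      have X: "?X \<in> sets (Th \<Otimes>\<^sub>M \<mu>)" by measurable
      have ind: "(\<lambda>p. indicator B (fst p) * ?f (fst p) (snd p)) \<in> borel_measurable (Th \<Otimes>\<^sub>M \<mu>)"
        "(\<lambda>p. indicator B (fst p) * ?g (fst p) (snd p)) \<in> borel_measurable (Th \<Otimes>\<^sub>M \<mu>)"
        using f g by measurable
      have "(\<integral>\<^sup>+\<theta>. indicator B \<theta> * (\<integral>\<^sup>+z. ?f \<theta> z \<partial>\<mu>) \<partial>Th) = (\<integral>\<^sup>+\<theta>. (\<integral>\<^sup>+z. indicator B \<theta> * ?f \<theta> z \<partial>\<mu>) \<partial>Th)"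
        by (intro nn_integral_cong nn_integral_cmult[symmetric]) measurable
      also have "\<dots> = (\<integral>\<^sup>+p. indicator B (fst p) * ?f (fst p) (snd p) \<partial>(Th \<Otimes>\<^sub>M \<mu>))"
        using \<mu>.nn_integral_fst[OF ind(1)] by simp
      also have "\<dots> = (\<integral>\<^sup>+p. indicator ?X p \<partial>(Th \<Otimes>\<^sub>M \<mu>))"
        by (intro nn_integral_cong) (auto simp: indicator_def space_pair_measure)
      also have "\<dots> = emeasure (Th \<Otimes>\<^sub>M \<mu>) ?X" using X by simp
      also have "\<dots> = (\<integral>\<^sup>+x. indicator (B \<times> {..real_of_rat r}) (fst x, slice_proj (fst x) (snd x)) * emeasure (slice_kernel (fst x, slice_proj (fst x) (snd x))) {..real_of_rat q} \<partial>(Th \<Otimes>\<^sub>M \<mu>))"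
        by (rule slice_kernel(2)) measurable
      also have "\<dots> = (\<integral>\<^sup>+p. indicator B (fst p) * ?g (fst p) (snd p) \<partial>(Th \<Otimes>\<^sub>M \<mu>))"
        by (intro nn_integral_cong) (auto simp: indicator_def)
      also have "\<dots> = (\<integral>\<^sup>+\<theta>. (\<integral>\<^sup>+z. indicator B \<theta> * ?g \<theta> z \<partial>\<mu>) \<partial>Th)"
        using \<mu>.nn_integral_fst[OF ind(2)] by simp
      also have "\<dots> = (\<integral>\<^sup>+\<theta>. indicator B \<theta> * (\<integral>\<^sup>+z. ?g \<theta> z \<partial>\<mu>) \<partial>Th)"
      proof (rule nn_integral_cong)
        fix \<theta>
        have "(\<lambda>z. ?g \<theta> z) \<in> borel_measurable \<mu>"
          using measurable_compose[OF measurable_Pair1' g, of \<theta>] by simp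
        then show "(\<integral>\<^sup>+z. indicator B \<theta> * ?g \<theta> z \<partial>\<mu>) = indicator B \<theta> * (\<integral>\<^sup>+z. ?g \<theta> z \<partial>\<mu>)" by (rule nn_integral_cmult)
      qed
      finally show "(\<integral>\<^sup>+\<theta>. indicator B \<theta> * (\<integral>\<^sup>+z. ?f \<theta> z \<partial>\<mu>) \<partial>Th) = (\<integral>\<^sup>+\<theta>. indicator B \<theta> * (\<integral>\<^sup>+z. ?g \<theta> z \<partial>\<mu>) \<partial>Th)" .
    qed
    then show ?thesis by (simp only: fs)
  qed
  then have "AE \<theta> in Th. \<forall>r q. emeasure \<mu> {z. slice_proj \<theta> z \<le> real_of_rat r \<and> along \<theta> z \<le> real_of_rat q} =
    (\<integral>\<^sup>+z. indicator {..real_of_rat r} (slice_proj \<theta> z) * emeasure (slice_at \<theta> (slice_proj \<theta> z)) {..real_of_rat q} \<partial>\<mu>)"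
    by (intro AE_all_countable[THEN iffD2] allI)
  then show ?thesis
  proof eventually_elim
    case (elim \<theta>)
    let ?s = "slice_proj \<theta>" and ?u = "along \<theta>"
    have sm: "?s \<in> borel_measurable \<mu>" "?u \<in> borel_measurable \<mu>" by (simp_all cong: measurable_cong_sets)
    have km: "(\<lambda>z. slice_at \<theta> (?s z)) \<in> \<mu> \<rightarrow>\<^sub>M subprob_algebra borel" using sm by (intro slice_at_measurable) simp
    have kem: "(\<lambda>z. emeasure (slice_at \<theta> (?s z)) C) \<in> borel_measurable \<mu>" if "C \<in> sets borel" for C
      using measurable_emeasure_kernel[OF km that] .
    have set1: "{z. ?s z \<in> B \<and> ?u z \<in> C} \<in> sets \<mu>" if "B \<in> sets borel" "C \<in> sets borel" for B C
    proof -
      have "?s -` B \<inter> space \<mu> \<inter> (?u -` C \<inter> space \<mu>) \<in> sets \<mu>"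
        using that sm by (intro sets.Int measurable_sets)
      then show ?thesis by (simp add: vimage_def Collect_conj_eq[symmetric])
    qed
    have one: "emeasure \<mu> {z. ?s z \<in> B \<and> ?u z \<le> real_of_rat q} = (\<integral>\<^sup>+z. indicator B (?s z) * emeasure (slice_at \<theta> (?s z)) {..real_of_rat q} \<partial>\<mu>)"
      if B: "B \<in> sets borel" for B q
    proof -
      let ?M1 = "distr (density \<mu> (\<lambda>z. indicator {..real_of_rat q} (?u z))) borel ?s"
      let ?M2 = "distr (density \<mu> (\<lambda>z. emeasure (slice_at \<theta> (?s z)) {..real_of_rat q})) borel ?s"
      have im: "(\<lambda>z. indicator {..real_of_rat q} (?u z) :: ennreal) \<in> borel_measurable \<mu>" using sm by measurable
      have e1: "emeasure ?M1 B = emeasure \<mu> {z. ?s z \<in> B \<and> ?u z \<le> real_of_rat q}" if B: "B \<in> sets borel" for B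
      proof -
        have "emeasure ?M1 B = (\<integral>\<^sup>+z. indicator {z. ?s z \<in> B \<and> ?u z \<in> {..real_of_rat q}} z \<partial>\<mu>)"
          unfolding emeasure_distr_density[OF sm(1) im B] by (intro nn_integral_cong) (auto simp: indicator_def)
        also have "\<dots> = emeasure \<mu> {z. ?s z \<in> B \<and> ?u z \<in> {..real_of_rat q}}"
          by (rule nn_integral_indicator[OF set1[OF B]]) simp
        finally show ?thesis by simp
      qed
      have e2: "emeasure ?M2 B = (\<integral>\<^sup>+z. indicator B (?s z) * emeasure (slice_at \<theta> (?s z)) {..real_of_rat q} \<partial>\<mu>)" if B: "B \<in> sets borel" for B
        by (rule emeasure_distr_density[OF sm(1) kem B]) simp
      have "?M1 = ?M2"
      proof (rule finite_measure_eqI_rat)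
        show "finite_measure ?M1"
        proof (rule finite_measureI)
          have "emeasure ?M1 UNIV \<le> 1" by (subst e1, simp) (rule \<mu>.emeasure_le_1)
          then show "emeasure ?M1 (space ?M1) \<noteq> \<infinity>" by (auto simp: top_unique)
        qed
        show "emeasure ?M1 {..real_of_rat r} = emeasure ?M2 {..real_of_rat r}" for r
          by (subst e1, simp, subst e2, simp) (use elim in simp)
      qed simp_all
      then show ?thesis using e1[OF B] e2[OF B] by simp
    qed
    show ?case unfolding disintegrates_def
    proof (intro ballI)
      fix B C :: "real set" assume B: "B \<in> sets borel" and C: "C \<in> sets borel"
      have im: "(\<lambda>z. indicator B (?s z) :: ennreal) \<in> borel_measurable \<mu>" using sm B by measurable
      let ?M1 = "distr (density \<mu> (\<lambda>z. indicator B (?s z))) borel ?u"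
      let ?M2 = "density \<mu> (\<lambda>z. indicator B (?s z)) \<bind> (\<lambda>z. slice_at \<theta> (?s z))"
      have km': "(\<lambda>z. slice_at \<theta> (?s z)) \<in> density \<mu> (\<lambda>z. indicator B (?s z)) \<rightarrow>\<^sub>M subprob_algebra borel"
        using km by simp
      have e1: "emeasure ?M1 C = emeasure \<mu> {z. ?s z \<in> B \<and> ?u z \<in> C}" if C: "C \<in> sets borel" for C
      proof -
        have "emeasure ?M1 C = (\<integral>\<^sup>+z. indicator {z. ?s z \<in> B \<and> ?u z \<in> C} z \<partial>\<mu>)"
          unfolding emeasure_distr_density[OF sm(2) im C] by (intro nn_integral_cong) (auto simp: indicator_def)
        also have "\<dots> = emeasure \<mu> {z. ?s z \<in> B \<and> ?u z \<in> C}" by (rule nn_integral_indicator[OF set1[OF B C]])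
        finally show ?thesis .
      qed
      have e2: "emeasure ?M2 C = (\<integral>\<^sup>+z. indicator B (?s z) * emeasure (slice_at \<theta> (?s z)) C \<partial>\<mu>)" if C: "C \<in> sets borel" for C
      proof -
        have "emeasure ?M2 C = (\<integral>\<^sup>+z. emeasure (slice_at \<theta> (?s z)) C \<partial>density \<mu> (\<lambda>z. indicator B (?s z)))"
          by (rule emeasure_bind[OF _ km' C]) simp
        also have "\<dots> = (\<integral>\<^sup>+z. indicator B (?s z) * emeasure (slice_at \<theta> (?s z)) C \<partial>\<mu>)"
          by (rule nn_integral_density[OF im kem[OF C]])
        finally show ?thesis .
      qed
      have "?M1 = ?M2"
      proof (rule finite_measure_eqI_rat)
        show "finite_measure ?M1"
        proof (rule finite_measureI)
          have "emeasure ?M1 UNIV \<le> 1" by (subst e1, simp) (rule \<mu>.emeasure_le_1)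
          then show "emeasure ?M1 (space ?M1) \<noteq> \<infinity>" by (auto simp: top_unique)
        qed
        show "emeasure ?M1 {..real_of_rat r} = emeasure ?M2 {..real_of_rat r}" for r
          by (subst e1, simp, subst e2, simp) (use one[OF B] in simp)
        show "sets ?M2 = sets borel" by (rule sets_bind) (auto simp: slice_at_props)
      qed simp
      then show "emeasure \<mu> {z. ?s z \<in> B \<and> ?u z \<in> C} = (\<integral>\<^sup>+z. indicator B (?s z) * emeasure (slice_at \<theta> (?s z)) C \<partial>\<mu>)"
        using e1[OF C] e2[OF C] by simp
    qed
  qed
qed

lemma nn_integral_resample:
  assumes dis: "disintegrates \<theta>" and f: "f \<in> borel_measurable (borel \<Otimes>\<^sub>M borel)"
  shows "(\<integral>\<^sup>+z. f (slice_proj \<theta> z, along \<theta> z) \<partial>\<mu>) =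
    (\<integral>\<^sup>+z. \<integral>\<^sup>+v. f (slice_proj \<theta> z, v) \<partial>slice_at \<theta> (slice_proj \<theta> z) \<partial>\<mu>)"
proof -
  let ?s = "slice_proj \<theta>" and ?u = "along \<theta>"
  let ?J1 = "distr \<mu> (borel \<Otimes>\<^sub>M borel) (\<lambda>z. (?s z, ?u z))"
  let ?k = "\<lambda>z. distr (slice_at \<theta> (?s z)) (borel \<Otimes>\<^sub>M borel) (Pair (?s z))"
  let ?J2 = "\<mu> \<bind> ?k"
  have sm: "?s \<in> borel_measurable \<mu>" "?u \<in> borel_measurable \<mu>" by (simp_all cong: measurable_cong_sets)
  have km: "(\<lambda>z. slice_at \<theta> (?s z)) \<in> \<mu> \<rightarrow>\<^sub>M subprob_algebra borel" using sm by (intro slice_at_measurable) simp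
  have km2: "?k \<in> \<mu> \<rightarrow>\<^sub>M subprob_algebra (borel \<Otimes>\<^sub>M borel)"
    using km sm by (intro measurable_distr2[where M=borel]) (auto simp: case_prod_unfold)
  have pm: "(\<lambda>z. (?s z, ?u z)) \<in> \<mu> \<rightarrow>\<^sub>M borel \<Otimes>\<^sub>M borel" using sm by measurable
  have Px: "Pair x \<in> slice_at \<theta> x' \<rightarrow>\<^sub>M borel \<Otimes>\<^sub>M borel" for x x'
    by (simp add: slice_at_props cong: measurable_cong_sets)
  have "?J1 = ?J2"
  proof (rule measure_eqI_generator_eq[OF Int_stable_pair_measure_generator, where \<Omega>=UNIV and A="\<lambda>_. UNIV"])
    show "{a \<times> b |a b. a \<in> sets borel \<and> b \<in> sets borel} \<subseteq> Pow (UNIV :: (real \<times> real) set)" by simp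
    show "sets ?J1 = sigma_sets UNIV {a \<times> b |a b. a \<in> sets borel \<and> b \<in> sets borel}"
      by (simp add: sets_pair_measure)
    show "sets ?J2 = sigma_sets UNIV {a \<times> b |a b. a \<in> sets borel \<and> b \<in> sets borel}"
      by (subst sets_bind[where N="borel \<Otimes>\<^sub>M borel"]) (simp_all add: sets_pair_measure)
    show "range (\<lambda>_::nat. UNIV) \<subseteq> {a \<times> b |a b. a \<in> sets (borel::real measure) \<and> b \<in> sets (borel :: real measure)}"
      by (auto intro!: exI[of _ UNIV])
    show "emeasure ?J1 UNIV \<noteq> \<infinity>"
      using prob_space.emeasure_le_1[OF \<mu>.prob_space_distr[OF pm], of UNIV] by (auto simp: top_unique)
    fix X assume "X \<in> {a \<times> b |a b. a \<in> sets (borel::real measure) \<and> b \<in> sets (borel :: real measure)}"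
    then obtain B C where X: "X = B \<times> C" and B: "B \<in> sets borel" and C: "C \<in> sets borel" by blast
    have Xs: "X \<in> sets (borel \<Otimes>\<^sub>M borel)" unfolding X using B C by simp
    have "emeasure ?J1 X = emeasure \<mu> {z. ?s z \<in> B \<and> ?u z \<in> C}"
      using pm Xs by (subst emeasure_distr) (auto simp: X vimage_def)
    also have "\<dots> = (\<integral>\<^sup>+z. indicator B (?s z) * emeasure (slice_at \<theta> (?s z)) C \<partial>\<mu>)"
      using dis B C unfolding disintegrates_def by blast
    also have "\<dots> = (\<integral>\<^sup>+z. emeasure (?k z) X \<partial>\<mu>)"
    proof (rule nn_integral_cong)
      fix z
      have "emeasure (?k z) X = emeasure (slice_at \<theta> (?s z)) (Pair (?s z) -` X \<inter> space (slice_at \<theta> (?s z)))"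
        by (rule emeasure_distr[OF Px Xs])
      also have "Pair (?s z) -` X \<inter> space (slice_at \<theta> (?s z)) = (if ?s z \<in> B then C else {})"
        by (auto simp: X slice_at_props)
      finally show "indicator B (?s z) * emeasure (slice_at \<theta> (?s z)) C = emeasure (?k z) X" by simp
    qed
    also have "\<dots> = emeasure ?J2 X" by (rule emeasure_bind[OF _ km2 Xs, symmetric]) simp
    finally show "emeasure ?J1 X = emeasure ?J2 X" .
  qed simp
  then have "(\<integral>\<^sup>+y. f y \<partial>?J1) = (\<integral>\<^sup>+y. f y \<partial>?J2)" by simp
  also have "\<dots> = (\<integral>\<^sup>+z. \<integral>\<^sup>+y. f y \<partial>?k z \<partial>\<mu>)" using f km2 by (rule nn_integral_bind)
  also have "\<dots> = (\<integral>\<^sup>+z. \<integral>\<^sup>+v. f (?s z, v) \<partial>slice_at \<theta> (?s z) \<partial>\<mu>)"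
    by (intro nn_integral_cong nn_integral_distr Px) (use f in simp)
  finally show ?thesis using nn_integral_distr[OF pm, of f] f by simp
qed

text \<open>The law of a point does not change if it is replaced by another point of the same slice, chosen by
  the slice measure. This is where the quasi-Palm property comes from.\<close>

lemma AE_resample:
  assumes dis: "disintegrates \<theta>" and R: "{p. R (fst p) (snd p)} \<in> sets (borel \<Otimes>\<^sub>M borel)"
  shows "(AE z in \<mu>. R (slice_proj \<theta> z) (along \<theta> z)) \<longleftrightarrow>
    (AE z in \<mu>. AE v in slice_at \<theta> (slice_proj \<theta> z). R (slice_proj \<theta> z) v)"
proof -
  let ?s = "slice_proj \<theta>" and ?u = "along \<theta>"
  define f :: "real \<times> real => ennreal" where "f = indicator {p. \<not> R (fst p) (snd p)}"
  have "{p. \<not> R (fst p) (snd p)} = space (borel \<Otimes>\<^sub>M borel) - {p. R (fst p) (snd p)}" by (auto simp: space_pair_measure)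
  also have "\<dots> \<in> sets (borel \<Otimes>\<^sub>M borel)" using R by (rule sets.compl_sets)
  finally have f: "f \<in> borel_measurable (borel \<Otimes>\<^sub>M borel)" unfolding f_def by (rule borel_measurable_indicator)
  have sm: "?s \<in> borel_measurable \<mu>" "?u \<in> borel_measurable \<mu>" by (simp_all cong: measurable_cong_sets)
  have m1: "(\<lambda>z. f (?s z, ?u z)) \<in> borel_measurable \<mu>"
    by (rule measurable_compose[OF measurable_Pair[OF sm] f])
  have m2: "(\<lambda>v. f (x, v)) \<in> borel_measurable (slice_at \<theta> x')" for x x'
    using measurable_compose[OF measurable_Pair1' f, of x] by (simp add: slice_at_props cong: measurable_cong_sets)
  have m3: "(\<lambda>z. \<integral>\<^sup>+v. f (?s z, v) \<partial>slice_at \<theta> (?s z)) \<in> borel_measurable \<mu>"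
  proof (rule nn_integral_measurable_subprob_algebra2[where N=borel])
    show "(\<lambda>(x, y). f (?s x, y)) \<in> borel_measurable (\<mu> \<Otimes>\<^sub>M borel)"
      unfolding case_prod_unfold using sm by (intro measurable_compose[OF _ f]) measurable
    show "(\<lambda>z. slice_at \<theta> (?s z)) \<in> \<mu> \<rightarrow>\<^sub>M subprob_algebra borel" using sm by (intro slice_at_measurable) simp
  qed
  have "(AE z in \<mu>. R (?s z) (?u z)) \<longleftrightarrow> (\<integral>\<^sup>+z. f (?s z, ?u z) \<partial>\<mu>) = 0"
    unfolding nn_integral_0_iff_AE[OF m1] by (simp add: f_def indicator_eq_0_iff)
  also have "\<dots> \<longleftrightarrow> (AE z in \<mu>. (\<integral>\<^sup>+v. f (?s z, v) \<partial>slice_at \<theta> (?s z)) = 0)"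
    unfolding nn_integral_resample[OF dis f] nn_integral_0_iff_AE[OF m3] ..
  also have "\<dots> \<longleftrightarrow> (AE z in \<mu>. AE v in slice_at \<theta> (?s z). R (?s z) v)"
    unfolding nn_integral_0_iff_AE[OF m2] by (simp add: f_def indicator_eq_0_iff)
  finally show ?thesis .
qed

end

section \<open>The scenery along the skew product\<close>

context self_affine_furstenberg
begin

interpretation \<mu>: prob_space \<mu> by (rule prob_space_\<mu>)

interpretation ST: pair_prob_space "measure_pmf sign_pmf" Th by (rule pair_prob_space_signed)

interpretation S: random_maps STh p signed_map by (rule random_maps_signed)

lemma distr_coding: "distr \<B> borel (coding T) = \<mu>"
  by (simp add: self_affine_measure_def)

lemma coding_shift_measurable: "(\<lambda>a. coding T (\<lambda>n. a (Suc n))) \<in> \<B> \<rightarrow>\<^sub>M borel"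
  using measurable_compose[OF bernoulli_Suc_measurable coding_measurable] .

lemma distr_coding_shift: "distr \<B> borel (\<lambda>a. coding T (\<lambda>n. a (Suc n))) = \<mu>"
proof (rule measure_eqI)
  fix X assume "X \<in> sets (distr \<B> borel (\<lambda>a. coding T (\<lambda>n. a (Suc n))))"
  then have X: "X \<in> sets borel" by simp
  have m: "(\<lambda>a. indicator X (coding T (\<lambda>n. a (Suc n))) :: ennreal) \<in> borel_measurable \<B>"
    using coding_shift_measurable X by measurable
  have "emeasure (distr \<B> borel (\<lambda>a. coding T (\<lambda>n. a (Suc n)))) X = (\<integral>\<^sup>+z. indicator X z \<partial>distr \<B> borel (\<lambda>a. coding T (\<lambda>n. a (Suc n))))"
    using X by simp
  also have "\<dots> = (\<integral>\<^sup>+a. indicator X (coding T (\<lambda>n. a (Suc n))) \<partial>\<B>)"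
    using X by (intro nn_integral_distr coding_shift_measurable) simp
  also have "\<dots> = (\<integral>\<^sup>+i. \<integral>\<^sup>+a. indicator X (coding T a) \<partial>\<B> \<partial>measure_pmf p)"
    unfolding nn_integral_bernoulli_first[OF m] by simp
  also have "\<dots> = (\<integral>\<^sup>+a. indicator X (coding T a) \<partial>\<B>)"
    by simp
  also have "\<dots> = (\<integral>\<^sup>+z. indicator X z \<partial>\<mu>)" using X by (intro nn_integral_\<mu>[symmetric]) simp
  also have "\<dots> = emeasure \<mu> X" using X by simp
  finally show "emeasure (distr \<B> borel (\<lambda>a. coding T (\<lambda>n. a (Suc n)))) X = emeasure \<mu> X" .
qed simp

lemma AE_\<mu>_T:
  assumes ae: "AE z in \<mu>. R z" and i: "i \<in> set_pmf p" shows "AE z in \<mu>. R (T i z)"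
proof -
  obtain N where N: "N \<in> null_sets \<mu>" "{z \<in> space \<mu>. \<not> R z} \<subseteq> N" using ae by (auto simp: eventually_ae_filter)
  have Ns: "N \<in> sets borel" using N by auto
  have Tm: "T i \<in> \<mu> \<rightarrow>\<^sub>M borel" for i by (simp cong: measurable_cong_sets)
  have TN: "T i -` N \<inter> space \<mu> \<in> sets \<mu>" for i by (rule measurable_sets[OF Tm Ns])
  have "(\<integral>\<^sup>+i. \<integral>\<^sup>+z. indicator N (T i z) \<partial>\<mu> \<partial>measure_pmf p) = 0"
    using nn_integral_\<mu>_self_similar[of "indicator N"] Ns N(1) by (simp add: null_setsD1)
  then have "(\<integral>\<^sup>+z. indicator N (T i z) \<partial>\<mu>) = 0"
    using i nn_integral_0_iff_AE[of "\<lambda>i. \<integral>\<^sup>+z. indicator N (T i z) \<partial>\<mu>" "measure_pmf p"] by (simp add: AE_measure_pmf_iff)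
  moreover have "(\<lambda>z. indicator N (T i z) :: ennreal) \<in> borel_measurable \<mu>"
    using Tm Ns by (intro measurable_compose[OF Tm]) simp
  ultimately have "AE z in \<mu>. indicator N (T i z) = (0::ennreal)" using nn_integral_0_iff_AE by blast
  then show ?thesis
  proof eventually_elim
    case (elim z)
    then have "T i z \<notin> N" by (simp add: indicator_eq_0_iff)
    then show ?case using N(2) by auto
  qed
qed

lemma nn_integral_\<mu>_cylinder:
  assumes f [measurable]: "f \<in> borel_measurable borel"
  shows "(\<integral>\<^sup>+z. f z * indicator (T i ` disk) z \<partial>\<mu>) = ennreal (pmf p i) * (\<integral>\<^sup>+z. f (T i z) \<partial>\<mu>)"
proof -
  have "(\<integral>\<^sup>+z. f z * indicator (T i ` disk) z \<partial>\<mu>) =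
    (\<integral>\<^sup>+j. \<integral>\<^sup>+z. f (T j z) * indicator (T i ` disk) (T j z) \<partial>\<mu> \<partial>measure_pmf p)"
    by (rule nn_integral_\<mu>_self_similar) measurable
  also have "\<dots> = (\<integral>\<^sup>+j. indicator {i} j * (\<integral>\<^sup>+z. f (T i z) \<partial>\<mu>) \<partial>measure_pmf p)"
  proof (rule nn_integral_cong)
    fix j
    have "(\<integral>\<^sup>+z. f (T j z) * indicator (T i ` disk) (T j z) \<partial>\<mu>) = (\<integral>\<^sup>+z. indicator {i} j * f (T i z) \<partial>\<mu>)"
    proof (rule nn_integral_cong_AE)
      show "AE z in \<mu>. f (T j z) * indicator (T i ` disk) (T j z) = indicator {i} j * f (T i z)"
        using AE_\<mu>_disk
      proof eventually_elim
        case (elim z)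
        have "T j z \<in> T i ` disk \<longleftrightarrow> i = j" using elim separation[of i j] by blast
        then show ?case by (auto simp: indicator_def)
      qed
    qed
    also have "\<dots> = indicator {i} j * (\<integral>\<^sup>+z. f (T i z) \<partial>\<mu>)"
      by (rule nn_integral_cmult) measurable
    finally show "(\<integral>\<^sup>+z. f (T j z) * indicator (T i ` disk) (T j z) \<partial>\<mu>) = indicator {i} j * (\<integral>\<^sup>+z. f (T i z) \<partial>\<mu>)" .
  qed
  also have "\<dots> = ennreal (pmf p i) * (\<integral>\<^sup>+z. f (T i z) \<partial>\<mu>)"
    by (simp add: nn_integral_multc emeasure_pmf_single)
  finally show ?thesis .
qed

text \<open>The slice at \<open>x\<close> as it is seen from the position \<open>u\<close> in the orientation \<open>e\<close>, which is \<open>1\<close> or \<open>-1\<close>.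
  The sceneries zoom into these measures at \<open>0\<close>.\<close>

definition shifted :: "real => real => real => real => real measure" where
  "shifted e \<theta> x u = distr (slice_at \<theta> x) borel (\<lambda>v. e * (v - u))"

abbreviation "local_slice e \<theta> z \<equiv> shifted e \<theta> (slice_proj \<theta> z) (along \<theta> z)"

lemma sets_shifted [simp]: "sets (shifted e \<theta> x u) = sets borel" and space_shifted [simp]: "space (shifted e \<theta> x u) = UNIV"
  by (simp_all add: shifted_def)

lemma slice_at_borel: "f \<in> borel_measurable borel ==> f \<in> borel_measurable (slice_at \<theta> x)"
  by (simp add: slice_at_props cong: measurable_cong_sets)

lemma prob_space_shifted: "prob_space (shifted e \<theta> x u)"
  unfolding shifted_def by (intro prob_space.prob_space_distr slice_at_props slice_at_borel) simp

lemma emeasure_shifted: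
  "C \<in> sets borel ==> emeasure (shifted e \<theta> x u) C = emeasure (slice_at \<theta> x) {v. e * (v - u) \<in> C}"
  unfolding shifted_def
  by (subst emeasure_distr[OF slice_at_borel]) (simp_all add: slice_at_props vimage_def)

lemma shifted_measurable:
  assumes [measurable]: "e \<in> borel_measurable M" "\<theta> \<in> borel_measurable M" "x \<in> borel_measurable M" "u \<in> borel_measurable M"
  shows "(\<lambda>y. shifted (e y) (\<theta> y) (x y) (u y)) \<in> M \<rightarrow>\<^sub>M subprob_algebra borel"
  unfolding shifted_def
proof (rule measurable_distr2[where M=borel])
  show "(\<lambda>(y, v). e y * (v - u y)) \<in> M \<Otimes>\<^sub>M borel \<rightarrow>\<^sub>M borel" by measurable
  show "(\<lambda>y. slice_at (\<theta> y) (x y)) \<in> M \<rightarrow>\<^sub>M subprob_algebra borel" by (rule slice_at_measurable) measurable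
qed

lemma sign_scale_interval: "e = 1 \<or> e = - 1 ==> e * w \<in> {- c..c} \<longleftrightarrow> w \<in> {- c..c}" for e w c :: real
  by auto

lemma msupport_shifted:
  assumes e: "e = 1 \<or> e = - 1"
  shows "0 \<in> msupport (shifted e \<theta> x u) \<longleftrightarrow> u \<in> msupport (slice_at \<theta> x)"
proof -
  have "emeasure (shifted e \<theta> x u) {0 - 1 / Suc n..0 + 1 / Suc n} = emeasure (slice_at \<theta> x) {u - 1 / Suc n..u + 1 / Suc n}" for n
  proof -
    have "{v. e * (v - u) \<in> {0 - 1 / real (Suc n)..0 + 1 / real (Suc n)}} = {u - 1 / real (Suc n)..u + 1 / real (Suc n)}"
      using e by auto
    then show ?thesis by (subst emeasure_shifted) simp_all
  qed
  then show ?thesis by (simp add: msupport_iff_windows slice_at_props)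
qed

definition slice_point_supported :: "real => real => real => bool" where
  "slice_point_supported \<theta> x u \<longleftrightarrow> u \<in> msupport (slice_at \<theta> x)"

lemma slice_point_supported_measurable:
  assumes [measurable]: "\<theta> \<in> borel_measurable M" "x \<in> borel_measurable M" "u \<in> borel_measurable M"
  shows "{y \<in> space M. slice_point_supported (\<theta> y) (x y) (u y)} \<in> sets M"
proof -
  have [measurable]: "(\<lambda>y. emeasure (slice_at (\<theta> y) (x y)) {v. u y - 1 / real (Suc n) \<le> v \<and> v \<le> u y + 1 / real (Suc n)}) \<in> borel_measurable M" for n
    by (rule slice_at_emeasure_measurable) measurable
  have "{y \<in> space M. slice_point_supported (\<theta> y) (x y) (u y)} =
    {y \<in> space M. \<forall>n. 0 < emeasure (slice_at (\<theta> y) (x y)) {v. u y - 1 / real (Suc n) \<le> v \<and> v \<le> u y + 1 / real (Suc n)}}"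
    by (simp add: slice_point_supported_def msupport_iff_windows slice_at_props atLeastAtMost_def atLeast_def atMost_def Collect_conj_eq)
  also have "\<dots> \<in> sets M" by measurable
  finally show ?thesis .
qed

lemma AE_slice_point_supported:
  assumes dis: "disintegrates \<theta>"
  shows "AE z in \<mu>. slice_point_supported \<theta> (slice_proj \<theta> z) (along \<theta> z)"
proof (subst AE_resample[OF dis])
  have "{p \<in> space (borel \<Otimes>\<^sub>M borel). slice_point_supported \<theta> (fst p) (snd p)} \<in> sets (borel \<Otimes>\<^sub>M borel)"
    by (rule slice_point_supported_measurable) measurable
  then show "{p. slice_point_supported \<theta> (fst p) (snd p)} \<in> sets (borel \<Otimes>\<^sub>M borel)" by (simp add: space_pair_measure)
  show "AE z in \<mu>. AE v in slice_at \<theta> (slice_proj \<theta> z). slice_point_supported \<theta> (slice_proj \<theta> z) v"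
    unfolding slice_point_supported_def by (intro AE_I2 AE_msupport slice_at_props)
qed

text \<open>Within this distance of a point of a first level cylinder there is no point of another one.\<close>

definition gap :: real where
  "gap = (SOME \<delta>. \<delta> > 0 \<and> (\<forall>i. \<forall>z\<in>T i ` disk. \<forall>z'\<in>(\<Union>j. T j ` disk). dist z z' < \<delta> --> z' \<in> T i ` disk))"

lemma gap: "gap > 0" "z \<in> T i ` disk ==> z' \<in> (\<Union>j. T j ` disk) ==> dist z z' < gap ==> z' \<in> T i ` disk"
proof -
  have g: "gap > 0 \<and> (\<forall>i. \<forall>z\<in>T i ` disk. \<forall>z'\<in>(\<Union>j. T j ` disk). dist z z' < gap --> z' \<in> T i ` disk)"
    unfolding gap_def by (rule someI_ex) (rule cylinder_gap)
  then show "gap > 0" by (rule conjunct1)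
  show "z' \<in> T i ` disk" if "z \<in> T i ` disk" "z' \<in> (\<Union>j. T j ` disk)" "dist z z' < gap"
    using mp[OF bspec[OF bspec[OF spec[OF conjunct2[OF g]] that(1)] that(2)] that(3)] .
qed

text \<open>From this time on, windows are shorter than \<open>gap\<close>. It is at least \<open>ln 2\<close> because the windows of
  \<open>slice_scenery\<close> have half-length \<open>exp (-t) / 2 = exp (- (t + ln 2))\<close>.\<close>

definition start_time :: real where "start_time = max (ln 2) (1 - ln gap)"

lemma exp_start_time: "s \<ge> start_time ==> exp (- s) < gap"
proof -
  assume "s \<ge> start_time"
  then have "- s < ln gap" by (simp add: start_time_def)
  then have "exp (- s) < exp (ln gap)" by simp
  then show ?thesis using gap(1) by simp
qed

text \<open>Self-similarity of slices: inside \<open>T i ` disk\<close>, the slice in direction \<open>\<theta>\<close> through \<open>T i z\<close> is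
  proportional to the affine image of the slice in direction \<open>\<phi> i \<theta>\<close> through \<open>z\<close>. The condition is
  tested on rational half-lines in order to be a measurable condition on \<open>\<theta>\<close> and \<open>z\<close>.\<close>

definition step_ok :: "'k => real => real^2 => bool" where
  "step_ok i \<theta> z \<longleftrightarrow> \<theta> \<in> Q \<and> T i z \<in> T i ` disk \<and>
     emeasure (slice_at \<theta> (slice_proj \<theta> (T i z))) {v. line_point \<theta> (slice_proj \<theta> (T i z)) v \<notin> (\<Union>j. T j ` disk)} = 0 \<and>
     emeasure (slice_at \<theta> (slice_proj \<theta> (T i z))) {v. line_point \<theta> (slice_proj \<theta> (T i z)) v \<in> T i ` disk} \<noteq> 0 \<and>
     (\<forall>q. emeasure (slice_at \<theta> (slice_proj \<theta> (T i z))) {v. v \<le> real_of_rat q \<and> line_point \<theta> (slice_proj \<theta> (T i z)) v \<in> T i ` disk} =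
        emeasure (slice_at \<theta> (slice_proj \<theta> (T i z))) {v. line_point \<theta> (slice_proj \<theta> (T i z)) v \<in> T i ` disk} *
        emeasure (slice_at (\<phi> i \<theta>) (slice_proj (\<phi> i \<theta>) z))
          {v. along \<theta> (T i z) + sgn (det (A i)) / stretch i \<theta> * (v - along (\<phi> i \<theta>) z) \<le> real_of_rat q})"

lemma cylinders_sets [measurable]: "(\<Union>j. T j ` disk) \<in> sets borel"
  by measurable

lemma step_ok_measurable: "{x. step_ok i (fst x) (snd x)} \<in> sets (borel \<Otimes>\<^sub>M borel)"
proof -
  let ?M = "borel \<Otimes>\<^sub>M borel :: (real \<times> (real^2)) measure"
  have t [measurable]: "(\<lambda>x. \<phi> i (fst x)) \<in> borel_measurable ?M" "(\<lambda>x. T i (snd x)) \<in> borel_measurable ?M"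
    "(\<lambda>x. stretch i (fst x)) \<in> borel_measurable ?M"
    by (rule measurable_compose[OF measurable_fst \<phi>_measurable] measurable_compose[OF measurable_snd T_measurable]
      measurable_compose[OF measurable_fst stretch_measurable])+
  have t2 [measurable]: "(\<lambda>x. \<phi> i (fst (fst x))) \<in> borel_measurable (?M \<Otimes>\<^sub>M (borel :: real measure))"
    "(\<lambda>x. T i (snd (fst x))) \<in> borel_measurable (?M \<Otimes>\<^sub>M (borel :: real measure))"
    "(\<lambda>x. stretch i (fst (fst x))) \<in> borel_measurable (?M \<Otimes>\<^sub>M (borel :: real measure))"
    using measurable_compose[OF measurable_fst t(1)] measurable_compose[OF measurable_fst t(2)]
      measurable_compose[OF measurable_fst t(3)] by simp_all
  have [measurable]: "(\<lambda>x. emeasure (slice_at (fst x) (slice_proj (fst x) (T i (snd x)))) {v. line_point (fst x) (slice_proj (fst x) (T i (snd x))) v \<notin> (\<Union>j. T j ` disk)}) \<in> borel_measurable ?M"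
    by (rule slice_at_emeasure_measurable) measurable
  have [measurable]: "(\<lambda>x. emeasure (slice_at (fst x) (slice_proj (fst x) (T i (snd x)))) {v. line_point (fst x) (slice_proj (fst x) (T i (snd x))) v \<in> T i ` disk}) \<in> borel_measurable ?M"
    by (rule slice_at_emeasure_measurable) measurable
  have [measurable]: "(\<lambda>x. emeasure (slice_at (fst x) (slice_proj (fst x) (T i (snd x)))) {v. v \<le> real_of_rat q \<and> line_point (fst x) (slice_proj (fst x) (T i (snd x))) v \<in> T i ` disk}) \<in> borel_measurable ?M" for q
    by (rule slice_at_emeasure_measurable) measurable
  have [measurable]: "(\<lambda>x. emeasure (slice_at (\<phi> i (fst x)) (slice_proj (\<phi> i (fst x)) (snd x)))
          {v. along (fst x) (T i (snd x)) + sgn (det (A i)) / stretch i (fst x) * (v - along (\<phi> i (fst x)) (snd x)) \<le> real_of_rat q}) \<in> borel_measurable ?M" for q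
    by (rule slice_at_emeasure_measurable) measurable
  have "{x \<in> space ?M. step_ok i (fst x) (snd x)} \<in> sets ?M"
    unfolding step_ok_def by measurable
  then show ?thesis by (simp add: space_pair_measure)
qed

lemma inverse_dir:
  assumes \<theta>: "\<theta> \<in> Q"
  shows "A i *v dir (\<phi> i \<theta>) = (sgn (det (A i)) / stretch i \<theta>) *\<^sub>R dir \<theta>"
proof -
  have s: "sgn (det (A i)) * sgn (det (A i)) = 1" using sg[of i] by auto
  have "dir \<theta> = A i *v (matrix_inv (A i) *v dir \<theta>)" by (simp only: matrix_inv_cancel(1)[OF invertible])
  also have "\<dots> = (sgn (det (A i)) * stretch i \<theta>) *\<^sub>R (A i *v dir (\<phi> i \<theta>))"
    by (simp only: stretch_dir[OF \<theta>] matrix_vector_mult_scaleR)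
  finally have d: "dir \<theta> = (sgn (det (A i)) * stretch i \<theta>) *\<^sub>R (A i *v dir (\<phi> i \<theta>))" .
  have "(sgn (det (A i)) / stretch i \<theta>) * (sgn (det (A i)) * stretch i \<theta>) = 1"
    using s stretch_pos[of i \<theta>] by (simp add: field_simps)
  then show ?thesis by (subst d) (simp only: scaleR_scaleR scaleR_one)
qed

text \<open>The map \<open>T i\<close> sends lines in direction \<open>\<phi> i \<theta>\<close> to lines in direction \<open>\<theta>\<close>, and it carries \<open>\<mu>\<close>, up
  to the factor \<open>pmf p i\<close>, to the part of \<open>\<mu>\<close> inside \<open>T i ` disk\<close>. So both sides of the identity are
  conditional distributions of that part along its slices.\<close>

lemma AE_step_ok:
  assumes i: "i \<in> set_pmf p"
  shows "AE \<theta> in Th. AE z in \<mu>. step_ok i \<theta> z"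
  using Th_Q AE_disintegrates AE_\<Phi>[OF AE_disintegrates i]
proof eventually_elim
  case (elim \<theta>)
  note \<theta> = elim(1) and dis = elim(2) and dis' = elim(3)
  define \<theta>' where "\<theta>' = \<phi> i \<theta>"
  define c where "c = sgn (det (A i)) / stretch i \<theta>"
  let ?s = "slice_proj \<theta>" and ?u = "along \<theta>" and ?s' = "slice_proj \<theta>'" and ?u' = "along \<theta>'"
  let ?K = "T i ` disk"
  \<comment> \<open>In the orthonormal frames of \<open>\<phi> i \<theta>\<close> and \<open>\<theta>\<close> the affine map \<open>T i\<close> is triangular; \<open>gi\<close> inverts
    its action on the slice positions.\<close>
  define \<alpha> where "\<alpha> = ?s (A i *v normal_dir \<theta>')" define \<beta> where "\<beta> = ?s (d i)"
  define \<gamma> where "\<gamma> = ?u (A i *v normal_dir \<theta>')" define \<beta>' where "\<beta>' = ?u (d i)"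
  define h where "h x v = c * v + \<gamma> * x + \<beta>'" for x v
  define gi where "gi x = (x - \<beta>) / \<alpha>" for x
  have Ad: "A i *v dir \<theta>' = c *\<^sub>R dir \<theta>" unfolding \<theta>'_def c_def by (rule inverse_dir[OF \<theta>])
  have Tz: "T i z = (?u' z * c) *\<^sub>R dir \<theta> + ?s' z *\<^sub>R (A i *v normal_dir \<theta>') + d i" for z
  proof -
    have "A i *v z = A i *v (line_point \<theta>' (?s' z) (?u' z))" by (simp only: line_point_coords)
    also have "\<dots> = ?u' z *\<^sub>R (A i *v dir \<theta>') + ?s' z *\<^sub>R (A i *v normal_dir \<theta>')"
      by (simp only: line_point_def matrix_vector_right_distrib matrix_vector_mult_scaleR)
    finally show ?thesis by (simp add: affine_map_def Ad)
  qed
  have sT: "?s (T i z) = \<alpha> * ?s' z + \<beta>" for z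
    unfolding Tz[of z] by (simp add: slice_proj_normal inner_add_left \<alpha>_def \<beta>_def)
  have uT: "?u (T i z) = h (?s' z) (?u' z)" for z
    unfolding Tz[of z] by (simp add: along_def inner_add_left h_def \<gamma>_def \<beta>'_def)
  have \<alpha>: "\<alpha> \<noteq> 0"
  proof
    assume "\<alpha> = 0"
    then have "A i *v normal_dir \<theta>' = \<gamma> *\<^sub>R dir \<theta>"
      using line_point_coords[of \<theta> "A i *v normal_dir \<theta>'"] by (simp add: line_point_def \<alpha>_def \<gamma>_def)
    moreover have c0: "c \<noteq> 0" using sg[of i] stretch_pos[of i \<theta>] by (auto simp: c_def)
    ultimately have "A i *v normal_dir \<theta>' = A i *v ((\<gamma> / c) *\<^sub>R dir \<theta>')"
      by (simp add: matrix_vector_mult_scaleR Ad)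
    then have "matrix_inv (A i) *v (A i *v normal_dir \<theta>') = matrix_inv (A i) *v (A i *v ((\<gamma> / c) *\<^sub>R dir \<theta>'))" by simp
    then have "normal_dir \<theta>' = (\<gamma> / c) *\<^sub>R dir \<theta>'" by (simp only: matrix_inv_cancel(2)[OF invertible])
    then have "normal_dir \<theta>' \<bullet> normal_dir \<theta>' = (\<gamma> / c) * (dir \<theta>' \<bullet> normal_dir \<theta>')" by (metis inner_scaleR_left)
    then show False by simp
  qed
  have gi: "gi (\<alpha> * x + \<beta>) = x" for x using \<alpha> by (simp add: gi_def)
  \<comment> \<open>Both functions \<open>f q\<close> and \<open>\<rho> * k q\<close> of the slice position have the same integrals over Borel sets.\<close>
  define \<rho> where "\<rho> x = emeasure (slice_at \<theta> x) {v. line_point \<theta> x v \<in> ?K}" for x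
  define f where "f q x = emeasure (slice_at \<theta> x) {v. v \<le> real_of_rat q \<and> line_point \<theta> x v \<in> ?K}" for q x
  define k where "k q x = emeasure (slice_at \<theta>' (gi x)) {v. h (gi x) v \<le> real_of_rat q}" for q x
  have gim [measurable]: "gi \<in> borel_measurable borel" unfolding gi_def by measurable
  have sb [measurable]: "?s \<in> borel_measurable borel" "?u \<in> borel_measurable borel" "?s' \<in> borel_measurable borel" "?u' \<in> borel_measurable borel"
    by simp_all
  have \<rho>m [measurable]: "\<rho> \<in> borel_measurable borel"
    unfolding \<rho>_def by (rule slice_at_emeasure_measurable[where f="\<lambda>_. \<theta>" and g="\<lambda>x. x"]) measurable
  have fm [measurable]: "f q \<in> borel_measurable borel" for q
    unfolding f_def by (rule slice_at_emeasure_measurable[where f="\<lambda>_. \<theta>" and g="\<lambda>x. x"]) measurable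
  have km [measurable]: "k q \<in> borel_measurable borel" for q
    unfolding k_def h_def by (rule slice_at_emeasure_measurable[where f="\<lambda>_. \<theta>'" and g=gi]) measurable
  have le1: "emeasure (slice_at t x) X \<le> 1" for t x X using slice_at_props(1) by (rule prob_space.emeasure_le_1)
  let ?\<eta> = "distr \<mu> borel ?s"
  have sm: "?s \<in> borel_measurable \<mu>" by (simp cong: measurable_cong_sets)
  have ss: "{v. line_point \<theta> x v \<in> ?K} \<in> sets (slice_at \<theta> x)" "{v. v \<le> c \<and> line_point \<theta> x v \<in> ?K} \<in> sets (slice_at \<theta> x)" for x c
  proof -
    have "{v \<in> space borel. line_point \<theta> x v \<in> ?K} \<in> sets borel" "{v \<in> space borel. v \<le> c \<and> line_point \<theta> x v \<in> ?K} \<in> sets borel"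
      by measurable
    then show "{v. line_point \<theta> x v \<in> ?K} \<in> sets (slice_at \<theta> x)" "{v. v \<le> c \<and> line_point \<theta> x v \<in> ?K} \<in> sets (slice_at \<theta> x)"
      by (simp_all add: slice_at_props)
  qed
  have "AE x in ?\<eta>. f q x = \<rho> x * k q x" for q
  proof (rule AE_eq_of_integrals)
    show "f q \<in> borel_measurable ?\<eta>" "(\<lambda>x. \<rho> x * k q x) \<in> borel_measurable ?\<eta>" by measurable
    have "(\<integral>\<^sup>+x. \<rho> x * k q x \<partial>?\<eta>) \<le> (\<integral>\<^sup>+x. 1 \<partial>?\<eta>)"
    proof (rule nn_integral_mono)
      fix x
      have "\<rho> x * k q x \<le> 1 * 1" unfolding \<rho>_def k_def by (intro mult_mono le1) simp_all
      then show "\<rho> x * k q x \<le> 1" by simp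
    qed
    also have "\<dots> < \<infinity>" using prob_space.emeasure_space_1[OF \<mu>.prob_space_distr[OF sm]] by simp
    finally show "(\<integral>\<^sup>+x. \<rho> x * k q x \<partial>?\<eta>) < \<infinity>" .
    fix X assume "X \<in> sets ?\<eta>"
    then have X [measurable]: "X \<in> sets borel" by simp
    define F1 :: "real \<times> real => ennreal" where
      "F1 = (\<lambda>y. indicator X (fst y) * indicator {y. snd y \<le> real_of_rat q \<and> line_point \<theta> (fst y) (snd y) \<in> ?K} y)"
    have F1m: "F1 \<in> borel_measurable (borel \<Otimes>\<^sub>M borel)"
    proof -
      have "{y \<in> space (borel \<Otimes>\<^sub>M borel). snd y \<le> real_of_rat q \<and> line_point \<theta> (fst y) (snd y) \<in> ?K} \<in> sets (borel \<Otimes>\<^sub>M borel)" by measurable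
      then have [measurable]: "{y. snd y \<le> real_of_rat q \<and> line_point \<theta> (fst y) (snd y) \<in> ?K} \<in> sets (borel \<Otimes>\<^sub>M borel)" by (simp add: space_pair_measure)
      show ?thesis unfolding F1_def by measurable
    qed
    define F2 :: "real \<times> real => ennreal" where
      "F2 = (\<lambda>y. indicator X (\<alpha> * fst y + \<beta>) * indicator {y. h (fst y) (snd y) \<le> real_of_rat q} y)"
    have F2m: "F2 \<in> borel_measurable (borel \<Otimes>\<^sub>M borel)"
    proof -
      have "{y \<in> space (borel \<Otimes>\<^sub>M borel). h (fst y) (snd y) \<le> real_of_rat q} \<in> sets (borel \<Otimes>\<^sub>M borel)" unfolding h_def by measurable
      then have [measurable]: "{y. h (fst y) (snd y) \<le> real_of_rat q} \<in> sets (borel \<Otimes>\<^sub>M borel)" by (simp add: space_pair_measure)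
      show ?thesis unfolding F2_def by measurable
    qed
    define F3 :: "real \<times> real => ennreal" where
      "F3 = (\<lambda>y. (indicator X (fst y) * k q (fst y)) * indicator {y. line_point \<theta> (fst y) (snd y) \<in> ?K} y)"
    have F3m: "F3 \<in> borel_measurable (borel \<Otimes>\<^sub>M borel)"
    proof -
      have "{y \<in> space (borel \<Otimes>\<^sub>M borel). line_point \<theta> (fst y) (snd y) \<in> ?K} \<in> sets (borel \<Otimes>\<^sub>M borel)" by measurable
      then have [measurable]: "{y. line_point \<theta> (fst y) (snd y) \<in> ?K} \<in> sets (borel \<Otimes>\<^sub>M borel)" by (simp add: space_pair_measure)
      show ?thesis unfolding F3_def by measurable
    qed
    have "(\<integral>\<^sup>+x. indicator X x * f q x \<partial>?\<eta>) = (\<integral>\<^sup>+z. indicator X (?s z) * f q (?s z) \<partial>\<mu>)"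
      by (rule nn_integral_distr[OF sm]) measurable
    also have "\<dots> = (\<integral>\<^sup>+z. \<integral>\<^sup>+v. F1 (?s z, v) \<partial>slice_at \<theta> (?s z) \<partial>\<mu>)"
    proof (rule nn_integral_cong)
      fix z
      have "(\<integral>\<^sup>+v. F1 (?s z, v) \<partial>slice_at \<theta> (?s z)) =
        (\<integral>\<^sup>+v. indicator X (?s z) * indicator {v. v \<le> real_of_rat q \<and> line_point \<theta> (?s z) v \<in> ?K} v \<partial>slice_at \<theta> (?s z))"
        by (intro nn_integral_cong) (simp add: F1_def indicator_def)
      then show "indicator X (?s z) * f q (?s z) = (\<integral>\<^sup>+v. F1 (?s z, v) \<partial>slice_at \<theta> (?s z))"
        using ss(2) by (simp add: nn_integral_cmult f_def)
    qed
    also have "\<dots> = (\<integral>\<^sup>+z. F1 (?s z, ?u z) \<partial>\<mu>)" by (rule nn_integral_resample[OF dis F1m, symmetric])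
    also have "\<dots> = (\<integral>\<^sup>+z. (indicator X (?s z) * indicator {..real_of_rat q} (?u z)) * indicator ?K z \<partial>\<mu>)"
      by (intro nn_integral_cong) (auto simp: F1_def line_point_coords indicator_def)
    also have "\<dots> = ennreal (pmf p i) * (\<integral>\<^sup>+z. indicator X (?s (T i z)) * indicator {..real_of_rat q} (?u (T i z)) \<partial>\<mu>)"
      by (rule nn_integral_\<mu>_cylinder) measurable
    also have "(\<integral>\<^sup>+z. indicator X (?s (T i z)) * indicator {..real_of_rat q} (?u (T i z)) \<partial>\<mu>) = (\<integral>\<^sup>+z. F2 (?s' z, ?u' z) \<partial>\<mu>)"
      by (intro nn_integral_cong) (simp add: sT uT F2_def indicator_def)
    also have "\<dots> = (\<integral>\<^sup>+z. \<integral>\<^sup>+v. F2 (?s' z, v) \<partial>slice_at \<theta>' (?s' z) \<partial>\<mu>)"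
      using dis' F2m unfolding \<theta>'_def by (rule nn_integral_resample)
    also have "\<dots> = (\<integral>\<^sup>+z. indicator X (?s (T i z)) * k q (?s (T i z)) \<partial>\<mu>)"
    proof (rule nn_integral_cong)
      fix z
      have "{v \<in> space borel. h (?s' z) v \<le> real_of_rat q} \<in> sets borel" unfolding h_def by measurable
      then have s: "{v. h (?s' z) v \<le> real_of_rat q} \<in> sets (slice_at \<theta>' (?s' z))" by (simp add: slice_at_props)
      have "(\<integral>\<^sup>+v. F2 (?s' z, v) \<partial>slice_at \<theta>' (?s' z)) =
        (\<integral>\<^sup>+v. indicator X (\<alpha> * ?s' z + \<beta>) * indicator {v. h (?s' z) v \<le> real_of_rat q} v \<partial>slice_at \<theta>' (?s' z))"
        by (intro nn_integral_cong) (simp add: F2_def indicator_def)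
      then show "(\<integral>\<^sup>+v. F2 (?s' z, v) \<partial>slice_at \<theta>' (?s' z)) = indicator X (?s (T i z)) * k q (?s (T i z))"
        using s by (simp add: nn_integral_cmult k_def sT gi)
    qed
    also have "ennreal (pmf p i) * \<dots> = (\<integral>\<^sup>+z. (indicator X (?s z) * k q (?s z)) * indicator ?K z \<partial>\<mu>)"
      by (rule nn_integral_\<mu>_cylinder[symmetric]) measurable
    also have "\<dots> = (\<integral>\<^sup>+z. F3 (?s z, ?u z) \<partial>\<mu>)"
      by (intro nn_integral_cong) (simp add: F3_def line_point_coords indicator_def)
    also have "\<dots> = (\<integral>\<^sup>+z. \<integral>\<^sup>+v. F3 (?s z, v) \<partial>slice_at \<theta> (?s z) \<partial>\<mu>)"
      by (rule nn_integral_resample[OF dis F3m])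
    also have "\<dots> = (\<integral>\<^sup>+z. indicator X (?s z) * (\<rho> (?s z) * k q (?s z)) \<partial>\<mu>)"
    proof (rule nn_integral_cong)
      fix z
      have "(\<integral>\<^sup>+v. F3 (?s z, v) \<partial>slice_at \<theta> (?s z)) =
        (\<integral>\<^sup>+v. (indicator X (?s z) * k q (?s z)) * indicator {v. line_point \<theta> (?s z) v \<in> ?K} v \<partial>slice_at \<theta> (?s z))"
        by (intro nn_integral_cong) (simp add: F3_def indicator_def)
      then show "(\<integral>\<^sup>+v. F3 (?s z, v) \<partial>slice_at \<theta> (?s z)) = indicator X (?s z) * (\<rho> (?s z) * k q (?s z))"
        using ss(1) by (simp add: nn_integral_cmult \<rho>_def mult_ac)
    qed
    also have "\<dots> = (\<integral>\<^sup>+x. indicator X x * (\<rho> x * k q x) \<partial>?\<eta>)"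
      by (rule nn_integral_distr[OF sm, symmetric]) measurable
    finally show "(\<integral>\<^sup>+x. indicator X x * f q x \<partial>?\<eta>) = (\<integral>\<^sup>+x. indicator X x * (\<rho> x * k q x) \<partial>?\<eta>)" .
  qed
  then have "AE x in ?\<eta>. \<forall>q. f q x = \<rho> x * k q x" by (simp add: AE_all_countable)
  from AE_distrD[OF sm this] have "AE z in \<mu>. \<forall>q. f q (?s z) = \<rho> (?s z) * k q (?s z)" .
  from AE_\<mu>_T[OF this i] have G1: "AE z in \<mu>. \<forall>q. f q (?s (T i z)) = \<rho> (?s (T i z)) * k q (?s (T i z))" .
  have "AE z in \<mu>. line_point \<theta> (?s z) (?u z) \<in> ?K --> \<rho> (?s z) \<noteq> 0"
  proof (subst AE_resample[OF dis, where R="\<lambda>x v. line_point \<theta> x v \<in> ?K --> \<rho> x \<noteq> 0"])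
    have "{y \<in> space (borel \<Otimes>\<^sub>M borel). line_point \<theta> (fst y) (snd y) \<in> ?K --> \<rho> (fst y) \<noteq> 0} \<in> sets (borel \<Otimes>\<^sub>M borel)" by measurable
    then show "{y. line_point \<theta> (fst y) (snd y) \<in> ?K --> \<rho> (fst y) \<noteq> 0} \<in> sets (borel \<Otimes>\<^sub>M borel)" by (simp add: space_pair_measure)
    show "AE z in \<mu>. AE v in slice_at \<theta> (?s z). line_point \<theta> (?s z) v \<in> ?K --> \<rho> (?s z) \<noteq> 0"
    proof (rule AE_I2)
      fix z
      show "AE v in slice_at \<theta> (?s z). line_point \<theta> (?s z) v \<in> ?K --> \<rho> (?s z) \<noteq> 0"
      proof (cases "\<rho> (?s z) = 0")
        case True
        then have "{v. line_point \<theta> (?s z) v \<in> ?K} \<in> null_sets (slice_at \<theta> (?s z))"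
          using ss(1) by (simp add: null_sets_def \<rho>_def)
        then have "AE v in slice_at \<theta> (?s z). v \<notin> {v. line_point \<theta> (?s z) v \<in> ?K}" by (rule AE_not_in)
        then show ?thesis by eventually_elim simp
      qed simp
    qed
  qed
  then have "AE z in \<mu>. z \<in> ?K --> \<rho> (?s z) \<noteq> 0" by (simp only: line_point_coords)
  from AE_\<mu>_T[OF this i] have G2: "AE z in \<mu>. T i z \<in> ?K --> \<rho> (?s (T i z)) \<noteq> 0" .
  have "AE z in \<mu>. line_point \<theta> (?s z) (?u z) \<in> (\<Union>j. T j ` disk)"
    using AE_\<mu>_cylinders by (simp only: line_point_coords)
  then have "AE z in \<mu>. AE v in slice_at \<theta> (?s z). line_point \<theta> (?s z) v \<in> (\<Union>j. T j ` disk)"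
  proof (subst (asm) AE_resample[OF dis, where R="\<lambda>x v. line_point \<theta> x v \<in> (\<Union>j. T j ` disk)"])
    have "{y \<in> space (borel \<Otimes>\<^sub>M borel). line_point \<theta> (fst y) (snd y) \<in> (\<Union>j. T j ` disk)} \<in> sets (borel \<Otimes>\<^sub>M borel)" by measurable
    then show "{y. line_point \<theta> (fst y) (snd y) \<in> (\<Union>j. T j ` disk)} \<in> sets (borel \<Otimes>\<^sub>M borel)" by (simp add: space_pair_measure)
  qed
  from AE_\<mu>_T[OF this i] have G3: "AE z in \<mu>. AE v in slice_at \<theta> (?s (T i z)). line_point \<theta> (?s (T i z)) v \<in> (\<Union>j. T j ` disk)" .
  from G1 G2 G3 AE_\<mu>_disk show ?case
  proof eventually_elim
    case (elim z)
    have TK: "T i z \<in> ?K" using elim(4) by (rule imageI)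
    let ?x = "?s (T i z)"
    have hh: "?u (T i z) + c * (v - ?u' z) = h (?s' z) v" for v
      unfolding uT h_def by (simp add: algebra_simps)
    have "{v \<in> space borel. line_point \<theta> ?x v \<notin> (\<Union>j. T j ` disk)} \<in> sets borel" by measurable
    then have "{v. line_point \<theta> ?x v \<notin> (\<Union>j. T j ` disk)} \<in> sets (slice_at \<theta> ?x)" by (simp add: slice_at_props)
    then have "emeasure (slice_at \<theta> ?x) {v. line_point \<theta> ?x v \<notin> (\<Union>j. T j ` disk)} = 0"
      using elim(3) by (subst (asm) AE_iff_measurable) (auto simp: slice_at_props)
    moreover have "k q ?x = emeasure (slice_at \<theta>' (?s' z)) {v. ?u (T i z) + c * (v - ?u' z) \<le> real_of_rat q}" for q
      unfolding k_def sT gi hh ..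
    ultimately show ?case
      using elim(1,2) \<theta> TK unfolding step_ok_def f_def \<rho>_def \<theta>'_def[symmetric] c_def[symmetric] by simp
  qed
qed

text \<open>Windows shorter than \<open>gap\<close> around \<open>T i z\<close> see only \<open>T i ` disk\<close>, so by \<open>step_ok\<close> the two measures
  agree there up to a factor, which the normalisation removes. The image of the slice is scaled by
  \<open>1 / stretch i \<theta>\<close>, which shifts the time, and reversed if the determinant is negative.\<close>

lemma step_identity:
  assumes ok: "step_ok i \<theta> z" and e: "e = 1 \<or> e = - 1" and s: "s \<ge> start_time"
  shows "zoom s (local_slice e \<theta> (T i z)) = zoom (s - ln (stretch i \<theta>)) (local_slice (e * sgn (det (A i))) (\<phi> i \<theta>) z)"
proof -
  define x u x' u' where "x = slice_proj \<theta> (T i z)" and "u = along \<theta> (T i z)"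
    and "x' = slice_proj (\<phi> i \<theta>) z" and "u' = along (\<phi> i \<theta>) z"
  let ?N = "slice_at \<theta> x" and ?N' = "slice_at (\<phi> i \<theta>) x'" and ?K = "T i ` disk"
  define c where "c = sgn (det (A i)) / stretch i \<theta>"
  define r where "r = emeasure ?N {v. line_point \<theta> x v \<in> ?K}"
  have rpos: "r \<noteq> 0" and TK: "T i z \<in> ?K" and union: "emeasure ?N {v. line_point \<theta> x v \<notin> (\<Union>j. T j ` disk)} = 0"
    and eq: "\<And>q. emeasure ?N {v. v \<le> real_of_rat q \<and> line_point \<theta> x v \<in> ?K} = r * emeasure ?N' {v. u + c * (v - u') \<le> real_of_rat q}"
    using ok unfolding step_ok_def x_def u_def x'_def u'_def c_def r_def by blast+
  interpret N: prob_space ?N by (rule slice_at_props)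
  interpret N': prob_space ?N' by (rule slice_at_props)
  have rle: "r \<le> 1" unfolding r_def by (rule N.emeasure_le_1)
  then have rtop: "r \<noteq> \<infinity>" by (auto simp: top_unique)
  have lp: "{v. line_point \<theta> x v \<in> ?K} \<in> sets borel" "{v. line_point \<theta> x v \<in> (\<Union>j. T j ` disk)} \<in> sets borel"
  proof -
    have "{v \<in> space borel. line_point \<theta> x v \<in> ?K} \<in> sets borel" "{v \<in> space borel. line_point \<theta> x v \<in> (\<Union>j. T j ` disk)} \<in> sets borel"
      by measurable
    then show "{v. line_point \<theta> x v \<in> ?K} \<in> sets borel" "{v. line_point \<theta> x v \<in> (\<Union>j. T j ` disk)} \<in> sets borel" by simp_all
  qed
  have all: "emeasure ?N {v. v \<in> C \<and> line_point \<theta> x v \<in> ?K} = r * emeasure ?N' {v. u + c * (v - u') \<in> C}"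
    if C: "C \<in> sets borel" for C
  proof -
    let ?M1 = "density ?N (indicator {v. line_point \<theta> x v \<in> ?K})"
    let ?M2 = "scale_measure r (distr ?N' borel (\<lambda>v. u + c * (v - u')))"
    have hm: "(\<lambda>v. u + c * (v - u')) \<in> borel_measurable ?N'" by (rule slice_at_borel) simp
    have e1: "emeasure ?M1 C = emeasure ?N {v. v \<in> C \<and> line_point \<theta> x v \<in> ?K}" if "C \<in> sets borel" for C
    proof -
      have "emeasure ?M1 C = (\<integral>\<^sup>+v. indicator {v. line_point \<theta> x v \<in> ?K} v * indicator C v \<partial>?N)"
        using that lp by (intro emeasure_density slice_at_borel borel_measurable_indicator) (simp_all add: slice_at_props)
      also have "\<dots> = (\<integral>\<^sup>+v. indicator ({v. line_point \<theta> x v \<in> ?K} \<inter> C) v \<partial>?N)"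
        by (intro nn_integral_cong) (simp add: indicator_def)
      also have "\<dots> = emeasure ?N ({v. line_point \<theta> x v \<in> ?K} \<inter> C)"
        using that lp by (intro nn_integral_indicator) (simp add: slice_at_props)
      finally show ?thesis by (simp add: Collect_conj_eq Int_commute)
    qed
    have e2: "emeasure ?M2 C = r * emeasure ?N' {v. u + c * (v - u') \<in> C}" if "C \<in> sets borel" for C
      using that by (simp add: emeasure_distr[OF hm] vimage_def slice_at_props)
    have "?M1 = ?M2"
    proof (rule finite_measure_eqI_rat)
      show "finite_measure ?M1"
      proof (rule finite_measureI)
        have "emeasure ?M1 UNIV \<le> 1" by (subst e1, simp) (rule N.emeasure_le_1)
        then show "emeasure ?M1 (space ?M1) \<noteq> \<infinity>" by (auto simp: top_unique slice_at_props)
      qed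
      show "emeasure ?M1 {..real_of_rat q} = emeasure ?M2 {..real_of_rat q}" for q
        by (subst e1, simp, subst e2, simp) (use eq[of q] in simp)
    qed (simp_all add: slice_at_props)
    then show ?thesis using e1[OF C] e2[OF C] by simp
  qed
  have small: "emeasure ?N C = r * emeasure ?N' {v. u + c * (v - u') \<in> C}"
    if C: "C \<in> sets borel" and sub: "\<And>v. v \<in> C ==> \<bar>v - u\<bar> \<le> exp (- s)" for C
  proof -
    have Tz: "T i z = line_point \<theta> x u" unfolding x_def u_def by (rule line_point_coords[symmetric])
    have "v \<in> C ==> line_point \<theta> x v \<in> (\<Union>j. T j ` disk) ==> line_point \<theta> x v \<in> ?K" for v
    proof -
      assume v: "v \<in> C" "line_point \<theta> x v \<in> (\<Union>j. T j ` disk)"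
      have "T i z - line_point \<theta> x v = (u - v) *\<^sub>R dir \<theta>" unfolding Tz by (simp add: line_point_def algebra_simps)
      then have "dist (T i z) (line_point \<theta> x v) = \<bar>u - v\<bar>" by (simp add: dist_norm)
      also have "\<dots> < gap" using sub[OF v(1)] exp_start_time[OF s] by linarith
      finally show "line_point \<theta> x v \<in> ?K" using gap(2)[OF TK v(2)] by blast
    qed
    moreover have "AE v in ?N. v \<notin> {v. line_point \<theta> x v \<notin> (\<Union>j. T j ` disk)}"
    proof (rule AE_not_in)
      have "- {v. line_point \<theta> x v \<in> (\<Union>j. T j ` disk)} \<in> sets borel" using lp(2) by (rule borel_comp)
      then have "{v. line_point \<theta> x v \<notin> (\<Union>j. T j ` disk)} \<in> sets ?N" by (simp add: Collect_neg_eq slice_at_props)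
      then show "{v. line_point \<theta> x v \<notin> (\<Union>j. T j ` disk)} \<in> null_sets ?N" using union by (simp add: null_sets_def)
    qed
    ultimately have "AE v in ?N. v \<in> C \<longleftrightarrow> v \<in> {v. v \<in> C \<and> line_point \<theta> x v \<in> ?K}"
      by (auto elim!: eventually_mono)
    moreover have "{v. v \<in> C \<and> line_point \<theta> x v \<in> ?K} \<in> sets ?N"
      using sets.Int[OF C lp(1)] by (simp add: Collect_conj_eq slice_at_props)
    ultimately have "emeasure ?N C = emeasure ?N {v. v \<in> C \<and> line_point \<theta> x v \<in> ?K}"
      using C by (intro emeasure_eq_AE) (simp_all add: slice_at_props)
    then show ?thesis using all[OF C] by simp
  qed
  define \<epsilon> where "\<epsilon> = sgn (det (A i))"
  have \<rho>: "stretch i \<theta> > 0" by (rule stretch_pos)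
  define s' where "s' = s - ln (stretch i \<theta>)"
  have es: "exp s' = exp s / stretch i \<theta>" "exp (- s') = exp (- s) * stretch i \<theta>"
    using \<rho> by (simp_all add: s'_def exp_diff exp_minus field_simps)
  have win: "e * (c * w) \<in> zoom_window s \<longleftrightarrow> (e * \<epsilon>) * w \<in> zoom_window s'" for w
  proof -
    have "e * (c * w) = ((e * \<epsilon>) * w) / stretch i \<theta>" by (simp add: c_def \<epsilon>_def)
    then show ?thesis unfolding es atLeastAtMost_iff using \<rho> by (simp add: pos_le_divide_eq pos_divide_le_eq)
  qed
  have sc: "exp s * (e * (c * w)) = exp s' * ((e * \<epsilon>) * w)" for w
    unfolding es by (simp add: c_def \<epsilon>_def)
  have num: "emeasure (shifted e \<theta> x u) C = r * emeasure (shifted (e * \<epsilon>) (\<phi> i \<theta>) x' u') C'"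
    if C: "C \<in> sets borel" "C' \<in> sets borel" "C \<subseteq> zoom_window s" and CC: "\<And>w. e * (c * w) \<in> C \<longleftrightarrow> (e * \<epsilon>) * w \<in> C'" for C C'
  proof -
    have m: "{v. e * (v - u) \<in> C} \<in> sets borel"
      using measurable_sets[of "\<lambda>v. e * (v - u)" borel borel C] C(1) by (simp add: vimage_def)
    have "emeasure (shifted e \<theta> x u) C = emeasure ?N {v. e * (v - u) \<in> C}" by (rule emeasure_shifted[OF C(1)])
    also have "\<dots> = r * emeasure ?N' {v. u + c * (v - u') \<in> {v. e * (v - u) \<in> C}}"
    proof (rule small[OF m])
      fix v assume "v \<in> {v. e * (v - u) \<in> C}"
      then have "e * (v - u) \<in> {- exp (- s)..exp (- s)}" using C(3) by blast
      then have "v - u \<in> {- exp (- s)..exp (- s)}" by (simp only: sign_scale_interval[OF e])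
      then show "\<bar>v - u\<bar> \<le> exp (- s)" by auto
    qed
    also have "{v. u + c * (v - u') \<in> {v. e * (v - u) \<in> C}} = {v. (e * \<epsilon>) * (v - u') \<in> C'}"
      by (simp add: CC[symmetric])
    also have "emeasure ?N' \<dots> = emeasure (shifted (e * \<epsilon>) (\<phi> i \<theta>) x' u') C'" by (rule emeasure_shifted[OF C(2), symmetric])
    finally show ?thesis .
  qed
  have "zoom s (shifted e \<theta> x u) = zoom s' (shifted (e * \<epsilon>) (\<phi> i \<theta>) x' u')"
  proof (rule measure_eqI)
    fix B assume "B \<in> sets (zoom s (shifted e \<theta> x u))"
    then have B [measurable]: "B \<in> sets borel" by simp
    have "{v \<in> space borel. v \<in> zoom_window t \<and> exp t * v \<in> B} \<in> sets borel" for t by measurable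
    then have m: "{v. v \<in> zoom_window t \<and> exp t * v \<in> B} \<in> sets borel" for t by simp
    have "emeasure (zoom s (shifted e \<theta> x u)) B =
      (r * emeasure (shifted (e * \<epsilon>) (\<phi> i \<theta>) x' u') {v. v \<in> zoom_window s' \<and> exp s' * v \<in> B}) /
      (r * emeasure (shifted (e * \<epsilon>) (\<phi> i \<theta>) x' u') (zoom_window s'))"
    proof (subst emeasure_zoom[OF sets_shifted B], subst num[OF m m], blast)
      show "e * (c * w) \<in> {v. v \<in> zoom_window s \<and> exp s * v \<in> B} \<longleftrightarrow> (e * \<epsilon>) * w \<in> {v. v \<in> zoom_window s' \<and> exp s' * v \<in> B}" for w
        unfolding mem_Collect_eq win sc ..
      show "r * emeasure (shifted (e * \<epsilon>) (\<phi> i \<theta>) x' u') {v. v \<in> zoom_window s' \<and> exp s' * v \<in> B} / emeasure (shifted e \<theta> x u) (zoom_window s) =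
        r * emeasure (shifted (e * \<epsilon>) (\<phi> i \<theta>) x' u') {v. v \<in> zoom_window s' \<and> exp s' * v \<in> B} / (r * emeasure (shifted (e * \<epsilon>) (\<phi> i \<theta>) x' u') (zoom_window s'))"
        by (subst num[of "zoom_window s" "zoom_window s'"]) (simp_all only: win order_refl borel_closed closed_atLeastAtMost)
    qed
    also have "\<dots> = emeasure (shifted (e * \<epsilon>) (\<phi> i \<theta>) x' u') {v. v \<in> zoom_window s' \<and> exp s' * v \<in> B} / emeasure (shifted (e * \<epsilon>) (\<phi> i \<theta>) x' u') (zoom_window s')"
      by (simp only: mult.commute[of r] divide_mult_eq[OF rpos rtop])
    also have "\<dots> = emeasure (zoom s' (shifted (e * \<epsilon>) (\<phi> i \<theta>) x' u')) B" by (rule emeasure_zoom[OF sets_shifted B, symmetric])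
    finally show "emeasure (zoom s (shifted e \<theta> x u)) B = emeasure (zoom s' (shifted (e * \<epsilon>) (\<phi> i \<theta>) x' u')) B" .
  qed simp
  then show ?thesis by (simp only: x_def u_def x'_def u'_def \<epsilon>_def s'_def)
qed

end

section \<open>The scenery of the slices as a flow\<close>

lemma zoom_mem_iff:
  assumes "sets m = sets borel" "A \<subseteq> interval_measures"
  shows "zoom s m \<in> A \<longleftrightarrow> emeasure m (zoom_window s) \<noteq> 0 \<and> total_zoom s m \<in> A"
  using zoom_null[OF assms(1), of s] assms(2) by (auto simp: total_zoom_def)

lemma zoom_mem_measurable:
  assumes K: "K \<in> M \<rightarrow>\<^sub>M subprob_algebra borel" and s [measurable]: "s \<in> borel_measurable M"
    and A: "A \<in> sets weak_star_borel"
  shows "{x \<in> space M. zoom (s x) (K x) \<in> A} \<in> sets M"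
proof -
  have [measurable]: "(\<lambda>x. emeasure (K x) (zoom_window (s x))) \<in> borel_measurable M"
  proof (rule emeasure_measurable_subprob_algebra2[OF _ K])
    have "(SIGMA x:space M. zoom_window (s x)) = {p \<in> space (M \<Otimes>\<^sub>M borel). snd p \<in> zoom_window (s (fst p))}"
      by (auto simp: space_pair_measure)
    also have "\<dots> \<in> sets (M \<Otimes>\<^sub>M borel)" unfolding atLeastAtMost_iff by measurable
    finally show "(SIGMA x:space M. zoom_window (s x)) \<in> sets (M \<Otimes>\<^sub>M borel)" .
  qed
  have "(\<lambda>x. total_zoom (s x) (K x)) -` A \<inter> space M \<in> sets M"
    using measurable_total_zoom[OF K s] A by (rule measurable_sets)
  moreover have "{x \<in> space M. emeasure (K x) (zoom_window (s x)) \<noteq> 0} \<in> sets M" by measurable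
  ultimately have "{x \<in> space M. emeasure (K x) (zoom_window (s x)) \<noteq> 0} \<inter> ((\<lambda>x. total_zoom (s x) (K x)) -` A \<inter> space M) \<in> sets M"
    by (rule sets.Int[rotated])
  also have "{x \<in> space M. emeasure (K x) (zoom_window (s x)) \<noteq> 0} \<inter> ((\<lambda>x. total_zoom (s x) (K x)) -` A \<inter> space M) =
    {x \<in> space M. zoom (s x) (K x) \<in> A}"
  proof -
    have "A \<subseteq> interval_measures" using sets.sets_into_space[OF A] by simp
    then have "zoom (s x) (K x) \<in> A \<longleftrightarrow> emeasure (K x) (zoom_window (s x)) \<noteq> 0 \<and> total_zoom (s x) (K x) \<in> A" if "x \<in> space M" for x
      using measurable_space[OF K that] by (intro zoom_mem_iff) (auto simp: space_subprob_algebra)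
    then show ?thesis by blast
  qed
  finally show ?thesis .
qed

lemma recentred_zoom_null_measurable:
  assumes A: "A \<in> sets weak_star_borel" and t: "t \<ge> 0"
  shows "{m \<in> interval_measures. AE x in m. {x - exp (- t)..x + exp (- t)} \<subseteq> {-1..1} --> zoom t (recentre x m) \<notin> A} \<in> sets weak_star_borel"
proof -
  let ?I = "{x::real. {x - exp (- t)..x + exp (- t)} \<subseteq> {-1..1}}"
  let ?M = "weak_star_borel \<Otimes>\<^sub>M (borel :: real measure)"
  have I: "?I = {x. -1 \<le> x - exp (- t) \<and> x + exp (- t) \<le> 1}"
    by (auto simp: less_imp_le[OF order_less_trans[of _ 0]])
  have K: "(\<lambda>m. m) \<in> weak_star_borel \<rightarrow>\<^sub>M subprob_algebra borel"
    by (rule measurable_prob_algebraD[OF measurable_weak_star_borel_prob_algebra])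
  have D: "(\<lambda>y. distr (fst y) borel (\<lambda>v. v - snd y)) \<in> ?M \<rightarrow>\<^sub>M subprob_algebra borel"
    using measurable_compose[OF measurable_fst K] by (intro measurable_distr2[where M=borel]) auto
  have zm: "{y \<in> space ?M. zoom t (distr (fst y) borel (\<lambda>v. v - snd y)) \<in> A} \<in> sets ?M"
    by (rule zoom_mem_measurable[OF D _ A]) simp
  have "{y \<in> space ?M. -1 \<le> snd y - exp (- t) \<and> snd y + exp (- t) \<le> 1} \<in> sets ?M" by measurable
  with zm have "space ?M - {y \<in> space ?M. -1 \<le> snd y - exp (- t) \<and> snd y + exp (- t) \<le> 1} \<inter>
     {y \<in> space ?M. zoom t (distr (fst y) borel (\<lambda>v. v - snd y)) \<in> A} \<in> sets ?M"
    by (intro sets.compl_sets sets.Int)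
  also have "space ?M - {y \<in> space ?M. -1 \<le> snd y - exp (- t) \<and> snd y + exp (- t) \<le> 1} \<inter>
     {y \<in> space ?M. zoom t (distr (fst y) borel (\<lambda>v. v - snd y)) \<in> A} =
    {y \<in> space ?M. snd y \<in> ?I --> zoom t (distr (fst y) borel (\<lambda>v. v - snd y)) \<notin> A}"
    unfolding I by blast
  finally have "{m \<in> space weak_star_borel. AE x in m. x \<in> ?I --> zoom t (distr m borel (\<lambda>v. v - x)) \<notin> A} \<in> sets weak_star_borel"
    by (rule pred_AE_kernel[OF K])
  also have "{m \<in> space weak_star_borel. AE x in m. x \<in> ?I --> zoom t (distr m borel (\<lambda>v. v - x)) \<notin> A} =
    {m \<in> interval_measures. AE x in m. {x - exp (- t)..x + exp (- t)} \<subseteq> {-1..1} --> zoom t (recentre x m) \<notin> A}"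
  proof (intro Collect_cong conj_cong)
    fix m assume "m \<in> interval_measures"
    then have "zoom t (recentre x m) = zoom t (distr m borel (\<lambda>v. v - x))" for x
      using interval_measuresD(1)[of m] interval_measuresD(2)[of m] t
      by (intro zoom_recentre_eq) (auto intro: prob_space.finite_measure)
    then show "(AE x in m. x \<in> ?I --> zoom t (distr m borel (\<lambda>v. v - x)) \<notin> A) \<longleftrightarrow>
      (AE x in m. {x - exp (- t)..x + exp (- t)} \<subseteq> {-1..1} --> zoom t (recentre x m) \<notin> A)" by simp
  qed simp
  finally show ?thesis .
qed

context self_affine_furstenberg
begin

interpretation \<mu>: prob_space \<mu> by (rule prob_space_\<mu>)

interpretation ST: pair_prob_space "measure_pmf sign_pmf" Th by (rule pair_prob_space_signed)

interpretation S: random_maps STh p signed_map by (rule random_maps_signed)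

lemma AE_flow_iff:
  assumes g: "g \<in> \<B> \<rightarrow>\<^sub>M borel" and dg: "distr \<B> borel g = \<mu>"
    and R: "{x. R (fst x) (fst (snd x)) (snd (snd x))} \<in> sets (borel \<Otimes>\<^sub>M (borel \<Otimes>\<^sub>M borel))"
  shows "(AE \<omega> in BSTh. R (fst (snd \<omega>)) (snd (snd \<omega>)) (g (fst \<omega>))) \<longleftrightarrow>
    (\<forall>e\<in>set_pmf sign_pmf. AE \<theta> in Th. AE z in \<mu>. R e \<theta> z)"
proof -
  have pull: "{x \<in> space M. R (a x) (b x) (c x)} \<in> sets M"
    if "a \<in> borel_measurable M" "b \<in> borel_measurable M" "c \<in> borel_measurable M" for a b c and M :: "'z measure"
  proof -
    have "(\<lambda>x. (a x, b x, c x)) -` {x. R (fst x) (fst (snd x)) (snd (snd x))} \<inter> space M \<in> sets M"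
      using that R by (intro measurable_sets[OF measurable_Pair[OF _ measurable_Pair]])
    also have "(\<lambda>x. (a x, b x, c x)) -` {x. R (fst x) (fst (snd x)) (snd (snd x))} \<inter> space M = {x \<in> space M. R (a x) (b x) (c x)}"
      by auto
    finally show ?thesis .
  qed
  have f1: "fst \<in> borel_measurable STh" by (rule measurable_compose[OF measurable_fst]) simp
  have f2: "snd \<in> borel_measurable STh" using measurable_snd by (simp cong: measurable_cong_sets)
  have P: "{\<omega> \<in> space BSTh. R (fst (snd \<omega>)) (snd (snd \<omega>)) (g (fst \<omega>))} \<in> sets BSTh"
    by (intro pull measurable_compose[OF measurable_snd f1] measurable_compose[OF measurable_snd f2] measurable_compose[OF measurable_fst g])
  have g': "(AE a in \<B>. R e \<theta> (g a)) \<longleftrightarrow> (AE z in \<mu>. R e \<theta> z)" for e \<theta>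
  proof -
    have "{z \<in> space borel. R e \<theta> z} \<in> sets borel" by (intro pull) simp_all
    from AE_distr_iff[OF g this] show ?thesis by (simp only: dg)
  qed
  have "(AE \<omega> in BSTh. R (fst (snd \<omega>)) (snd (snd \<omega>)) (g (fst \<omega>))) \<longleftrightarrow>
    (AE a in \<B>. AE \<tau> in STh. R (fst \<tau>) (snd \<tau>) (g a))"
    using S.BT.AE_pair_iff[of "\<lambda>a \<tau>. R (fst \<tau>) (snd \<tau>) (g a)", OF P] by (rule sym)
  also have "\<dots> \<longleftrightarrow> (AE \<tau> in STh. AE a in \<B>. R (fst \<tau>) (snd \<tau>) (g a))"
    by (rule S.BT.AE_commute[of "\<lambda>a \<tau>. R (fst \<tau>) (snd \<tau>) (g a)", OF P])
  also have "\<dots> \<longleftrightarrow> (AE \<tau> in STh. AE z in \<mu>. R (fst \<tau>) (snd \<tau>) z)" unfolding g' ..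
  also have "\<dots> \<longleftrightarrow> (AE e in measure_pmf sign_pmf. AE \<theta> in Th. AE z in \<mu>. R e \<theta> z)"
  proof (rule ST.AE_pair_iff[symmetric])
    have "\<mu> \<in> space (subprob_algebra borel)"
      using \<mu>.subprob_space_axioms by (simp add: space_subprob_algebra)
    then have c: "(\<lambda>_. \<mu>) \<in> STh \<rightarrow>\<^sub>M subprob_algebra borel" by (rule measurable_const)
    show "{x \<in> space STh. AE z in \<mu>. R (fst x) (snd x) z} \<in> sets STh"
      by (rule pred_AE_kernel[OF c], intro pull measurable_compose[OF measurable_fst f1] measurable_compose[OF measurable_fst f2] measurable_snd)
  qed
  finally show ?thesis by (simp only: AE_measure_pmf_iff)
qed

lemma sign_pmf_signs: "e \<in> set_pmf sign_pmf ==> e = 1 \<or> e = - 1" and one_in_sign_pmf: "1 \<in> set_pmf sign_pmf"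
  by (auto simp: sign_pmf_def split: if_splits)

text \<open>The scenery at the point coded by \<open>a\<close> of its slice in direction \<open>\<theta>\<close> with orientation \<open>e\<close>, where \<open>\<omega> = (a, e, \<theta>)\<close>.\<close>

definition scen :: "(nat => 'k) \<times> real \<times> real => real => real measure" where
  "scen \<omega> s = total_zoom (start_time + s) (local_slice (fst (snd \<omega>)) (snd (snd \<omega>)) (coding T (fst \<omega>)))"

text \<open>The time after which the window around the coded point looks like a window around the point coded by the shifted word.\<close>

definition roof :: "(nat => 'k) \<times> real \<times> real => real" where
  "roof \<omega> = ln (stretch (fst \<omega> 0) (snd (snd \<omega>)))"

lemma flow_coordinates_measurable [measurable]:
  "(\<lambda>\<omega>. fst (snd \<omega>)) \<in> borel_measurable BSTh" "(\<lambda>\<omega>. snd (snd \<omega>)) \<in> borel_measurable BSTh"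
  "(\<lambda>\<omega>. coding T (fst \<omega>)) \<in> borel_measurable BSTh"
proof -
  have f1: "fst \<in> borel_measurable STh" by (rule measurable_compose[OF measurable_fst]) simp
  have f2: "snd \<in> borel_measurable STh" using measurable_snd by (simp cong: measurable_cong_sets)
  show "(\<lambda>\<omega>. fst (snd \<omega>)) \<in> borel_measurable BSTh" "(\<lambda>\<omega>. snd (snd \<omega>)) \<in> borel_measurable BSTh"
    "(\<lambda>\<omega>. coding T (fst \<omega>)) \<in> borel_measurable BSTh"
    by (intro measurable_compose[OF measurable_snd f1] measurable_compose[OF measurable_snd f2] measurable_compose[OF measurable_fst coding_measurable])+
qed

lemma local_slice_measurable:
  assumes [measurable]: "e \<in> borel_measurable M" "\<theta> \<in> borel_measurable M" "z \<in> borel_measurable M"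
  shows "(\<lambda>x. local_slice (e x) (\<theta> x) (z x)) \<in> M \<rightarrow>\<^sub>M subprob_algebra borel"
  by (rule shifted_measurable) measurable

abbreviation supported :: "(nat => 'k) \<times> real \<times> real => bool" where
  "supported \<omega> \<equiv> (fst (snd \<omega>) = 1 \<or> fst (snd \<omega>) = - 1) \<and>
    slice_point_supported (snd (snd \<omega>)) (slice_proj (snd (snd \<omega>)) (coding T (fst \<omega>))) (along (snd (snd \<omega>)) (coding T (fst \<omega>)))"

lemma AE_supported: "AE \<omega> in BSTh. supported \<omega>"
proof (subst AE_flow_iff[OF coding_measurable distr_coding,
    where R="\<lambda>e \<theta> z. (e = 1 \<or> e = - 1) \<and> slice_point_supported \<theta> (slice_proj \<theta> z) (along \<theta> z)"])
  let ?M = "borel \<Otimes>\<^sub>M (borel \<Otimes>\<^sub>M borel) :: (real \<times> real \<times> (real^2)) measure"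
  have "{x \<in> space ?M. slice_point_supported (fst (snd x)) (slice_proj (fst (snd x)) (snd (snd x))) (along (fst (snd x)) (snd (snd x)))} \<in> sets ?M"
    by (rule slice_point_supported_measurable) measurable
  moreover have "{x \<in> space ?M. fst x = 1 \<or> fst x = - 1} \<in> sets ?M" by measurable
  ultimately have "{x \<in> space ?M. fst x = 1 \<or> fst x = - 1} \<inter>
     {x \<in> space ?M. slice_point_supported (fst (snd x)) (slice_proj (fst (snd x)) (snd (snd x))) (along (fst (snd x)) (snd (snd x)))} \<in> sets ?M"
    by (rule sets.Int[rotated])
  then show "{x. (fst x = 1 \<or> fst x = - 1) \<and> slice_point_supported (fst (snd x)) (slice_proj (fst (snd x)) (snd (snd x))) (along (fst (snd x)) (snd (snd x)))}
      \<in> sets ?M" by (simp add: space_pair_measure Collect_conj_eq)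
  show "\<forall>e\<in>set_pmf sign_pmf. AE \<theta> in Th. AE z in \<mu>. (e = 1 \<or> e = - 1) \<and> slice_point_supported \<theta> (slice_proj \<theta> z) (along \<theta> z)"
  proof
    fix e assume "e \<in> set_pmf sign_pmf"
    then have e: "e = 1 \<or> e = - 1" by (rule sign_pmf_signs)
    show "AE \<theta> in Th. AE z in \<mu>. (e = 1 \<or> e = - 1) \<and> slice_point_supported \<theta> (slice_proj \<theta> z) (along \<theta> z)"
      using AE_disintegrates
    proof eventually_elim
      case (elim \<theta>)
      from AE_slice_point_supported[OF elim] show ?case by eventually_elim (use e in simp)
    qed
  qed
qed

lemma supported_local_slice:
  assumes "e = 1 \<or> e = - 1" "slice_point_supported \<theta> x u"
  shows "emeasure (shifted e \<theta> x u) (zoom_window s) \<noteq> 0" "total_zoom s (shifted e \<theta> x u) = zoom s (shifted e \<theta> x u)"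
    "zoom s (shifted e \<theta> x u) \<in> pointed_measures"
    "t \<ge> 0 ==> zoom t (zoom s (shifted e \<theta> x u)) = zoom (s + t) (shifted e \<theta> x u)"
proof -
  interpret prob_space "shifted e \<theta> x u" by (rule prob_space_shifted)
  have 0: "0 \<in> msupport (shifted e \<theta> x u)"
    using assms by (simp add: msupport_shifted slice_point_supported_def)
  show pos: "emeasure (shifted e \<theta> x u) (zoom_window s) \<noteq> 0" for s by (rule msupport_window_pos[OF sets_shifted 0])
  then show "total_zoom s (shifted e \<theta> x u) = zoom s (shifted e \<theta> x u)" by (simp add: total_zoom_def)
  show "zoom s (shifted e \<theta> x u) \<in> pointed_measures"
    by (rule zoom_pointed[OF sets_shifted finite_measure_axioms 0])
  show "t \<ge> 0 ==> zoom t (zoom s (shifted e \<theta> x u)) = zoom (s + t) (shifted e \<theta> x u)"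
    by (rule zoom_zoom[OF sets_shifted pos]) simp_all
qed

text \<open>The contraction of \<open>A i\<close> bounds the roof away from zero.\<close>

lemma one_le_rate_stretch: "1 \<le> rate * stretch i \<theta>"
proof -
  have "1 = norm (A i *v (matrix_inv (A i) *v dir \<theta>))" by (simp add: matrix_inv_cancel(1)[OF invertible])
  also have "\<dots> \<le> onorm ((*v) (A i)) * stretch i \<theta>"
    unfolding stretch_def by (rule onorm) (rule matrix_vector_mul_bounded_linear)
  also have "\<dots> \<le> rate * stretch i \<theta>" by (intro mult_right_mono rate less_imp_le[OF stretch_pos])
  finally show ?thesis .
qed

definition roof_max :: real where "roof_max = ln (SOME C. \<forall>i \<theta>. stretch i \<theta> \<le> C)"

lemma roof_bounds: "ln (1 / rate) \<le> roof \<omega>" "roof \<omega> \<le> roof_max" and roof_min_pos: "0 < ln (1 / rate)"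
proof -
  have r: "0 < rate"
    using one_le_rate_stretch rate(1) by (metis less_eq_real_def mult_zero_left not_one_le_zero)
  then show "0 < ln (1 / rate)" using rate(2) by simp
  have "1 / rate \<le> stretch i \<theta>" for i \<theta> using one_le_rate_stretch[of i \<theta>] r by (simp add: divide_le_eq mult.commute)
  then show "ln (1 / rate) \<le> roof \<omega>" unfolding roof_def using r stretch_pos by (subst ln_le_cancel_iff) simp_all
  have "\<forall>i \<theta>. stretch i \<theta> \<le> (SOME C. \<forall>i \<theta>. stretch i \<theta> \<le> C)" using stretch_bounded by (rule someI_ex)
  then have "stretch (fst \<omega> 0) (snd (snd \<omega>)) \<le> (SOME C. \<forall>i \<theta>. stretch i \<theta> \<le> C)" by blast
  then show "roof \<omega> \<le> roof_max" unfolding roof_def roof_max_def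
    using stretch_pos order_less_le_trans[OF stretch_pos] by (subst ln_le_cancel_iff) simp_all
qed

lemma roof_measurable: "roof \<in> borel_measurable BSTh"
  unfolding roof_def
proof (rule measurable_compose_countable[where g="\<lambda>\<omega>. fst \<omega> 0" and f="\<lambda>i \<omega>. ln (stretch i (snd (snd \<omega>)))"])
  show "(\<lambda>\<omega>. fst \<omega> 0) \<in> BSTh \<rightarrow>\<^sub>M count_space UNIV"
    using measurable_compose[OF measurable_fst bernoulli_coordinate_measurable] .
  show "(\<lambda>\<omega>. ln (stretch i (snd (snd \<omega>)))) \<in> borel_measurable BSTh" for i
    using measurable_compose[OF flow_coordinates_measurable(2) stretch_measurable] by (rule borel_measurable_ln)
qed

lemma AE_step_ok_flow: "AE \<omega> in BSTh. step_ok (fst \<omega> 0) (snd (snd \<omega>)) (coding T (\<lambda>n. fst \<omega> (Suc n)))"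
proof -
  have "AE \<omega> in BSTh. step_ok i (snd (snd \<omega>)) (coding T (\<lambda>n. fst \<omega> (Suc n)))" if i: "i \<in> set_pmf p" for i
  proof (subst AE_flow_iff[OF coding_shift_measurable distr_coding_shift, where R="\<lambda>e \<theta> z. step_ok i \<theta> z"])
    let ?M = "borel \<Otimes>\<^sub>M (borel \<Otimes>\<^sub>M borel) :: (real \<times> real \<times> (real^2)) measure"
    have "snd -` {x. step_ok i (fst x) (snd x)} \<inter> space ?M \<in> sets ?M"
      by (rule measurable_sets[OF measurable_snd step_ok_measurable])
    then show "{x. step_ok i (fst (snd x)) (snd (snd x))} \<in> sets ?M" by (simp add: space_pair_measure vimage_def)
  qed (use AE_step_ok[OF i] in blast)
  then have all: "AE \<omega> in BSTh. \<forall>i\<in>set_pmf p. step_ok i (snd (snd \<omega>)) (coding T (\<lambda>n. fst \<omega> (Suc n)))"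
    by (intro AE_ball_countable') (auto intro: countable_finite)
  have "AE a in distr BSTh \<B> fst. \<forall>n. a n \<in> set_pmf p"
    using AE_bernoulli_letters by (simp only: ST.distr_pair_fst prob_space.distr_pair_fst[OF ST.prob_space_axioms])
  from AE_distrD[OF measurable_fst this] all show ?thesis by eventually_elim blast
qed

lemma scenery_flow: "scenery_flow BSTh S.skew roof scen (ln (1 / rate)) roof_max"
proof (intro scenery_flow.intro scenery_flow_axioms.intro)
  show em: "ergodic_map BSTh S.skew" by (rule ergodic_signed_skew)
  show "roof \<in> borel_measurable BSTh" by (rule roof_measurable)
  show "0 < ln (1 / rate)" by (rule roof_min_pos)
  show "ln (1 / rate) \<le> roof \<omega> \<and> roof \<omega> \<le> roof_max" for \<omega> using roof_bounds by blast
  show "(\<lambda>(\<omega>, s). scen \<omega> s) \<in> BSTh \<Otimes>\<^sub>M borel \<rightarrow>\<^sub>M weak_star_borel"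
    unfolding scen_def case_prod_unfold
    by (intro measurable_total_zoom local_slice_measurable measurable_compose[OF measurable_fst flow_coordinates_measurable(1)]
      measurable_compose[OF measurable_fst flow_coordinates_measurable(2)] measurable_compose[OF measurable_fst flow_coordinates_measurable(3)]) measurable
  show "AE \<omega> in BSTh. \<forall>s\<ge>0. scen \<omega> s \<in> pointed_measures"
    using AE_supported by eventually_elim (auto simp: scen_def supported_local_slice)
  show "AE \<omega> in BSTh. \<forall>s\<ge>0. \<forall>t\<ge>0. zoom t (scen \<omega> s) = scen \<omega> (s + t)"
    using AE_supported by eventually_elim (auto simp: scen_def supported_local_slice add.assoc)
  show "AE \<omega> in BSTh. \<forall>s\<ge>0. scen \<omega> (s + roof \<omega>) = scen (S.skew \<omega>) s"
    using AE_supported ergodic_map.AE_comp[OF em AE_supported] AE_step_ok_flow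
  proof eventually_elim
    case (elim \<omega>)
    obtain a e \<theta> where \<omega>: "\<omega> = (a, e, \<theta>)" by (metis prod.exhaust)
    let ?i = "a 0" and ?z = "coding T (\<lambda>n. a (Suc n))"
    have sk: "S.skew \<omega> = (\<lambda>n. a (Suc n), e * sgn (det (A ?i)), \<phi> ?i \<theta>)"
      by (simp add: \<omega> S.skew_def signed_map_def)
    show ?case
    proof (intro allI impI)
      fix s :: real assume s: "0 \<le> s"
      have e: "e = 1 \<or> e = - 1" and ok: "step_ok ?i \<theta> ?z" using elim by (simp_all add: \<omega>)
      have r: "0 \<le> roof \<omega>" using roof_bounds(1)[of \<omega>] roof_min_pos by linarith
      have "scen \<omega> (s + roof \<omega>) = zoom (start_time + (s + roof \<omega>)) (local_slice e \<theta> (coding T a))"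
        using elim(1) by (simp add: scen_def \<omega> supported_local_slice(2))
      also have "\<dots> = zoom (start_time + (s + roof \<omega>)) (local_slice e \<theta> (T ?i ?z))"
        by (simp only: coding_Suc[of a])
      also have "\<dots> = zoom (start_time + (s + roof \<omega>) - ln (stretch ?i \<theta>)) (local_slice (e * sgn (det (A ?i))) (\<phi> ?i \<theta>) ?z)"
        using s r by (intro step_identity[OF ok e]) simp
      also have "start_time + (s + roof \<omega>) - ln (stretch ?i \<theta>) = start_time + s" by (simp add: roof_def \<omega>)
      also have "zoom (start_time + s) (local_slice (e * sgn (det (A ?i))) (\<phi> ?i \<theta>) ?z) = scen (S.skew \<omega>) s"
        using elim(2) unfolding sk by (simp add: scen_def supported_local_slice(2))
      finally show "scen \<omega> (s + roof \<omega>) = scen (S.skew \<omega>) s" .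
    qed
  qed
qed

end

section \<open>The quasi-Palm property\<close>

context self_affine_furstenberg
begin

interpretation \<mu>: prob_space \<mu> by (rule prob_space_\<mu>)

interpretation ST: pair_prob_space "measure_pmf sign_pmf" Th by (rule pair_prob_space_signed)

interpretation S: random_maps STh p signed_map by (rule random_maps_signed)

interpretation flow: scenery_flow "BSTh" S.skew roof scen "ln (1 / rate)" roof_max by (rule scenery_flow)

abbreviation "scenery_law \<equiv> flow.law"

lemma AE_time_flow_iff:
  fixes X :: "real => real => real => real^2 => bool"
  assumes X: "{x. X (fst x) (fst (snd x)) (fst (snd (snd x))) (snd (snd (snd x)))} \<in> sets (borel \<Otimes>\<^sub>M (borel \<Otimes>\<^sub>M (borel \<Otimes>\<^sub>M borel)))" (is "?S \<in> _")
  shows "(AE \<omega> in BSTh. AE s in lborel. 0 \<le> s --> X s (fst (snd \<omega>)) (snd (snd \<omega>)) (coding T (fst \<omega>))) \<longleftrightarrow>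
    (AE s in lborel. 0 \<le> s --> (\<forall>e\<in>set_pmf sign_pmf. AE \<theta> in Th. AE z in \<mu>. X s e \<theta> z))"
proof -
  let ?M4 = "borel \<Otimes>\<^sub>M (borel \<Otimes>\<^sub>M (borel \<Otimes>\<^sub>M borel)) :: (real \<times> real \<times> real \<times> (real^2)) measure"
  let ?M = "BSTh \<Otimes>\<^sub>M (lborel :: real measure)"
  let ?f = "\<lambda>x. (snd x, fst (snd (fst x)), snd (snd (fst x)), coding T (fst (fst x)))"
  interpret BL: pair_sigma_finite "BSTh" lborel
    by (intro pair_sigma_finite.intro prob_space_imp_sigma_finite S.BT.prob_space_axioms lborel.sigma_finite_measure_axioms)
  have f: "?f \<in> ?M \<rightarrow>\<^sub>M ?M4"
    by (intro measurable_Pair measurable_compose[OF measurable_fst flow_coordinates_measurable(1)]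
      measurable_compose[OF measurable_fst flow_coordinates_measurable(2)] measurable_compose[OF measurable_fst flow_coordinates_measurable(3)]) measurable
  have "?f -` ?S \<inter> space ?M \<in> sets ?M"
    by (rule measurable_sets[OF f X])
  moreover have "{x \<in> space ?M. snd x < 0} \<in> sets ?M" by measurable
  ultimately have "{x \<in> space ?M. snd x < 0} \<union> (?f -` ?S \<inter> space ?M) \<in> sets ?M"
    by (rule sets.Un[rotated])
  also have "{x \<in> space ?M. snd x < 0} \<union> (?f -` ?S \<inter> space ?M) =
    {x \<in> space ?M. 0 \<le> snd x --> X (snd x) (fst (snd (fst x))) (snd (snd (fst x))) (coding T (fst (fst x)))}" by auto
  finally have m: "{x \<in> space ?M. 0 \<le> snd x --> X (snd x) (fst (snd (fst x))) (snd (snd (fst x))) (coding T (fst (fst x)))} \<in> sets ?M" .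
  have flow: "(AE \<omega> in BSTh. X s (fst (snd \<omega>)) (snd (snd \<omega>)) (coding T (fst \<omega>))) \<longleftrightarrow>
    (\<forall>e\<in>set_pmf sign_pmf. AE \<theta> in Th. AE z in \<mu>. X s e \<theta> z)" for s
  proof (rule AE_flow_iff[OF coding_measurable distr_coding])
    have "Pair s -` ?S \<in> sets (borel \<Otimes>\<^sub>M (borel \<Otimes>\<^sub>M borel))"
      using X by (rule sets_Pair1)
    then show "{x. X s (fst x) (fst (snd x)) (snd (snd x))} \<in> sets (borel \<Otimes>\<^sub>M (borel \<Otimes>\<^sub>M borel))" by (simp add: vimage_def)
  qed
  have "(AE \<omega> in BSTh. AE s in lborel. 0 \<le> s --> X s (fst (snd \<omega>)) (snd (snd \<omega>)) (coding T (fst \<omega>))) \<longleftrightarrow>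
    (AE s in lborel. AE \<omega> in BSTh. 0 \<le> s --> X s (fst (snd \<omega>)) (snd (snd \<omega>)) (coding T (fst \<omega>)))"
    by (rule BL.AE_commute[of "\<lambda>\<omega> s. 0 \<le> s --> X s (fst (snd \<omega>)) (snd (snd \<omega>)) (coding T (fst \<omega>))", OF m])
  also have "\<dots> \<longleftrightarrow> (AE s in lborel. 0 \<le> s --> (\<forall>e\<in>set_pmf sign_pmf. AE \<theta> in Th. AE z in \<mu>. X s e \<theta> z))"
  proof (rule eventually_subst, rule AE_I2)
    fix s :: real
    show "(AE \<omega> in BSTh. 0 \<le> s --> X s (fst (snd \<omega>)) (snd (snd \<omega>)) (coding T (fst \<omega>))) =
      (0 \<le> s --> (\<forall>e\<in>set_pmf sign_pmf. AE \<theta> in Th. AE z in \<mu>. X s e \<theta> z))"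
      by (cases "0 \<le> s") (simp_all add: flow)
  qed
  finally show ?thesis .
qed

lemma emeasure_zoom_shifted_eq_0_iff:
  assumes [measurable]: "B \<in> sets borel" and e: "e = 1 \<or> e = - 1"
  shows "emeasure (zoom s (shifted e \<theta> x u)) B = 0 \<longleftrightarrow>
    emeasure (slice_at \<theta> x) {v. \<bar>v - u\<bar> \<le> exp (- s) \<and> exp s * (e * (v - u)) \<in> B} = 0"
proof -
  interpret prob_space "shifted e \<theta> x u" by (rule prob_space_shifted)
  have "{v \<in> space borel. v \<in> zoom_window s \<and> exp s * v \<in> B} \<in> sets borel" by measurable
  then have m: "{v. v \<in> zoom_window s \<and> exp s * v \<in> B} \<in> sets borel" by simp
  have w: "e * (v - u) \<in> zoom_window s \<longleftrightarrow> \<bar>v - u\<bar> \<le> exp (- s)" for v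
    unfolding sign_scale_interval[OF e] by auto
  have "emeasure (zoom s (shifted e \<theta> x u)) B = 0 \<longleftrightarrow> emeasure (shifted e \<theta> x u) {v. v \<in> zoom_window s \<and> exp s * v \<in> B} = 0"
    by (subst emeasure_zoom) (simp_all add: ennreal_divide_eq_0_iff)
  then show ?thesis by (simp only: emeasure_shifted[OF m] w mem_Collect_eq)
qed

text \<open>A point \<open>y\<close> of the scenery is a point of the same slice at a distance that the zoom has magnified.\<close>

lemma recentre_zoom_shifted:
  assumes e: "e = 1 \<or> e = - 1" and sup: "slice_point_supported \<theta> x u" and t: "t \<ge> 0"
    and y: "{y - exp (- t)..y + exp (- t)} \<subseteq> {-1..1}"
  shows "zoom t (recentre y (zoom s (shifted e \<theta> x u))) = zoom (s + t) (shifted e \<theta> x (u + e * (exp (- s) * y)))"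
proof -
  interpret prob_space "shifted e \<theta> x u" by (rule prob_space_shifted)
  have "finite_measure (zoom s (shifted e \<theta> x u))"
    using supported_local_slice(3)[OF e sup] by (auto simp: pointed_measures_def interval_measures_def intro: prob_space.finite_measure)
  then have "zoom t (recentre y (zoom s (shifted e \<theta> x u))) = zoom t (distr (zoom s (shifted e \<theta> x u)) borel (\<lambda>w. w - y))"
    using t by (intro zoom_recentre_eq) simp_all
  also have "\<dots> = zoom (s + t) (distr (shifted e \<theta> x u) borel (\<lambda>v. v - exp (- s) * y))"
    by (rule zoom_shift_zoom[OF sets_shifted supported_local_slice(1)[OF e sup] _ y]) simp
  also have "distr (shifted e \<theta> x u) borel (\<lambda>v. v - exp (- s) * y) = shifted e \<theta> x (u + e * (exp (- s) * y))"
  proof -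
    have "e * (v - u) - exp (- s) * y = e * (v - (u + e * (exp (- s) * y)))" for v
      using e by (auto simp: algebra_simps)
    then show ?thesis unfolding shifted_def by (subst distr_distr) (auto simp: comp_def slice_at_borel)
  qed
  finally show ?thesis .
qed

lemma shifted_zoom_mem_measurable:
  assumes "e \<in> borel_measurable M" "\<theta> \<in> borel_measurable M" "x \<in> borel_measurable M" "u \<in> borel_measurable M"
    "s \<in> borel_measurable M" and A: "F \<in> sets weak_star_borel"
  shows "{y \<in> space M. zoom (s y) (shifted (e y) (\<theta> y) (x y) (u y)) \<in> F} \<in> sets M"
  by (rule zoom_mem_measurable[OF shifted_measurable]) fact+

lemma local_recentring:
  assumes F: "F \<in> sets weak_star_borel" and e: "e = 1 \<or> e = - 1" and sup: "slice_point_supported \<theta> x u" and t: "t > 0"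
  shows "(AE y in zoom s (shifted e \<theta> x u). {y - exp (- t)..y + exp (- t)} \<subseteq> {-1..1} --> zoom t (recentre y (zoom s (shifted e \<theta> x u))) \<notin> F) \<longleftrightarrow>
    emeasure (slice_at \<theta> x) {v. zoom (s + t) (shifted e \<theta> x v) \<in> F \<and> \<bar>v - u\<bar> \<le> exp (- s) * (1 - exp (- t))} = 0"
proof -
  define B where "B = {y. {y - exp (- t)..y + exp (- t)} \<subseteq> {-1..1} \<and> zoom (s + t) (shifted e \<theta> x (u + e * (exp (- s) * y))) \<in> F}"
  have I: "{y - exp (- t)..y + exp (- t)} \<subseteq> {-1..1} \<longleftrightarrow> \<bar>y\<bar> \<le> 1 - exp (- t)" for y :: real
  proof -
    have "y - exp (- t) \<le> y + exp (- t)" using exp_gt_zero[of "- t"] by linarith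
    then show ?thesis by (subst atLeastatMost_subset_iff) linarith
  qed
  have "{y \<in> space borel. zoom (s + t) (shifted e \<theta> x (u + e * (exp (- s) * y))) \<in> F} \<in> sets borel"
    by (intro shifted_zoom_mem_measurable F) measurable
  moreover have "{y \<in> space borel. \<bar>y\<bar> \<le> 1 - exp (- t)} \<in> sets borel" by measurable
  ultimately have B: "B \<in> sets borel" unfolding B_def I by (simp add: Collect_conj_eq sets.Int)
  have "(AE y in zoom s (shifted e \<theta> x u). {y - exp (- t)..y + exp (- t)} \<subseteq> {-1..1} --> zoom t (recentre y (zoom s (shifted e \<theta> x u))) \<notin> F) \<longleftrightarrow>
    (AE y in zoom s (shifted e \<theta> x u). y \<notin> B)"
  proof (rule eventually_subst, rule AE_I2)
    fix y
    show "({y - exp (- t)..y + exp (- t)} \<subseteq> {-1..1} --> zoom t (recentre y (zoom s (shifted e \<theta> x u))) \<notin> F) = (y \<notin> B)"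
      using recentre_zoom_shifted[OF e sup less_imp_le[OF t], of y s] by (auto simp: B_def)
  qed
  also have "\<dots> \<longleftrightarrow> emeasure (zoom s (shifted e \<theta> x u)) B = 0"
    using B by (intro AE_iff_measurable) (auto simp: zoom_def)
  also have "\<dots> \<longleftrightarrow> emeasure (slice_at \<theta> x) {v. \<bar>v - u\<bar> \<le> exp (- s) \<and> exp s * (e * (v - u)) \<in> B} = 0"
    by (rule emeasure_zoom_shifted_eq_0_iff[OF B e])
  also have "{v. \<bar>v - u\<bar> \<le> exp (- s) \<and> exp s * (e * (v - u)) \<in> B} =
    {v. zoom (s + t) (shifted e \<theta> x v) \<in> F \<and> \<bar>v - u\<bar> \<le> exp (- s) * (1 - exp (- t))}"
  proof (rule Collect_cong)
    fix v
    have "e * (exp (- s) * (exp s * (e * (v - u)))) = (e * e) * ((exp (- s) * exp s) * (v - u))" by (simp only: mult_ac)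
    also have "\<dots> = v - u" using e by (auto simp: exp_minus)
    finally have inv: "e * (exp (- s) * (exp s * (e * (v - u)))) = v - u" .
    have cancel: "u + e * (exp (- s) * (exp s * (e * (v - u)))) = v" unfolding inv by simp
    have "\<bar>exp s * (e * (v - u))\<bar> = exp s * \<bar>v - u\<bar>" using e by (auto simp: abs_mult)
    then have small: "\<bar>exp s * (e * (v - u))\<bar> \<le> 1 - exp (- t) \<longleftrightarrow> \<bar>v - u\<bar> \<le> exp (- s) * (1 - exp (- t))"
      by (simp add: exp_minus field_simps)
    have "exp (- s) * (1 - exp (- t)) \<le> exp (- s) * 1" by (intro mult_left_mono) simp_all
    then have "\<bar>v - u\<bar> \<le> exp (- s) * (1 - exp (- t)) ==> \<bar>v - u\<bar> \<le> exp (- s)" by linarith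
    then show "\<bar>v - u\<bar> \<le> exp (- s) \<and> exp s * (e * (v - u)) \<in> B \<longleftrightarrow>
      zoom (s + t) (shifted e \<theta> x v) \<in> F \<and> \<bar>v - u\<bar> \<le> exp (- s) * (1 - exp (- t))"
      unfolding B_def mem_Collect_eq I cancel small by blast
  qed
  finally show ?thesis .
qed

text \<open>By resampling, both sides say that almost every slice measure gives mass zero to the points with
  scenery in \<open>F\<close>, on the right hand side only in the vicinity of almost every point, which is enough by
  \<open>null_of_locally_null\<close>.\<close>

lemma typical_point_iff_typical_neighbour:
  assumes F: "F \<in> sets weak_star_borel" and dis: "disintegrates \<theta>" and h: "h > 0"
  shows "(AE z in \<mu>. zoom s (local_slice e \<theta> z) \<notin> F) \<longleftrightarrow>
    (AE z in \<mu>. emeasure (slice_at \<theta> (slice_proj \<theta> z)) {v. zoom s (shifted e \<theta> (slice_proj \<theta> z) v) \<in> F \<and> \<bar>v - along \<theta> z\<bar> \<le> h} = 0)"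
proof -
  let ?B2 = "borel \<Otimes>\<^sub>M borel :: (real \<times> real) measure"
  define bad where "bad x = {v. zoom s (shifted e \<theta> x v) \<in> F}" for x
  have bm: "bad x \<in> sets borel" for x
  proof -
    have "{v \<in> space borel. zoom s (shifted e \<theta> x v) \<in> F} \<in> sets borel"
      by (intro shifted_zoom_mem_measurable F) measurable
    then show ?thesis by (simp add: bad_def)
  qed
  have bs: "bad x \<in> sets (slice_at \<theta> y)" for x y using bm by (simp add: slice_at_props)
  have near: "{v. zoom s (shifted e \<theta> x v) \<in> F \<and> \<bar>v - u\<bar> \<le> h} = bad x \<inter> {u - h..u + h}" for x u
    by (auto simp: bad_def)
  have 1: "(AE z in \<mu>. zoom s (local_slice e \<theta> z) \<notin> F) \<longleftrightarrow> (AE z in \<mu>. emeasure (slice_at \<theta> (slice_proj \<theta> z)) (bad (slice_proj \<theta> z)) = 0)"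
  proof (subst AE_resample[OF dis, where R="\<lambda>x v. zoom s (shifted e \<theta> x v) \<notin> F"])
    have "{y \<in> space ?B2. zoom s (shifted e \<theta> (fst y) (snd y)) \<in> F} \<in> sets ?B2"
      by (intro shifted_zoom_mem_measurable F) measurable
    then have "space ?B2 - {y \<in> space ?B2. zoom s (shifted e \<theta> (fst y) (snd y)) \<in> F} \<in> sets ?B2" by (rule sets.compl_sets)
    then show "{y. zoom s (shifted e \<theta> (fst y) (snd y)) \<notin> F} \<in> sets ?B2"
      by (simp add: space_pair_measure Compl_eq[symmetric] Compl_eq_Diff_UNIV[symmetric] Collect_neg_eq)
    show "(AE z in \<mu>. AE v in slice_at \<theta> (slice_proj \<theta> z). zoom s (shifted e \<theta> (slice_proj \<theta> z) v) \<notin> F) \<longleftrightarrow>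
      (AE z in \<mu>. emeasure (slice_at \<theta> (slice_proj \<theta> z)) (bad (slice_proj \<theta> z)) = 0)"
    proof (rule eventually_subst, rule AE_I2)
      fix z
      show "(AE v in slice_at \<theta> (slice_proj \<theta> z). zoom s (shifted e \<theta> (slice_proj \<theta> z) v) \<notin> F) =
        (emeasure (slice_at \<theta> (slice_proj \<theta> z)) (bad (slice_proj \<theta> z)) = 0)"
        using bs by (intro AE_iff_measurable) (auto simp: bad_def slice_at_props)
    qed
  qed
  show ?thesis
  proof (rule iffI)
    assume "AE z in \<mu>. zoom s (local_slice e \<theta> z) \<notin> F"
    then have "AE z in \<mu>. emeasure (slice_at \<theta> (slice_proj \<theta> z)) (bad (slice_proj \<theta> z)) = 0" by (simp only: 1)
    then show "AE z in \<mu>. emeasure (slice_at \<theta> (slice_proj \<theta> z)) {v. zoom s (shifted e \<theta> (slice_proj \<theta> z) v) \<in> F \<and> \<bar>v - along \<theta> z\<bar> \<le> h} = 0"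
    proof eventually_elim
      case (elim z)
      have "emeasure (slice_at \<theta> (slice_proj \<theta> z)) (bad (slice_proj \<theta> z) \<inter> {along \<theta> z - h..along \<theta> z + h}) \<le> 0"
        unfolding elim[symmetric] using bs by (intro emeasure_mono) auto
      then show ?case by (simp add: near)
    qed
  next
    assume "AE z in \<mu>. emeasure (slice_at \<theta> (slice_proj \<theta> z)) {v. zoom s (shifted e \<theta> (slice_proj \<theta> z) v) \<in> F \<and> \<bar>v - along \<theta> z\<bar> \<le> h} = 0"
    then have "AE z in \<mu>. AE u in slice_at \<theta> (slice_proj \<theta> z).
      emeasure (slice_at \<theta> (slice_proj \<theta> z)) {v. zoom s (shifted e \<theta> (slice_proj \<theta> z) v) \<in> F \<and> \<bar>v - u\<bar> \<le> h} = 0"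
    proof (subst (asm) AE_resample[OF dis, where R="\<lambda>x u. emeasure (slice_at \<theta> x) {v. zoom s (shifted e \<theta> x v) \<in> F \<and> \<bar>v - u\<bar> \<le> h} = 0"])
      let ?M = "?B2 \<Otimes>\<^sub>M (borel :: real measure)"
      have "{y \<in> space ?M. zoom s (shifted e \<theta> (fst (fst y)) (snd y)) \<in> F} \<in> sets ?M"
        by (intro shifted_zoom_mem_measurable F) measurable
      moreover have "{y \<in> space ?M. \<bar>snd y - snd (fst y)\<bar> \<le> h} \<in> sets ?M" by measurable
      ultimately have "{y \<in> space ?M. zoom s (shifted e \<theta> (fst (fst y)) (snd y)) \<in> F \<and> \<bar>snd y - snd (fst y)\<bar> \<le> h} \<in> sets ?M"
        by (rule sets.sets_Collect_conj[rotated])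
      then have [measurable]: "(\<lambda>y. emeasure (slice_at \<theta> (fst y)) {v. zoom s (shifted e \<theta> (fst y) v) \<in> F \<and> \<bar>v - snd y\<bar> \<le> h}) \<in> borel_measurable ?B2"
        by (intro slice_at_emeasure_measurable) simp_all
      have "{y \<in> space ?B2. emeasure (slice_at \<theta> (fst y)) {v. zoom s (shifted e \<theta> (fst y) v) \<in> F \<and> \<bar>v - snd y\<bar> \<le> h} = 0} \<in> sets ?B2"
        by measurable
      then show "{y. emeasure (slice_at \<theta> (fst y)) {v. zoom s (shifted e \<theta> (fst y) v) \<in> F \<and> \<bar>v - snd y\<bar> \<le> h} = 0} \<in> sets ?B2"
        by (simp add: space_pair_measure)
    qed
    then have "AE z in \<mu>. emeasure (slice_at \<theta> (slice_proj \<theta> z)) (bad (slice_proj \<theta> z)) = 0"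
    proof eventually_elim
      case (elim z)
      then show ?case unfolding near by (rule null_of_locally_null[OF slice_at_props(2) bm h])
    qed
    then show "AE z in \<mu>. zoom s (local_slice e \<theta> z) \<notin> F" by (simp only: 1)
  qed
qed

text \<open>A recentred scenery is the scenery at a point of the same slice near the given one, seen later by
  the time \<open>t\<close>. On the side of the law itself, invariance supplies this additional time. For fixed
  time, orientation and direction the two conditions then agree by
  \<open>typical_point_iff_typical_neighbour\<close>.\<close>

lemma quasi_palm_scenery_law: "quasi_palm scenery_law"
  unfolding quasi_palm_def
proof (intro allI impI ballI)
  fix t :: real and F assume t: "0 < t" and "F \<in> sets scenery_law"
  then have F: "F \<in> sets weak_star_borel" by (simp add: flow.sets_law)
  let ?e = "\<lambda>\<omega>. fst (snd \<omega>) :: real" and ?\<theta> = "\<lambda>\<omega>. snd (snd \<omega>) :: real" and ?z = "\<lambda>\<omega>. coding T (fst \<omega>)"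
  let ?Q = "\<lambda>m. AE x in m. {x - exp (- t)..x + exp (- t)} \<subseteq> {-1..1} --> zoom t (recentre x m) \<notin> F"
  \<comment> \<open>The radius is that of the set of centres whose windows lie in \<open>[-1,1]\<close>, at the scale of the scenery.\<close>
  let ?near = "\<lambda>s e \<theta> z. emeasure (slice_at \<theta> (slice_proj \<theta> z))
    {v. zoom (start_time + s + t) (shifted e \<theta> (slice_proj \<theta> z) v) \<in> F \<and> \<bar>v - along \<theta> z\<bar> \<le> exp (- (start_time + s)) * (1 - exp (- t))} = 0"
  let ?M4 = "borel \<Otimes>\<^sub>M (borel \<Otimes>\<^sub>M (borel \<Otimes>\<^sub>M borel)) :: (real \<times> real \<times> real \<times> (real^2)) measure"
  have "emeasure scenery_law F = 0 \<longleftrightarrow> emeasure scenery_law {m \<in> pointed_measures. zoom t m \<in> F} = 0"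
    using t by (subst flow.emeasure_law_zoom[OF F]) simp_all
  also have "\<dots> \<longleftrightarrow> (AE \<omega> in BSTh. AE s in lborel. 0 \<le> s --> scen \<omega> s \<notin> {m \<in> pointed_measures. zoom t m \<in> F})"
    by (rule flow.emeasure_law_eq_0_iff[OF measurable_zoom_pointed[OF F]])
  also have "\<dots> \<longleftrightarrow> (AE \<omega> in BSTh. AE s in lborel. 0 \<le> s --> zoom (start_time + s + t) (local_slice (?e \<omega>) (?\<theta> \<omega>) (?z \<omega>)) \<notin> F)"
    using AE_supported
  proof (rule eventually_subst[OF eventually_mono])
    fix \<omega> assume "supported \<omega>"
    then show "(AE s in lborel. 0 \<le> s --> scen \<omega> s \<notin> {m \<in> pointed_measures. zoom t m \<in> F}) =
      (AE s in lborel. 0 \<le> s --> zoom (start_time + s + t) (local_slice (?e \<omega>) (?\<theta> \<omega>) (?z \<omega>)) \<notin> F)"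
      using t by (simp add: scen_def supported_local_slice)
  qed
  also have "\<dots> \<longleftrightarrow> (AE s in lborel. 0 \<le> s --> (\<forall>e\<in>set_pmf sign_pmf. AE \<theta> in Th. AE z in \<mu>. zoom (start_time + s + t) (local_slice e \<theta> z) \<notin> F))"
  proof (rule AE_time_flow_iff[where X="\<lambda>s e \<theta> z. zoom (start_time + s + t) (local_slice e \<theta> z) \<notin> F"])
    have "{y \<in> space ?M4. zoom (start_time + fst y + t) (local_slice (fst (snd y)) (fst (snd (snd y))) (snd (snd (snd y)))) \<in> F} \<in> sets ?M4"
      by (intro shifted_zoom_mem_measurable F) measurable
    then have "{y \<in> space ?M4. \<not> zoom (start_time + fst y + t) (local_slice (fst (snd y)) (fst (snd (snd y))) (snd (snd (snd y)))) \<in> F} \<in> sets ?M4"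
      by (rule sets.sets_Collect_neg)
    then show "{y. zoom (start_time + fst y + t) (local_slice (fst (snd y)) (fst (snd (snd y))) (snd (snd (snd y)))) \<notin> F} \<in> sets ?M4"
      by (simp add: space_pair_measure)
  qed
  also have "\<dots> \<longleftrightarrow> (AE s in lborel. 0 \<le> s --> (\<forall>e\<in>set_pmf sign_pmf. AE \<theta> in Th. AE z in \<mu>. ?near s e \<theta> z))"
  proof (rule eventually_subst, rule AE_I2)
    fix s :: real
    have h: "exp (- (start_time + s)) * (1 - exp (- t)) > 0" using t by simp
    have "(AE \<theta> in Th. AE z in \<mu>. zoom (start_time + s + t) (local_slice e \<theta> z) \<notin> F) = (AE \<theta> in Th. AE z in \<mu>. ?near s e \<theta> z)" for e
    proof (rule eventually_subst)
      show "AE \<theta> in Th. (AE z in \<mu>. zoom (start_time + s + t) (local_slice e \<theta> z) \<notin> F) = (AE z in \<mu>. ?near s e \<theta> z)"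
        using AE_disintegrates by eventually_elim (rule typical_point_iff_typical_neighbour[OF F _ h])
    qed
    then show "(0 \<le> s --> (\<forall>e\<in>set_pmf sign_pmf. AE \<theta> in Th. AE z in \<mu>. zoom (start_time + s + t) (local_slice e \<theta> z) \<notin> F)) =
      (0 \<le> s --> (\<forall>e\<in>set_pmf sign_pmf. AE \<theta> in Th. AE z in \<mu>. ?near s e \<theta> z))" by simp
  qed
  also have "\<dots> \<longleftrightarrow> (AE \<omega> in BSTh. AE s in lborel. 0 \<le> s --> ?near s (?e \<omega>) (?\<theta> \<omega>) (?z \<omega>))"
  proof (rule AE_time_flow_iff[where X="?near", symmetric])
    let ?M = "?M4 \<Otimes>\<^sub>M (borel :: real measure)"
    have "{y \<in> space ?M. zoom (start_time + fst (fst y) + t) (shifted (fst (snd (fst y))) (fst (snd (snd (fst y))))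
        (slice_proj (fst (snd (snd (fst y)))) (snd (snd (snd (fst y))))) (snd y)) \<in> F} \<in> sets ?M"
      by (intro shifted_zoom_mem_measurable F) measurable
    moreover have "{y \<in> space ?M. \<bar>snd y - along (fst (snd (snd (fst y)))) (snd (snd (snd (fst y))))\<bar>
        \<le> exp (- (start_time + fst (fst y))) * (1 - exp (- t))} \<in> sets ?M" by measurable
    ultimately have "{y \<in> space ?M. zoom (start_time + fst (fst y) + t) (shifted (fst (snd (fst y))) (fst (snd (snd (fst y))))
        (slice_proj (fst (snd (snd (fst y)))) (snd (snd (snd (fst y))))) (snd y)) \<in> F \<and>
        \<bar>snd y - along (fst (snd (snd (fst y)))) (snd (snd (snd (fst y))))\<bar> \<le> exp (- (start_time + fst (fst y))) * (1 - exp (- t))} \<in> sets ?M"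
      by (rule sets.sets_Collect_conj[rotated])
    then have [measurable]: "(\<lambda>y. emeasure (slice_at (fst (snd (snd y))) (slice_proj (fst (snd (snd y))) (snd (snd (snd y)))))
      {v. zoom (start_time + fst y + t) (shifted (fst (snd y)) (fst (snd (snd y))) (slice_proj (fst (snd (snd y))) (snd (snd (snd y)))) v) \<in> F \<and>
        \<bar>v - along (fst (snd (snd y))) (snd (snd (snd y)))\<bar> \<le> exp (- (start_time + fst y)) * (1 - exp (- t))}) \<in> borel_measurable ?M4"
      proof (rule slice_at_emeasure_measurable[rotated 2])
      show "(\<lambda>y. fst (snd (snd y))) \<in> borel_measurable ?M4" "(\<lambda>y. slice_proj (fst (snd (snd y))) (snd (snd (snd y)))) \<in> borel_measurable ?M4"
        by measurable
    qed
    have "{y \<in> space ?M4. ?near (fst y) (fst (snd y)) (fst (snd (snd y))) (snd (snd (snd y)))} \<in> sets ?M4" by measurable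
    then show "{y. ?near (fst y) (fst (snd y)) (fst (snd (snd y))) (snd (snd (snd y)))} \<in> sets ?M4"
      by (simp add: space_pair_measure)
  qed
  also have "\<dots> \<longleftrightarrow> (AE \<omega> in BSTh. AE s in lborel. 0 \<le> s --> ?Q (scen \<omega> s))"
    using AE_supported
  proof (rule eventually_subst[OF eventually_mono])
    fix \<omega> assume sup: "supported \<omega>"
    have "?near s (?e \<omega>) (?\<theta> \<omega>) (?z \<omega>) = ?Q (scen \<omega> s)" for s
      unfolding scen_def supported_local_slice(2)[OF conjunct1[OF sup] conjunct2[OF sup]]
        local_recentring[OF F conjunct1[OF sup] conjunct2[OF sup] t] ..
    then show "(AE s in lborel. 0 \<le> s --> ?near s (?e \<omega>) (?\<theta> \<omega>) (?z \<omega>)) = (AE s in lborel. 0 \<le> s --> ?Q (scen \<omega> s))" by simp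
  qed
  also have "\<dots> \<longleftrightarrow> (AE m in scenery_law. ?Q m)"
    using t by (intro flow.AE_law_iff[symmetric] recentred_zoom_null_measurable[OF F]) simp
  finally show "emeasure scenery_law F = 0 \<longleftrightarrow> (AE m in scenery_law. ?Q m)" .
qed

end

section \<open>Time averages of slice sceneries\<close>

lemma time_average_shift:
  fixes h :: "real => real"
  assumes h: "h \<in> borel_measurable borel" and B: "\<And>s. \<bar>h s\<bar> \<le> B" and c: "c \<ge> 0"
    and lim: "((\<lambda>t. 1 / t * (LBINT s:{0..<t}. h (s + c))) \<longlongrightarrow> L) at_top"
  shows "((\<lambda>t. 1 / t * (LBINT s:{0..<t}. h s)) \<longlongrightarrow> L) at_top"
proof -
  have "((\<lambda>t. 1 / t * (LBINT s:{0..<t}. h (s + c)) - 1 / t * (LBINT s:{0..<t}. h s)) \<longlongrightarrow> 0) at_top"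
  proof (rule Lim_null_comparison)
    show "((\<lambda>t. 2 * B * c / t) \<longlongrightarrow> 0) at_top"
      by (rule tendsto_divide_0[OF tendsto_const filterlim_at_top_imp_at_infinity[OF filterlim_ident]])
    show "\<forall>\<^sub>F t in at_top. norm (1 / t * (LBINT s:{0..<t}. h (s + c)) - 1 / t * (LBINT s:{0..<t}. h s)) \<le> 2 * B * c / t"
      using eventually_gt_at_top[of 0]
    proof eventually_elim
      case (elim t)
      have 1: "(LBINT s:{0..<c + t}. h s) = (LBINT s:{0..<c}. h s) + (LBINT s:{c..<c + t}. h s)"
        using elim c by (intro bounded_set_integral_split[OF h B]) auto
      have 2: "(LBINT s:{0..<c + t}. h s) = (LBINT s:{0..<t}. h s) + (LBINT s:{t..<c + t}. h s)"
        using elim c by (intro bounded_set_integral_split[OF h B]) auto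
      have "\<bar>LBINT s:{0..<c}. h s\<bar> \<le> B * (c - 0)" by (rule bounded_set_integral_le[OF h B c])
      moreover have "\<bar>LBINT s:{t..<c + t}. h s\<bar> \<le> B * ((c + t) - t)" using c by (intro bounded_set_integral_le[OF h B]) simp
      ultimately have "\<bar>(LBINT s:{0..<t}. h (s + c)) - (LBINT s:{0..<t}. h s)\<bar> \<le> 2 * B * c"
        using 1 2 by (simp add: set_integral_translate)
      then have "\<bar>(LBINT s:{0..<t}. h (s + c)) - (LBINT s:{0..<t}. h s)\<bar> / t \<le> 2 * B * c / t"
        using elim by (intro divide_right_mono) auto
      then show ?case using elim by (simp add: diff_divide_distrib[symmetric] abs_divide)
    qed
  qed
  from tendsto_diff[OF lim this] show ?thesis by simp
qed

lemma weak_star_time_averages: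
  assumes P: "prob_space P" "sets P = sets weak_star_borel" and m: "m \<in> borel \<rightarrow>\<^sub>M weak_star_borel"
    and mono: "\<And>l. ((\<lambda>t. 1 / t * (LBINT s:{0..<t}. moment_monomial l (m s))) \<longlongrightarrow> (LINT x|P. moment_monomial l x)) at_top"
    and F: "continuous_map weak_star euclideanreal F"
  shows "((\<lambda>t. 1 / t * (LBINT s:{0..<t}. F (m s))) \<longlongrightarrow> (LINT x|P. F x)) at_top"
proof -
  interpret P: prob_space P by fact
  have spP: "space P = interval_measures" using sets_eq_imp_space_eq[OF P(2)] by simp
  have mi: "m s \<in> interval_measures" for s using measurable_space[OF m, of s] by simp
  have mF: "(\<lambda>s. F (m s)) \<in> borel_measurable borel" if "continuous_map weak_star euclideanreal F" for F
    using measurable_compose[OF m borel_measurable_continuous_map_weak_star[OF that]] .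
  have iF: "set_integrable lborel {a..<b} (\<lambda>s. F (m s))" if F: "continuous_map weak_star euclideanreal F" for F a b
  proof -
    obtain B where "\<And>m. m \<in> interval_measures ==> \<bar>F m\<bar> \<le> B" using continuous_map_weak_star_bounded[OF F] by blast
    then show ?thesis using mi by (intro bounded_set_integrable[OF mF[OF F], where B=B]) blast
  qed
  have iP: "integrable P F" if F: "continuous_map weak_star euclideanreal F" for F
  proof -
    obtain B where "\<And>m. m \<in> interval_measures ==> \<bar>F m\<bar> \<le> B" using continuous_map_weak_star_bounded[OF F] by blast
    moreover have "F \<in> borel_measurable P"
      using borel_measurable_continuous_map_weak_star[OF F] by (simp cong: measurable_cong_sets add: P(2))
    ultimately show ?thesis by (intro P.integrable_const_bound[of F B]) (auto intro!: AE_I2 simp: spP)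
  qed
  define G where "G xs x = (\<Sum>(a, l)\<leftarrow>xs. a * moment_monomial l x)" for xs x
  have G0: "G [] = (\<lambda>x. 0)" and GC: "G ((a, l) # xs) = (\<lambda>x. a * moment_monomial l x + G xs x)" for a l xs
    by (simp_all add: G_def fun_eq_iff)
  have G: "continuous_map weak_star euclideanreal (G xs) \<and>
    ((\<lambda>t. 1 / t * (LBINT s:{0..<t}. G xs (m s))) \<longlongrightarrow> (LINT x|P. G xs x)) at_top" for xs
  proof (induction xs)
    case Nil
    then show ?case unfolding G0 by simp
  next
    case (Cons y xs)
    obtain a l where y: "y = (a, l)" by (cases y)
    note mm = continuous_map_moment_monomial[of l]
    have am: "continuous_map weak_star euclideanreal (\<lambda>x. a * moment_monomial l x)"
      by (intro continuous_map_real_mult mm) simp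
    have "1 / t * (LBINT s:{0..<t}. a * moment_monomial l (m s) + G xs (m s)) =
      a * (1 / t * (LBINT s:{0..<t}. moment_monomial l (m s))) + 1 / t * (LBINT s:{0..<t}. G xs (m s))" for t
      using iF[OF am] iF[OF conjunct1[OF Cons]] by (simp add: set_integral_add algebra_simps)
    moreover have "(LINT x|P. a * moment_monomial l x + G xs x) = a * (LINT x|P. moment_monomial l x) + (LINT x|P. G xs x)"
      using iP[OF am] iP[OF conjunct1[OF Cons]] by simp
    moreover have "((\<lambda>t. a * (1 / t * (LBINT s:{0..<t}. moment_monomial l (m s))) + 1 / t * (LBINT s:{0..<t}. G xs (m s)))
      \<longlongrightarrow> a * (LINT x|P. moment_monomial l x) + (LINT x|P. G xs x)) at_top"
      by (intro tendsto_add tendsto_mult_left mono conjunct2[OF Cons])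
    ultimately show ?case unfolding y GC using continuous_map_add[OF am conjunct1[OF Cons]] by simp
  qed
  show ?thesis
  proof (rule tendstoI)
    fix e :: real assume e: "e > 0"
    obtain xs where xs: "\<And>m. m \<in> interval_measures ==> \<bar>F m - G xs m\<bar> < e / 4"
      using weak_star_approx[OF F, of "e / 4"] e unfolding G_def by auto
    have Gc: "continuous_map weak_star euclideanreal (G xs)" using G by blast
    have intP: "\<bar>(LINT x|P. F x) - (LINT x|P. G xs x)\<bar> \<le> e / 4"
    proof -
      have "\<bar>(LINT x|P. F x) - (LINT x|P. G xs x)\<bar> = \<bar>LINT x|P. F x - G xs x\<bar>"
        using iP[OF F] iP[OF Gc] by simp
      also have "\<dots> \<le> (LINT x|P. \<bar>F x - G xs x\<bar>)" by (rule integral_abs_bound)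
      also have "\<dots> \<le> (LINT x|P. e / 4)"
        using iP[OF F] iP[OF Gc] xs by (intro integral_mono) (auto simp: spP intro: less_imp_le)
      finally show ?thesis by (simp add: P.prob_space)
    qed
    have "\<forall>\<^sub>F t in at_top. dist (1 / t * (LBINT s:{0..<t}. G xs (m s))) (LINT x|P. G xs x) < e / 4"
      using conjunct2[OF G[of xs]] e by (intro tendstoD) auto
    then show "\<forall>\<^sub>F t in at_top. dist (1 / t * (LBINT s:{0..<t}. F (m s))) (LINT x|P. F x) < e"
      using eventually_gt_at_top[of 0]
    proof eventually_elim
      case (elim t)
      have "(LBINT s:{0..<t}. F (m s)) - (LBINT s:{0..<t}. G xs (m s)) = (LBINT s:{0..<t}. F (m s) - G xs (m s))"
        using iF[OF F] iF[OF Gc] by (simp add: set_integral_diff)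
      moreover have "\<bar>LBINT s:{0..<t}. F (m s) - G xs (m s)\<bar> \<le> e / 4 * (t - 0)"
        using elim(2) mF[OF F] mF[OF Gc] less_imp_le[OF xs[OF mi]] by (intro bounded_set_integral_le borel_measurable_diff) auto
      ultimately have "\<bar>(LBINT s:{0..<t}. F (m s)) - (LBINT s:{0..<t}. G xs (m s))\<bar> / t \<le> e / 4"
        using elim(2) by (simp add: divide_le_eq)
      then have "\<bar>1 / t * (LBINT s:{0..<t}. F (m s)) - 1 / t * (LBINT s:{0..<t}. G xs (m s))\<bar> \<le> e / 4"
        using elim(2) by (simp add: diff_divide_distrib[symmetric] abs_divide)
      with elim(1) intP e show ?case unfolding dist_real_def by linarith
    qed
  qed
qed

lemma (in pair_sigma_finite) AE_pair_swapped:
  assumes "AE x in M1 \<Otimes>\<^sub>M M2. R x" shows "AE y in M2. AE x in M1. R (x, y)"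
proof -
  interpret sw: pair_sigma_finite M2 M1 ..
  have "AE x in distr (M2 \<Otimes>\<^sub>M M1) (M1 \<Otimes>\<^sub>M M2) (\<lambda>(x, y). (y, x)). R x"
    using assms by (simp only: distr_pair_swap[symmetric])
  from sw.AE_pair[OF AE_distrD[OF measurable_pair_swap' this]] show ?thesis by simp
qed

lemma window_iff:
  assumes "slice_proj \<theta> z = slice_proj \<theta> y"
  shows "z \<in> window y \<theta> t \<longleftrightarrow> \<bar>along \<theta> z - along \<theta> y\<bar> \<le> exp (- t) / 2"
proof -
  define c where "c = exp (- t) / 2"
  have c: "c > 0" by (simp add: c_def)
  have z: "z = y + (along \<theta> z - along \<theta> y) *\<^sub>R dir \<theta>"
  proof -
    have "z = line_point \<theta> (slice_proj \<theta> y) (along \<theta> z)" using line_point_coords[of \<theta> z] assms by simp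
    also have "\<dots> = line_point \<theta> (slice_proj \<theta> y) (along \<theta> y) + (along \<theta> z - along \<theta> y) *\<^sub>R dir \<theta>"
      by (simp add: line_point_def algebra_simps)
    finally show ?thesis by (simp only: line_point_coords)
  qed
  have p: "(1 - k) *\<^sub>R (y - c *\<^sub>R dir \<theta>) + k *\<^sub>R (y + c *\<^sub>R dir \<theta>) = y + ((2 * k - 1) * c) *\<^sub>R dir \<theta>" for k
    by (simp add: algebra_simps scaleR_2[symmetric])
  have "z \<in> window y \<theta> t \<longleftrightarrow> (\<exists>k. 0 \<le> k \<and> k \<le> 1 \<and> z = y + ((2 * k - 1) * c) *\<^sub>R dir \<theta>)"
    unfolding window_def c_def[symmetric] closed_segment_def p by blast
  also have "\<dots> \<longleftrightarrow> (\<exists>k. 0 \<le> k \<and> k \<le> 1 \<and> along \<theta> z - along \<theta> y = (2 * k - 1) * c)"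
  proof (intro ex_cong1 conj_cong refl)
    fix k
    have "z = y + ((2 * k - 1) * c) *\<^sub>R dir \<theta> ==> along \<theta> z = along \<theta> y + (2 * k - 1) * c"
      by (simp add: along_def inner_add_left)
    then show "z = y + ((2 * k - 1) * c) *\<^sub>R dir \<theta> \<longleftrightarrow> along \<theta> z - along \<theta> y = (2 * k - 1) * c"
      using z by auto
  qed
  also have "\<dots> \<longleftrightarrow> \<bar>along \<theta> z - along \<theta> y\<bar> \<le> c"
  proof
    assume "\<exists>k. 0 \<le> k \<and> k \<le> 1 \<and> along \<theta> z - along \<theta> y = (2 * k - 1) * c"
    then obtain k where k: "0 \<le> k" "k \<le> 1" "along \<theta> z - along \<theta> y = (2 * k - 1) * c" by blast
    have "\<bar>2 * k - 1\<bar> \<le> 1" using k by linarith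
    then have "\<bar>2 * k - 1\<bar> * c \<le> 1 * c" using c by (intro mult_right_mono) auto
    then show "\<bar>along \<theta> z - along \<theta> y\<bar> \<le> c" using k c by (simp add: abs_mult)
  next
    assume a: "\<bar>along \<theta> z - along \<theta> y\<bar> \<le> c"
    let ?k = "((along \<theta> z - along \<theta> y) / c + 1) / 2"
    have "- 1 \<le> (along \<theta> z - along \<theta> y) / c" "(along \<theta> z - along \<theta> y) / c \<le> 1"
      using a c by (auto simp: pos_le_divide_eq pos_divide_le_eq)
    then show "\<exists>k. 0 \<le> k \<and> k \<le> 1 \<and> along \<theta> z - along \<theta> y = (2 * k - 1) * c"
      using c by (intro exI[of _ ?k]) (auto simp: field_simps)
  qed
  finally show ?thesis by (simp add: c_def)
qed

context self_affine_furstenberg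
begin

interpretation \<mu>: prob_space \<mu> by (rule prob_space_\<mu>)

interpretation ST: pair_prob_space "measure_pmf sign_pmf" Th by (rule pair_prob_space_signed)

interpretation S: random_maps STh p signed_map by (rule random_maps_signed)

interpretation flow: scenery_flow "BSTh" S.skew roof scen "ln (1 / rate)" roof_max by (rule scenery_flow)

text \<open>The windows of \<open>slice_scenery\<close> have half-length \<open>exp (-t) / 2\<close>, whence the time \<open>ln 2 + t\<close>.\<close>

lemma slice_scenery_eq_zoom:
  assumes N: "sets N = sets borel" and on: "AE z in N. slice_proj \<theta> z = slice_proj \<theta> y"
    and al: "distr N borel (along \<theta>) = slice_at \<theta> (slice_proj \<theta> y)" and D: "D (slice_proj \<theta> y) = N"
  shows "slice_scenery D \<theta> y t = zoom (ln 2 + t) (local_slice 1 \<theta> y)"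
proof (rule measure_eqI)
  let ?u = "along \<theta> y" and ?\<nu> = "slice_at \<theta> (slice_proj \<theta> y)"
  have am: "along \<theta> \<in> borel_measurable N" using N by (simp cong: measurable_cong_sets)
  have W: "window y \<theta> t \<in> sets borel" unfolding window_def by (intro borel_closed closed_segment)
  have g: "(\<lambda>z. 2 * exp t * ((z - y) \<bullet> dir \<theta>)) \<in> borel_measurable (uniform_measure N (window y \<theta> t))"
    using N by (simp cong: measurable_cong_sets)
  have window: "zoom_window (ln 2 + t) = {- (exp (- t) / 2)..exp (- t) / 2}"
    by (simp add: exp_diff exp_minus divide_simps)
  have win: "v \<in> zoom_window (ln 2 + t) \<longleftrightarrow> \<bar>v\<bar> \<le> exp (- t) / 2" for v unfolding window by auto
  have spN: "space N = UNIV" using sets_eq_imp_space_eq[OF N] by simp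
  have ex: "exp (ln 2 + t) = 2 * exp t" by (simp add: exp_add)
  have key: "emeasure N {z. z \<in> window y \<theta> t \<and> along \<theta> z \<in> C} = emeasure ?\<nu> {v. 1 * (v - ?u) \<in> zoom_window (ln 2 + t) \<and> v \<in> C}"
    if C: "C \<in> sets borel" for C
  proof -
    let ?C = "{v. 1 * (v - ?u) \<in> zoom_window (ln 2 + t) \<and> v \<in> C}"
    have "?C = {?u - exp (- t) / 2..?u + exp (- t) / 2} \<inter> C" unfolding window by auto
    then have Cs: "?C \<in> sets borel" using C by simp
    have "emeasure N {z. z \<in> window y \<theta> t \<and> along \<theta> z \<in> C} = emeasure N (along \<theta> -` ?C \<inter> space N)"
    proof (rule emeasure_eq_AE)
      show "AE z in N. z \<in> {z. z \<in> window y \<theta> t \<and> along \<theta> z \<in> C} \<longleftrightarrow> z \<in> along \<theta> -` ?C \<inter> space N"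
        using on
      proof eventually_elim
        case (elim z)
        show ?case
          unfolding mem_Collect_eq window_iff[OF elim] vimage_eq Int_iff spN mult_1 win by blast
      qed
      have "{z \<in> space N. z \<in> window y \<theta> t} \<in> sets N" using W N sets_eq_imp_space_eq[OF N] by simp
      moreover have "{z \<in> space N. along \<theta> z \<in> C} \<in> sets N" using measurable_sets[OF am C] by (simp add: vimage_def Int_def conj_commute)
      ultimately have "{z \<in> space N. z \<in> window y \<theta> t \<and> along \<theta> z \<in> C} \<in> sets N" by (rule sets.sets_Collect_conj[rotated])
      then show "{z. z \<in> window y \<theta> t \<and> along \<theta> z \<in> C} \<in> sets N" using sets_eq_imp_space_eq[OF N] by simp
      show "along \<theta> -` ?C \<inter> space N \<in> sets N" by (rule measurable_sets[OF am Cs])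
    qed
    also have "\<dots> = emeasure ?\<nu> ?C" unfolding al[symmetric] by (rule emeasure_distr[OF am Cs, symmetric])
    finally show ?thesis .
  qed
  fix B assume "B \<in> sets (slice_scenery D \<theta> y t)"
  then have B: "B \<in> sets borel" by (simp add: slice_scenery_def)
  define C where "C = {v. 2 * exp t * (v - ?u) \<in> B}"
  have "{v \<in> space borel. 2 * exp t * (v - ?u) \<in> B} \<in> sets borel" using B by measurable
  then have C: "C \<in> sets borel" by (simp add: C_def)
  have al': "(z - y) \<bullet> dir \<theta> = along \<theta> z - ?u" for z by (simp add: along_def inner_diff_left)
  have pre: "{z. along \<theta> z \<in> C} \<in> sets N" using measurable_sets[OF am C] sets_eq_imp_space_eq[OF N] by (simp add: vimage_def)
  have "emeasure (slice_scenery D \<theta> y t) B = emeasure (uniform_measure N (window y \<theta> t)) {z. along \<theta> z \<in> C}"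
    unfolding slice_scenery_def D using sets_eq_imp_space_eq[OF N]
    by (subst emeasure_distr[OF g B]) (simp add: vimage_def al' C_def)
  also have "\<dots> = emeasure N (window y \<theta> t \<inter> {z. along \<theta> z \<in> C}) / emeasure N (window y \<theta> t)"
    using W pre N by (intro emeasure_uniform_measure) simp_all
  also have "window y \<theta> t \<inter> {z. along \<theta> z \<in> C} = {z. z \<in> window y \<theta> t \<and> along \<theta> z \<in> C}" by blast
  also have "emeasure N (window y \<theta> t) = emeasure N {z. z \<in> window y \<theta> t \<and> along \<theta> z \<in> UNIV}" by simp
  also have "emeasure N {z. z \<in> window y \<theta> t \<and> along \<theta> z \<in> C} / \<dots> =
    emeasure ?\<nu> {v. 1 * (v - ?u) \<in> zoom_window (ln 2 + t) \<and> v \<in> C} / emeasure ?\<nu> {v. 1 * (v - ?u) \<in> zoom_window (ln 2 + t) \<and> v \<in> UNIV}"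
    using key[OF C] key[of UNIV] by simp
  also have "\<dots> = emeasure (zoom (ln 2 + t) (local_slice 1 \<theta> y)) B"
  proof -
    have "{v \<in> space borel. v \<in> zoom_window (ln 2 + t) \<and> exp (ln 2 + t) * v \<in> B} \<in> sets borel" using B by measurable
    then have m: "{v. v \<in> zoom_window (ln 2 + t) \<and> exp (ln 2 + t) * v \<in> B} \<in> sets borel" by simp
    show ?thesis
      unfolding emeasure_zoom[OF sets_shifted B] emeasure_shifted[OF m] emeasure_shifted[OF borel_closed[OF closed_atLeastAtMost]]
      by (simp only: C_def ex mem_Collect_eq mult_1 UNIV_I conj_absorb simp_thms)
  qed
  finally show "emeasure (slice_scenery D \<theta> y t) B = emeasure (zoom (ln 2 + t) (local_slice 1 \<theta> y)) B" .
qed (simp add: slice_scenery_def)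

text \<open>Two disintegrations over the same projection agree almost everywhere. Since \<open>D x\<close> is carried by a
  single line, it is determined by its image under the coordinate along the line.\<close>

lemma AE_slice_scenery_eq_zoom:
  assumes D: "slice_disintegration E \<mu> \<theta> D" and dis: "disintegrates \<theta>"
  shows "AE z in \<mu>. \<forall>t. slice_scenery D \<theta> z t = zoom (ln 2 + t) (local_slice 1 \<theta> z)"
proof -
  let ?s = "slice_proj \<theta>" and ?u = "along \<theta>"
  let ?\<eta> = "distr \<mu> borel ?s"
  have sm: "?s \<in> borel_measurable \<mu>" by (simp cong: measurable_cong_sets)
  have Dm: "D \<in> borel \<rightarrow>\<^sub>M prob_algebra borel" and Df: "AE x in ?\<eta>. emeasure (D x) (E \<inter> ?s -` {x}) = 1"
    and De: "\<And>B. B \<in> sets borel ==> emeasure \<mu> B = (\<integral>\<^sup>+x. emeasure (D x) B \<partial>?\<eta>)"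
    using D by (auto simp: slice_disintegration_def)
  have Dx: "prob_space (D x)" "sets (D x) = sets borel" for x
    using measurable_space[OF Dm, of x] by (auto simp: space_prob_algebra)
  have Du: "?u \<in> borel_measurable (D x)" for x by (simp add: Dx cong: measurable_cong_sets)
  have Ds: "AE x in ?\<eta>. AE z in D x. ?s z = x"
    using Df
  proof eventually_elim
    case (elim x)
    interpret Dx: prob_space "D x" by (rule Dx)
    have "E \<inter> ?s -` {x} \<in> sets (D x)" using elim emeasure_notin_sets[of "E \<inter> ?s -` {x}" "D x"] by force
    then have "AE z in D x. z \<in> E \<inter> ?s -` {x}" using elim by (intro Dx.AE_prob_1) (simp add: measure_def)
    then show ?case by eventually_elim simp
  qed
  have De': "(\<lambda>x. emeasure (D x) B) \<in> borel_measurable borel" if "B \<in> sets borel" for B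
    using measurable_emeasure_kernel[OF measurable_prob_algebraD[OF Dm] that] .
  have usets: "{z. ?u z \<le> q} \<in> sets borel" for q
  proof -
    have "{z \<in> space borel. ?u z \<le> q} \<in> sets borel" by measurable
    then show ?thesis by simp
  qed
  have eD: "emeasure (distr (D x) borel ?u) {..q} = emeasure (D x) {z. ?u z \<le> q}" for x q
    using sets_eq_imp_space_eq[OF Dx(2)] by (subst emeasure_distr[OF Du]) (simp_all add: vimage_def)
  have "AE x in ?\<eta>. distr (D x) borel ?u = slice_at \<theta> x"
  proof (rule kernel_eq_of_rat)
    show "finite_measure ?\<eta>" by (intro prob_space.finite_measure \<mu>.prob_space_distr sm)
    show "finite_measure (distr (D x) borel ?u)" for x
      by (intro prob_space.finite_measure prob_space.prob_space_distr Dx Du)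
    show "emeasure (slice_at \<theta> x) {..real_of_rat q} \<le> 1" for x q using slice_at_props(1) by (rule prob_space.emeasure_le_1)
    show "(\<lambda>x. emeasure (distr (D x) borel ?u) {..real_of_rat q}) \<in> borel_measurable ?\<eta>" for q
      unfolding eD using De'[OF usets] by simp
    have "(\<lambda>x. slice_at \<theta> x) \<in> borel \<rightarrow>\<^sub>M subprob_algebra borel" by (intro slice_at_measurable) simp_all
    from measurable_emeasure_kernel[OF this] show "(\<lambda>x. emeasure (slice_at \<theta> x) {..real_of_rat q}) \<in> borel_measurable ?\<eta>" for q by simp
    then have sq: "(\<lambda>x. emeasure (slice_at \<theta> x) {..real_of_rat q}) \<in> borel_measurable borel" for q by simp
    fix B q assume "B \<in> sets ?\<eta>"
    then have B: "B \<in> sets borel" by simp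
    have "{z \<in> space borel. ?s z \<in> B \<and> ?u z \<le> real_of_rat q} \<in> sets borel" using B by measurable
    then have BC: "{z. ?s z \<in> B \<and> ?u z \<le> real_of_rat q} \<in> sets borel" by simp
    have "(\<integral>\<^sup>+x. indicator B x * emeasure (distr (D x) borel ?u) {..real_of_rat q} \<partial>?\<eta>) =
      (\<integral>\<^sup>+x. emeasure (D x) {z. ?s z \<in> B \<and> ?u z \<le> real_of_rat q} \<partial>?\<eta>)"
    proof (rule nn_integral_cong_AE)
      show "AE x in ?\<eta>. indicator B x * emeasure (distr (D x) borel ?u) {..real_of_rat q} =
        emeasure (D x) {z. ?s z \<in> B \<and> ?u z \<le> real_of_rat q}"
        using Ds
      proof eventually_elim
        case (elim x)
        have "emeasure (D x) {z. ?s z \<in> B \<and> ?u z \<le> real_of_rat q} = emeasure (D x) (if x \<in> B then {z. ?u z \<le> real_of_rat q} else {})"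
        proof (rule emeasure_eq_AE)
          show "AE z in D x. z \<in> {z. ?s z \<in> B \<and> ?u z \<le> real_of_rat q} \<longleftrightarrow> z \<in> (if x \<in> B then {z. ?u z \<le> real_of_rat q} else {})"
            using elim by eventually_elim simp
        qed (use BC usets in \<open>simp_all add: Dx\<close>)
        then show ?case unfolding eD by simp
      qed
    qed
    also have "\<dots> = emeasure \<mu> {z. ?s z \<in> B \<and> ?u z \<in> {..real_of_rat q}}" using De[OF BC] by simp
    also have "\<dots> = (\<integral>\<^sup>+z. indicator B (?s z) * emeasure (slice_at \<theta> (?s z)) {..real_of_rat q} \<partial>\<mu>)"
      using bspec[OF bspec[OF dis[unfolded disintegrates_def] B], of "{..real_of_rat q}"] by simp
    also have "\<dots> = (\<integral>\<^sup>+x. indicator B x * emeasure (slice_at \<theta> x) {..real_of_rat q} \<partial>?\<eta>)"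
    proof (rule nn_integral_distr[OF sm, symmetric])
      have "indicator B \<in> borel_measurable borel" using B by simp
      from borel_measurable_times_ennreal[OF this sq[of q]]
      show "(\<lambda>x. indicator B x * emeasure (slice_at \<theta> x) {..real_of_rat q}) \<in> borel_measurable ?\<eta>" by simp
    qed
    finally show "(\<integral>\<^sup>+x. indicator B x * emeasure (distr (D x) borel ?u) {..real_of_rat q} \<partial>?\<eta>) =
      (\<integral>\<^sup>+x. indicator B x * emeasure (slice_at \<theta> x) {..real_of_rat q} \<partial>?\<eta>)" .
  qed (simp_all add: slice_at_props)
  with Ds have "AE x in ?\<eta>. (AE z in D x. ?s z = x) \<and> distr (D x) borel ?u = slice_at \<theta> x" by eventually_elim simp
  from AE_distrD[OF sm this] show ?thesis
  proof eventually_elim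
    case (elim z)
    show ?case using slice_scenery_eq_zoom[where N="D (slice_proj \<theta> z)" and D=D, OF Dx(2) conjunct1[OF elim] conjunct2[OF elim] refl] by blast
  qed
qed

lemma ergodic_fractal_distribution_scenery_law: "ergodic_fractal_distribution scenery_law"
  unfolding ergodic_fractal_distribution_def
  using flow.fd_distribution_law flow.ergodic_distribution_law quasi_palm_scenery_law by blast

text \<open>The orientation \<open>1\<close> is an atom of \<open>sign_pmf\<close>, so a statement about almost all \<open>(a, e, \<theta>)\<close> holds for
  \<open>e = 1\<close>, which is the orientation of \<open>slice_scenery\<close>.\<close>

lemma AE_flow_moment_averages:
  "AE \<theta> in Th. AE a in \<B>. \<forall>l. ((\<lambda>t. 1 / t * (LBINT s:{0..<t}. moment_monomial l (scen (a, 1, \<theta>) s)))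
     \<longlongrightarrow> (LINT m|scenery_law. moment_monomial l m)) at_top"
proof -
  have "AE \<omega> in BSTh. ((\<lambda>t. 1 / t * (LBINT s:{0..<t}. moment_monomial l (scen \<omega> s))) \<longlongrightarrow> (LINT m|scenery_law. moment_monomial l m)) at_top" for l
    by (rule flow.time_averages[OF borel_measurable_continuous_map_weak_star[OF continuous_map_moment_monomial] moment_monomial_bound])
  then have "AE \<omega> in BSTh. \<forall>l. ((\<lambda>t. 1 / t * (LBINT s:{0..<t}. moment_monomial l (scen \<omega> s))) \<longlongrightarrow> (LINT m|scenery_law. moment_monomial l m)) at_top"
    by (simp add: AE_all_countable)
  from ST.AE_pair[OF S.BT.AE_pair_swapped[OF this]] show ?thesis
    using one_in_sign_pmf by (auto simp: AE_measure_pmf_iff)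
qed

lemma AE_slice_time_averages:
  "AE \<theta> in Th. \<forall>D. slice_disintegration E \<mu> \<theta> D --> (AE a in \<B>. \<forall>F. continuous_map weak_star euclideanreal F -->
     ((\<lambda>t. 1 / t * (LBINT s:{0..t}. F (slice_scenery D \<theta> (coding T a) s))) \<longlongrightarrow> (LINT m|scenery_law. F m)) at_top)"
  using AE_flow_moment_averages AE_disintegrates
proof eventually_elim
  case (elim \<theta>)
  note mono = elim(1) and dis = elim(2)
  show ?case
  proof (intro allI impI)
    fix D assume D: "slice_disintegration E \<mu> \<theta> D"
    show "AE a in \<B>. \<forall>F. continuous_map weak_star euclideanreal F -->
     ((\<lambda>t. 1 / t * (LBINT s:{0..t}. F (slice_scenery D \<theta> (coding T a) s))) \<longlongrightarrow> (LINT m|scenery_law. F m)) at_top"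
      using mono AE_\<mu>_coding[OF AE_slice_scenery_eq_zoom[OF D dis]] AE_\<mu>_coding[OF AE_slice_point_supported[OF dis]]
    proof eventually_elim
      case (elim a)
      let ?N = "local_slice 1 \<theta> (coding T a)"
      let ?c = "start_time - ln 2"
      have "?N \<in> space (subprob_algebra borel)"
        using prob_space_imp_subprob_space[OF prob_space_shifted] by (simp add: space_subprob_algebra)
      then have Nm: "(\<lambda>s. total_zoom (ln 2 + s) ?N) \<in> borel \<rightarrow>\<^sub>M weak_star_borel" "(\<lambda>s. total_zoom (start_time + s) ?N) \<in> borel \<rightarrow>\<^sub>M weak_star_borel"
        by (intro measurable_total_zoom measurable_const; measurable)+
      have sc: "slice_scenery D \<theta> (coding T a) s = total_zoom (ln 2 + s) ?N" for s
        using elim(2,3) by (simp add: supported_local_slice(2))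
      show ?case
      proof (intro allI impI)
        fix F assume F: "continuous_map weak_star euclideanreal F"
        obtain B where B: "\<And>m. m \<in> interval_measures ==> \<bar>F m\<bar> \<le> B" using continuous_map_weak_star_bounded[OF F] by blast
        have h: "(\<lambda>s. F (total_zoom (ln 2 + s) ?N)) \<in> borel_measurable borel"
          by (rule measurable_compose[OF Nm(1) borel_measurable_continuous_map_weak_star[OF F]])
        have "((\<lambda>t. 1 / t * (LBINT s:{0..<t}. F (total_zoom (start_time + s) ?N))) \<longlongrightarrow> (LINT m|scenery_law. F m)) at_top"
          using elim(1) by (intro weak_star_time_averages[OF flow.prob_space_law flow.sets_law(1) Nm(2) _ F]) (simp add: scen_def)
        then have "((\<lambda>t. 1 / t * (LBINT s:{0..<t}. F (total_zoom (ln 2 + (s + ?c)) ?N))) \<longlongrightarrow> (LINT m|scenery_law. F m)) at_top"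
          by (simp add: algebra_simps)
        then have "((\<lambda>t. 1 / t * (LBINT s:{0..<t}. F (total_zoom (ln 2 + s) ?N))) \<longlongrightarrow> (LINT m|scenery_law. F m)) at_top"
        proof (rule time_average_shift[OF h, rotated 2])
          show "\<bar>F (total_zoom (ln 2 + s) ?N)\<bar> \<le> B" for s using measurable_space[OF Nm(1), of s] by (intro B) simp
          show "0 \<le> ?c" by (simp add: start_time_def)
        qed
        then show "((\<lambda>t. 1 / t * (LBINT s:{0..t}. F (slice_scenery D \<theta> (coding T a) s))) \<longlongrightarrow> (LINT m|scenery_law. F m)) at_top"
          by (simp only: set_integral_Ico_eq_Icc[OF h] sc)
      qed
    qed
  qed
qed

end

theorem theorem4p2:
  fixes A :: "'k::finite \<Rightarrow> real^2^2" and d :: "'k \<Rightarrow> real^2" and p :: "'k pmf"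
    and \<mu>F :: "real measure"
  defines "T \<equiv> \<lambda>i. affine_map (A i) (d i)"
  assumes positive: "\<And>i r c. 0 < A i $ r $ c"
    and invertible: "\<And>i. invertible (A i)"
    and norm_less_one: "\<And>i. onorm ((*v) (A i)) < 1"
    and into_disk: "\<And>i. T i ` cball 0 1 \<subseteq> cball 0 1"
    and separation: "\<And>i j. i \<noteq> j \<Longrightarrow> T i ` cball 0 1 \<inter> T j ` cball 0 1 = {}"
    and furstenberg: "furstenberg_measure A p \<mu>F"
  shows "\<exists>P. ergodic_fractal_distribution P \<and>
    (AE \<theta> in \<mu>F. \<forall>D. slice_disintegration (attractor T) (self_affine_measure T p) \<theta> D \<longrightarrow>
      (AE a in bernoulli_measure p.
        \<forall>F. continuous_map weak_star euclideanreal F \<longrightarrow>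
          ((\<lambda>t. 1 / t * (LBINT s:{0..t}. F (slice_scenery D \<theta> (coding T a) s)))
             \<longlongrightarrow> (LINT m|P. F m)) at_top))"
proof -
  interpret self_affine_furstenberg A d p \<mu>F
    using positive invertible norm_less_one into_disk separation furstenberg
    by unfold_locales (simp_all add: T_def)
  show ?thesis
    unfolding T_def
    using ergodic_fractal_distribution_scenery_law AE_Th_\<mu>F[OF AE_slice_time_averages] by (intro exI conjI)
qed

end
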